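(* Let $W$ be a finite positive Borel measure on $\mathbb T$ with $W(A)>0$ for every nonempty open set $A\subseteq\mathbb T$, and let $W^N_x=W\{[x/N,(x+1)/N)\}$ for $x\in\mathbb T_N$. Assume that there exists $\gamma_0>0$ such that $$\lim_{N\to\infty}\frac1{N^{2+\gamma_0}}\sum_{x\in\mathbb T_N}\frac1{W^N_x}=0 .$$ Fix $\gamma\ge\gamma_0$ and a continuous function $u_0:\mathbb T\to\mathbb R_+$. Then, for every $t\ge0$, every continuous function $H:\mathbb T\to\mathbb R$ and every $\delta>0$, $$\lim_{N\to\infty}\mathbb P_{\mu^N_{u_0(\cdot)}}\Big[\,\Big|\langle\pi^N_t,H\rangle-\int_{\mathbb T}H(x)\,u(t,x)\,W(dx)\Big|>\delta\,\Big]=0,$$ where $u$ is the unique weak solution (on $[0,T]\times\mathbb T$, for any $T>t$) of $$\frac{d}{dt}u=\frac12\,\frac{d}{dW}\frac{d}{dx}u,\qquad u(0,\cdot)=u_0(\cdot).$$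
   Context: $\mathbb T=\mathbb R/\mathbb Z$, $\mathbb T_N=\mathbb Z/N\mathbb Z$, $\mathbb N_0=\{0,1,\dots\}$, $\Omega_N=\mathbb N_0^{\mathbb T_N}$; for $\eta\in\Omega_N$, $\eta(x)$ is the number of particles at $x$. Write $y\sim x$ if $|y-x|=1$ in $\mathbb T_N$. Particle system: $L_N$ acts on bounded $f:\Omega_N\to\mathbb R$ by $$(L_Nf)(\eta)=\frac12\sum_{x\in\mathbb T_N}\sum_{y\sim x}\frac{\eta(x)}{N W^N_x}\,[f(\eta^{x,y})-f(\eta)],$$ where $\eta^{x,y}$ is obtained from $\eta$ by moving one particle from $x$ to $y$. $\{\eta_t:t\ge0\}$ is the Markov process with generator $N^2L_N$ (time speeded up by $N^2$), and $\mathbb P_\mu$ is its law when the initial distribution is $\mu$. Initial measure: $\mu^N_{u_0(\cdot)}$ is the product measure on $\Omega_N$ under which $\eta(x)$ is Poisson with parameter $u_0(x/N)\,N^\gamma\,W^N_x$, $x\in\mathbb T_N$. Empirical measure: $\pi^N_t=N^{-\gamma}\sum_{x\in\mathbb T_N}\eta_t(x)\,\delta_{x/N}$, and $\langle\pi^N_t,H\rangle=N^{-\gamma}\sum_{x\in\mathbb T_N}H(x/N)\eta_t(x)$. Weak solution: let $\mathcal H_1$ be the Sobolev space of functions in $L^2(\mathbb T)$ (Lebesgue) with generalized derivative in $L^2(\mathbb T)$, with $\langle f,g\rangle_{1,2}=\langle f,g\rangle+\int_{\mathbb T}\partial_xf\,\partial_xg\,dx$, where $\langle\cdot,\cdot\rangle$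 is the scalar product of $L^2(\mathbb T)$; $\langle f,g\rangle_W=\int fg\,dW$. A bounded measurable $u:[0,T]\times\mathbb T\to\mathbb R$ is a weak solution if (i) $\int_0^T\langle u_t,u_t\rangle_{1,2}\,dt<\infty$; and (ii) for every smooth $G:[0,T]\times\mathbb T\to\mathbb R$ with $G_T=0$, $$\langle G_0,u_0\rangle_W+\int_0^T\langle\partial_tG_t,u_t\rangle_W\,dt=\frac12\int_0^T\langle\partial_xG_t,\partial_xu_t\rangle\,dt .$$ Conventions: for almost every $t$, $u_t\in\mathcal H_1$ is its continuous version in $x$ (used in integrals against $W$); uniqueness means $u_t$ is determined for almost every $t$; at a fixed time $t$, $u(t,\cdot)$ refers to the version for which $t\mapsto\int H(x)u(t,x)W(dx)$ is continuous for every continuous $H$. *)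

theory Defs
  imports "HOL-Probability.Probability"
begin

text \<open>
  The torus $T = R/Z$ is rendered through its fundamental domain $[0,1)$: functions on $T$ are
  1-periodic functions on the reals (so that continuity and smoothness on $T$ are continuity and
  smoothness on the real line), open subsets of $T$ are 1-periodic open sets, and Borel measures on
  $T$ are measures on the Borel sets of $[0,1)$. The discrete torus $Z/NZ$ is the set \<open>{..<N}\<close>
  with addition modulo \<open>N\<close>.
\<close>

definition torus_fun :: "(real \<Rightarrow> real) \<Rightarrow> bool" where
  "torus_fun f \<longleftrightarrow> (\<forall>x. f (x + 1) = f x)"

definition torus_continuous :: "(real \<Rightarrow> real) \<Rightarrow> bool" where
  "torus_continuous f \<longleftrightarrow> torus_fun f \<and> continuous_on UNIV f"

definition torus_smooth :: "(real \<Rightarrow> real) \<Rightarrow> bool" where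
  "torus_smooth f \<longleftrightarrow> torus_fun f \<and> (\<forall>n x. (deriv ^^ n) f field_differentiable (at x))"

definition torus_open :: "real set \<Rightarrow> bool" where
  "torus_open A \<longleftrightarrow> open A \<and> (\<forall>x. x + 1 \<in> A \<longleftrightarrow> x \<in> A)"

definition torus_measure :: "real measure \<Rightarrow> bool" where
  "torus_measure W \<longleftrightarrow> finite_measure W \<and> sets W = sets (restrict_space borel {0..<1::real})"

definition positive_on_open :: "real measure \<Rightarrow> bool" where
  "positive_on_open W \<longleftrightarrow>
     (\<forall>A. torus_open A \<and> A \<noteq> {} \<longrightarrow> emeasure W (A \<inter> {0..<1}) > 0)"

definition cell :: "real measure \<Rightarrow> nat \<Rightarrow> nat \<Rightarrow> real" where
  "cell W N x = measure W {real x / real N ..< (real x + 1) / real N}"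

definition Omega :: "nat \<Rightarrow> (nat \<Rightarrow> nat) set" where
  "Omega N = {\<eta>. \<forall>x\<ge>N. \<eta> x = 0}"

text \<open>Set of neighbours, so that for \<open>N = 2\<close> the single neighbour is counted once.\<close>

definition nbrs :: "nat \<Rightarrow> nat \<Rightarrow> nat set" where
  "nbrs N x = {y. y < N \<and> (y = (x + 1) mod N \<or> x = (y + 1) mod N)}"

text \<open>Only meaningful if \<open>\<eta> x > 0\<close>; otherwise the jump has rate 0 in the generator.\<close>

definition move :: "nat \<Rightarrow> nat \<Rightarrow> (nat \<Rightarrow> nat) \<Rightarrow> (nat \<Rightarrow> nat)" where
  "move x y \<eta> = (let \<zeta> = \<eta>(x := \<eta> x - 1) in \<zeta>(y := \<zeta> y + 1))"

definition L :: "real measure \<Rightarrow> nat \<Rightarrow> ((nat \<Rightarrow> nat) \<Rightarrow> real) \<Rightarrow> (nat \<Rightarrow> nat) \<Rightarrow> real" where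
  "L W N f \<eta> = 1/2 * (\<Sum>x<N. \<Sum>y\<in>nbrs N x.
       real (\<eta> x) / (real N * cell W N x) * (f (move x y \<eta>) - f \<eta>))"

definition transition_semigroup :: "'s set \<Rightarrow> (real \<Rightarrow> 's \<Rightarrow> 's pmf) \<Rightarrow> bool" where
  "transition_semigroup S p \<longleftrightarrow>
     (\<forall>t\<ge>0. \<forall>\<eta>\<in>S. set_pmf (p t \<eta>) \<subseteq> S) \<and>
     (\<forall>\<eta>\<in>S. p 0 \<eta> = return_pmf \<eta>) \<and>
     (\<forall>s\<ge>0. \<forall>t\<ge>0. \<forall>\<eta>\<in>S. p (s + t) \<eta> = bind_pmf (p s \<eta>) (p t))"

text \<open>
  The generator acts on all bounded functions; since its rates are unbounded, the derivative of the
  semigroup at time 0 is taken pointwise in the initial state.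
\<close>

definition has_generator ::
  "'s set \<Rightarrow> (real \<Rightarrow> 's \<Rightarrow> 's pmf) \<Rightarrow> (('s \<Rightarrow> real) \<Rightarrow> 's \<Rightarrow> real) \<Rightarrow> bool" where
  "has_generator S p A \<longleftrightarrow>
     (\<forall>f. bounded (range f) \<longrightarrow> (\<forall>\<eta>\<in>S.
        ((\<lambda>h. (measure_pmf.expectation (p h \<eta>) f - f \<eta>) / h) \<longlongrightarrow> A f \<eta>) (at_right 0)))"

definition natural_filtration :: "'a measure \<Rightarrow> (real \<Rightarrow> 'a \<Rightarrow> 's) \<Rightarrow> real \<Rightarrow> 'a measure" where
  "natural_filtration M X s =
     sigma (space M) {X r -` B \<inter> space M | r B. 0 \<le> r \<and> r \<le> s}"

text \<open>Right-continuous with left limits, for the discrete topology on the state space.\<close>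

definition cadlag_path :: "(real \<Rightarrow> 's) \<Rightarrow> bool" where
  "cadlag_path w \<longleftrightarrow>
     (\<forall>t\<ge>0. \<forall>\<^sub>F s in at_right t. w s = w t) \<and>
     (\<forall>t>0. \<exists>\<xi>. \<forall>\<^sub>F s in at_left t. w s = \<xi>)"

definition markov_process_with_generator ::
  "'a measure \<Rightarrow> (real \<Rightarrow> 'a \<Rightarrow> 's) \<Rightarrow> 's set \<Rightarrow> (('s \<Rightarrow> real) \<Rightarrow> 's \<Rightarrow> real) \<Rightarrow> 's pmf \<Rightarrow> bool" where
  "markov_process_with_generator M X S A \<mu> \<longleftrightarrow>
     prob_space M \<and>
     (\<forall>t\<ge>0. X t \<in> measurable M (count_space UNIV)) \<and>
     (\<forall>t\<ge>0. \<forall>\<omega>\<in>space M. X t \<omega> \<in> S) \<and>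
     (\<forall>\<omega>\<in>space M. cadlag_path (\<lambda>t. X t \<omega>)) \<and>
     distr M (count_space UNIV) (X 0) = measure_pmf \<mu> \<and>
     (\<exists>p. transition_semigroup S p \<and> has_generator S p A \<and>
        (\<forall>f. bounded (range f) \<longrightarrow> (\<forall>s\<ge>0. \<forall>t\<ge>0.
           AE \<omega> in M. real_cond_exp M (natural_filtration M X s) (\<lambda>\<omega>. f (X (s + t) \<omega>)) \<omega>
                      = measure_pmf.expectation (p t (X s \<omega>)) f)))"

text \<open>The library's \<open>poisson_pmf\<close> requires a positive rate, hence the case distinction.\<close>

definition poisson0 :: "real \<Rightarrow> nat pmf" where
  "poisson0 r = (if r = 0 then return_pmf 0 else poisson_pmf r)"

definition initial_measure ::
  "real measure \<Rightarrow> real \<Rightarrow> (real \<Rightarrow> real) \<Rightarrow> nat \<Rightarrow> (nat \<Rightarrow> nat) pmf" where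
  "initial_measure W \<gamma> u0 N =
     Pi_pmf {..<N} 0 (\<lambda>x. poisson0 (u0 (real x / real N) * real N powr \<gamma> * cell W N x))"

definition empirical_pairing :: "nat \<Rightarrow> real \<Rightarrow> (nat \<Rightarrow> nat) \<Rightarrow> (real \<Rightarrow> real) \<Rightarrow> real" where
  "empirical_pairing N \<gamma> \<eta> H =
     real N powr (- \<gamma>) * (\<Sum>x<N. H (real x / real N) * real (\<eta> x))"

definition L2_torus :: "(real \<Rightarrow> real) set" where
  "L2_torus = {f. torus_fun f \<and> set_borel_measurable lebesgue {0..<1} f \<and>
                  set_integrable lebesgue {0..<1} (\<lambda>x. (f x)\<^sup>2)}"

definition inner_L2 :: "(real \<Rightarrow> real) \<Rightarrow> (real \<Rightarrow> real) \<Rightarrow> real" where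
  "inner_L2 f g = (LINT x:{0..<1}|lebesgue. f x * g x)"

definition inner_W :: "real measure \<Rightarrow> (real \<Rightarrow> real) \<Rightarrow> (real \<Rightarrow> real) \<Rightarrow> real" where
  "inner_W W f g = (\<integral>x. f x * g x \<partial>W)"

definition generalized_deriv :: "(real \<Rightarrow> real) \<Rightarrow> (real \<Rightarrow> real) \<Rightarrow> bool" where
  "generalized_deriv f g \<longleftrightarrow>
     (\<forall>\<phi>. torus_smooth \<phi> \<longrightarrow> inner_L2 f (deriv \<phi>) = - inner_L2 g \<phi>)"

definition H1 :: "(real \<Rightarrow> real) set" where
  "H1 = {f \<in> L2_torus. \<exists>g\<in>L2_torus. generalized_deriv f g}"

text \<open>A representative of the generalized derivative, for \<open>f \<in> H1\<close>; unique almost everywhere.\<close>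

definition weak_dx :: "(real \<Rightarrow> real) \<Rightarrow> (real \<Rightarrow> real)" where
  "weak_dx f = (SOME g. g \<in> L2_torus \<and> generalized_deriv f g)"

definition inner_H1 :: "(real \<Rightarrow> real) \<Rightarrow> (real \<Rightarrow> real) \<Rightarrow> real" where
  "inner_H1 f g = inner_L2 f g + inner_L2 (weak_dx f) (weak_dx g)"

text \<open>
  Smoothness on $[0,T] \times T$, up to the boundary (one-sided time derivatives at $0$ and $T$):
  \<open>D i j\<close> is the partial derivative of order \<open>i\<close> in time and \<open>j\<close> in space, and all of them are
  required to exist and to be jointly continuous.
\<close>

definition smooth_test :: "real \<Rightarrow> (real \<Rightarrow> real \<Rightarrow> real) \<Rightarrow> bool" where
  "smooth_test T G \<longleftrightarrow>
     (\<forall>t\<in>{0..T}. torus_fun (G t)) \<and>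
     (\<exists>D :: nat \<Rightarrow> nat \<Rightarrow> real \<Rightarrow> real \<Rightarrow> real.
        D 0 0 = G \<and>
        (\<forall>i j. continuous_on ({0..T} \<times> UNIV) (\<lambda>(t, x). D i j t x) \<and>
          (\<forall>t\<in>{0..T}. \<forall>x.
             ((\<lambda>s. D i j s x) has_real_derivative D (Suc i) j t x) (at t within {0..T}) \<and>
             (D i j t has_real_derivative D i (Suc j) t x) (at x))))"

definition dt :: "real \<Rightarrow> (real \<Rightarrow> real \<Rightarrow> real) \<Rightarrow> real \<Rightarrow> real \<Rightarrow> real" where
  "dt T G t x = vector_derivative (\<lambda>s. G s x) (at t within {0..T})"

text \<open>
  For almost every \<open>t\<close> the function \<open>u t\<close> is required to be the continuous version of an element
  of \<open>H1\<close>; its integrals against \<open>W\<close> are those of this version.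
\<close>

definition weak_solution ::
  "real measure \<Rightarrow> (real \<Rightarrow> real) \<Rightarrow> real \<Rightarrow> (real \<Rightarrow> real \<Rightarrow> real) \<Rightarrow> bool" where
  "weak_solution W u0 T u \<longleftrightarrow>
     (\<forall>t\<in>{0..T}. torus_fun (u t)) \<and>
     (\<lambda>(t, x). u t x) \<in> borel_measurable (restrict_space borel ({0..T} \<times> UNIV)) \<and>
     (\<exists>C. \<forall>t\<in>{0..T}. \<forall>x. \<bar>u t x\<bar> \<le> C) \<and>
     (AE t in lebesgue. t \<in> {0..T} \<longrightarrow> u t \<in> H1 \<and> torus_continuous (u t)) \<and>
     (\<integral>\<^sup>+t\<in>{0..T}. ennreal (inner_H1 (u t) (u t)) \<partial>lebesgue) < \<infinity> \<and>
     (\<forall>G. smooth_test T G \<and> (\<forall>x. G T x = 0) \<longrightarrow>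
        inner_W W (G 0) u0 + (LINT t:{0..T}|lebesgue. inner_W W (dt T G t) (u t))
        = 1/2 * (LINT t:{0..T}|lebesgue. inner_L2 (deriv (G t)) (weak_dx (u t))))"

text \<open>The version in time that gives a meaning to \<open>u t\<close> at a fixed time \<open>t\<close>.\<close>

definition weakly_continuous_version ::
  "real measure \<Rightarrow> real \<Rightarrow> (real \<Rightarrow> real \<Rightarrow> real) \<Rightarrow> bool" where
  "weakly_continuous_version W T u \<longleftrightarrow>
     (\<forall>H. torus_continuous H \<longrightarrow> continuous_on {0..T} (\<lambda>t. \<integral>x. H x * u t x \<partial>W))"

end

theory Submission
  imports Defs
begin

text \<open>
  The particles move independently, so everything reduces to the walk of one particle. Its jump
  rate out of \<open>x\<close> is inversely proportional to \<open>W\<^sup>N\<^sub>x\<close>, which makes it reversible with respect to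
  \<open>W\<^sup>N\<close>. Poisson occupation numbers stay Poisson under independent motion; hence at time \<open>t\<close> the
  numbers \<open>\<eta>(x)\<close> are independent Poisson with intensity \<open>N\<^sup>\<gamma> v\<^sub>N(t,x) W\<^sup>N\<^sub>x\<close>, where \<open>v\<^sub>N\<close> solves the
  discrete heat equation \<open>\<partial>\<^sub>t v = L v\<close> of the walk, started from \<open>u0\<close>. The lemma \<open>laplace_functional\<close> states
  this through generating functions: the semigroup maps a product \<open>\<Prod>\<^sub>x a(x)\<^bsup>\<eta>(x)\<^esup>\<close> to a product of
  the same form (\<open>semigroup_product\<close>), and reversibility moves the evolution from \<open>a\<close> to \<open>u0\<close>
  (\<open>flow_duality\<close>). For nonnegative \<open>H\<close> the Laplace transform of \<open>\<langle>\<pi>,H\<rangle>\<close> is then explicit and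
  converges to that of the constant \<open>\<integral> H u\<^sub>t dW\<close> as soon as \<open>\<Sum>\<^sub>x W\<^sup>N\<^sub>x H(x/N) v\<^sub>N(t,x)\<close> does,
  because \<open>N\<^sup>\<gamma> (1 - exp (- N\<^sup>-\<^sup>\<gamma> h)) \<rightarrow> h\<close>. A Chebyshev estimate for \<open>exp (- \<langle>\<pi>,H\<rangle>)\<close> turns this
  into convergence in probability. What remains is deterministic: \<open>v\<^sub>N\<close> converges, and its limit is
  the unique weak solution.

  Convergence. Dissipation of the quadratic mass bounds the Dirichlet energy of \<open>v\<^sub>N(t)\<close> by
  \<open>C\<^sup>2 m / t\<close> for every \<open>N\<close>, with \<open>m\<close> the mass of \<open>W\<close> and \<open>C\<close> a bound of \<open>u0\<close>, so the
  piecewise linear interpolations are uniformly \<open>1/2\<close>-Hoelder in space. Two grids \<open>N\<close> and \<open>M\<close> are compared through the time primitives \<open>A\<close> and \<open>B\<close> of the two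
  flows \<open>a\<close> and \<open>b\<close>. The integrated equations \<open>L A = a - a(0)\<close> and \<open>L B = b - b(0)\<close>, tested
  against \<open>a - b\<close>, show that \<open>\<integral> (a - b)\<^sup>2 dW\<close> is \<open>- 1/4\<close> of the time derivative of
  \<open>\<integral> (\<partial>\<^sub>x A - \<partial>\<^sub>x B)\<^sup>2 dx\<close>, up to an error that vanishes as \<open>N\<close> and \<open>M\<close> grow (\<open>F_le\<close>). Since the
  latter integral is nonnegative and starts from \<open>0\<close>, the time integral of \<open>\<integral> (a - b)\<^sup>2 dW\<close> is
  small; continuity in time yields fixed times, and the Hoelder bound together with the positivity
  of \<open>W\<close> on open sets yields the supremum norm (\<open>uniform_cauchy\<close>). With a bound on \<open>\<partial>\<^sub>t v\<^sub>N\<close> in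
  \<open>L\<^sup>1(W)\<close> the gradients are Cauchy in \<open>L\<^sup>2\<close> as well (\<open>grad_dist\<close>), hence the limit \<open>u\<close> has a
  square integrable generalized derivative for every positive time, and the discrete equations pass
  to the weak formulation.

  Uniqueness. Let \<open>d\<close> be the difference of two weak solutions. Testing with \<open>p(t) e(x)\<close>, for \<open>p\<close> a
  polynomial and \<open>e\<close> a sine or cosine of frequency \<open>w\<close>, shows that
  \<open>\<integral> e d\<^sub>t dW = - w\<^sup>2/2 \<integral>\<^sub>0\<^sup>t \<integral> e d\<^sub>s dx ds\<close> for almost every \<open>t\<close>. Convolve \<open>d\<^sub>t\<close> with a multiple of
  \<open>cos\<^sup>2\<^sup>n (\<pi> x)\<close>, an approximate identity with nonnegative Fourier coefficients, and integrate the
  product with \<open>d\<^sub>t\<close> against \<open>W\<close> and over time: every Fourier mode contributes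
  \<open>- w\<^sup>2/2 \<integral> r(t) (\<integral>\<^sub>0\<^sup>t r) dt = - w\<^sup>2/4 (\<integral> r)\<^sup>2 \<le> 0\<close>. In the limit \<open>\<integral>\<integral> d\<^sup>2 dW dt \<le> 0\<close>, so \<open>d\<^sub>t\<close>
  vanishes \<open>W\<close>-almost everywhere, and everywhere by continuity (\<open>AE_d_zero\<close>).
\<close>

section \<open>Jump processes and the backward equation\<close>

text \<open>
  A continuous function with a continuous right derivative is continuously differentiable. Subtract
  a primitive of the derivative; the difference has right derivative \<open>0\<close>, and at the last point up
  to which it grows with slope at most \<open>e\<close> the right derivative lets it go further.
\<close>

lemma right_derivative_imp_derivative:
  fixes F \<phi> :: "real \<Rightarrow> real"
  assumes F: "continuous_on {0..} F" and \<phi>: "continuous_on {0..} \<phi>"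
    and R: "\<And>t. t \<ge> 0 \<Longrightarrow> ((\<lambda>h. (F (t + h) - F t) / h) \<longlongrightarrow> \<phi> t) (at_right 0)"
    and t: "t \<ge> 0"
  shows "(F has_real_derivative \<phi> t) (at t within {0..})"
proof -
  define P where "P s = integral {0..s} \<phi>" for s
  have P: "(P has_real_derivative \<phi> s) (at s within {0..b})" if "0 \<le> s" "s \<le> b" for s b
    unfolding P_def using that \<phi>
    by (intro integral_has_real_derivative) (auto intro: continuous_on_subset)
  define G where "G s = F s - P s" for s
  have Gc: "continuous_on {0..b} G" for b
    unfolding G_def
    by (intro continuous_intros continuous_on_subset[OF F] DERIV_continuous_on[OF P]) auto
  have GR: "((\<lambda>h. (G (s + h) - G s) / h) \<longlongrightarrow> 0) (at_right 0)" if s: "s \<ge> 0" for s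
  proof -
    have "(P has_real_derivative \<phi> s) (at s within {s..s+1})"
      using P[of s "s+1"] s by (auto intro: DERIV_subset)
    then have "(P has_real_derivative \<phi> s) (at_right s)"
      by (simp add: at_within_Icc_at_right)
    then have "((\<lambda>y. (P y - P s) / (y - s)) \<longlongrightarrow> \<phi> s) (at_right s)"
      by (simp add: has_field_derivative_iff)
    then have "((\<lambda>h. (P (s + h) - P s) / h) \<longlongrightarrow> \<phi> s) (at_right 0)"
      by (simp add: filterlim_at_right_to_0[of _ _ s] add.commute)
    from tendsto_diff[OF R[OF s] this] show ?thesis
      by (simp add: G_def flip: diff_divide_distrib) (simp add: algebra_simps)
  qed
  have key: "G b - G a \<le> e * (b - a)"
    if "0 \<le> a" "a \<le> b" "0 < e" and G: "\<And>b. continuous_on {0..b} G"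
      and GR: "\<And>s. s \<ge> 0 \<Longrightarrow> ((\<lambda>h. (G (s + h) - G s) / h) \<longlongrightarrow> 0) (at_right 0)"
    for a b e :: real and G :: "real \<Rightarrow> real"
  proof (rule ccontr)
    assume neg: "\<not> G b - G a \<le> e * (b - a)"
    define K where "K s = G s - G a - e * (s - a)" for s
    \<comment> \<open>The last point at which the growth since \<open>a\<close> has average slope at most \<open>e\<close> is \<open>Sup A\<close>.\<close>
    define A where "A = {s \<in> {a..b}. K s \<le> 0}"
    have "continuous_on {a..b} G" by (rule continuous_on_subset[OF that(4)[of b]]) (use that in auto)
    then have "continuous_on {a..b} K" unfolding K_def by (intro continuous_intros)
    then have "closed A" unfolding A_def
      using continuous_closed_preimage[of "{a..b}" K "{..0}"] by (simp add: vimage_def Int_def conj_commute)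
    moreover have "a \<in> A" using that by (simp add: A_def K_def)
    moreover have bdd: "bdd_above A" unfolding A_def by (rule bdd_aboveI[of _ b]) auto
    ultimately have cA: "Sup A \<in> A" using closed_contains_Sup[of A] by auto
    define c where "c = Sup A"
    have c: "a \<le> c" "c \<le> b" "K c \<le> 0" using cA by (auto simp: A_def c_def)
    have "c \<noteq> b" using neg c by (auto simp: K_def)
    with c have cb: "c < b" by auto
    have "\<forall>\<^sub>F h in at_right 0. (G (c + h) - G c) / h < e"
      using order_tendstoD(2)[OF GR[of c]] c that by auto
    moreover have "\<forall>\<^sub>F h in at_right 0. h < b - c"
      by (rule eventually_at_rightI[of 0 "b - c"]) (use cb in auto)
    moreover have "\<forall>\<^sub>F h::real in at_right 0. h > 0" by (simp add: eventually_at_right_less)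
    ultimately have "\<forall>\<^sub>F h in at_right 0. (G (c + h) - G c) / h < e \<and> h < b - c \<and> 0 < h"
      by eventually_elim auto
    from eventually_happens'[OF trivial_limit_at_right_real this]
    obtain h where h: "(G (c + h) - G c) / h < e" "h < b - c" "0 < h" by auto
    then have "G (c + h) - G c < e * h" by (simp add: pos_divide_less_eq)
    then have "K (c + h) \<le> 0" using c by (simp add: K_def algebra_simps)
    then have "c + h \<in> A" using c h by (auto simp: A_def)
    then have "c + h \<le> c" unfolding c_def by (rule cSup_upper[OF _ bdd])
    then show False using h by simp
  qed
  have const: "G s = G 0" if s: "s \<ge> 0" for s
  proof -
    have u: "G s - G 0 \<le> e" if "e > 0" for e
    proof -
      have "G s - G 0 \<le> e / (s + 1) * (s - 0)"
        using s that Gc GR by (intro key) auto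
      also have "\<dots> \<le> e" using s that by (simp add: field_simps)
      finally show ?thesis .
    qed
    have l: "- G s + G 0 \<le> e" if "e > 0" for e
    proof -
      have "(- G s) - (- G 0) \<le> e / (s + 1) * (s - 0)"
        using s that
      proof (intro key[where G="\<lambda>s. - G s"] continuous_intros Gc)
        fix r :: real assume "r \<ge> 0"
        from tendsto_minus[OF GR[OF this]]
        show "((\<lambda>h. (- G (r + h) - - G r) / h) \<longlongrightarrow> 0) (at_right 0)"
          by (simp add: diff_divide_distrib)
      qed auto
      also have "\<dots> \<le> e" using s that by (simp add: field_simps)
      finally show ?thesis by simp
    qed
    have "G s - G 0 \<le> 0" using u by (rule field_le_epsilon) simp
    moreover have "- G s + G 0 \<le> 0" using l by (rule field_le_epsilon) simp
    ultimately show ?thesis by simp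
  qed
  have FP: "G 0 + P s = F s" if "s \<ge> 0" for s using const[OF that] unfolding G_def by linarith
  have "((\<lambda>s. G 0 + P s) has_real_derivative \<phi> t) (at t within {0..t+1})"
    using DERIV_add[OF DERIV_const P[of t "t+1"]] t by simp
  then have "(F has_real_derivative \<phi> t) (at t within {0..t+1})"
    by (rule has_field_derivative_transform_within[where d=1])
      (use t FP in auto)
  moreover have "at t within {0..t+1} = at t within {0..}"
  proof (rule at_within_nhd[of _ "{..<t+1}"])
  qed (use t in auto)
  ultimately show ?thesis by simp
qed

text \<open>
  Gronwall's argument for \<open>\<Sum>\<^sub>\<eta> (D t \<eta>)\<^sup>2\<close>, whose derivative is bounded by its own multiple since
  \<open>2 a (b - a) \<le> b\<^sup>2\<close>. Only moves of positive rate have to stay in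
  \<open>S\<close>, since the others do not contribute to the equation.
\<close>

lemma jump_ode_unique:
  fixes D :: "real \<Rightarrow> 's \<Rightarrow> real"
  assumes S: "finite S" and I: "finite I"
    and c: "\<And>i \<eta>. i \<in> I \<Longrightarrow> \<eta> \<in> S \<Longrightarrow> c i \<eta> \<ge> 0"
    and m: "\<And>i \<eta>. i \<in> I \<Longrightarrow> \<eta> \<in> S \<Longrightarrow> c i \<eta> \<noteq> 0 \<Longrightarrow> m i \<eta> \<in> S"
    and D: "\<And>t \<eta>. t \<ge> 0 \<Longrightarrow> \<eta> \<in> S \<Longrightarrow>
      ((\<lambda>s. D s \<eta>) has_real_derivative (\<Sum>i\<in>I. c i \<eta> * (D t (m i \<eta>) - D t \<eta>))) (at t within {0..})"
    and D0: "\<And>\<eta>. \<eta> \<in> S \<Longrightarrow> D 0 \<eta> = 0"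
    and t: "t \<ge> 0" and \<eta>: "\<eta> \<in> S"
  shows "D t \<eta> = 0"
proof -
  define V where "V t = (\<Sum>\<eta>\<in>S. (D t \<eta>)\<^sup>2)" for t
  define C where "C = (\<Sum>\<eta>\<in>S. \<Sum>i\<in>I. c i \<eta>)"
  define V' where "V' t = (\<Sum>\<eta>\<in>S. 2 * D t \<eta> * (\<Sum>i\<in>I. c i \<eta> * (D t (m i \<eta>) - D t \<eta>)))" for t
  have V: "(V has_real_derivative V' t) (at t within {0..})" if "t \<ge> 0" for t
    unfolding V_def V'_def using that
    by (auto intro!: derivative_eq_intros D sum.cong)
  have V'_le: "V' t \<le> C * V t" for t
  proof -
    have 1: "2 * D t \<eta> * (c i \<eta> * (D t (m i \<eta>) - D t \<eta>)) \<le> c i \<eta> * V t" if "i \<in> I" "\<eta> \<in> S" for i \<eta>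
    proof (cases "c i \<eta> = 0")
      case False
      have "2 * D t \<eta> * (D t (m i \<eta>) - D t \<eta>) \<le> (D t (m i \<eta>))\<^sup>2"
        using zero_le_power2[of "D t (m i \<eta>) - D t \<eta>"] zero_le_power2[of "D t \<eta>"]
        unfolding power2_eq_square by argo
      also have "\<dots> \<le> V t" unfolding V_def
        using m[OF that False] S by (intro member_le_sum[where f="\<lambda>\<eta>. (D t \<eta>)\<^sup>2"]) auto
      finally have "c i \<eta> * (2 * D t \<eta> * (D t (m i \<eta>) - D t \<eta>)) \<le> c i \<eta> * V t"
        using c[OF that] by (intro mult_left_mono)
      then show ?thesis by (simp add: mult_ac)
    qed simp
    have "V' t = (\<Sum>\<eta>\<in>S. \<Sum>i\<in>I. 2 * D t \<eta> * (c i \<eta> * (D t (m i \<eta>) - D t \<eta>)))"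
      by (simp add: V'_def sum_distrib_left)
    also have "\<dots> \<le> (\<Sum>\<eta>\<in>S. \<Sum>i\<in>I. c i \<eta> * V t)" by (intro sum_mono 1)
    also have "\<dots> = C * V t" by (simp add: C_def sum_distrib_right)
    finally show ?thesis .
  qed
  define Z where "Z s = V s * exp (- C * s)" for s
  have Z: "(Z has_real_derivative (V' s - C * V s) * exp (- C * s)) (at s within {0..})" if "s \<ge> 0" for s
    unfolding Z_def using that by (auto intro!: derivative_eq_intros V simp: algebra_simps)
  have "Z t \<le> Z 0"
  proof (rule DERIV_nonpos_imp_decreasing_open[OF t])
    fix s assume s: "0 < s" "s < t"
    have "(Z has_real_derivative (V' s - C * V s) * exp (- C * s)) (at s)"
      using Z[of s] s by (simp add: at_within_interior[of s "{0..}"] interior_Ici)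
    moreover have "(V' s - C * V s) * exp (- C * s) \<le> 0"
      using V'_le[of s] by (intro mult_nonpos_nonneg) auto
    ultimately show "\<exists>y. DERIV Z s :> y \<and> y \<le> 0" by blast
  next
    show "continuous_on {0..t} Z"
      by (rule DERIV_continuous_on, rule DERIV_subset[OF Z]) auto
  qed
  then have "V t \<le> 0" using D0 by (simp add: Z_def V_def mult_le_0_iff)
  moreover have "(D t \<eta>)\<^sup>2 \<le> V t" unfolding V_def
    using \<eta> S by (intro member_le_sum[where f="\<lambda>\<eta>. (D t \<eta>)\<^sup>2"]) auto
  ultimately show ?thesis using zero_le_power2[of "D t \<eta>"] by (metis order_trans order_antisym zero_eq_power2)
qed

abbreviation sg :: "(real \<Rightarrow> 's \<Rightarrow> 's pmf) \<Rightarrow> ('s \<Rightarrow> real) \<Rightarrow> real \<Rightarrow> 's \<Rightarrow> real" where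
  "sg p f t \<eta> \<equiv> measure_pmf.expectation (p t \<eta>) f"

lemma integrable_pmf_bounded: "bounded (range f) \<Longrightarrow> integrable (measure_pmf q) (f :: 's \<Rightarrow> real)"
  unfolding bounded_iff by (force intro: measure_pmf.integrable_const_bound)

lemma sg_bounded:
  assumes "\<And>\<xi>. \<bar>f \<xi>\<bar> \<le> C" shows "\<bar>sg p f t \<eta>\<bar> \<le> C"
proof -
  have "\<bar>sg p f t \<eta>\<bar> \<le> measure_pmf.expectation (p t \<eta>) (\<lambda>x. \<bar>f x\<bar>)" by (rule integral_abs_bound)
  also have "\<dots> \<le> measure_pmf.expectation (p t \<eta>) (\<lambda>x. C)"
    using assms by (intro integral_mono integrable_pmf_bounded) (auto simp: bounded_iff)
  finally show ?thesis by simp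
qed

lemma bounded_range_real: "bounded (range f) \<longleftrightarrow> (\<exists>C. \<forall>\<xi>. \<bar>f \<xi>\<bar> \<le> (C::real))"
  by (auto simp: bounded_iff)

lemma sg_bounded_range: "bounded (range f) \<Longrightarrow> bounded (range (sg p f t))"
  unfolding bounded_range_real using sg_bounded by meson

lemma sg_semigroup:
  assumes p: "transition_semigroup S p" and f: "bounded (range f)" and "s \<ge> 0" "t \<ge> 0" "\<eta> \<in> S"
  shows "sg p f (s + t) \<eta> = sg p (sg p f t) s \<eta>"
proof -
  obtain C where C: "\<And>\<xi>. \<bar>f \<xi>\<bar> \<le> C" using f unfolding bounded_range_real by blast
  have "p (s + t) \<eta> = bind_pmf (p s \<eta>) (p t)"
    using assms by (auto simp: transition_semigroup_def)
  then have "measure_pmf (p (s+t) \<eta>) = measure_pmf (p s \<eta>) \<bind> (\<lambda>x. measure_pmf (p t x))"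
    by (simp add: measure_pmf_bind)
  then have "sg p f (s + t) \<eta> = integral\<^sup>L (measure_pmf (p s \<eta>) \<bind> (\<lambda>x. measure_pmf (p t x))) f"
    by simp
  also have "\<dots> = sg p (sg p f t) s \<eta>"
    by (rule integral_bind[where K="count_space UNIV" and B=C and B'=1])
       (use C in \<open>auto simp: measure_pmf_in_subprob_algebra measure_pmf.emeasure_space_1\<close>)
  finally show ?thesis .
qed

text \<open>
  Within a short time the process most likely has not left \<open>\<eta>\<close>; this is what makes the semigroup
  continuous although the rates are unbounded on the whole state space.
\<close>

lemma sg_dist_le:
  assumes "\<And>\<xi>. \<bar>g \<xi>\<bar> \<le> C"
  shows "\<bar>sg p g h \<eta> - g \<eta>\<bar> \<le> 2 * C * (1 - pmf (p h \<eta>) \<eta>)"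
proof -
  have ig: "integrable (p h \<eta>) g" using assms by (intro integrable_pmf_bounded) (auto simp: bounded_iff)
  have ind: "measure_pmf.expectation (p h \<eta>) (indicator (- {\<eta>})) = 1 - pmf (p h \<eta>) \<eta>"
    using measure_pmf.prob_compl[of "{\<eta>}" "p h \<eta>"] by (simp add: Compl_eq_Diff_UNIV[symmetric] pmf.rep_eq)
  have "\<bar>sg p g h \<eta> - g \<eta>\<bar> = \<bar>measure_pmf.expectation (p h \<eta>) (\<lambda>\<xi>. g \<xi> - g \<eta>)\<bar>"
    using ig by simp
  also have "\<dots> \<le> measure_pmf.expectation (p h \<eta>) (\<lambda>\<xi>. \<bar>g \<xi> - g \<eta>\<bar>)" by (rule integral_abs_bound)
  also have "\<dots> \<le> measure_pmf.expectation (p h \<eta>) (\<lambda>\<xi>. 2 * C * indicator (- {\<eta>}) \<xi>)"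
  proof (intro integral_mono)
    show "integrable (p h \<eta>) (\<lambda>\<xi>. \<bar>g \<xi> - g \<eta>\<bar>)" using ig by simp
    show "integrable (p h \<eta>) (\<lambda>\<xi>. 2 * C * indicator (- {\<eta>}) \<xi>)"
      by (intro integrable_mult_right integrable_pmf_bounded) (auto simp: bounded_iff indicator_def)
    fix \<xi>
    show "\<bar>g \<xi> - g \<eta>\<bar> \<le> 2 * C * indicator (- {\<eta>}) \<xi>"
      using assms[of \<xi>] assms[of \<eta>] by (auto simp: indicator_def)
  qed
  also have "\<dots> = 2 * C * (1 - pmf (p h \<eta>) \<eta>)" using ind by simp
  finally show ?thesis .
qed

text \<open>
  The generator applied to the indicator of \<open>{\<eta>}\<close> is finite.
\<close>

lemma pmf_stay_tendsto:
  assumes p: "has_generator S p A" and \<eta>: "\<eta> \<in> S"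
  shows "((\<lambda>h. pmf (p h \<eta>) \<eta>) \<longlongrightarrow> 1) (at_right 0)"
proof -
  let ?f = "indicator {\<eta>} :: _ \<Rightarrow> real"
  have "bounded (range ?f)" unfolding bounded_range_real by (auto intro!: exI[of _ 1] simp: indicator_def)
  with p \<eta> have "((\<lambda>h. (sg p ?f h \<eta> - ?f \<eta>) / h) \<longlongrightarrow> A ?f \<eta>) (at_right 0)"
    unfolding has_generator_def by blast
  from tendsto_mult[OF this tendsto_ident_at]
  have "((\<lambda>h. (pmf (p h \<eta>) \<eta> - 1) / h * h) \<longlongrightarrow> 0) (at_right 0)"
    by (simp add: measure_pmf_single)
  then have "((\<lambda>h. pmf (p h \<eta>) \<eta> - 1) \<longlongrightarrow> 0) (at_right 0)"
    by (rule Lim_transform_eventually) (auto simp: eventually_at_filter)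
  from tendsto_add[OF this tendsto_const[of 1]] show ?thesis by simp
qed

lemma sg_continuous:
  assumes p: "transition_semigroup S p" "has_generator S p A" and f: "bounded (range f)" and \<eta>: "\<eta> \<in> S"
  shows "continuous_on {0..} (\<lambda>t. sg p f t \<eta>)"
  unfolding continuous_on_iff
proof (intro ballI allI impI)
  fix t e :: real assume t: "t \<in> {0..}" and e: "0 < e"
  obtain C where C: "\<And>\<xi>. \<bar>f \<xi>\<bar> \<le> C" using f unfolding bounded_range_real by blast
  have C0: "C \<ge> 0" using C[of \<eta>] by simp
  have "\<forall>\<^sub>F h in at_right 0. dist (pmf (p h \<eta>) \<eta>) 1 < e / (2 * C + 1)"
    using pmf_stay_tendsto[OF p(2) \<eta>] e C0 by (intro tendstoD) auto
  then obtain d where d0: "d > 0" "\<And>h. 0 < h \<Longrightarrow> h < d \<Longrightarrow> \<bar>pmf (p h \<eta>) \<eta> - 1\<bar> < e / (2 * C + 1)"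
    by (auto simp: eventually_at_right_field dist_real_def)
  have d: "d > 0" "\<And>h. 0 < h \<Longrightarrow> h < d \<Longrightarrow> 1 - pmf (p h \<eta>) \<eta> < e / (2 * C + 1)"
    using d0 by (simp, force)
  have key: "\<bar>sg p f b \<eta> - sg p f a \<eta>\<bar> < e" if "0 \<le> a" "a < b" "b < a + d" for a b
  proof -
    have "sg p f ((b - a) + a) \<eta> = sg p (sg p f a) (b - a) \<eta>"
      using that \<eta> by (intro sg_semigroup[OF p(1) f]) auto
    then have "\<bar>sg p f b \<eta> - sg p f a \<eta>\<bar> \<le> 2 * C * (1 - pmf (p (b - a) \<eta>) \<eta>)"
      using sg_dist_le[of "sg p f a" C p "b - a" \<eta>] sg_bounded[of f C] C by simp
    also have "\<dots> \<le> 2 * C * (e / (2 * C + 1))"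
      using d(2)[of "b - a"] that C0 by (intro mult_left_mono) auto
    also have "\<dots> < e" using C0 e by (simp add: field_simps)
    finally show ?thesis .
  qed
  show "\<exists>d>0. \<forall>t'\<in>{0..}. dist t' t < d \<longrightarrow> dist (sg p f t' \<eta>) (sg p f t \<eta>) < e"
  proof (intro exI[of _ d] conjI ballI impI)
    fix t' assume "t' \<in> {0..}" "dist t' t < d"
    then show "dist (sg p f t' \<eta>) (sg p f t \<eta>) < e"
      using key[of t t'] key[of t' t] t e by (cases t t' rule: linorder_cases) (auto simp: dist_real_def)
  qed (fact d)
qed

text \<open>
  The generator gives only the right derivative at time \<open>0\<close>. The semigroup property carries it to
  every time, where it is continuous, so it is a two-sided derivative.
\<close>

lemma backward_equation:
  assumes p: "transition_semigroup S p" "has_generator S p A"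
    and A: "\<And>f \<eta>. A f \<eta> = (\<Sum>i\<in>I. c i \<eta> * (f (m i \<eta>) - f \<eta>))"
    and m: "\<And>i \<eta>. i \<in> I \<Longrightarrow> \<eta> \<in> S \<Longrightarrow> c i \<eta> \<noteq> 0 \<Longrightarrow> m i \<eta> \<in> S"
    and f: "bounded (range f)" and \<eta>: "\<eta> \<in> S" and t: "t \<ge> 0"
  shows "((\<lambda>s. sg p f s \<eta>) has_real_derivative (\<Sum>i\<in>I. c i \<eta> * (sg p f t (m i \<eta>) - sg p f t \<eta>)))
           (at t within {0..})"
proof (rule right_derivative_imp_derivative[OF sg_continuous[OF p f \<eta>] _ _ t])
  have "continuous_on {0..} (\<lambda>s. c i \<eta> * (sg p f s (m i \<eta>) - sg p f s \<eta>))" if "i \<in> I" for i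
    using m[OF that \<eta>] sg_continuous[OF p f] \<eta> by (cases "c i \<eta> = 0") (auto intro!: continuous_intros)
  then show "continuous_on {0..} (\<lambda>s. \<Sum>i\<in>I. c i \<eta> * (sg p f s (m i \<eta>) - sg p f s \<eta>))"
    by (intro continuous_on_sum)
  fix s :: real assume s: "s \<ge> 0"
  have "((\<lambda>h. (sg p (sg p f s) h \<eta> - sg p f s \<eta>) / h) \<longlongrightarrow> A (sg p f s) \<eta>) (at_right 0)"
    using p(2) sg_bounded_range[OF f] \<eta> by (auto simp: has_generator_def)
  then have "((\<lambda>h. (sg p (sg p f s) h \<eta> - sg p f s \<eta>) / h) \<longlongrightarrow>
     (\<Sum>i\<in>I. c i \<eta> * (sg p f s (m i \<eta>) - sg p f s \<eta>))) (at_right 0)" by (simp add: A)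
  then show "((\<lambda>h. (sg p f (s + h) \<eta> - sg p f s \<eta>) / h) \<longlongrightarrow>
     (\<Sum>i\<in>I. c i \<eta> * (sg p f s (m i \<eta>) - sg p f s \<eta>))) (at_right 0)"
  proof (rule Lim_transform_eventually)
    have "sg p (sg p f s) h \<eta> = sg p f (s + h) \<eta>" if "h > 0" for h
      using sg_semigroup[OF p(1) f, of h s \<eta>] s \<eta> that by (simp add: add.commute)
    then show "\<forall>\<^sub>F h in at_right 0. (sg p (sg p f s) h \<eta> - sg p f s \<eta>) / h = (sg p f (s + h) \<eta> - sg p f s \<eta>) / h"
      by (auto simp: eventually_at_filter)
  qed
qed

section \<open>Independent particles on the discrete torus\<close>

definition total :: "nat \<Rightarrow> (nat \<Rightarrow> nat) \<Rightarrow> nat" where "total N \<eta> = (\<Sum>x<N. \<eta> x)"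

text \<open>
  The factor \<open>N\<^sup>2\<close> of the accelerated time and the factor \<open>1/2\<close> of the generator are included.
\<close>

definition rate :: "real measure \<Rightarrow> nat \<Rightarrow> nat \<Rightarrow> real" where
  "rate W N x = real N / (2 * cell W N x)"

text \<open>
  The generator \<open>(d/dW) (d/dx) / 2\<close> discretized: the walk of one particle.
\<close>

definition lap :: "real measure \<Rightarrow> nat \<Rightarrow> (nat \<Rightarrow> real) \<Rightarrow> nat \<Rightarrow> real" where
  "lap W N a x = rate W N x * (\<Sum>y\<in>nbrs N x. a y - a x)"

definition one :: "nat \<Rightarrow> nat \<Rightarrow> nat" where "one x = (\<lambda>y. if y = x then 1 else 0)"

lemma finite_nbrs[simp]: "finite (nbrs N x)" by (simp add: nbrs_def)

lemma nbrs_less: "y \<in> nbrs N x \<Longrightarrow> y < N" by (simp add: nbrs_def)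

lemma accelerated_L:
  "N \<ge> 1 \<Longrightarrow> (real N)\<^sup>2 * L W N f \<eta> =
     (\<Sum>(x, y)\<in>Sigma {..<N} (nbrs N). (rate W N x * real (\<eta> x)) * (f (move x y \<eta>) - f \<eta>))"
  unfolding L_def sum_distrib_left
proof (subst sum.Sigma[symmetric], simp, simp, intro sum.cong refl, goal_cases)
  case (1 x y)
  then show ?case by (cases "cell W N x = 0") (auto simp: rate_def power2_eq_square field_simps)
qed

lemma total_move:
  assumes "x < N" "y < N" "\<eta> x \<noteq> 0" shows "total N (move x y \<eta>) = total N \<eta>"
proof -
  have "(\<Sum>z<N. \<eta> z) = \<eta> x + (\<Sum>z\<in>{..<N}-{x}. \<eta> z)" using assms by (intro sum.remove) auto
  moreover have upd: "(\<Sum>z<N. (\<zeta>(w := v)) z) = v + (\<Sum>z\<in>{..<N}-{w}. \<zeta> z)" if "w < N" for \<zeta> :: "nat \<Rightarrow> nat" and w v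
    using that by (subst sum.remove[of _ w]) (auto intro!: sum.cong)
  have "(\<Sum>z<N. (\<eta>(x := \<eta> x - 1)) z) = (\<eta> x - 1) + (\<Sum>z\<in>{..<N}-{x}. \<eta> z)" by (rule upd) fact
  moreover have "(\<Sum>z<N. \<zeta> z) = \<zeta> y + (\<Sum>z\<in>{..<N}-{y}. \<zeta> z)" for \<zeta> :: "nat \<Rightarrow> nat"
    using assms by (intro sum.remove) auto
  ultimately show ?thesis using assms upd[of y "\<eta>(x := \<eta> x - 1)"]
    by (simp add: total_def move_def Let_def)
qed

lemma move_Omega: "x < N \<Longrightarrow> y < N \<Longrightarrow> \<eta> \<in> Omega N \<Longrightarrow> move x y \<eta> \<in> Omega N"
  by (auto simp: Omega_def move_def Let_def)

lemma move_one: "move x y (one x) = one y"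
  by (auto simp: move_def one_def Let_def fun_eq_iff)

lemma one_Omega: "x < N \<Longrightarrow> one x \<in> Omega N" by (auto simp: Omega_def one_def)

lemma finite_Omega_total: "finite {\<eta> \<in> Omega N. total N \<eta> = K}"
proof (rule finite_subset)
  show "{\<eta> \<in> Omega N. total N \<eta> = K} \<subseteq> PiE_dflt {..<N} 0 (\<lambda>_. {..K})"
    by (auto simp: PiE_dflt_def Omega_def total_def intro!: member_le_sum)
qed (rule finite_PiE_dflt, auto)

lemma prod_pow_update:
  fixes b :: "nat \<Rightarrow> real"
  assumes "y < N" shows "(\<Prod>z<N. b z ^ (\<zeta>(y := \<zeta> y + 1)) z) = b y * (\<Prod>z<N. b z ^ \<zeta> z)"
proof -
  have "(\<Prod>z<N. b z ^ (\<zeta>(y := \<zeta> y + 1)) z) = b y ^ (\<zeta> y + 1) * (\<Prod>z\<in>{..<N}-{y}. b z ^ \<zeta> z)"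
    using assms by (subst prod.remove[of _ y]) (auto intro!: prod.cong)
  also have "\<dots> = b y * (b y ^ \<zeta> y * (\<Prod>z\<in>{..<N}-{y}. b z ^ \<zeta> z))" by simp
  also have "b y ^ \<zeta> y * (\<Prod>z\<in>{..<N}-{y}. b z ^ \<zeta> z) = (\<Prod>z<N. b z ^ \<zeta> z)"
    using assms by (subst (2) prod.remove[of _ y]) auto
  finally show ?thesis .
qed

text \<open>
  A move changes only the factors of \<open>x\<close> and \<open>y\<close>, so the difference is a discrete derivative in
  \<open>b x\<close>. It matches the derivative of the product when \<open>b\<close> evolves by the walk of one particle.
\<close>

lemma prod_pow_move:
  fixes b :: "nat \<Rightarrow> real"
  assumes "x < N" "y < N" "\<eta> x \<noteq> 0"
  shows "(\<Prod>z<N. b z ^ move x y \<eta> z) - (\<Prod>z<N. b z ^ \<eta> z)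
       = b x ^ (\<eta> x - 1) * (\<Prod>z\<in>{..<N}-{x}. b z ^ \<eta> z) * (b y - b x)"
proof -
  define \<zeta> where "\<zeta> = \<eta>(x := \<eta> x - 1)"
  have 1: "move x y \<eta> = \<zeta>(y := \<zeta> y + 1)" by (simp add: move_def \<zeta>_def Let_def)
  have 2: "\<eta> = \<zeta>(x := \<zeta> x + 1)" using assms by (auto simp: \<zeta>_def)
  have "(\<Prod>z<N. b z ^ \<eta> z) = b x * (\<Prod>z<N. b z ^ \<zeta> z)"
    by (subst 2) (rule prod_pow_update[OF assms(1)])
  moreover have "(\<Prod>z<N. b z ^ move x y \<eta> z) = b y * (\<Prod>z<N. b z ^ \<zeta> z)"
    unfolding 1 by (rule prod_pow_update[OF assms(2)])
  moreover have "(\<Prod>z<N. b z ^ \<zeta> z) = b x ^ (\<eta> x - 1) * (\<Prod>z\<in>{..<N}-{x}. b z ^ \<eta> z)"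
    using assms(1) by (subst prod.remove[of _ x]) (auto simp: \<zeta>_def intro!: prod.cong)
  ultimately show ?thesis by (simp add: algebra_simps)
qed

lemma DERIV_prod_within:
  fixes f :: "'i \<Rightarrow> real \<Rightarrow> real"
  assumes "finite A" "\<And>x. x \<in> A \<Longrightarrow> (f x has_real_derivative f' x) (at z within S)"
  shows "((\<lambda>u. \<Prod>x\<in>A. f x u) has_real_derivative (\<Sum>x\<in>A. f' x * (\<Prod>y\<in>A-{x}. f y z))) (at z within S)"
  using assms
proof (induction A rule: finite_induct)
  case (insert x A)
  have eq: "insert x A - {y} = insert x (A - {y})" if "y \<in> A" for y
    using insert.hyps that by auto
  show ?case
    using insert.hyps
    by (auto intro!: derivative_eq_intros insert.prems insert.IH sum.cong
             simp: sum_distrib_left sum_distrib_right eq)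
qed auto

lemma sum_move_one:
  assumes "x < N"
  shows "(\<Sum>(x', y)\<in>Sigma {..<N} (nbrs N). (rate W N x' * real (one x x')) * (f (move x' y (one x)) - f (one x)))
       = lap W N (\<lambda>y. f (one y)) x"
proof -
  have "(\<Sum>(x', y)\<in>Sigma {..<N} (nbrs N). (rate W N x' * real (one x x')) * (f (move x' y (one x)) - f (one x)))
      = (\<Sum>x'<N. \<Sum>y\<in>nbrs N x'. (rate W N x' * real (one x x')) * (f (move x' y (one x)) - f (one x)))"
    by (subst sum.Sigma) auto
  also have "\<dots> = (\<Sum>x'<N. if x' = x then (\<Sum>y\<in>nbrs N x. rate W N x * (f (one y) - f (one x))) else 0)"
    by (intro sum.cong refl) (auto simp: move_one, auto simp: one_def)
  also have "\<dots> = lap W N (\<lambda>y. f (one y)) x"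
    using assms by (simp add: lap_def sum_distrib_left)
  finally show ?thesis .
qed

lemma prod_pow_one: "x < N \<Longrightarrow> (\<Prod>z<N. (b z::real) ^ one x z) = b x"
  by (subst prod.remove[of _ x]) (auto simp: one_def)

section \<open>Generating functions of the particle system\<close>

text \<open>
  Particles are independent: both sides solve the backward equation, and it has only one solution
  because the number of particles is conserved and there are finitely many configurations with a
  given number. This works without constructing the process from independent walks.
\<close>

lemma semigroup_product:
  fixes p :: "real \<Rightarrow> (nat \<Rightarrow> nat) \<Rightarrow> (nat \<Rightarrow> nat) pmf"
  assumes N: "N \<ge> 1" and W: "\<And>x. x < N \<Longrightarrow> cell W N x \<ge> 0"
    and p: "transition_semigroup (Omega N) p" "has_generator (Omega N) p (\<lambda>f \<xi>. (real N)\<^sup>2 * L W N f \<xi>)"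
    and a: "\<And>x. 0 \<le> a x" "\<And>x. a x \<le> 1" and t: "t \<ge> 0" and \<eta>: "\<eta> \<in> Omega N"
  defines "f \<equiv> \<lambda>\<eta>. \<Prod>z<N. a z ^ \<eta> z"
  shows "sg p f t \<eta> = (\<Prod>x<N. sg p f t (one x) ^ \<eta> x)"
proof -
  let ?I = "Sigma {..<N} (nbrs N)"
  let ?c = "\<lambda>(x, y) \<eta>. rate W N x * real (\<eta> x)"
  let ?m = "\<lambda>(x, y) \<eta>. move x y \<eta>"
  have f1: "0 \<le> f \<eta> \<and> f \<eta> \<le> 1" for \<eta> unfolding f_def using a
    by (auto intro!: prod_nonneg prod_le_1 power_le_one)
  have fb: "bounded (range f)" unfolding bounded_range_real using f1 by (intro exI[of _ 1]) (auto simp: abs_le_iff)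
  define b where "b s x = sg p f s (one x)" for s x
  define F where "F s \<eta> = (\<Prod>x<N. b s x ^ \<eta> x)" for s and \<eta> :: "nat \<Rightarrow> nat"
  have A: "(real N)\<^sup>2 * L W N g \<xi> = (\<Sum>i\<in>?I. ?c i \<xi> * (g (?m i \<xi>) - g \<xi>))" for g \<xi>
    by (subst accelerated_L[OF N]) (auto intro!: sum.cong)
  have m: "?m i \<xi> \<in> Omega N" if "i \<in> ?I" "\<xi> \<in> Omega N" for i \<xi>
    using that by (auto intro!: move_Omega nbrs_less)
  have bw: "((\<lambda>s. sg p f s \<xi>) has_real_derivative (\<Sum>i\<in>?I. ?c i \<xi> * (sg p f s (?m i \<xi>) - sg p f s \<xi>)))
           (at s within {0..})" if "s \<ge> 0" "\<xi> \<in> Omega N" for s \<xi>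
    by (rule backward_equation[OF p A m fb]) (use that in auto)
  have bd: "((\<lambda>s. b s x) has_real_derivative lap W N (b s) x) (at s within {0..})" if "s \<ge> 0" "x < N" for s x
    using bw[OF that(1) one_Omega[OF that(2)]] sum_move_one[OF that(2), of W "sg p f s"]
    unfolding b_def by (simp add: split_def)
  have Fd: "((\<lambda>s. F s \<xi>) has_real_derivative (\<Sum>i\<in>?I. ?c i \<xi> * (F s (?m i \<xi>) - F s \<xi>))) (at s within {0..})"
    if s: "s \<ge> 0" for s \<xi>
  proof -
    have "((\<lambda>s. F s \<xi>) has_real_derivative
        (\<Sum>x<N. (real (\<xi> x) * b s x ^ (\<xi> x - 1) * lap W N (b s) x) * (\<Prod>y\<in>{..<N}-{x}. b s y ^ \<xi> y))) (at s within {0..})"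
      unfolding F_def by (rule DERIV_prod_within) (auto intro!: derivative_eq_intros bd s)
    moreover have "(\<Sum>x<N. (real (\<xi> x) * b s x ^ (\<xi> x - 1) * lap W N (b s) x) * (\<Prod>y\<in>{..<N}-{x}. b s y ^ \<xi> y))
       = (\<Sum>x<N. \<Sum>y\<in>nbrs N x. rate W N x * real (\<xi> x) * (F s (move x y \<xi>) - F s \<xi>))"
    proof (rule sum.cong[OF refl])
      fix x assume x: "x \<in> {..<N}"
      have "rate W N x * real (\<xi> x) * (F s (move x y \<xi>) - F s \<xi>)
          = rate W N x * real (\<xi> x) * (b s x ^ (\<xi> x - 1) * (\<Prod>z\<in>{..<N}-{x}. b s z ^ \<xi> z) * (b s y - b s x))"
        if "y \<in> nbrs N x" for y
        using prod_pow_move[of x N y \<xi> "b s"] x nbrs_less[OF that] by (cases "\<xi> x = 0") (auto simp: F_def)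
      then have "(\<Sum>y\<in>nbrs N x. rate W N x * real (\<xi> x) * (F s (move x y \<xi>) - F s \<xi>)) = (\<Sum>y\<in>nbrs N x.
          rate W N x * real (\<xi> x) * (b s x ^ (\<xi> x - 1) * (\<Prod>z\<in>{..<N}-{x}. b s z ^ \<xi> z) * (b s y - b s x)))"
        by (rule sum.cong[OF refl])
      then show "(real (\<xi> x) * b s x ^ (\<xi> x - 1) * lap W N (b s) x) * (\<Prod>y\<in>{..<N}-{x}. b s y ^ \<xi> y)
          = (\<Sum>y\<in>nbrs N x. rate W N x * real (\<xi> x) * (F s (move x y \<xi>) - F s \<xi>))"
        by (simp add: lap_def sum_distrib_left sum_distrib_right mult_ac)
    qed
    moreover have "\<dots> = (\<Sum>i\<in>?I. ?c i \<xi> * (F s (?m i \<xi>) - F s \<xi>))"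
      by (subst sum.Sigma) (auto intro!: sum.cong)
    ultimately show ?thesis by simp
  qed
  have init: "sg p f 0 \<xi> = f \<xi>" if "\<xi> \<in> Omega N" for \<xi>
    using p(1) that by (simp add: transition_semigroup_def)
  \<comment> \<open>The finite system consists of the configurations with as many particles as \<open>\<eta>\<close>.\<close>
  have "sg p f t \<eta> - F t \<eta> = 0"
  proof (rule jump_ode_unique[where S="{\<xi> \<in> Omega N. total N \<xi> = total N \<eta>}" and I="?I" and c="?c" and m="?m"
        and D="\<lambda>s \<xi>. sg p f s \<xi> - F s \<xi>"])
    show "finite {\<xi> \<in> Omega N. total N \<xi> = total N \<eta>}" by (rule finite_Omega_total)
    show "finite ?I" by auto
    show "?c i \<xi> \<ge> 0" if "i \<in> ?I" for i \<xi> using that W by (auto simp: rate_def)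
    show "?m i \<xi> \<in> {\<xi> \<in> Omega N. total N \<xi> = total N \<eta>}"
      if "i \<in> ?I" "\<xi> \<in> {\<xi> \<in> Omega N. total N \<xi> = total N \<eta>}" "?c i \<xi> \<noteq> 0" for i \<xi>
      using that m[of i \<xi>] total_move[of "fst i" N "snd i" \<xi>] by (auto dest: nbrs_less)
    show "((\<lambda>s. sg p f s \<xi> - F s \<xi>) has_real_derivative
            (\<Sum>i\<in>?I. ?c i \<xi> * ((sg p f s (?m i \<xi>) - F s (?m i \<xi>)) - (sg p f s \<xi> - F s \<xi>)))) (at s within {0..})"
      if "0 \<le> s" "\<xi> \<in> {\<xi> \<in> Omega N. total N \<xi> = total N \<eta>}" for s \<xi>
      using DERIV_diff[OF bw[of s \<xi>] Fd[of s \<xi>]] that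
      by (simp add: sum_subtractf[symmetric] algebra_simps)
    show "sg p f 0 \<xi> - F 0 \<xi> = 0" if "\<xi> \<in> {\<xi> \<in> Omega N. total N \<xi> = total N \<eta>}" for \<xi>
    proof -
      have "b 0 x = a x" if "x < N" for x
        using init[OF one_Omega[OF that]] prod_pow_one[OF that, of a] by (simp add: b_def f_def)
      then show ?thesis using init that by (simp add: F_def f_def)
    qed
  qed (use t \<eta> in auto)
  then show ?thesis by (simp add: F_def b_def)
qed

text \<open>
  On configurations with a single particle the backward equation is the discrete heat equation.
\<close>

lemma one_particle_flow:
  fixes p :: "real \<Rightarrow> (nat \<Rightarrow> nat) \<Rightarrow> (nat \<Rightarrow> nat) pmf"
  assumes N: "N \<ge> 1"
    and p: "transition_semigroup (Omega N) p" "has_generator (Omega N) p (\<lambda>f \<xi>. (real N)\<^sup>2 * L W N f \<xi>)"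
    and f: "bounded (range f)"
  shows "\<And>t x. t \<ge> 0 \<Longrightarrow> x < N \<Longrightarrow>
      ((\<lambda>s. sg p f s (one x)) has_real_derivative lap W N (\<lambda>y. sg p f t (one y)) x) (at t within {0..})"
    and "\<And>x. x < N \<Longrightarrow> sg p f 0 (one x) = f (one x)"
proof -
  let ?I = "Sigma {..<N} (nbrs N)"
  let ?c = "\<lambda>(x, y) \<eta>. rate W N x * real (\<eta> x)"
  let ?m = "\<lambda>(x, y) \<eta>. move x y \<eta>"
  have A: "(real N)\<^sup>2 * L W N g \<xi> = (\<Sum>i\<in>?I. ?c i \<xi> * (g (?m i \<xi>) - g \<xi>))" for g \<xi>
    by (subst accelerated_L[OF N]) (auto intro!: sum.cong)
  have m: "?m i \<xi> \<in> Omega N" if "i \<in> ?I" "\<xi> \<in> Omega N" for i \<xi>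
    using that by (auto intro!: move_Omega nbrs_less)
  show "((\<lambda>s. sg p f s (one x)) has_real_derivative lap W N (\<lambda>y. sg p f t (one y)) x) (at t within {0..})"
    if "t \<ge> 0" "x < N" for t x
    using backward_equation[OF p A m f one_Omega[OF that(2)] that(1)] sum_move_one[OF that(2), of W "sg p f t"]
    by (simp add: split_def)
  show "sg p f 0 (one x) = f (one x)" if "x < N" for x
    using p(1) one_Omega[OF that] by (simp add: transition_semigroup_def)
qed

text \<open>
  The Markov property at time \<open>0\<close>, integrated.
\<close>

lemma markov_expectation:
  assumes X: "markov_process_with_generator M X S A \<mu>"
  obtains p where "transition_semigroup S p" "has_generator S p A"
    "\<And>f t. bounded (range f) \<Longrightarrow> t \<ge> 0 \<Longrightarrow>
      (\<integral>\<omega>. f (X t \<omega>) \<partial>M) = measure_pmf.expectation \<mu> (sg p f t)"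
proof -
  from X obtain p where p: "transition_semigroup S p" "has_generator S p A"
    and ce: "\<And>f s t. bounded (range f) \<Longrightarrow> s \<ge> 0 \<Longrightarrow> t \<ge> 0 \<Longrightarrow>
      AE \<omega> in M. real_cond_exp M (natural_filtration M X s) (\<lambda>\<omega>. f (X (s + t) \<omega>)) \<omega>
                      = sg p f t (X s \<omega>)"
    unfolding markov_process_with_generator_def by blast
  from X have M: "prob_space M" and meas: "\<And>t. t \<ge> 0 \<Longrightarrow> X t \<in> measurable M (count_space UNIV)"
    and X0: "distr M (count_space UNIV) (X 0) = measure_pmf \<mu>"
    unfolding markov_process_with_generator_def by auto
  interpret prob_space M by fact
  have sub: "subalgebra M (natural_filtration M X s)" for s
  proof -
    have "{X r -` B \<inter> space M | r B. 0 \<le> r \<and> r \<le> s} \<subseteq> sets M"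
      using measurable_sets[OF meas] by auto
    moreover have "{X r -` B \<inter> space M | r B. 0 \<le> r \<and> r \<le> s} \<subseteq> Pow (space M)" by auto
    ultimately show ?thesis unfolding subalgebra_def natural_filtration_def
      by (simp add: sets.sigma_sets_subset)
  qed
  have main: "(\<integral>\<omega>. f (X t \<omega>) \<partial>M) = measure_pmf.expectation \<mu> (sg p f t)"
    if f: "bounded (range f)" and t: "t \<ge> 0" for f t
  proof -
    interpret S: finite_measure_subalgebra M "natural_filtration M X 0"
      by unfold_locales (rule sub)
    have [measurable]: "X t \<in> measurable M (count_space UNIV)" "X 0 \<in> measurable M (count_space UNIV)"
      using meas t by auto
    obtain C where C: "\<And>\<xi>. \<bar>f \<xi>\<bar> \<le> C" using f unfolding bounded_range_real by blast
    have int: "integrable M (\<lambda>\<omega>. f (X t \<omega>))"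
      by (rule integrable_const_bound[where B=C])
         (use C in \<open>auto intro!: measurable_compose[OF meas[OF t]]\<close>)
    have "(\<integral>\<omega>. f (X t \<omega>) \<partial>M) = (\<integral>\<omega>. real_cond_exp M (natural_filtration M X 0) (\<lambda>\<omega>. f (X t \<omega>)) \<omega> \<partial>M)"
      using S.real_cond_exp_int[OF int] by simp
    also have "\<dots> = (\<integral>\<omega>. sg p f t (X 0 \<omega>) \<partial>M)"
      using ce[OF f order_refl t] by (intro integral_cong_AE) auto
    also have "\<dots> = (\<integral>\<xi>. sg p f t \<xi> \<partial>distr M (count_space UNIV) (X 0))"
      by (rule integral_distr[symmetric]) auto
    finally show ?thesis by (simp add: X0)
  qed
  show ?thesis using that[OF p main] by blast
qed

lemma poisson0_generating_function:
  assumes "r \<ge> 0" "b \<ge> 0"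
  shows "measure_pmf.expectation (poisson0 r) (\<lambda>k. b ^ k) = exp (r * (b - 1))"
    and "integrable (poisson0 r) (\<lambda>k. b ^ k)"
proof -
  have "has_bochner_integral (poisson0 r) (\<lambda>k. b ^ k) (exp (r * (b - 1)))"
  proof (cases "r = 0")
    case True
    then show ?thesis by (simp add: poisson0_def has_bochner_integral_iff integrable_measure_pmf_finite)
  next
    case False
    then have r: "r > 0" using assms by simp
    have "(\<lambda>k. (r * b) ^ k /\<^sub>R fact k) sums exp (r * b)" by (rule exp_converges)
    then have "(\<lambda>k. (r * b) ^ k /\<^sub>R fact k * exp (- r)) sums (exp (r * b) * exp (- r))"
      by (rule sums_mult2)
    moreover have "(\<lambda>k. (r * b) ^ k /\<^sub>R fact k * exp (- r)) = (\<lambda>k. pmf (poisson_pmf r) k * b ^ k)"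
      using r by (auto simp: fun_eq_iff power_mult_distrib divide_inverse)
    moreover have "exp (r * b) * exp (- r) = exp (r * (b - 1))"
      by (simp add: exp_add[symmetric] algebra_simps)
    ultimately have s: "(\<lambda>k. pmf (poisson_pmf r) k * b ^ k) sums exp (r * (b - 1))" by simp
    then have "has_bochner_integral (count_space UNIV) (\<lambda>k. pmf (poisson_pmf r) k * b ^ k) (exp (r * (b - 1)))"
      using assms unfolding has_bochner_integral_iff
      by (subst integrable_count_space_nat_iff, subst integral_count_space_nat)
         (auto simp: integrable_count_space_nat_iff abs_mult sums_iff)
    then show ?thesis using False
      by (simp add: poisson0_def measure_pmf_eq_density has_bochner_integral_density)
  qed
  then show "measure_pmf.expectation (poisson0 r) (\<lambda>k. b ^ k) = exp (r * (b - 1))"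
    and "integrable (poisson0 r) (\<lambda>k. b ^ k)" by (auto simp: has_bochner_integral_iff)
qed

lemma initial_generating_function:
  assumes "\<And>x. 0 \<le> u0 x" "\<And>x. x < N \<Longrightarrow> 0 \<le> b x"
  shows "measure_pmf.expectation (initial_measure W \<gamma> u0 N) (\<lambda>\<eta>. \<Prod>x<N. b x ^ \<eta> x)
     = exp (\<Sum>x<N. u0 (real x / real N) * real N powr \<gamma> * cell W N x * (b x - 1))"
proof -
  have r: "u0 (real x / real N) * real N powr \<gamma> * cell W N x \<ge> 0" for x
    using assms by (simp add: cell_def)
  have "measure_pmf.expectation (initial_measure W \<gamma> u0 N) (\<lambda>\<eta>. \<Prod>x<N. b x ^ \<eta> x)
      = (\<Prod>x<N. measure_pmf.expectation (poisson0 (u0 (real x / real N) * real N powr \<gamma> * cell W N x)) (\<lambda>k. b x ^ k))"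
    unfolding initial_measure_def using assms r
    by (intro expectation_prod_Pi_pmf) (auto intro!: poisson0_generating_function)
  also have "\<dots> = (\<Prod>x<N. exp (u0 (real x / real N) * real N powr \<gamma> * cell W N x * (b x - 1)))"
    using assms r by (intro prod.cong refl poisson0_generating_function) auto
  finally show ?thesis by (simp add: exp_sum)
qed

lemma set_initial_measure: "set_pmf (initial_measure W \<gamma> u0 N) \<subseteq> Omega N"
  unfolding initial_measure_def using set_Pi_pmf_subset[of "{..<N}" 0]
  by (force simp: Omega_def)

section \<open>Reversibility and Poisson occupation numbers\<close>

lemma sum_nbrs_swap: "(\<Sum>x<N. \<Sum>y\<in>nbrs N x. G x y) = (\<Sum>x<N. \<Sum>y\<in>nbrs N x. (G y x :: real))"
proof -
  have *: "(\<Sum>x<N. \<Sum>y\<in>nbrs N x. G x y) = (\<Sum>x<N. \<Sum>y<N. if y = (x + 1) mod N \<or> x = (y + 1) mod N then G x y else 0)" for G :: "nat \<Rightarrow> nat \<Rightarrow> real"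
    by (intro sum.cong refl sum.mono_neutral_cong_left) (auto simp: nbrs_def)
  show ?thesis
    unfolding * by (subst sum.swap) (intro sum.cong refl, auto)
qed

text \<open>
  The Dirichlet form of the walk; each bond is counted from both of its ends, whence the factor
  \<open>1/2\<close>.
\<close>

definition energy :: "nat \<Rightarrow> (nat \<Rightarrow> real) \<Rightarrow> (nat \<Rightarrow> real) \<Rightarrow> real" where
  "energy N a b = real N / 2 * (\<Sum>x<N. \<Sum>y\<in>nbrs N x. (a y - a x) * (b y - b x))"

text \<open>
  Summation by parts: the weights \<open>cell W N x\<close> cancel the denominators of the rates.
\<close>

lemma lap_energy:
  assumes "\<And>x. x < N \<Longrightarrow> cell W N x > 0"
  shows "(\<Sum>x<N. cell W N x * (a x * lap W N b x)) = - energy N a b / 2"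
proof -
  let ?S = "\<Sum>x<N. \<Sum>y\<in>nbrs N x. a x * (b y - b x)"
  have "(\<Sum>x<N. cell W N x * (a x * lap W N b x)) = (\<Sum>x<N. \<Sum>y\<in>nbrs N x. real N / 2 * (a x * (b y - b x)))"
    using assms by (intro sum.cong refl) (force simp: lap_def rate_def sum_distrib_left sum_divide_distrib intro!: sum.cong)
  also have "\<dots> = real N / 2 * ?S" by (simp add: sum_distrib_left)
  also have "?S = - (\<Sum>x<N. \<Sum>y\<in>nbrs N x. (a y - a x) * (b y - b x)) / 2"
  proof -
    have "?S + ?S = ?S + (\<Sum>x<N. \<Sum>y\<in>nbrs N x. a y * (b x - b y))"
      by (subst (3) sum_nbrs_swap) simp
    also have "\<dots> = - (\<Sum>x<N. \<Sum>y\<in>nbrs N x. (a y - a x) * (b y - b x))"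
      unfolding sum.distrib[symmetric] sum_negf[symmetric] by (intro sum.cong refl) (simp add: algebra_simps)
    finally show ?thesis by simp
  qed
  finally show ?thesis by (simp add: energy_def)
qed

lemma energy_commute: "energy N a b = energy N b a"
  by (simp add: energy_def mult.commute)

definition flow_on :: "real measure \<Rightarrow> nat \<Rightarrow> (real \<Rightarrow> nat \<Rightarrow> real) \<Rightarrow> bool" where
  "flow_on W N f \<longleftrightarrow> (\<forall>t\<ge>0. \<forall>x<N. ((\<lambda>s. f s x) has_real_derivative lap W N (f t) x) (at t within {0..}))"

text \<open>
  The sum \<open>\<Sum>\<^sub>x W\<^sup>N\<^sub>x f(s,x) g(t-s,x)\<close> does not depend on \<open>s\<close>, because the walk is reversible.
\<close>

lemma flow_duality:
  assumes c: "\<And>x. x < N \<Longrightarrow> cell W N x > 0" and f: "flow_on W N f" and g: "flow_on W N g" and t: "t \<ge> 0"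
  shows "(\<Sum>x<N. cell W N x * (f 0 x * g t x)) = (\<Sum>x<N. cell W N x * (f t x * g 0 x))"
proof (cases "t = 0")
  case False
  then have t: "t > 0" using t by simp
  define P where "P s = (\<Sum>x<N. cell W N x * (f s x * g (t - s) x))" for s
  have d: "((\<lambda>s. f s x) has_real_derivative lap W N (f s) x) (at s)" if "flow_on W N f" "s > 0" "x < N" for f s x
    using that by (auto simp: flow_on_def at_within_interior[of s "{0..}"] interior_Ici dest!: spec[of _ s])
  have cf: "continuous_on {0..} (\<lambda>s. f s x)" if "flow_on W N f" "x < N" for f x
    using that by (intro DERIV_continuous_on[where D="\<lambda>t. lap W N (f t) x"]) (auto simp: flow_on_def)
  have "P t = P 0"
  proof (rule DERIV_isconst2[of 0 t P t])
    show "continuous_on {0..t} P"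
      unfolding P_def
      by (intro continuous_intros continuous_on_subset[OF cf[OF f]] continuous_on_compose2[OF cf[OF g]]) auto
    fix s assume s: "0 < s" "s < t"
    have "((\<lambda>s. g (t - s) x) has_real_derivative lap W N (g (t - s)) x * (-1)) (at s)" if "x < N" for x
      by (rule DERIV_chain2[OF d[OF g _ that]]) (use s in \<open>auto intro!: derivative_eq_intros\<close>)
    then have "(P has_real_derivative (\<Sum>x<N. cell W N x * (f s x * (lap W N (g (t - s)) x * (-1)) + lap W N (f s) x * g (t - s) x))) (at s)"
      unfolding P_def by (intro DERIV_sum DERIV_cmult DERIV_mult') (auto intro!: d[OF f] s)
    moreover have "(\<Sum>x<N. cell W N x * (f s x * (lap W N (g (t - s)) x * (-1)) + lap W N (f s) x * g (t - s) x))
       = (\<Sum>x<N. cell W N x * (g (t - s) x * lap W N (f s) x)) - (\<Sum>x<N. cell W N x * (f s x * lap W N (g (t - s)) x))"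
      unfolding sum_subtractf[symmetric] by (intro sum.cong refl) (simp add: algebra_simps)
    moreover have "\<dots> = 0" by (simp add: lap_energy[OF c] energy_commute[of N "f s"])
    ultimately show "DERIV P s :> 0" by simp
  qed (use t in auto)
  then show ?thesis by (simp add: P_def)
qed simp

text \<open>
  The Laplace functional of independent Poisson variables with intensities \<open>N\<^sup>\<gamma> v(t,x) W\<^sup>N\<^sub>x\<close>. At time
  \<open>0\<close> the intensity is \<open>N\<^sup>\<gamma> u0 W\<^sup>N\<close> and the semigroup acts on \<open>a\<close>; duality turns this into the
  evolution of \<open>u0\<close>. The function \<open>v\<close> is the expectation of \<open>u0\<close> along the walk of one particle.
\<close>

proposition laplace_functional:
  assumes N: "N \<ge> 1" and c: "\<And>x. x < N \<Longrightarrow> cell W N x > 0" and u0: "\<And>x. 0 \<le> u0 x"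
    and u0C: "\<And>x. u0 x \<le> C"
    and X: "markov_process_with_generator M X (Omega N) (\<lambda>f \<xi>. (real N)\<^sup>2 * L W N f \<xi>) (initial_measure W \<gamma> u0 N)"
  obtains v where "flow_on W N v" "\<And>x. x < N \<Longrightarrow> v 0 x = u0 (real x / real N)"
    "\<And>t x. \<bar>v t x\<bar> \<le> C"
    "\<And>t a. t \<ge> 0 \<Longrightarrow> (\<And>x. 0 \<le> a x \<and> a x \<le> 1) \<Longrightarrow>
       (\<integral>\<omega>. (\<Prod>x<N. a x ^ X t \<omega> x) \<partial>M)
     = exp (- (real N powr \<gamma> * (\<Sum>x<N. cell W N x * (v t x * (1 - a x)))))"
proof -
  obtain p where p: "transition_semigroup (Omega N) p" "has_generator (Omega N) p (\<lambda>f \<xi>. (real N)\<^sup>2 * L W N f \<xi>)"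
    and E: "\<And>f t. bounded (range f) \<Longrightarrow> t \<ge> 0 \<Longrightarrow>
      (\<integral>\<omega>. f (X t \<omega>) \<partial>M) = measure_pmf.expectation (initial_measure W \<gamma> u0 N) (sg p f t)"
    using markov_expectation[OF X] by metis
  have C: "C \<ge> 0" using u0[of 0] u0C[of 0] by simp
  \<comment> \<open>The function \<open>u0\<close> on configurations with one particle, and \<open>0\<close> on all others.\<close>
  define h where "h \<eta> = (\<Sum>y<N. if \<eta> = one y then u0 (real y / real N) else 0)" for \<eta>
  have one_inj: "one x = one y \<longleftrightarrow> x = y" for x y by (auto simp: one_def fun_eq_iff split: if_splits)
  have h_one: "h (one x) = u0 (real x / real N)" if "x < N" for x using that by (simp add: h_def one_inj)
  have hC: "\<bar>h \<eta>\<bar> \<le> C" for \<eta>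
  proof (cases "\<exists>x<N. \<eta> = one x")
    case True
    then show ?thesis using u0 u0C h_one by auto
  next
    case False
    then have "h \<eta> = 0" unfolding h_def by (intro sum.neutral) auto
    then show ?thesis using C by simp
  qed
  have hb: "bounded (range h)" using hC unfolding bounded_range_real by blast
  define v where "v t x = sg p h t (one x)" for t x
  have v: "flow_on W N v" unfolding flow_on_def v_def using one_particle_flow[OF N p hb] by auto
  have v0: "v 0 x = u0 (real x / real N)" if "x < N" for x
    using one_particle_flow(2)[OF N p hb that] h_one[OF that] by (simp add: v_def)
  have vC: "\<bar>v t x\<bar> \<le> C" for t x unfolding v_def by (rule sg_bounded[OF hC])
  show ?thesis
  proof (rule that[OF v v0 vC])
    fix t :: real and a :: "nat \<Rightarrow> real" assume t: "t \<ge> 0" and a: "\<And>x. 0 \<le> a x \<and> a x \<le> 1"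
    define f where "f \<eta> = (\<Prod>x<N. a x ^ \<eta> x)" for \<eta> :: "nat \<Rightarrow> nat"
    have f1: "0 \<le> f \<eta> \<and> f \<eta> \<le> 1" for \<eta> unfolding f_def using a
      by (auto intro!: prod_nonneg prod_le_1 power_le_one)
    have fb: "bounded (range f)" unfolding bounded_range_real using f1 by (intro exI[of _ 1]) (auto simp: abs_le_iff)
    define b where "b s x = sg p f s (one x)" for s x
    have b: "flow_on W N b" unfolding flow_on_def b_def using one_particle_flow[OF N p fb] by auto
    have b0: "b 0 x = a x" if "x < N" for x
      using one_particle_flow(2)[OF N p fb that] prod_pow_one[OF that, of a] by (simp add: b_def f_def)
    have bpos: "b s x \<ge> 0" for s x unfolding b_def using f1 by (simp add: integral_nonneg_AE)
    have "flow_on W N (\<lambda>_ _. 1)" by (simp add: flow_on_def lap_def)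
    from flow_duality[OF c v this t] flow_duality[OF c v b t]
    have dual: "(\<Sum>x<N. cell W N x * (v 0 x * (b t x - 1))) = (\<Sum>x<N. cell W N x * (v t x * (b 0 x - 1)))"
      by (simp add: right_diff_distrib sum_subtractf)
    have "(\<integral>\<omega>. f (X t \<omega>) \<partial>M) = measure_pmf.expectation (initial_measure W \<gamma> u0 N) (sg p f t)"
      by (rule E[OF fb t])
    also have "\<dots> = measure_pmf.expectation (initial_measure W \<gamma> u0 N) (\<lambda>\<eta>. \<Prod>x<N. b t x ^ \<eta> x)"
    proof (intro integral_cong_AE AE_pmfI)
      fix \<eta> assume "\<eta> \<in> set_pmf (initial_measure W \<gamma> u0 N)"
      then have "\<eta> \<in> Omega N" using set_initial_measure by blast
      then show "sg p f t \<eta> = (\<Prod>x<N. b t x ^ \<eta> x)"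
        using semigroup_product[OF N _ p _ _ t, of a \<eta>] c a unfolding f_def b_def by (simp add: less_imp_le)
    qed auto
    also have "\<dots> = exp (\<Sum>x<N. u0 (real x / real N) * real N powr \<gamma> * cell W N x * (b t x - 1))"
      by (rule initial_generating_function) (use u0 bpos in auto)
    also have "(\<Sum>x<N. u0 (real x / real N) * real N powr \<gamma> * cell W N x * (b t x - 1))
        = real N powr \<gamma> * (\<Sum>x<N. cell W N x * (v 0 x * (b t x - 1)))"
      unfolding sum_distrib_left by (intro sum.cong refl) (simp add: v0)
    also have "\<dots> = real N powr \<gamma> * (\<Sum>x<N. cell W N x * (v t x * (a x - 1)))"
      unfolding dual by (auto simp: b0 intro!: sum.cong)
    also have "(\<Sum>x<N. cell W N x * (v t x * (a x - 1))) = - (\<Sum>x<N. cell W N x * (v t x * (1 - a x)))"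
      unfolding sum_negf[symmetric] by (intro sum.cong refl) (simp add: algebra_simps)
    finally show "(\<integral>\<omega>. (\<Prod>x<N. a x ^ X t \<omega> x) \<partial>M) = exp (- (real N powr \<gamma> * (\<Sum>x<N. cell W N x * (v t x * (1 - a x)))))"
      by (simp add: f_def)
  qed
qed

section \<open>Energy decay of the discrete heat flow\<close>

lemma half_line_nonincreasing:
  assumes P: "\<And>t. t \<ge> 0 \<Longrightarrow> (P has_real_derivative P' t) (at t within {0..})"
    and neg: "\<And>t. a < t \<Longrightarrow> t < b \<Longrightarrow> P' t \<le> 0" and ab: "0 \<le> a" "a \<le> b"
  shows "P b \<le> P a"
proof (rule DERIV_nonpos_imp_decreasing_open[OF ab(2)])
  fix s assume s: "a < s" "s < b"
  have "(P has_real_derivative P' s) (at s)"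
    using P[of s] s ab by (simp add: at_within_interior[of s "{0..}"] interior_Ici)
  then show "\<exists>y. DERIV P s :> y \<and> y \<le> 0" using neg s by blast
next
  show "continuous_on {a..b} P"
    by (rule DERIV_continuous_on, rule DERIV_subset[OF P]) (use ab in auto)
qed

lemma energy_nonneg: "energy N a a \<ge> 0"
  unfolding energy_def power2_eq_square[symmetric] by (intro mult_nonneg_nonneg sum_nonneg) auto

lemma energy_diff: "energy N (\<lambda>x. a x - b x) d = energy N a d - energy N b d"
  unfolding energy_def right_diff_distrib[symmetric] sum_subtractf[symmetric]
  by (intro arg_cong[where f="\<lambda>r. _ * r"] sum.cong refl) (simp add: algebra_simps)

lemma energy_diff_right: "energy N d (\<lambda>x. a x - b x) = energy N d a - energy N d b"
  by (simp add: energy_commute[of N d] energy_diff)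

lemma energy_le: "2 * energy N a b \<le> energy N a a + energy N b b"
  using energy_nonneg[of N "\<lambda>x. a x - b x"] energy_commute[of N a b]
  by (simp add: energy_diff energy_diff_right)

lemma energy_cong: "(\<And>x. x < N \<Longrightarrow> a x = a' x) \<Longrightarrow> (\<And>x. x < N \<Longrightarrow> b x = b' x) \<Longrightarrow> energy N a b = energy N a' b'"
  unfolding energy_def by (intro arg_cong[where f="\<lambda>r. _ * r"] sum.cong refl) (auto dest: nbrs_less)

lemma energy_deriv:
  assumes "\<And>x. x < N \<Longrightarrow> ((\<lambda>s. a s x) has_real_derivative a' x) F" "\<And>x. x < N \<Longrightarrow> ((\<lambda>s. b s x) has_real_derivative b' x) F"
   and F: "F = at t within S"
  shows "((\<lambda>s. energy N (a s) (b s)) has_real_derivative energy N a' (b t) + energy N (a t) b') F"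
proof -
  have "((\<lambda>s. energy N (a s) (b s)) has_real_derivative
     (real N / 2 * (\<Sum>x<N. \<Sum>y\<in>nbrs N x. (a t y - a t x) * (b' y - b' x) + (a' y - a' x) * (b t y - b t x)))) F"
    unfolding energy_def F
    by (intro DERIV_cmult DERIV_sum DERIV_mult' DERIV_diff) (use assms in \<open>auto dest: nbrs_less\<close>)
  then show ?thesis by (simp only: energy_def sum.distrib distrib_left add.commute)
qed

text \<open>
  A bounded solution of the discrete heat equation, with the total mass \<open>m\<close> of the cells. The
  bounds below depend on \<open>C\<close>, \<open>m\<close> and the time only, hence not on the grid.
\<close>

locale flow =
  fixes W :: "real measure" and N :: nat and f :: "real \<Rightarrow> nat \<Rightarrow> real" and C m :: real
  assumes cell: "\<And>x. x < N \<Longrightarrow> cell W N x > 0"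
    and flow: "flow_on W N f"
    and bound: "\<And>t x. \<bar>f t x\<bar> \<le> C"
    and mass: "(\<Sum>x<N. cell W N x) = m"
begin

definition diss :: "real \<Rightarrow> real" where "diss t = energy N (f t) (f t)"
definition speed :: "real \<Rightarrow> real" where "speed t = (\<Sum>x<N. cell W N x * (lap W N (f t) x)\<^sup>2)"

lemma deriv: "t \<ge> 0 \<Longrightarrow> x < N \<Longrightarrow> ((\<lambda>s. f s x) has_real_derivative lap W N (f t) x) (at t within {0..})"
  using flow by (auto simp: flow_on_def)

lemma diss_nonneg: "diss t \<ge> 0" by (simp add: diss_def energy_nonneg)

lemma deriv_lap: "t \<ge> 0 \<Longrightarrow> x < N \<Longrightarrow> ((\<lambda>s. lap W N (f s) x) has_real_derivative lap W N (lap W N (f t)) x) (at t within {0..})"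
  by (subst (1 2) lap_def) (intro DERIV_cmult DERIV_sum DERIV_diff deriv, auto dest: nbrs_less)

lemma deriv_weighted:
  assumes g: "\<And>x. x < N \<Longrightarrow> ((\<lambda>s. g s x) has_real_derivative g' x) (at t within {0..})"
  shows "((\<lambda>s. \<Sum>x<N. cell W N x * (g s x)\<^sup>2) has_real_derivative 2 * (\<Sum>x<N. cell W N x * (g t x * g' x))) (at t within {0..})"
proof -
  have "((\<lambda>s. \<Sum>x<N. cell W N x * (g s x)\<^sup>2) has_real_derivative (\<Sum>x<N. cell W N x * (2 * g t x * g' x))) (at t within {0..})"
    by (intro DERIV_cmult DERIV_sum) (use g in \<open>auto intro!: derivative_eq_intros\<close>)
  then show ?thesis by (simp add: sum_distrib_left mult_ac)
qed

lemma deriv_mass2: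
  assumes "t \<ge> 0"
  shows "((\<lambda>s. \<Sum>x<N. cell W N x * (f s x)\<^sup>2) has_real_derivative - diss t) (at t within {0..})"
  using deriv_weighted[of f "lap W N (f t)" t] deriv assms
  by (simp add: diss_def lap_energy[OF cell])

lemma deriv_diss:
  assumes "t \<ge> 0" shows "(diss has_real_derivative - 4 * speed t) (at t within {0..})"
proof -
  have "energy N (lap W N (f t)) (f t) + energy N (f t) (lap W N (f t)) = 2 * energy N (lap W N (f t)) (f t)"
    by (simp add: energy_commute[of N "f t"])
  also have "\<dots> = - 4 * speed t"
    using lap_energy[OF cell, of "lap W N (f t)" "f t"] by (simp add: speed_def power2_eq_square)
  finally show ?thesis
    using energy_deriv[of N f "lap W N (f t)" "at t within {0..}" f "lap W N (f t)" t "{0..}"] deriv assms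
    by (simp add: diss_def[abs_def])
qed

lemma deriv_speed:
  assumes "t \<ge> 0" shows "(speed has_real_derivative - energy N (lap W N (f t)) (lap W N (f t))) (at t within {0..})"
  unfolding speed_def[abs_def]
  using deriv_weighted[of "\<lambda>t. lap W N (f t)" "lap W N (lap W N (f t))" t] deriv_lap assms
  by (simp add: lap_energy[OF cell])

lemma mass_nonneg: "m \<ge> 0" unfolding mass[symmetric] by (intro sum_nonneg) (simp add: cell less_imp_le)

lemma initial_mass2: "(\<Sum>x<N. cell W N x * (f t x)\<^sup>2) \<le> C\<^sup>2 * m"
proof -
  have "(\<Sum>x<N. cell W N x * (f t x)\<^sup>2) \<le> (\<Sum>x<N. cell W N x * C\<^sup>2)"
    by (intro sum_mono mult_left_mono) (auto simp: cell less_imp_le abs_le_square_iff[symmetric] intro: order_trans[OF bound abs_ge_self])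
  also have "\<dots> = C\<^sup>2 * m" by (simp add: mass[symmetric] sum_distrib_left mult.commute)
  finally show ?thesis .
qed

lemma speed_nonneg: "speed t \<ge> 0" unfolding speed_def by (intro sum_nonneg) (simp add: cell less_imp_le)

lemma diss_mono: "0 \<le> a \<Longrightarrow> a \<le> b \<Longrightarrow> diss b \<le> diss a"
  by (rule half_line_nonincreasing[OF deriv_diss]) (use speed_nonneg in auto)

lemma speed_mono: "0 \<le> a \<Longrightarrow> a \<le> b \<Longrightarrow> speed b \<le> speed a"
  by (rule half_line_nonincreasing[OF deriv_speed]) (use energy_nonneg in auto)

text \<open>
  The dissipation is the rate of decay of \<open>\<Sum> W\<^sup>N\<^sub>x f\<^sup>2 \<le> C\<^sup>2 m\<close> and it decreases in time, so \<open>t\<close> times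
  its final value is at most the total decay.
\<close>

lemma diss_bound: assumes "t \<ge> 0" shows "t * diss t \<le> C\<^sup>2 * m"
proof -
  have d: "((\<lambda>s. (\<Sum>x<N. cell W N x * (f s x)\<^sup>2) + s * diss t) has_real_derivative - diss s + diss t) (at s within {0..})"
    if "s \<ge> 0" for s
    by (rule DERIV_add[OF deriv_mass2[OF that]]) (auto intro!: derivative_eq_intros)
  have "(\<Sum>x<N. cell W N x * (f t x)\<^sup>2) + t * diss t \<le> (\<Sum>x<N. cell W N x * (f 0 x)\<^sup>2) + 0 * diss t"
    by (rule half_line_nonincreasing[where a=0 and b=t and P'="\<lambda>s. - diss s + diss t"])
       (use assms d in \<open>auto intro!: diss_mono\<close>)
  moreover have "(\<Sum>x<N. cell W N x * (f t x)\<^sup>2) \<ge> 0" by (intro sum_nonneg) (simp add: cell less_imp_le)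
  ultimately show ?thesis using initial_mass2[of 0] by simp
qed

text \<open>
  The same argument one derivative higher, on the interval from \<open>t/2\<close> to \<open>t\<close>.
\<close>

lemma speed_bound: assumes "t > 0" shows "t\<^sup>2 * speed t \<le> C\<^sup>2 * m"
proof -
  have "diss t + 4 * (t * speed t) \<le> diss (t / 2) + 4 * ((t / 2) * speed t)"
    by (rule half_line_nonincreasing[where a="t/2" and b=t and P'="\<lambda>s. - 4 * speed s + 4 * speed t"])
       (use assms in \<open>auto intro!: derivative_eq_intros deriv_diss speed_mono\<close>)
  then have "2 * (t * speed t) \<le> diss (t / 2)" using diss_nonneg[of t] by simp
  then have "t / 2 * (2 * (t * speed t)) \<le> t / 2 * diss (t / 2)" using assms by (intro mult_left_mono) auto
  also have "\<dots> \<le> C\<^sup>2 * m" using diss_bound[of "t/2"] assms by simp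
  finally show ?thesis by (simp add: power2_eq_square)
qed

text \<open>
  The derivative in \<open>r\<close> of the left-hand side is
  \<open>- energy (f r - f s, f r) \<le> (energy (f s, f s) - energy (f r, f r)) / 2\<close>.
\<close>

lemma increment_bound:
  assumes "0 \<le> s" "s \<le> r"
  shows "(\<Sum>x<N. cell W N x * (f r x - f s x)\<^sup>2) \<le> (r - s) * diss s / 2"
proof -
  let ?P = "\<lambda>q. (\<Sum>x<N. cell W N x * (f q x - f s x)\<^sup>2) - (q - s) * diss s / 2"
  let ?P' = "\<lambda>q. - energy N (\<lambda>x. f q x - f s x) (f q) - diss s / 2"
  have "?P r \<le> ?P s"
  proof (rule half_line_nonincreasing[where P'="?P'", OF _ _ assms])
    fix q :: real assume q: "q \<ge> 0"
    have "((\<lambda>q. f q x - f s x) has_real_derivative lap W N (f q) x) (at q within {0..})" if "x < N" for x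
      using deriv[OF q that] by (auto intro!: derivative_eq_intros)
    from deriv_weighted[of "\<lambda>q x. f q x - f s x" "lap W N (f q)" q, OF this]
    have *: "((\<lambda>q. \<Sum>x<N. cell W N x * (f q x - f s x)\<^sup>2) has_real_derivative - energy N (\<lambda>x. f q x - f s x) (f q)) (at q within {0..})"
      by (simp add: lap_energy[OF cell])
    have "((\<lambda>q. (q - s) * diss s / 2) has_real_derivative diss s / 2) (at q within {0..})"
      by (auto intro!: derivative_eq_intros)
    from DERIV_diff[OF * this] show "(?P has_real_derivative ?P' q) (at q within {0..})" .
  next
    fix q assume q: "s < q" "q < r"
    show "?P' q \<le> 0"
      using energy_le[of N "f s" "f q"] energy_nonneg[of N "f q"] by (simp add: energy_diff diss_def)
  qed
  then show ?thesis by simp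
qed

lemma speed_l1: "t > 0 \<Longrightarrow> (\<Sum>x<N. cell W N x * \<bar>lap W N (f t) x\<bar>) \<le> m + C\<^sup>2 * m / t\<^sup>2"
proof -
  assume t: "t > 0"
  have "(\<Sum>x<N. cell W N x * \<bar>lap W N (f t) x\<bar>) \<le> (\<Sum>x<N. cell W N x * (1 + (lap W N (f t) x)\<^sup>2))"
  proof (intro sum_mono mult_left_mono)
    fix x
    have "\<bar>z\<bar> \<le> 1 + z\<^sup>2" for z :: real
      using zero_le_power2[of "\<bar>z\<bar> - 1"] zero_le_power2[of z] unfolding power2_eq_square
      by (auto simp: algebra_simps abs_if split: if_splits)
    then show "\<bar>lap W N (f t) x\<bar> \<le> 1 + (lap W N (f t) x)\<^sup>2" .
  qed (simp add: cell less_imp_le)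
  also have "\<dots> = m + speed t" by (simp add: distrib_left sum.distrib mass speed_def)
  also have "speed t \<le> C\<^sup>2 * m / t\<^sup>2" using speed_bound[OF t] t by (simp add: field_simps)
  finally show ?thesis by simp
qed

end

section \<open>Measures on the torus and their cells\<close>

lemma torus_measureD:
  assumes "torus_measure W"
  shows "finite_measure W" "sets W = sets (restrict_space borel {0..<1::real})" "space W = {0..<1}"
proof -
  show 1: "finite_measure W" "sets W = sets (restrict_space borel {0..<1::real})"
    using assms by (auto simp: torus_measure_def)
  from sets_eq_imp_space_eq[OF 1(2)] show "space W = {0..<1}" by (simp add: space_restrict_space)
qed

lemma torus_measurable:
  assumes "torus_measure W" "f \<in> borel_measurable borel" shows "f \<in> borel_measurable W"
proof -
  have "f \<in> borel_measurable (restrict_space borel {0..<1})" using assms(2) by (rule measurable_restrict_space1)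
  then show ?thesis using measurable_cong_sets[OF torus_measureD(2)[OF assms(1)] refl] by blast
qed

lemma torus_integrable:
  assumes "torus_measure W" "f \<in> borel_measurable borel" "\<And>y. y \<in> {0..<1} \<Longrightarrow> \<bar>f y\<bar> \<le> C"
  shows "integrable W (f :: real \<Rightarrow> real)"
proof -
  interpret finite_measure W by (rule torus_measureD) fact
  show ?thesis
    by (rule integrable_const_bound[where B=C])
       (use assms torus_measurable in \<open>auto simp: torus_measureD intro!: AE_I2\<close>)
qed

lemma torus_sets: "torus_measure W \<Longrightarrow> A \<in> sets borel \<Longrightarrow> A \<subseteq> {0..<1} \<Longrightarrow> A \<in> sets W"
  by (auto simp: torus_measureD sets_restrict_space)

text \<open>
  The cell of the grid that contains the point \<open>y\<close> of \<open>[0,1)\<close>.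
\<close>

definition idx :: "nat \<Rightarrow> real \<Rightarrow> nat" where "idx N y = nat \<lfloor>real N * y\<rfloor>"

lemma idx_less: "N \<ge> 1 \<Longrightarrow> y \<in> {0..<1} \<Longrightarrow> idx N y < N"
  by (auto simp: idx_def nat_less_iff floor_less_iff)

lemma idx_eq_iff:
  assumes "N \<ge> 1" "y \<in> {0..<1}" shows "idx N y = x \<longleftrightarrow> y \<in> {real x / real N ..< (real x + 1) / real N}"
proof -
  have "idx N y = x \<longleftrightarrow> \<lfloor>real N * y\<rfloor> = int x" using assms by (auto simp: idx_def)
  also have "\<dots> \<longleftrightarrow> real x \<le> real N * y \<and> real N * y < real x + 1" by (simp add: floor_eq_iff)
  also have "\<dots> \<longleftrightarrow> y \<in> {real x / real N ..< (real x + 1) / real N}" using assms by (auto simp: field_simps)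
  finally show ?thesis .
qed

lemma idx_bounds:
  assumes "N \<ge> 1" "y \<in> {0..<1}" shows "real (idx N y) / real N \<le> y" "y < (real (idx N y) + 1) / real N"
  using idx_eq_iff[OF assms, of "idx N y"] by auto

lemma cell_subset: "x < N \<Longrightarrow> {real x / real N ..< (real x + 1) / real N} \<subseteq> {0..<1}"
proof -
  assume "x < N"
  then have "(real x + 1) / real N \<le> 1" by (simp add: field_simps)
  then show ?thesis by (auto intro: order_trans[OF divide_nonneg_nonneg])
qed

lemma idx_measurable[measurable]: "(\<lambda>y. (\<phi> (idx N y) :: real)) \<in> borel_measurable borel"
proof -
  have "idx N \<in> borel \<rightarrow>\<^sub>M count_space UNIV" unfolding idx_def[abs_def] by measurable
  then show ?thesis by (rule measurable_compose) simp
qed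

lemma cell_decomposition:
  assumes "N \<ge> 1" "y \<in> {0..<1}"
  shows "(\<phi> (idx N y) :: real) = (\<Sum>x<N. indicator {real x / real N ..< (real x + 1) / real N} y * \<phi> x)"
proof -
  have "(\<Sum>x<N. indicator {real x / real N ..< (real x + 1) / real N} y * \<phi> x) = (\<Sum>x<N. if idx N y = x then \<phi> x else 0)"
    by (intro sum.cong refl) (simp add: idx_eq_iff[OF assms] indicator_def)
  then show ?thesis using idx_less[OF assms] by simp
qed

lemma integral_idx:
  assumes W: "torus_measure W" and N: "N \<ge> 1"
  shows "(\<integral>y. \<phi> (idx N y) \<partial>W) = (\<Sum>x<N. cell W N x * \<phi> x)"
proof -
  interpret finite_measure W by (rule torus_measureD) fact
  let ?J = "\<lambda>x. {real x / real N ..< (real x + 1) / real N}"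
  have s: "?J x \<in> sets W" if "x < N" for x
    using torus_sets[OF W _ cell_subset[OF that]] by simp
  have "(\<integral>y. \<phi> (idx N y) \<partial>W) = (\<integral>y. (\<Sum>x<N. indicator (?J x) y * \<phi> x) \<partial>W)"
    using cell_decomposition[OF N, of _ \<phi>] by (intro Bochner_Integration.integral_cong) (auto simp: torus_measureD[OF W])
  also have "\<dots> = (\<Sum>x<N. (\<integral>y. indicator (?J x) y * \<phi> x \<partial>W))"
    using s by (intro Bochner_Integration.integral_sum integrable_mult_left) (auto simp: emeasure_eq_measure)
  also have "\<dots> = (\<Sum>x<N. cell W N x * \<phi> x)"
    using s by (intro sum.cong refl) (simp add: cell_def)
  finally show ?thesis .
qed

text \<open>
  A cell contains an open interval, and the periodic extension of that interval is open in the
  torus.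
\<close>

lemma cell_pos:
  assumes W: "torus_measure W" "positive_on_open W" and x: "x < N"
  shows "cell W N x > 0"
proof -
  interpret finite_measure W by (rule torus_measureD) fact
  define a b where "a = real x / real N" and "b = (real x + 1) / real N"
  have ab: "0 \<le> a" "a < b" "b \<le> 1" using x by (auto simp: a_def b_def field_simps)
  define A where "A = (\<Union>k::int. {a + of_int k <..< b + of_int k})"
  have shift: "y + 1 \<in> A \<longleftrightarrow> y \<in> A" for y
  proof
    assume "y + 1 \<in> A" then obtain k where "y + 1 \<in> {a + of_int k <..< b + of_int k}" by (auto simp: A_def)
    then have "y \<in> {a + of_int (k - 1) <..< b + of_int (k - 1)}" by auto
    then show "y \<in> A" unfolding A_def by blast
  next
    assume "y \<in> A" then obtain k where "y \<in> {a + of_int k <..< b + of_int k}" by (auto simp: A_def)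
    then have "y + 1 \<in> {a + of_int (k + 1) <..< b + of_int (k + 1)}" by auto
    then show "y + 1 \<in> A" unfolding A_def by blast
  qed
  have "(a + b) / 2 \<in> {a + of_int 0 <..< b + of_int 0}" using ab by auto
  then have ne: "A \<noteq> {}" unfolding A_def by blast
  have "torus_open A" unfolding torus_open_def using shift by (auto simp: A_def)
  with ne W(2) have pos: "emeasure W (A \<inter> {0..<1}) > 0" by (auto simp: positive_on_open_def)
  have "A \<inter> {0..<1} \<subseteq> {a..<b}"
  proof
    fix y assume "y \<in> A \<inter> {0..<1}"
    then obtain k where k: "y \<in> {a + of_int k <..< b + of_int k}" "0 \<le> y" "y < 1" by (auto simp: A_def)
    then have "real_of_int k < 1" "real_of_int k > -1" using ab by auto
    then have "k = 0" by linarith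
    then show "y \<in> {a..<b}" using k by auto
  qed
  then have "emeasure W (A \<inter> {0..<1}) \<le> emeasure W {a..<b}"
    using torus_sets[OF W(1), of "{a..<b}"] ab by (intro emeasure_mono) auto
  with pos have "emeasure W {a..<b} > 0" by (rule less_le_trans)
  then show ?thesis by (simp add: cell_def a_def b_def emeasure_eq_measure)
qed

lemma sum_cell:
  assumes "torus_measure W" "N \<ge> 1" shows "(\<Sum>x<N. cell W N x) = measure W {0..<1}"
  using integral_idx[OF assms, of "\<lambda>_. 1"] by (simp add: torus_measureD[OF assms(1)])

text \<open>
  The quadratic form \<open>\<integral> (s f - r g)\<^sup>2\<close> in \<open>(s,r)\<close> is nonnegative, so its discriminant is not positive.
\<close>

lemma Cauchy_Schwarz_integral:
  fixes f g :: "'a \<Rightarrow> real"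
  assumes [measurable]: "f \<in> borel_measurable M" "g \<in> borel_measurable M"
    and f2: "integrable M (\<lambda>x. (f x)\<^sup>2)" and g2: "integrable M (\<lambda>x. (g x)\<^sup>2)"
  shows "integrable M (\<lambda>x. f x * g x)"
    and "\<bar>\<integral>x. f x * g x \<partial>M\<bar> \<le> sqrt (\<integral>x. (f x)\<^sup>2 \<partial>M) * sqrt (\<integral>x. (g x)\<^sup>2 \<partial>M)"
proof -
  have le: "\<bar>f x * g x\<bar> \<le> (f x)\<^sup>2 + (g x)\<^sup>2" for x
    using zero_le_power2[of "\<bar>f x\<bar> - \<bar>g x\<bar>"] zero_le_power2[of "f x"] zero_le_power2[of "g x"]
    unfolding power2_diff power2_abs abs_mult by linarith
  show int: "integrable M (\<lambda>x. f x * g x)"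
    by (rule Bochner_Integration.integrable_bound[OF Bochner_Integration.integrable_add[OF f2 g2]])
       (use le in \<open>auto simp: abs_mult\<close>)
  define A B I where "A = (\<integral>x. (f x)\<^sup>2 \<partial>M)" and "B = (\<integral>x. (g x)\<^sup>2 \<partial>M)" and "I = (\<integral>x. f x * g x \<partial>M)"
  have AB: "A \<ge> 0" "B \<ge> 0" unfolding A_def B_def by auto
  have q: "s * s * A - 2 * s * r * I + r * r * B \<ge> 0" for s r
  proof -
    have "0 \<le> (\<integral>x. (s * f x - r * g x)\<^sup>2 \<partial>M)" by simp
    also have "(\<integral>x. (s * f x - r * g x)\<^sup>2 \<partial>M) = (\<integral>x. s * s * (f x)\<^sup>2 - 2 * s * r * (f x * g x) + r * r * (g x)\<^sup>2 \<partial>M)"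
      by (intro Bochner_Integration.integral_cong refl) (simp add: power2_eq_square algebra_simps)
    also have "\<dots> = s * s * A - 2 * s * r * I + r * r * B"
      using f2 g2 int by (simp add: A_def B_def I_def)
    finally show ?thesis .
  qed
  have "I\<^sup>2 \<le> A * B"
  proof (cases "B = 0")
    case True
    show ?thesis
    proof (cases "I = 0")
      case False
      \<comment> \<open>With \<open>B = 0\<close> the form is linear in \<open>r\<close>; this \<open>r\<close> makes it equal to \<open>- 1\<close>.\<close>
      have "(1/I) * (1/I) * A + 2 * ((A/I^2+1)/2) * (-1) \<ge> 0"
        using q[of "1/I" "(A/I^2+1)/2"] True False by simp
      then show ?thesis using False by (simp add: power2_eq_square field_simps)
    qed (use True in simp)
  next
    case False
    then have "B > 0" using AB by simp
    have "B * (A * B - I\<^sup>2) \<ge> 0" using q[of B I] by (simp add: power2_eq_square algebra_simps)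
    with \<open>B > 0\<close> show ?thesis by (simp add: zero_le_mult_iff)
  qed
  then have "sqrt (I\<^sup>2) \<le> sqrt (A * B)" by (rule real_sqrt_le_mono)
  then show "\<bar>\<integral>x. f x * g x \<partial>M\<bar> \<le> sqrt (\<integral>x. (f x)\<^sup>2 \<partial>M) * sqrt (\<integral>x. (g x)\<^sup>2 \<partial>M)"
    by (simp add: real_sqrt_mult A_def B_def I_def)
qed

definition Leb :: "real measure" where "Leb = restrict_space lborel {0..<1}"

lemma torus_Leb: "torus_measure Leb"
  unfolding torus_measure_def Leb_def
  by (auto simp: sets_restrict_space intro!: finite_measureI) (simp add: emeasure_restrict_space)

lemma integral_Leb: "(\<integral>x. f x \<partial>Leb) = (\<integral>x. indicator {0..<1} x * (f x :: real) \<partial>lborel)"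
  unfolding Leb_def by (subst integral_restrict_space) auto

lemma cell_Leb: "x < N \<Longrightarrow> cell Leb N x = 1 / real N"
proof -
  assume x: "x < N"
  have "measure Leb {real x / real N ..< (real x + 1) / real N} = measure lborel {real x / real N ..< (real x + 1) / real N}"
    unfolding Leb_def using cell_subset[OF x] by (subst measure_restrict_space) auto
  then show ?thesis using x by (simp add: cell_def field_simps)
qed

section \<open>Piecewise linear interpolation\<close>

definition site_succ :: "nat \<Rightarrow> nat \<Rightarrow> nat" where "site_succ N x = (x + 1) mod N"

text \<open>
  The value at \<open>x/N\<close> is \<open>a x\<close>. Indices are reduced modulo \<open>N\<close>, which makes the function periodic on
  the whole line and not only on one period.
\<close>

definition interp :: "nat \<Rightarrow> (nat \<Rightarrow> real) \<Rightarrow> real \<Rightarrow> real" where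
  "interp N a y = (let k = \<lfloor>real N * y\<rfloor> in
     a (nat (k mod int N)) + (real N * y - of_int k) * (a (nat ((k + 1) mod int N)) - a (nat (k mod int N))))"

text \<open>
  The derivative of the interpolation inside the cells.
\<close>

definition grad :: "nat \<Rightarrow> (nat \<Rightarrow> real) \<Rightarrow> real \<Rightarrow> real" where
  "grad N a y = real N * (a (site_succ N (idx N y)) - a (idx N y))"

lemma interp_periodic: "torus_fun (interp N a)"
proof -
  have "interp N a (y + 1) = interp N a y" for y
  proof -
    have "\<lfloor>real N * (y + 1)\<rfloor> = \<lfloor>real N * y\<rfloor> + int N"
      unfolding distrib_left mult_1_right by (metis floor_add_int of_int_of_nat_eq)
    moreover have "(\<lfloor>real N * y\<rfloor> + int N + 1) mod int N = (\<lfloor>real N * y\<rfloor> + 1) mod int N"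
      by (metis add.assoc add.commute mod_add_self2)
    ultimately show ?thesis by (simp add: interp_def Let_def distrib_left)
  qed
  then show ?thesis by (simp add: torus_fun_def)
qed

lemma interp_on_cell:
  assumes N: "N \<ge> 1" and y: "real_of_int k \<le> real N * y" "real N * y \<le> real_of_int k + 1"
  shows "interp N a y = a (nat (k mod int N)) + (real N * y - of_int k) * (a (nat ((k + 1) mod int N)) - a (nat (k mod int N)))"
proof (cases "real N * y = real_of_int k + 1")
  case True
  then have "\<lfloor>real N * y\<rfloor> = k + 1" by linarith
  then show ?thesis using True by (simp add: interp_def Let_def)
next
  case False
  then have "\<lfloor>real N * y\<rfloor> = k" using y by linarith
  then show ?thesis by (simp add: interp_def Let_def)
qed

lemma interp_on_cell_nat:
  assumes N: "N \<ge> 1" and x: "x < N" and y: "real x / real N \<le> y" "y \<le> (real x + 1) / real N"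
  shows "interp N a y = a x + (real N * y - real x) * (a (site_succ N x) - a x)"
proof -
  have "nat (int x mod int N) = x" using x by simp
  moreover have "nat ((int x + 1) mod int N) = site_succ N x" unfolding site_succ_def
    by (metis nat_int of_nat_Suc of_nat_mod semiring_1_class.of_nat_simps(2) Suc_eq_plus1 add.commute)
  ultimately show ?thesis
    using interp_on_cell[of N "int x" y a] N y by (simp add: field_simps)
qed

lemma interp_grid: assumes "x < N" shows "interp N a (real x / real N) = a x"
  using assms by (subst interp_on_cell_nat[of N x]) (auto simp: field_simps)

lemma interp_bound:
  assumes N: "N \<ge> 1" and a: "\<And>x. x < N \<Longrightarrow> \<bar>a x\<bar> \<le> C" shows "\<bar>interp N a y\<bar> \<le> C"
proof -
  define k where "k = \<lfloor>real N * y\<rfloor>"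
  define \<theta> where "\<theta> = real N * y - of_int k"
  have \<theta>: "0 \<le> \<theta>" "\<theta> \<le> 1" unfolding \<theta>_def k_def by linarith+
  have ub: "nat (j mod int N) < N" for j using N by (simp add: nat_less_iff)
  have "interp N a y = (1 - \<theta>) * a (nat (k mod int N)) + \<theta> * a (nat ((k + 1) mod int N))"
    by (simp add: interp_def Let_def \<theta>_def k_def algebra_simps)
  also have "\<bar>\<dots>\<bar> \<le> (1 - \<theta>) * \<bar>a (nat (k mod int N))\<bar> + \<theta> * \<bar>a (nat ((k + 1) mod int N))\<bar>"
    using \<theta> by (intro order_trans[OF abs_triangle_ineq]) (simp add: abs_mult)
  also have "\<dots> \<le> (1 - \<theta>) * C + \<theta> * C"
    using \<theta> a ub by (intro add_mono mult_left_mono) auto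
  finally show ?thesis by (simp add: algebra_simps)
qed

text \<open>
  Continuity on each closed cell of a mesh suffices: cells overlap at their end points.
\<close>

lemma continuous_on_mesh:
  fixes f :: "real \<Rightarrow> real"
  assumes h: "h > 0" and f: "\<And>k::int. continuous_on {of_int k * h .. (of_int k + 1) * h} f"
  shows "continuous_on UNIV f"
proof -
  have "isCont f x" for x
  proof -
    define k where "k = \<lfloor>x / h\<rfloor>"
    have k: "of_int k * h \<le> x" "x < (of_int k + 1) * h"
      using floor_divide_lower[OF h, of x] floor_divide_upper[OF h, of x] by (auto simp: k_def)
    let ?a = "(of_int k - 1) * h" and ?m = "of_int k * h" and ?b = "(of_int k + 1) * h"
    have "continuous_on ({?a .. ?m} \<union> {?m .. ?b}) f"
      using f[of "k-1"] f[of k] by (intro continuous_on_closed_Un) auto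
    moreover have "{?a<..<?b} \<subseteq> {?a .. ?m} \<union> {?m .. ?b}" by auto
    ultimately have "continuous_on {?a<..<?b} f" by (rule continuous_on_subset)
    moreover have "x \<in> {?a<..<?b}" using k h by (auto simp: algebra_simps)
    ultimately show ?thesis by (meson continuous_on_eq_continuous_at open_greaterThanLessThan)
  qed
  then show ?thesis by (simp add: continuous_at_imp_continuous_on)
qed

lemma interp_continuous:
  assumes N: "N \<ge> 1" shows "continuous_on UNIV (interp N a)"
proof (rule continuous_on_mesh[of "1 / real N"])
  show "1 / real N > 0" using N by simp
  fix k :: int
  have "continuous_on {of_int k * (1 / real N) .. (of_int k + 1) * (1 / real N)}
     (\<lambda>y. a (nat (k mod int N)) + (real N * y - of_int k) * (a (nat ((k + 1) mod int N)) - a (nat (k mod int N))))"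
    by (intro continuous_intros)
  then show "continuous_on {of_int k * (1 / real N) .. (of_int k + 1) * (1 / real N)} (interp N a)"
  proof (rule continuous_on_eq)
    fix y assume "y \<in> {of_int k * (1 / real N) .. (of_int k + 1) * (1 / real N)}"
    then have "of_int k \<le> real N * y" "real N * y \<le> of_int k + 1" using N by (auto simp: field_simps)
    from interp_on_cell[OF N this] show "a (nat (k mod int N)) + (real N * y - of_int k) * (a (nat ((k + 1) mod int N)) - a (nat (k mod int N)))
        = interp N a y" by simp
  qed
qed

lemma interp_measurable[measurable]: "N \<ge> 1 \<Longrightarrow> interp N a \<in> borel_measurable borel"
  using interp_continuous by (rule borel_measurable_continuous_onI)

lemma grad_measurable[measurable]: "grad N a \<in> borel_measurable borel"
  unfolding grad_def[abs_def] by measurable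

lemma grad_bound:
  assumes "N \<ge> 1" obtains C where "\<And>y. y \<in> {0..<1} \<Longrightarrow> \<bar>grad N a y\<bar> \<le> C" "C \<ge> 0"
proof
  fix y :: real assume "y \<in> {0..<1}"
  then have "idx N y < N" using assms idx_less by auto
  then show "\<bar>grad N a y\<bar> \<le> (\<Sum>x<N. \<bar>real N * (a (site_succ N x) - a x)\<bar>)"
    unfolding grad_def by (intro member_le_sum[where f="\<lambda>x. \<bar>real N * (a (site_succ N x) - a x)\<bar>"]) auto
qed (auto intro: sum_nonneg)

lemma grad_integrable: "N \<ge> 1 \<Longrightarrow> integrable Leb (grad N a)"
  using grad_bound[of N a] torus_integrable[OF torus_Leb grad_measurable] by metis

lemma interp_integral:
  assumes N: "N \<ge> 1" and uv: "0 \<le> u" "u \<le> v" "v \<le> 1"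
  shows "interp N a v - interp N a u = (\<integral>y. indicator {u..<v} y * grad N a y \<partial>Leb)"
proof -
  obtain C where C: "\<And>y. y \<in> {0..<1} \<Longrightarrow> \<bar>grad N a y\<bar> \<le> C" "C \<ge> 0" using grad_bound[OF N] by blast
  let ?g = "\<lambda>y. indicator {0..<1} y * grad N a y"
  have hi: "(?g has_integral interp N a v - interp N a u) {u..v}"
  proof (rule fundamental_theorem_of_calculus_interior_strong[where S="(\<lambda>x. real x / real N) ` {..N}"])
    show "continuous_on {u..v} (interp N a)" using interp_continuous[OF N] continuous_on_subset by blast
    fix y assume y: "y \<in> {u<..<v} - (\<lambda>x. real x / real N) ` {..N}"
    then have y01: "y \<in> {0..<1}" using uv by auto
    let ?x = "idx N y"
    have x: "?x < N" using idx_less[OF N y01] .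
    have "real ?x / real N \<noteq> y" using y x by (metis DiffD2 atMost_iff image_eqI less_imp_le)
    with idx_bounds[OF N y01] have b: "real ?x / real N < y" "y < (real ?x + 1) / real N" by auto
    have "((\<lambda>y. a ?x + (real N * y - real ?x) * (a (site_succ N ?x) - a ?x)) has_real_derivative grad N a y) (at y)"
      by (auto intro!: derivative_eq_intros simp: grad_def)
    then have "(interp N a has_real_derivative grad N a y) (at y)"
      by (rule has_field_derivative_transform_within_open[where S="{real ?x / real N<..<(real ?x + 1) / real N}"])
         (use b interp_on_cell_nat[OF N x, of _ a] in auto)
    then show "(interp N a has_vector_derivative ?g y) (at y)"
      using y01 by (simp add: has_real_derivative_iff_has_vector_derivative)
  qed (use uv in auto)
  have int: "set_integrable lborel {u..v} ?g"
    unfolding set_integrable_def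
  proof (rule Bochner_Integration.integrable_bound[where f="\<lambda>y. C * indicator {u..v} y"])
    show "AE x in lborel. norm (indicat_real {u..v} x *\<^sub>R (indicat_real {0..<1} x * grad N a x)) \<le> norm (C * indicat_real {u..v} x)"
      using C by (auto simp: indicator_def)
  qed (use uv in auto)
  have "interp N a v - interp N a u = (LINT y:{u..v}|lborel. ?g y)"
    using set_borel_integral_eq_integral(2)[OF int] integral_unique[OF hi] by simp
  also have "\<dots> = (\<integral>y. indicator {0..<1} y * (indicator {u..<v} y * grad N a y) \<partial>lborel)"
    unfolding set_lebesgue_integral_def
  proof (rule integral_cong_AE)
    show "AE y in lborel. indicat_real {u..v} y *\<^sub>R (indicat_real {0..<1} y * grad N a y) = indicat_real {0..<1} y * (indicat_real {u..<v} y * grad N a y)"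
      using AE_lborel_singleton[of v] by eventually_elim (auto simp: indicator_def)
  qed auto
  finally show ?thesis by (simp add: integral_Leb)
qed

lemma bij_succ: "N \<ge> 1 \<Longrightarrow> bij_betw (site_succ N) {..<N} {..<N}"
proof -
  assume N: "N \<ge> 1"
  have "inj_on (site_succ N) {..<N}"
    by (auto simp: inj_on_def site_succ_def mod_Suc split: if_splits)
  moreover have "site_succ N ` {..<N} \<subseteq> {..<N}" using N by (auto simp: site_succ_def)
  ultimately show ?thesis by (simp add: bij_betw_def endo_inj_surj)
qed

text \<open>
  From three sites on the two neighbours of a site differ, and the bonds are in bijection with the
  sites.
\<close>

lemma energy_succ:
  assumes N: "N \<ge> 3"
  shows "energy N a b = real N * (\<Sum>x<N. (a (site_succ N x) - a x) * (b (site_succ N x) - b x))"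
proof -
  let ?G = "\<lambda>x y. (a y - a x) * (b y - b x)"
  have split: "(\<Sum>y\<in>nbrs N x. ?G x y) = ?G x (site_succ N x) + (\<Sum>y<N. if site_succ N y = x then ?G x y else 0)" if x: "x < N" for x
  proof -
    have ne: "site_succ N (site_succ N x) \<noteq> x" using x N by (auto simp: site_succ_def mod_Suc split: if_splits)
    have "nbrs N x = insert (site_succ N x) {y\<in>{..<N}. site_succ N y = x}"
      using N by (auto simp: nbrs_def site_succ_def)
    then have "(\<Sum>y\<in>nbrs N x. ?G x y) = ?G x (site_succ N x) + (\<Sum>y\<in>{y\<in>{..<N}. site_succ N y = x}. ?G x y)"
      using ne by simp
    also have "(\<Sum>y\<in>{y\<in>{..<N}. site_succ N y = x}. ?G x y) = (\<Sum>y<N. if site_succ N y = x then ?G x y else 0)"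
      by (rule sum.inter_filter) simp
    finally show ?thesis .
  qed
  have "(\<Sum>x<N. \<Sum>y<N. if site_succ N y = x then ?G x y else 0) = (\<Sum>y<N. \<Sum>x<N. if site_succ N y = x then ?G x y else 0)"
    by (rule sum.swap)
  also have "\<dots> = (\<Sum>y<N. ?G y (site_succ N y))"
    using bij_betwE[OF bij_succ[of N]] N by (intro sum.cong refl) (auto simp: algebra_simps)
  finally have "(\<Sum>x<N. \<Sum>y\<in>nbrs N x. ?G x y) = 2 * (\<Sum>x<N. ?G x (site_succ N x))"
    using split by (simp add: sum.distrib)
  then show ?thesis by (simp add: energy_def)
qed

text \<open>
  A bond of the grid is a cell of the torus, so the Dirichlet form of \<open>a\<close> with the grid values of a
  function on the torus is an integral of derivatives. The function need not be adapted to this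
  grid: that is what allows the flows of two different grids to be tested against each other.
\<close>

lemma energy_integral:
  assumes N: "N \<ge> 3" and \<psi>: "integrable Leb \<psi>"
    and \<phi>: "\<And>x. x < N \<Longrightarrow> \<phi> (site_succ N x) - \<phi> x = (\<integral>y. indicator {real x / real N ..< (real x + 1) / real N} y * \<psi> y \<partial>Leb)"
  shows "energy N a \<phi> = (\<integral>y. grad N a y * \<psi> y \<partial>Leb)"
proof -
  let ?J = "\<lambda>x. {real x / real N ..< (real x + 1) / real N}"
  have "(\<integral>y. grad N a y * \<psi> y \<partial>Leb) = (\<integral>y. (\<Sum>x<N. real N * (a (site_succ N x) - a x) * (indicator (?J x) y * \<psi> y)) \<partial>Leb)"
  proof (rule Bochner_Integration.integral_cong[OF refl])
    fix y assume "y \<in> space Leb"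
    then have "y \<in> {0..<1}" by (simp add: torus_measureD[OF torus_Leb])
    from cell_decomposition[OF _ this, of N "\<lambda>x. real N * (a (site_succ N x) - a x)"] N
    have g: "grad N a y = (\<Sum>x<N. indicator (?J x) y * (real N * (a (site_succ N x) - a x)))" by (simp only: grad_def)
    show "grad N a y * \<psi> y = (\<Sum>x<N. real N * (a (site_succ N x) - a x) * (indicator (?J x) y * \<psi> y))"
      unfolding g sum_distrib_right by (simp only: mult_ac)
  qed
  also have "\<dots> = (\<Sum>x<N. real N * (a (site_succ N x) - a x) * (\<integral>y. indicator (?J x) y * \<psi> y \<partial>Leb))"
  proof (subst Bochner_Integration.integral_sum)
    fix x assume "x \<in> {..<N}"
    then have "?J x \<in> sets Leb" using torus_sets[OF torus_Leb _ cell_subset] by auto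
    then show "integrable Leb (\<lambda>y. real N * (a (site_succ N x) - a x) * (indicator (?J x) y * \<psi> y))"
      using integrable_mult_indicator[OF _ \<psi>] by (intro integrable_mult_right) simp
  qed simp
  also have "\<dots> = (\<Sum>x<N. real N * (a (site_succ N x) - a x) * (\<phi> (site_succ N x) - \<phi> x))"
    using \<phi> by (intro sum.cong refl) auto
  also have "\<dots> = energy N a \<phi>"
    unfolding energy_succ[OF N] sum_distrib_left by (simp add: mult_ac)
  finally show ?thesis by simp
qed

lemma energy_interp:
  assumes N: "N \<ge> 3" and M: "M \<ge> 1"
  shows "energy N a (\<lambda>x. interp M b (real x / real N)) = (\<integral>y. grad N a y * grad M b y \<partial>Leb)"
proof (rule energy_integral[OF N grad_integrable[OF M]])
  fix x assume x: "x < N"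
  have e: "interp M b (real (site_succ N x) / real N) = interp M b ((real x + 1) / real N)"
  proof (cases "x + 1 = N")
    case True
    then have "site_succ N x = 0" "(real x + 1) / real N = 0 + 1" using N by (auto simp: site_succ_def field_simps)
    then show ?thesis using interp_periodic[of M b] by (simp only: torus_fun_def) simp
  next
    case False
    then have "site_succ N x = x + 1" using x by (simp add: site_succ_def)
    then show ?thesis by (simp add: add.commute)
  qed
  show "interp M b (real (site_succ N x) / real N) - interp M b (real x / real N)
      = (\<integral>y. indicator {real x / real N ..< (real x + 1) / real N} y * grad M b y \<partial>Leb)"
    unfolding e using x by (intro interp_integral[OF M]) (auto simp: field_simps)
qed

lemma energy_grad:
  assumes N: "N \<ge> 3" shows "energy N a b = (\<integral>y. grad N a y * grad N b y \<partial>Leb)"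
proof -
  have "energy N a b = energy N a (\<lambda>x. interp N b (real x / real N))"
    unfolding energy_succ[OF N]
    using bij_betwE[OF bij_succ[of N]] N by (intro arg_cong2[where f="(*)"] sum.cong refl) (auto simp: interp_grid)
  then show ?thesis using energy_interp[OF N, of N a b] N by simp
qed

lemma grad_prod_integrable:
  assumes "N \<ge> 1" "M \<ge> 1" shows "integrable Leb (\<lambda>y. grad N a y * grad M b y)"
proof -
  obtain C where C: "\<And>y. y \<in> {0..<1} \<Longrightarrow> \<bar>grad N a y\<bar> \<le> C" "C \<ge> 0" using grad_bound[OF assms(1)] by blast
  obtain D where D: "\<And>y. y \<in> {0..<1} \<Longrightarrow> \<bar>grad M b y\<bar> \<le> D" "D \<ge> 0" using grad_bound[OF assms(2)] by blast
  show ?thesis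
    by (rule torus_integrable[OF torus_Leb, where C="C * D"]) (use C D in \<open>auto simp: abs_mult intro!: mult_mono\<close>)
qed

text \<open>
  Cauchy-Schwarz for the increment written as an integral of the gradient.
\<close>

lemma interp_holder:
  assumes N: "N \<ge> 3" and uv: "u \<in> {0..1}" "v \<in> {0..1}"
  shows "\<bar>interp N a v - interp N a u\<bar> \<le> sqrt (energy N a a * \<bar>v - u\<bar>)"
proof -
  have key: "\<bar>interp N a v - interp N a u\<bar> \<le> sqrt (energy N a a * \<bar>v - u\<bar>)" if uv: "0 \<le> u" "u \<le> v" "v \<le> 1" for u v
  proof -
    have m: "(\<lambda>y. indicator {u..<v} y :: real) \<in> borel_measurable Leb" "grad N a \<in> borel_measurable Leb"
      by (intro torus_measurable[OF torus_Leb]; simp)+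
    have i2: "integrable Leb (\<lambda>y. (indicator {u..<v} y :: real)\<^sup>2)"
      by (rule torus_integrable[OF torus_Leb, of _ 1]) (auto simp: indicator_def)
    have g2: "integrable Leb (\<lambda>y. (grad N a y)\<^sup>2)"
      using grad_prod_integrable[of N N a a] N by (simp add: power2_eq_square)
    have "(\<integral>y. (indicator {u..<v} y :: real)\<^sup>2 \<partial>Leb) = (\<integral>y. indicator {u..<v} y \<partial>lborel)"
      unfolding integral_Leb using uv by (intro Bochner_Integration.integral_cong) (auto simp: indicator_def)
    also have "\<dots> = v - u" using uv by simp
    finally have i: "(\<integral>y. (indicator {u..<v} y :: real)\<^sup>2 \<partial>Leb) = v - u" .
    have "\<bar>interp N a v - interp N a u\<bar> = \<bar>\<integral>y. indicator {u..<v} y * grad N a y \<partial>Leb\<bar>"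
      using interp_integral[of N u v a] N uv by simp
    also have "\<dots> \<le> sqrt (v - u) * sqrt (energy N a a)"
      using Cauchy_Schwarz_integral(2)[OF m i2 g2] unfolding i by (simp add: energy_grad[OF N] power2_eq_square)
    also have "\<dots> = sqrt (energy N a a * \<bar>v - u\<bar>)" using uv by (simp add: real_sqrt_mult mult.commute)
    finally show ?thesis .
  qed
  show ?thesis using key[of u v] key[of v u] uv by (cases "u \<le> v") (auto simp: abs_minus_commute)
qed

lemma interp_cell_osc:
  assumes N: "N \<ge> 3" and M: "M \<ge> 1" and y: "y \<in> {0..<1}"
  shows "\<bar>interp N a y - interp N a (real (idx M y) / real M)\<bar> \<le> sqrt (energy N a a / real M)"
proof -
  have b: "real (idx M y) / real M \<le> y" "y < (real (idx M y) + 1) / real M" using idx_bounds[OF M y] by auto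
  then have "\<bar>y - real (idx M y) / real M\<bar> \<le> 1 / real M" using M by (simp add: add_divide_distrib)
  have e0: "energy N a a \<ge> 0" unfolding energy_def power2_eq_square[symmetric] by (intro mult_nonneg_nonneg sum_nonneg) auto
  have "\<bar>interp N a y - interp N a (real (idx M y) / real M)\<bar> \<le> sqrt (energy N a a * \<bar>y - real (idx M y) / real M\<bar>)"
    using b y by (intro interp_holder[OF N]) auto
  also have "\<dots> \<le> sqrt (energy N a a * (1 / real M))"
    using \<open>\<bar>_\<bar> \<le> 1 / real M\<close> e0 by (intro real_sqrt_le_mono mult_left_mono) auto
  finally show ?thesis by simp
qed

section \<open>Comparison of the flows on two grids\<close>

lemma interp_deriv:
  assumes N: "N \<ge> 1" and a: "\<And>x. x < N \<Longrightarrow> ((\<lambda>s. a s x) has_real_derivative a' x) F" and F: "F = at t within S"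
  shows "((\<lambda>s. interp N (a s) y) has_real_derivative interp N a' y) F"
proof -
  have ub: "nat (j mod int N) < N" for j using N by (simp add: nat_less_iff)
  show ?thesis
    unfolding interp_def Let_def F
    by (intro DERIV_add DERIV_cmult DERIV_diff) (use a ub in \<open>auto simp: F\<close>)
qed

context flow begin

definition cum :: "real \<Rightarrow> nat \<Rightarrow> real" where "cum t x = integral {0..t} (\<lambda>s. f s x)"

lemma cum_0[simp]: "cum 0 x = 0" by (simp add: cum_def)

lemma cont: "x < N \<Longrightarrow> continuous_on {0..} (\<lambda>s. f s x)"
  by (rule DERIV_continuous_on[OF deriv]) auto

lemma cum_deriv:
  assumes "t \<ge> 0" "x < N" shows "((\<lambda>s. cum s x) has_real_derivative f t x) (at t within {0..})"
proof -
  have "((\<lambda>s. cum s x) has_real_derivative f t x) (at t within {0..t+1})"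
    unfolding cum_def using assms continuous_on_subset[OF cont[OF assms(2)]]
    by (intro integral_has_real_derivative) auto
  moreover have "at t within {0..t+1} = at t within {0..}"
    by (rule at_within_nhd[of _ "{..<t+1}"]) (use assms in auto)
  ultimately show ?thesis by simp
qed

text \<open>
  The heat equation integrated in time. It replaces the time derivative of \<open>f\<close>, for which no bound
  up to time \<open>0\<close> is available.
\<close>

lemma lap_cum:
  assumes "t \<ge> 0" "x < N" shows "lap W N (cum t) x = f t x - f 0 x"
proof -
  let ?P = "\<lambda>s. f s x - lap W N (cum s) x"
  have d: "((\<lambda>s. lap W N (cum s) x) has_real_derivative lap W N (f t) x) (at t within {0..})" if "t \<ge> 0" for t
    by (subst (1 2) lap_def) (intro DERIV_cmult DERIV_sum DERIV_diff cum_deriv, use that assms in \<open>auto dest: nbrs_less\<close>)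
  have e: "(?P has_real_derivative 0) (at t within {0..})" if "t \<ge> 0" for t
    using DERIV_diff[OF deriv[OF that assms(2)] d[OF that]] by simp
  have "?P t \<le> ?P 0" by (rule half_line_nonincreasing[OF e]) (use assms in auto)
  moreover have "- ?P t \<le> - ?P 0"
    by (rule half_line_nonincreasing[where P'="\<lambda>_. 0"]) (use assms DERIV_minus[OF e] in auto)
  moreover have "lap W N (cum 0) x = 0" by (simp add: lap_def)
  ultimately show ?thesis by simp
qed

lemma diss_le: "t > 0 \<Longrightarrow> diss t \<le> C\<^sup>2 * m / t"
  using diss_bound[of t] by (simp add: field_simps)

lemma C_nonneg: "C \<ge> 0" using bound[of 0 0] by simp

end

text \<open>
  Two flows on different grids that sample the same initial function; \<open>\<omega>\<close> bounds the oscillation of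
  that function on the cells.
\<close>

locale two_flows = A: flow W N a C m + B: flow W M b C m for W N M a b C m +
  fixes u0 :: "real \<Rightarrow> real" and \<omega> :: real
  assumes W: "torus_measure W" and N: "N \<ge> 3" and M: "M \<ge> 3"
    and a0: "\<And>x. x < N \<Longrightarrow> a 0 x = u0 (real x / real N)"
    and b0: "\<And>x. x < M \<Longrightarrow> b 0 x = u0 (real x / real M)"
    and u0: "\<And>y. \<bar>u0 y\<bar> \<le> C"
    and osc_N: "\<And>y. y \<in> {0..<1} \<Longrightarrow> \<bar>u0 (real (idx N y) / real N) - u0 y\<bar> \<le> \<omega>"
    and osc_M: "\<And>y. y \<in> {0..<1} \<Longrightarrow> \<bar>u0 (real (idx M y) / real M) - u0 y\<bar> \<le> \<omega>"
    and u0_meas[measurable]: "u0 \<in> borel_measurable borel"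
begin

lemma N1: "N \<ge> 1" "M \<ge> 1" using N M by auto

definition w :: "real \<Rightarrow> real \<Rightarrow> real" where "w t y = interp N (a t) y - interp M (b t) y"

text \<open>
  The mixed Dirichlet form of functions that live on different grids.
\<close>

definition cross :: "(nat \<Rightarrow> real) \<Rightarrow> (nat \<Rightarrow> real) \<Rightarrow> real" where
  "cross p q = (\<integral>y. grad N p y * grad M q y \<partial>Leb)"

lemma w_measurable[measurable]: "w t \<in> borel_measurable borel"
  unfolding w_def[abs_def] using N1 by measurable

lemma interp_a: "\<bar>interp N (a t) y\<bar> \<le> C" by (rule interp_bound[OF N1(1)]) (rule A.bound)
lemma interp_b: "\<bar>interp M (b t) y\<bar> \<le> C" by (rule interp_bound[OF N1(2)]) (rule B.bound)

lemma w_bound: "\<bar>w t y\<bar> \<le> 2 * C"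
  using interp_a[of t y] interp_b[of t y] by (simp add: w_def)

lemma energy_w_N: "energy N (\<lambda>x. w t (real x / real N)) p = energy N (a t) p - cross p (b t)"
proof -
  have "energy N (\<lambda>x. w t (real x / real N)) p = energy N (\<lambda>x. a t x - interp M (b t) (real x / real N)) p"
    by (rule energy_cong) (auto simp: w_def interp_grid)
  also have "\<dots> = energy N (a t) p - energy N p (\<lambda>x. interp M (b t) (real x / real N))"
    by (simp add: energy_diff energy_commute)
  finally show ?thesis using energy_interp[OF N N1(2)] by (simp add: cross_def)
qed

lemma energy_w_M: "energy M (\<lambda>x. w t (real x / real M)) q = cross (a t) q - energy M (b t) q"
proof -
  have "energy M (\<lambda>x. w t (real x / real M)) q = energy M (\<lambda>x. interp N (a t) (real x / real M) - b t x) q"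
    by (rule energy_cong) (auto simp: w_def interp_grid)
  also have "\<dots> = energy M q (\<lambda>x. interp N (a t) (real x / real M)) - energy M (b t) q"
    by (simp add: energy_diff energy_commute)
  finally show ?thesis using energy_interp[OF M N1(1)] by (simp add: cross_def mult.commute)
qed

lemma grad_diff_sq:
  "(\<integral>y. (grad N p y - grad M q y)\<^sup>2 \<partial>Leb) = energy N p p + energy M q q - 2 * cross p q"
proof -
  note i = grad_prod_integrable[OF N1(1) N1(1), of p p] grad_prod_integrable[OF N1(2) N1(2), of q q]
    grad_prod_integrable[OF N1, of p q]
  have "(\<integral>y. (grad N p y - grad M q y)\<^sup>2 \<partial>Leb)
      = (\<integral>y. grad N p y * grad N p y + grad M q y * grad M q y - 2 * (grad N p y * grad M q y) \<partial>Leb)"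
    by (intro Bochner_Integration.integral_cong refl) (simp add: power2_eq_square algebra_simps)
  then show ?thesis using i by (simp add: energy_grad[OF N] energy_grad[OF M] cross_def)
qed

text \<open>
  The squared \<open>L\<^sup>2\<close> distance of the gradients of the two primitives, see \<open>grad_diff_sq\<close>; \<open>Z'\<close> is its
  derivative.
\<close>

definition Z :: "real \<Rightarrow> real" where
  "Z t = energy N (A.cum t) (A.cum t) + energy M (B.cum t) (B.cum t) - 2 * cross (A.cum t) (B.cum t)"

definition Z' :: "real \<Rightarrow> real" where
  "Z' t = 2 * (energy N (a t) (A.cum t) + energy M (b t) (B.cum t) - cross (a t) (B.cum t) - cross (A.cum t) (b t))"

lemma Z_nonneg: "Z t \<ge> 0" unfolding Z_def grad_diff_sq[symmetric] by simp

lemma Z_0: "Z 0 = 0" unfolding Z_def grad_diff_sq[symmetric] by (simp add: grad_def)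

lemma Z_deriv:
  assumes t: "t \<ge> 0" shows "(Z has_real_derivative Z' t) (at t within {0..})"
proof -
  have c: "cross p q = energy N p (\<lambda>x. interp M q (real x / real N))" for p q
    using energy_interp[OF N N1(2)] by (simp add: cross_def)
  note e = energy_deriv[OF _ _ refl]
  have 1: "((\<lambda>s. energy N (A.cum s) (A.cum s)) has_real_derivative 2 * energy N (a t) (A.cum t)) (at t within {0..})"
    using e[of N A.cum "a t" t "{0..}" A.cum "a t"] A.cum_deriv[OF t] by (simp add: energy_commute[of N "A.cum t"])
  have 2: "((\<lambda>s. energy M (B.cum s) (B.cum s)) has_real_derivative 2 * energy M (b t) (B.cum t)) (at t within {0..})"
    using e[of M B.cum "b t" t "{0..}" B.cum "b t"] B.cum_deriv[OF t] by (simp add: energy_commute[of M "B.cum t"])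
  have 3: "((\<lambda>s. cross (A.cum s) (B.cum s)) has_real_derivative cross (a t) (B.cum t) + cross (A.cum t) (b t)) (at t within {0..})"
    unfolding c by (rule e) (auto intro!: A.cum_deriv interp_deriv[OF N1(2) _ refl] B.cum_deriv t)
  show ?thesis unfolding Z_def[abs_def] Z'_def
    using DERIV_diff[OF DERIV_add[OF 1 2] DERIV_cmult[OF 3, of 2]] by (simp add: algebra_simps)
qed

definition F :: "real \<Rightarrow> real" where "F t = (\<integral>y. (w t y)\<^sup>2 \<partial>W)"

text \<open>
  The error of replacing a point by the corner of its cell: both interpolations oscillate on cells by
  at most a Hoelder bound, the initial function by \<open>\<omega>\<close>.
\<close>

definition err :: "real \<Rightarrow> real" where
  "err t = 2 * C * (3 * sqrt (C\<^sup>2 * m / t) * (1 / sqrt N + 1 / sqrt M) + 2 * \<omega>)"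

lemma osc_a:
  assumes t: "t > 0" and K: "K \<ge> 1" and y: "y \<in> {0..<1}"
  shows "\<bar>interp N (a t) (real (idx K y) / real K) - interp N (a t) y\<bar> \<le> sqrt (C\<^sup>2 * m / t) * (1 / sqrt K)"
proof -
  have "\<bar>interp N (a t) (real (idx K y) / real K) - interp N (a t) y\<bar> \<le> sqrt (A.diss t / real K)"
    using interp_cell_osc[OF N K y, of "a t"] by (simp add: A.diss_def abs_minus_commute)
  also have "\<dots> \<le> sqrt (C\<^sup>2 * m / t / real K)"
    using A.diss_le[OF t] K by (intro real_sqrt_le_mono divide_right_mono) auto
  finally show ?thesis by (simp add: real_sqrt_divide real_sqrt_mult)
qed

end

lemma (in two_flows) two_flows_swap: "two_flows W M N b a C m u0 \<omega>"
  by unfold_locales (use W N M a0 b0 u0 osc_N osc_M in auto)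

context two_flows begin

lemma osc_b:
  assumes t: "t > 0" and K: "K \<ge> 1" and y: "y \<in> {0..<1}"
  shows "\<bar>interp M (b t) (real (idx K y) / real K) - interp M (b t) y\<bar> \<le> sqrt (C\<^sup>2 * m / t) * (1 / sqrt K)"
proof -
  interpret S: two_flows W M N b a C m u0 \<omega> by (rule two_flows_swap)
  show ?thesis using S.osc_a[OF assms] .
qed

text \<open>
  On each grid the increment of the flow since time \<open>0\<close> is \<open>lap\<close> of its primitive, and summation
  by parts against \<open>w\<close> turns it into an energy. The two initial values cancel up to \<open>\<omega>\<close>, and the
  four energies that remain add up to \<open>- Z' t / 4\<close>. The price is that \<open>w\<close> has to be evaluated at the
  corner of a cell of either grid.
\<close>

lemma F_le:
  assumes t: "t > 0" shows "F t \<le> - Z' t / 4 + m * err t"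
proof -
  interpret finite_measure W by (rule torus_measureD(1)[OF W])
  define \<kappa> where "\<kappa> = sqrt (C\<^sup>2 * m / t)"
  have \<kappa>: "\<kappa> \<ge> 0" using A.mass_nonneg t by (simp add: \<kappa>_def)
  have C: "C \<ge> 0" by (rule A.C_nonneg)
  let ?p = "\<lambda>y. real (idx N y) / real N" and ?q = "\<lambda>y. real (idx M y) / real M"
  let ?P = "interp N (a t)" and ?R = "interp M (b t)"
  let ?G1 = "\<lambda>y. w t (?p y) * (a t (idx N y) - a 0 (idx N y))"
  let ?G2 = "\<lambda>y. w t (?q y) * (b t (idx M y) - b 0 (idx M y))"
  have s1: "(\<integral>y. ?G1 y \<partial>W) = - energy N (\<lambda>x. w t (real x / real N)) (A.cum t) / 2"
  proof -
    have "(\<integral>y. ?G1 y \<partial>W) = (\<Sum>x<N. cell W N x * (w t (real x / real N) * (a t x - a 0 x)))"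
      by (rule integral_idx[OF W N1(1), of "\<lambda>x. w t (real x / real N) * (a t x - a 0 x)"])
    also have "\<dots> = (\<Sum>x<N. cell W N x * (w t (real x / real N) * lap W N (A.cum t) x))"
      using A.lap_cum[of t] t by (intro sum.cong refl) simp
    finally show ?thesis using lap_energy[OF A.cell, of "\<lambda>x. w t (real x / real N)" "A.cum t"] by simp
  qed
  have s2: "(\<integral>y. ?G2 y \<partial>W) = - energy M (\<lambda>x. w t (real x / real M)) (B.cum t) / 2"
  proof -
    have "(\<integral>y. ?G2 y \<partial>W) = (\<Sum>x<M. cell W M x * (w t (real x / real M) * (b t x - b 0 x)))"
      by (rule integral_idx[OF W N1(2), of "\<lambda>x. w t (real x / real M) * (b t x - b 0 x)"])
    also have "\<dots> = (\<Sum>x<M. cell W M x * (w t (real x / real M) * lap W M (B.cum t) x))"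
      using B.lap_cum[of t] t by (intro sum.cong refl) simp
    finally show ?thesis using lap_energy[OF B.cell, of "\<lambda>x. w t (real x / real M)" "B.cum t"] by simp
  qed
  have bd: "\<bar>w t z * (q - q')\<bar> \<le> 2 * C * (2 * C)" if "\<bar>q\<bar> \<le> C" "\<bar>q'\<bar> \<le> C" for z q q'
    unfolding abs_mult using w_bound[of t z] that C by (intro mult_mono) auto
  have i1: "integrable W ?G1"
    by (rule torus_integrable[OF W idx_measurable, where C="2 * C * (2 * C)"]) (use bd A.bound in auto)
  have i2: "integrable W ?G2"
    by (rule torus_integrable[OF W idx_measurable, where C="2 * C * (2 * C)"]) (use bd B.bound in auto)
  have pt: "(w t y)\<^sup>2 \<le> ?G1 y - ?G2 y + err t" if y: "y \<in> {0..<1}" for y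
  proof -
    have mult2: "\<bar>p * q - p' * q'\<bar> \<le> 2 * C * (\<bar>p - p'\<bar> + \<bar>q - q'\<bar>)" if "\<bar>p\<bar> \<le> 2 * C" "\<bar>q'\<bar> \<le> 2 * C" for p q p' q' :: real
    proof -
      have "p * q - p' * q' = p * (q - q') + q' * (p - p')" by (simp add: algebra_simps)
      also have "\<bar>\<dots>\<bar> \<le> \<bar>p\<bar> * \<bar>q - q'\<bar> + \<bar>q'\<bar> * \<bar>p - p'\<bar>" by (metis abs_mult abs_triangle_ineq)
      also have "\<dots> \<le> 2 * C * \<bar>q - q'\<bar> + 2 * C * \<bar>p - p'\<bar>" using that by (intro add_mono mult_right_mono) auto
      finally show ?thesis by (simp add: algebra_simps)
    qed
    \<comment> \<open>Two oscillations of interpolations in the first factor, one in the second, and that of \<open>u0\<close>.\<close>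
    have e1: "\<bar>w t y * (?P y - u0 y) - ?G1 y\<bar> \<le> 2 * C * (3 * \<kappa> * (1 / sqrt N) + \<omega>)"
    proof -
      have i: "idx N y < N" using idx_less[OF N1(1) y] .
      have "\<bar>w t y - w t (?p y)\<bar> \<le> 2 * (\<kappa> * (1 / sqrt N))"
        using osc_a[OF t N1(1) y] osc_b[OF t N1(1) y] unfolding w_def \<kappa>_def by linarith
      moreover have "\<bar>(?P y - u0 y) - (a t (idx N y) - a 0 (idx N y))\<bar> \<le> \<kappa> * (1 / sqrt N) + \<omega>"
        using osc_a[OF t N1(1) y] osc_N[OF y] a0[OF i] interp_grid[OF i, of "a t"] unfolding \<kappa>_def by linarith
      ultimately have s: "\<bar>w t y - w t (?p y)\<bar> + \<bar>(?P y - u0 y) - (a t (idx N y) - a 0 (idx N y))\<bar> \<le> 3 * \<kappa> * (1 / sqrt N) + \<omega>"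
        by linarith
      have "\<bar>w t y * (?P y - u0 y) - ?G1 y\<bar> \<le> 2 * C * (\<bar>w t y - w t (?p y)\<bar> + \<bar>(?P y - u0 y) - (a t (idx N y) - a 0 (idx N y))\<bar>)"
        using A.bound[of t "idx N y"] A.bound[of 0 "idx N y"] by (intro mult2 w_bound) linarith
      also have "\<dots> \<le> 2 * C * (3 * \<kappa> * (1 / sqrt N) + \<omega>)" using s C by (intro mult_left_mono) auto
      finally show ?thesis .
    qed
    have e2: "\<bar>w t y * (?R y - u0 y) - ?G2 y\<bar> \<le> 2 * C * (3 * \<kappa> * (1 / sqrt M) + \<omega>)"
    proof -
      have i: "idx M y < M" using idx_less[OF N1(2) y] .
      have "\<bar>w t y - w t (?q y)\<bar> \<le> 2 * (\<kappa> * (1 / sqrt M))"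
        using osc_a[OF t N1(2) y] osc_b[OF t N1(2) y] unfolding w_def \<kappa>_def by linarith
      moreover have "\<bar>(?R y - u0 y) - (b t (idx M y) - b 0 (idx M y))\<bar> \<le> \<kappa> * (1 / sqrt M) + \<omega>"
        using osc_b[OF t N1(2) y] osc_M[OF y] b0[OF i] interp_grid[OF i, of "b t"] unfolding \<kappa>_def by linarith
      ultimately have s: "\<bar>w t y - w t (?q y)\<bar> + \<bar>(?R y - u0 y) - (b t (idx M y) - b 0 (idx M y))\<bar> \<le> 3 * \<kappa> * (1 / sqrt M) + \<omega>"
        by linarith
      have "\<bar>w t y * (?R y - u0 y) - ?G2 y\<bar> \<le> 2 * C * (\<bar>w t y - w t (?q y)\<bar> + \<bar>(?R y - u0 y) - (b t (idx M y) - b 0 (idx M y))\<bar>)"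
        using B.bound[of t "idx M y"] B.bound[of 0 "idx M y"] by (intro mult2 w_bound) linarith
      also have "\<dots> \<le> 2 * C * (3 * \<kappa> * (1 / sqrt M) + \<omega>)" using s C by (intro mult_left_mono) auto
      finally show ?thesis .
    qed
    have "(w t y)\<^sup>2 = w t y * (?P y - u0 y) - w t y * (?R y - u0 y)"
      by (simp add: w_def power2_eq_square algebra_simps)
    moreover have "err t = 2 * C * (3 * \<kappa> * (1 / sqrt N) + \<omega>) + 2 * C * (3 * \<kappa> * (1 / sqrt M) + \<omega>)"
      by (simp add: err_def \<kappa>_def algebra_simps)
    ultimately show ?thesis using e1 e2 by linarith
  qed
  have "F t \<le> (\<integral>y. ?G1 y - ?G2 y + err t \<partial>W)"
    unfolding F_def
  proof (rule integral_mono)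
    have "\<bar>(w t y)\<^sup>2\<bar> \<le> (2 * C)\<^sup>2" for y
      using power_mono[OF w_bound abs_ge_zero, of t y 2] by simp
    then show "integrable W (\<lambda>y. (w t y)\<^sup>2)" by (intro torus_integrable[OF W]) auto
  qed (use i1 i2 pt torus_measureD[OF W] in auto)
  also have "\<dots> = (\<integral>y. ?G1 y \<partial>W) - (\<integral>y. ?G2 y \<partial>W) + m * err t"
    using i1 i2 sum_cell[OF W N1(1)] by (simp add: torus_measureD[OF W] A.mass)
  also have "\<dots> = - Z' t / 4 + m * err t"
    unfolding s1 s2 energy_w_N energy_w_M Z'_def by (simp add: energy_commute field_simps)
  finally show ?thesis .
qed

text \<open>
  The primitive of \<open>m * err\<close>, which is integrable at \<open>0\<close> since \<open>err\<close> behaves as \<open>1 / sqrt t\<close>.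
\<close>

definition Err :: "real \<Rightarrow> real" where
  "Err t = 2 * C * m * (6 * sqrt (C\<^sup>2 * m) * sqrt t * (1 / sqrt N + 1 / sqrt M) + 2 * \<omega> * t)"

text \<open>
  Integrate \<open>F_le\<close>: the function \<open>Z\<close> vanishes at \<open>0\<close> and is nonnegative at \<open>s + h\<close>.
\<close>

lemma F_average:
  assumes s: "s \<ge> 0" and h: "h > 0" and F: "\<And>r. r \<in> {s..s+h} \<Longrightarrow> \<kappa> \<le> F r"
  shows "\<kappa> * h \<le> Err (s + h)"
proof -
  define P where "P t = Z t / 4 - Err t" for t
  have d: "(P has_real_derivative Z' t / 4 - m * err t) (at t)" if "t > 0" for t
  proof -
    have "(Z has_real_derivative Z' t) (at t)"
      using Z_deriv[of t] that by (simp add: at_within_interior[of t "{0..}"] interior_Ici)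
    moreover have "(Err has_real_derivative m * err t) (at t)"
    proof -
      have g: "((\<lambda>t. 2 * C * m * (6 * k * sqrt t * e + 2 * \<omega> * t)) has_real_derivative
          2 * C * m * (6 * k * (inverse (sqrt t) / 2) * e + 2 * \<omega>)) (at t)" for k e
        using that by (auto intro!: derivative_eq_intros)
      have e: "m * err t = 2 * C * m * (6 * sqrt (C\<^sup>2 * m) * (inverse (sqrt t) / 2) * (1 / sqrt N + 1 / sqrt M) + 2 * \<omega>)"
        unfolding err_def real_sqrt_divide by (simp only: divide_inverse mult_ac) simp
      show ?thesis unfolding Err_def[abs_def] e
        using g[of "sqrt (C\<^sup>2 * m)" "1 / sqrt (real N) + 1 / sqrt (real M)"] .
    qed
    ultimately show ?thesis unfolding P_def[abs_def] by (intro DERIV_diff DERIV_cdivide)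
  qed
  have "continuous_on {0..} Z" by (rule DERIV_continuous_on[OF Z_deriv]) auto
  moreover have "continuous_on {0..} (\<lambda>t. k * (6 * l * sqrt t * e + 2 * \<omega> * t))" for k l e
    by (intro continuous_intros)
  ultimately have cont: "continuous_on {0..} P"
    unfolding P_def[abs_def] Err_def by (intro continuous_on_diff continuous_on_divide continuous_on_const) auto
  have F0: "F t \<ge> 0" for t unfolding F_def by simp
  have "P s \<le> P 0"
  proof (rule DERIV_nonpos_imp_decreasing_open[OF s])
    fix t assume t: "0 < t" "t < s"
    then show "\<exists>y. DERIV P t :> y \<and> y \<le> 0"
      using d[OF t(1)] F_le[OF t(1)] F0[of t] by (intro exI[of _ "Z' t / 4 - m * err t"]) auto
  next
    show "continuous_on {0..s} P" by (rule continuous_on_subset[OF cont]) auto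
  qed
  moreover have "P (s + h) + \<kappa> * (s + h) \<le> P s + \<kappa> * s"
  proof (rule DERIV_nonpos_imp_decreasing_open[of s "s + h" "\<lambda>t. P t + \<kappa> * t"])
    fix t assume t: "s < t" "t < s + h"
    then have t0: "t > 0" using s by simp
    have "DERIV (\<lambda>t. P t + \<kappa> * t) t :> Z' t / 4 - m * err t + \<kappa>"
      using d[OF t0] by (auto intro!: derivative_eq_intros)
    then show "\<exists>y. DERIV (\<lambda>t. P t + \<kappa> * t) t :> y \<and> y \<le> 0"
      using F_le[OF t0] F[of t] t by (intro exI[of _ "Z' t / 4 - m * err t + \<kappa>"]) auto
  next
    show "continuous_on {s..s+h} (\<lambda>t. P t + \<kappa> * t)"
      using s by (intro continuous_intros continuous_on_subset[OF cont]) auto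
  qed (use h in simp)
  moreover have "P 0 = 0" by (simp add: P_def Z_0 Err_def)
  moreover have "P (s + h) \<ge> - Err (s + h)" using Z_nonneg[of "s+h"] by (simp add: P_def)
  ultimately show ?thesis by (simp add: algebra_simps)
qed

text \<open>
  The interpolation differs from its value at the corner of the cell by a Hoelder bound, and the
  increments of the grid values in time are bounded through the dissipation.
\<close>

lemma time_osc_a:
  assumes s: "0 < s" "s \<le> r"
  shows "(\<integral>y. (interp N (a r) y - interp N (a s) y)\<^sup>2 \<partial>W) \<le> (r - s) * (C\<^sup>2 * m / s) + 8 * m * (C\<^sup>2 * m / s) * (1 / N)"
proof -
  interpret finite_measure W by (rule torus_measureD(1)[OF W])
  let ?k = "C\<^sup>2 * m / s"
  let ?g = "\<lambda>x. (a r x - a s x)\<^sup>2"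
  have k0: "?k \<ge> 0" using A.mass_nonneg s by simp
  have le: "(interp N (a r) y - interp N (a s) y)\<^sup>2 \<le> 2 * ?g (idx N y) + 8 * (?k * (1 / N))" if y: "y \<in> {0..<1}" for y
  proof -
    let ?d = "(interp N (a r) y - interp N (a s) y) - (a r (idx N y) - a s (idx N y))"
    have i: "idx N y < N" using idx_less[OF N1(1) y] .
    have "sqrt (C\<^sup>2 * m / r) \<le> sqrt ?k"
      using s A.mass_nonneg by (intro real_sqrt_le_mono divide_left_mono) auto
    then have "sqrt (C\<^sup>2 * m / r) * (1 / sqrt N) \<le> sqrt ?k * (1 / sqrt N)"
      by (intro mult_right_mono) auto
    then have "\<bar>?d\<bar> \<le> 2 * (sqrt ?k * (1 / sqrt N))"
      using osc_a[OF _ N1(1) y, of r] osc_a[OF s(1) N1(1) y] s unfolding interp_grid[OF i] by linarith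
    then have "\<bar>?d\<bar>\<^sup>2 \<le> (2 * (sqrt ?k * (1 / sqrt N)))\<^sup>2" by (intro power_mono) auto
    also have "\<dots> = 4 * (?k * (1 / N))" unfolding power_mult_distrib power_divide using k0 by simp
    finally have "?d\<^sup>2 \<le> 4 * (?k * (1 / N))" by simp
    moreover have "(p)\<^sup>2 \<le> 2 * q\<^sup>2 + 2 * (p - q)\<^sup>2" for p q :: real
      using zero_le_power2[of "p - 2 * q"] unfolding power2_eq_square by (simp add: algebra_simps)
    ultimately show ?thesis by (smt (verit))
  qed
  have "(\<integral>y. (interp N (a r) y - interp N (a s) y)\<^sup>2 \<partial>W) \<le> (\<integral>y. 2 * ?g (idx N y) + 8 * (?k * (1 / N)) \<partial>W)"
  proof (rule integral_mono)
    have "\<bar>(interp N (a r) y - interp N (a s) y)\<^sup>2\<bar> \<le> (2 * C)\<^sup>2" for y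
      using power_mono[of "\<bar>interp N (a r) y - interp N (a s) y\<bar>" "2 * C" 2]
        interp_a[of r y] interp_a[of s y] by simp
    then show "integrable W (\<lambda>y. (interp N (a r) y - interp N (a s) y)\<^sup>2)"
      using N1 by (intro torus_integrable[OF W]) auto
    have "\<bar>?g x\<bar> \<le> (2 * C)\<^sup>2" for x
      using power_mono[of "\<bar>a r x - a s x\<bar>" "2 * C" 2] A.bound[of r x] A.bound[of s x] by simp
    then show "integrable W (\<lambda>y. 2 * ?g (idx N y) + 8 * (?k * (1 / N)))"
      by (intro Bochner_Integration.integrable_add integrable_mult_right torus_integrable[OF W idx_measurable]) auto
  qed (use le torus_measureD[OF W] in auto)
  also have "\<dots> = 2 * (\<Sum>x<N. cell W N x * ?g x) + 8 * (?k * (1 / N)) * m"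
  proof -
    have "(\<integral>y. 2 * ?g (idx N y) + 8 * (?k * (1 / N)) \<partial>W) = (\<Sum>x<N. cell W N x * (2 * ?g x + 8 * (?k * (1 / N))))"
      by (rule integral_idx[OF W N1(1), of "\<lambda>x. 2 * ?g x + 8 * (?k * (1 / N))"])
    also have "\<dots> = 2 * (\<Sum>x<N. cell W N x * ?g x) + (\<Sum>x<N. cell W N x) * (8 * (?k * (1 / N)))"
      unfolding sum_distrib_left sum_distrib_right sum.distrib[symmetric] by (intro sum.cong refl) (simp only: algebra_simps)
    finally show ?thesis by (simp only: A.mass mult.commute)
  qed
  also have "2 * (\<Sum>x<N. cell W N x * ?g x) \<le> (r - s) * ?k"
  proof -
    have "2 * (\<Sum>x<N. cell W N x * ?g x) \<le> (r - s) * A.diss s" using A.increment_bound[of s r] s by simp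
    also have "\<dots> \<le> (r - s) * ?k" using A.diss_le[of s] s by (intro mult_left_mono) auto
    finally show ?thesis .
  qed
  finally show ?thesis by (simp only: mult_ac)
qed

lemma time_osc_b:
  assumes s: "0 < s" "s \<le> r"
  shows "(\<integral>y. (interp M (b r) y - interp M (b s) y)\<^sup>2 \<partial>W) \<le> (r - s) * (C\<^sup>2 * m / s) + 8 * m * (C\<^sup>2 * m / s) * (1 / M)"
proof -
  interpret S: two_flows W M N b a C m u0 \<omega> by (rule two_flows_swap)
  show ?thesis using S.time_osc_a[OF assms] .
qed

text \<open>
  The average bound provides a time \<open>r\<close> close to \<open>s\<close> at which \<open>F\<close> is small; both flows move little
  between \<open>s\<close> and \<open>r\<close>.
\<close>

lemma F_fixed_time:
  assumes s: "0 < s" and h: "h > 0" and small: "Err (s + h) < \<kappa> * h"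
  shows "F s \<le> 3 * \<kappa> + 6 * (h * (C\<^sup>2 * m / s)) + 24 * m * (C\<^sup>2 * m / s) * (1 / N + 1 / M)"
proof -
  interpret finite_measure W by (rule torus_measureD(1)[OF W])
  from small obtain r where r: "r \<in> {s..s+h}" "F r < \<kappa>"
    using F_average[of s h \<kappa>] s h by (meson linorder_not_le less_imp_le)
  let ?p = "\<lambda>y. interp N (a r) y - interp N (a s) y" and ?q = "\<lambda>y. interp M (b r) y - interp M (b s) y"
  have b2: "\<bar>x\<^sup>2\<bar> \<le> (2 * C)\<^sup>2" if "\<bar>x\<bar> \<le> 2 * C" for x using power_mono[OF that abs_ge_zero, of 2] by simp
  have i: "integrable W (\<lambda>y. (w s y)\<^sup>2)" "integrable W (\<lambda>y. (w r y)\<^sup>2)"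
    by (intro torus_integrable[OF W, where C="(2*C)\<^sup>2"] b2 w_bound; simp)+
  have ip: "integrable W (\<lambda>y. (?p y)\<^sup>2)"
    by (intro torus_integrable[OF W, where C="(2*C)\<^sup>2"] b2; insert N1 interp_a[of r] interp_a[of s]; simp; smt (verit))
  have iq: "integrable W (\<lambda>y. (?q y)\<^sup>2)"
    by (intro torus_integrable[OF W, where C="(2*C)\<^sup>2"] b2; insert N1 interp_b[of r] interp_b[of s]; simp; smt (verit))
  have "F s \<le> (\<integral>y. 3 * ((w r y)\<^sup>2 + (?p y)\<^sup>2 + (?q y)\<^sup>2) \<partial>W)"
    unfolding F_def
  proof (rule integral_mono)
    fix y
    have 3: "(x - p + q)\<^sup>2 \<le> 3 * (x\<^sup>2 + p\<^sup>2 + q\<^sup>2)" for x p q :: real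
      using zero_le_power2[of "x + p"] zero_le_power2[of "x - q"] zero_le_power2[of "p + q"]
      unfolding power2_eq_square by (simp add: algebra_simps)
    have "w s y = w r y - ?p y + ?q y" by (simp add: w_def)
    then show "(w s y)\<^sup>2 \<le> 3 * ((w r y)\<^sup>2 + (?p y)\<^sup>2 + (?q y)\<^sup>2)" using 3[of "w r y" "?p y" "?q y"] by simp
  qed (use i ip iq in auto)
  also have "\<dots> = 3 * (F r + (\<integral>y. (?p y)\<^sup>2 \<partial>W) + (\<integral>y. (?q y)\<^sup>2 \<partial>W))"
    using i ip iq by (simp add: F_def)
  finally have le: "F s \<le> 3 * (F r + (\<integral>y. (?p y)\<^sup>2 \<partial>W) + (\<integral>y. (?q y)\<^sup>2 \<partial>W))" .
  have hle: "(r - s) * (C\<^sup>2 * m / s) \<le> h * (C\<^sup>2 * m / s)"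
    using r s A.mass_nonneg by (intro mult_right_mono) auto
  have sr: "s \<le> r" using r by simp
  have comb: "f \<le> 3 * \<kappa> + 6 * q + 24 * m * k * (j + l)"
    if "f \<le> 3 * (g + i1 + i2)" "g < \<kappa>" "i1 \<le> p + 8 * m * k * j" "i2 \<le> p + 8 * m * k * l" "p \<le> q"
    for f g i1 i2 p q k j l :: real
  proof -
    have "24 * m * k * (j + l) = 3 * (8 * m * k * j) + 3 * (8 * m * k * l)" by (simp add: algebra_simps)
    then show ?thesis using that by argo
  qed
  show ?thesis by (rule comb[OF le r(2) time_osc_a[OF s sr] time_osc_b[OF s sr] hle])
qed

lemma w_holder:
  assumes s: "s > 0" and "y \<in> {0..1}" "z \<in> {0..1}"
  shows "\<bar>w s y - w s z\<bar> \<le> 2 * sqrt (C\<^sup>2 * m / s) * sqrt \<bar>y - z\<bar>"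
proof -
  have "\<bar>interp N (a s) y - interp N (a s) z\<bar> \<le> sqrt (C\<^sup>2 * m / s) * sqrt \<bar>y - z\<bar>"
    unfolding real_sqrt_mult[symmetric]
    by (rule order_trans[OF interp_holder[OF N]])
       (use assms A.diss_le[OF s, unfolded A.diss_def] in \<open>auto intro!: real_sqrt_le_mono mult_right_mono simp del: times_divide_eq_left\<close>)
  moreover have "\<bar>interp M (b s) y - interp M (b s) z\<bar> \<le> sqrt (C\<^sup>2 * m / s) * sqrt \<bar>y - z\<bar>"
    unfolding real_sqrt_mult[symmetric]
    by (rule order_trans[OF interp_holder[OF M]])
       (use assms B.diss_le[OF s, unfolded B.diss_def] in \<open>auto intro!: real_sqrt_le_mono mult_right_mono simp del: times_divide_eq_left\<close>)
  ultimately show ?thesis unfolding w_def by linarith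
qed

text \<open>
  Integrate by parts one factor of the squared gradient difference: \<open>w\<close> is small in supremum norm, and
  \<open>lap\<close> of either flow is bounded in \<open>L\<^sup>1(W)\<close> by \<open>speed_l1\<close>.
\<close>

lemma grad_dist:
  assumes s: "s > 0" and w: "\<And>y. \<bar>w s y\<bar> \<le> e"
  shows "(\<integral>y. (grad N (a s) y - grad M (b s) y)\<^sup>2 \<partial>Leb) \<le> 4 * e * (m + C\<^sup>2 * m / s\<^sup>2)"
proof -
  have e: "e \<ge> 0" using w[of 0] by simp
  have "(\<integral>y. (grad N (a s) y - grad M (b s) y)\<^sup>2 \<partial>Leb)
      = energy N (\<lambda>x. w s (real x / real N)) (a s) - energy M (\<lambda>x. w s (real x / real M)) (b s)"
    unfolding grad_diff_sq energy_w_N energy_w_M by simp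
  also have "\<dots> = - 2 * (\<Sum>x<N. cell W N x * (w s (real x / real N) * lap W N (a s) x))
      + 2 * (\<Sum>x<M. cell W M x * (w s (real x / real M) * lap W M (b s) x))"
    using lap_energy[OF A.cell, of "\<lambda>x. w s (real x / real N)" "a s"]
      lap_energy[OF B.cell, of "\<lambda>x. w s (real x / real M)" "b s"] by linarith
  also have "\<dots> \<le> 2 * (e * (m + C\<^sup>2 * m / s\<^sup>2)) + 2 * (e * (m + C\<^sup>2 * m / s\<^sup>2))"
  proof -
    have "\<bar>\<Sum>x<N. cell W N x * (w s (real x / real N) * lap W N (a s) x)\<bar> \<le> (\<Sum>x<N. e * (cell W N x * \<bar>lap W N (a s) x\<bar>))"
      using w A.cell by (intro order_trans[OF sum_abs] sum_mono) (auto simp: abs_mult mult_left_mono mult_right_mono less_imp_le intro!: mult_mono)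
    also have "\<dots> \<le> e * (m + C\<^sup>2 * m / s\<^sup>2)"
      unfolding sum_distrib_left[symmetric] using A.speed_l1[OF s] e by (intro mult_left_mono)
    finally have 1: "\<bar>\<Sum>x<N. cell W N x * (w s (real x / real N) * lap W N (a s) x)\<bar> \<le> e * (m + C\<^sup>2 * m / s\<^sup>2)" .
    have "\<bar>\<Sum>x<M. cell W M x * (w s (real x / real M) * lap W M (b s) x)\<bar> \<le> (\<Sum>x<M. e * (cell W M x * \<bar>lap W M (b s) x\<bar>))"
      using w B.cell by (intro order_trans[OF sum_abs] sum_mono) (auto simp: abs_mult mult_left_mono mult_right_mono less_imp_le intro!: mult_mono)
    also have "\<dots> \<le> e * (m + C\<^sup>2 * m / s\<^sup>2)"
      unfolding sum_distrib_left[symmetric] using B.speed_l1[OF s] e by (intro mult_left_mono)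
    finally have 2: "\<bar>\<Sum>x<M. cell W M x * (w s (real x / real M) * lap W M (b s) x)\<bar> \<le> e * (m + C\<^sup>2 * m / s\<^sup>2)" .
    have "- 2 * p + 2 * q \<le> 2 * E + 2 * E" if "\<bar>p\<bar> \<le> E" "\<bar>q\<bar> \<le> E" for p q E :: real using that by linarith
    from this[OF 1 2] show ?thesis .
  qed
  also have "\<dots> = 4 * e * (m + C\<^sup>2 * m / s\<^sup>2)" by (simp only: mult.assoc flip: distrib_right) simp
  finally show ?thesis .
qed

end

section \<open>Trigonometric approximation by powers of the cosine\<close>

lemma Leb_FTC:
  assumes F: "\<And>y. (F has_real_derivative f y) (at y)" and f: "continuous_on UNIV f"
    and uv: "0 \<le> u" "u \<le> v" "v \<le> 1"
  shows "(\<integral>y. indicator {u..<v} y * f y \<partial>Leb) = F v - F u"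
proof -
  have "(\<integral>y. indicator {u..<v} y * f y \<partial>Leb) = (\<integral>y. f y * indicator {u..v} y \<partial>lborel)"
    unfolding integral_Leb
  proof (rule integral_cong_AE)
    show "AE y in lborel. indicat_real {0..<1} y * (indicat_real {u..<v} y * f y) = f y * indicat_real {u..v} y"
      using AE_lborel_singleton[of v] by eventually_elim (use uv in \<open>auto simp: indicator_def\<close>)
    show "(\<lambda>y. indicat_real {0..<1} y * (indicat_real {u..<v} y * f y)) \<in> borel_measurable lborel"
      using borel_measurable_continuous_onI[OF f] by measurable
    show "(\<lambda>y. f y * indicat_real {u..v} y) \<in> borel_measurable lborel"
      using borel_measurable_continuous_onI[OF f] by measurable
  qed
  also have "\<dots> = F v - F u"
    using f F uv by (intro integral_FTC_Icc_real) (auto simp: continuous_on_eq_continuous_at)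
  finally show ?thesis .
qed

lemma Leb_FTC_01:
  assumes F: "\<And>y. (F has_real_derivative f y) (at y)" and f: "continuous_on UNIV f"
  shows "(\<integral>y. f y \<partial>Leb) = F 1 - F 0"
proof -
  have "(\<integral>y. f y \<partial>Leb) = (\<integral>y. indicator {0..<1} y * f y \<partial>Leb)"
    by (rule Bochner_Integration.integral_cong) (auto simp: torus_measureD[OF torus_Leb])
  then show ?thesis using Leb_FTC[OF assms, of 0 1] by simp
qed

lemma continuous_bounded_01:
  assumes "continuous_on {0..1} (f :: real \<Rightarrow> real)" obtains C where "\<And>y. y \<in> {0..1} \<Longrightarrow> \<bar>f y\<bar> \<le> C"
proof -
  have "bounded (f ` {0..1})" using assms by (intro compact_imp_bounded compact_continuous_image) auto
  then obtain a where "\<forall>x\<in>f ` {0..1}. norm x \<le> a" unfolding bounded_iff by blast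
  then show ?thesis by (intro that[of a]) auto
qed

lemma Leb_continuous_integrable:
  assumes "continuous_on UNIV f" shows "integrable Leb (f :: real \<Rightarrow> real)"
proof -
  obtain C where "\<And>y. y \<in> {0..1} \<Longrightarrow> \<bar>f y\<bar> \<le> C"
    using continuous_bounded_01[OF continuous_on_subset[OF assms]] by auto
  then show ?thesis
    by (intro torus_integrable[OF torus_Leb, where C=C] borel_measurable_continuous_onI[OF assms]) auto
qed

text \<open>
  The index \<open>k\<close> runs from \<open>0\<close> to \<open>2 n\<close>, so the frequencies run from \<open>- n\<close> to \<open>n\<close> in units of \<open>2 \<pi>\<close>.
\<close>

definition cosf :: "nat \<Rightarrow> nat \<Rightarrow> real \<Rightarrow> real" where "cosf n k x = cos (2 * pi * (real k - real n) * x)"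
definition sinf :: "nat \<Rightarrow> nat \<Rightarrow> real \<Rightarrow> real" where "sinf n k x = sin (2 * pi * (real k - real n) * x)"
text \<open>
  The Fourier coefficients of \<open>kern n\<close>; their sign is what the uniqueness proof needs.
\<close>

definition coeff_cp :: "nat \<Rightarrow> nat \<Rightarrow> real" where "coeff_cp n k = real ((2 * n) choose k) / real ((2 * n) choose n)"
text \<open>
  The de la Vallee Poussin kernel, normalized to have integral \<open>1\<close> over a period.
\<close>

definition kern :: "nat \<Rightarrow> real \<Rightarrow> real" where "kern n z = 4 ^ n / real ((2 * n) choose n) * cos (pi * z) ^ (2 * n)"

lemma coeff_cp_nonneg: "coeff_cp n k \<ge> 0" by (simp add: coeff_cp_def)

text \<open>
  The binomial expansion of \<open>(e\<^sup>i\<^sup>z + e\<^sup>-\<^sup>i\<^sup>z)\<^sup>2\<^sup>n\<close>.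
\<close>

lemma cos_power_expansion:
  "4 ^ n * cos z ^ (2 * n) = (\<Sum>k\<le>2 * n. real ((2 * n) choose k) * cos (2 * (real k - real n) * z))"
proof -
  have "complex_of_real (2 * cos z) = cis z + cis (- z)" by (simp add: complex_eq_iff)
  then have "complex_of_real ((2 * cos z) ^ (2 * n)) = (cis z + cis (- z)) ^ (2 * n)" by (metis of_real_power)
  also have "\<dots> = (\<Sum>k\<le>2 * n. of_nat ((2 * n) choose k) * cis z ^ k * cis (- z) ^ (2 * n - k))"
    by (rule binomial_ring)
  also have "\<dots> = (\<Sum>k\<le>2 * n. of_nat ((2 * n) choose k) * cis (2 * (real k - real n) * z))"
  proof (intro sum.cong refl)
    fix k assume k: "k \<in> {..2 * n}"
    have "cis z ^ k * cis (- z) ^ (2 * n - k) = cis (real k * z + real (2 * n - k) * (- z))"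
      by (simp only: Complex.DeMoivre cis_mult)
    also have "real k * z + real (2 * n - k) * (- z) = 2 * (real k - real n) * z"
      using k by (simp add: of_nat_diff algebra_simps)
    finally show "of_nat ((2 * n) choose k) * cis z ^ k * cis (- z) ^ (2 * n - k) = of_nat ((2 * n) choose k) * cis (2 * (real k - real n) * z)"
      by (simp add: mult.assoc)
  qed
  finally have "Re (complex_of_real ((2 * cos z) ^ (2 * n))) = Re (\<Sum>k\<le>2 * n. of_nat ((2 * n) choose k) * cis (2 * (real k - real n) * z))"
    by (rule arg_cong)
  then show ?thesis by (simp add: power_mult_distrib power_mult)
qed

lemma kern_nonneg: "kern n z \<ge> 0"
  by (simp add: kern_def power_mult)

lemma kern_sum: "kern n z = (\<Sum>k\<le>2 * n. real ((2 * n) choose k) * cos (2 * (real k - real n) * (pi * z))) / real ((2 * n) choose n)"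
  unfolding kern_def cos_power_expansion[symmetric] by simp

lemma kern_expansion: "kern n (x - y) = (\<Sum>k\<le>2 * n. coeff_cp n k * (cosf n k x * cosf n k y + sinf n k x * sinf n k y))"
proof -
  have "kern n (x - y) = (\<Sum>k\<le>2 * n. real ((2 * n) choose k) * cos (2 * (real k - real n) * (pi * (x - y)))) / real ((2 * n) choose n)"
    by (rule kern_sum)
  also have "\<dots> = (\<Sum>k\<le>2 * n. coeff_cp n k * (cosf n k x * cosf n k y + sinf n k x * sinf n k y))"
    unfolding sum_divide_distrib coeff_cp_def cosf_def sinf_def cos_diff[symmetric]
    by (intro sum.cong refl) (simp add: algebra_simps)
  finally show ?thesis .
qed

lemma kern_continuous: "continuous_on UNIV (\<lambda>y. kern n (x - y))"
  unfolding kern_def by (intro continuous_intros)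

lemma integral_cos_int:
  assumes "j \<noteq> 0" shows "(\<integral>y. cos (2 * pi * of_int j * (x - y)) \<partial>Leb) = 0"
proof -
  let ?w = "2 * pi * real_of_int j"
  let ?F = "\<lambda>y. - sin (?w * (x - y)) / ?w"
  have "(\<integral>y. cos (?w * (x - y)) \<partial>Leb) = ?F 1 - ?F 0"
    by (rule Leb_FTC_01) (use assms in \<open>auto intro!: derivative_eq_intros continuous_intros\<close>)
  also have "sin (?w * (x - 1)) = sin (?w * x - 2 * pi * real_of_int j)" by (simp add: algebra_simps)
  also have "\<dots> = sin (?w * x)" by (simp add: sin_diff sin_integer_2pi cos_integer_2pi)
  finally show ?thesis by simp
qed

lemma kern_integral: "(\<integral>y. kern n (x - y) \<partial>Leb) = 1"
proof -
  have i: "integrable Leb (\<lambda>y. cos (2 * (real k - real n) * (pi * (x - y))))" for k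
    by (intro Leb_continuous_integrable continuous_intros)
  have z: "(\<integral>y. cos (2 * (real k - real n) * (pi * (x - y))) \<partial>Leb) = (if k = n then 1 else 0)" for k
  proof (cases "k = n")
    case True
    then show ?thesis using sum_cell[OF torus_Leb, of 1] cell_Leb[of 0 1] by (simp add: torus_measureD[OF torus_Leb])
  next
    case False
    then have "int k - int n \<noteq> 0" by simp
    from integral_cos_int[OF this, of x] show ?thesis using False by (simp add: mult_ac)
  qed
  have "(\<integral>y. kern n (x - y) \<partial>Leb) = (\<integral>y. (\<Sum>k\<le>2 * n. real ((2 * n) choose k) * cos (2 * (real k - real n) * (pi * (x - y)))) / real ((2 * n) choose n) \<partial>Leb)"
    by (simp only: kern_sum)
  also have "\<dots> = (\<Sum>k\<le>2 * n. real ((2 * n) choose k) * (if k = n then 1 else 0)) / real ((2 * n) choose n)"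
    using i z by simp
  also have "(\<Sum>k\<le>2 * n. real ((2 * n) choose k) * (if k = n then 1 else 0)) = (\<Sum>k\<le>2 * n. if k = n then real ((2 * n) choose k) else 0)"
    by (intro sum.cong refl) auto
  also have "\<dots> = real ((2 * n) choose n)" by (subst sum.delta) auto
  finally show ?thesis by simp
qed

text \<open>
  Since \<open>sin\<^sup>2 = 1 - cos\<^sup>2\<close>, this is a difference of the masses of \<open>kern n\<close> and of a multiple of
  \<open>kern (n + 1)\<close>, given by the ratio of two central binomial coefficients. It tends to \<open>0\<close>, so
  \<open>kern n\<close> concentrates at the integers.
\<close>

lemma kern_variance: "(\<integral>y. (sin (pi * (x - y)))\<^sup>2 * kern n (x - y) \<partial>Leb) = 1 / (2 * real n + 2)"
proof -
  let ?B = "\<lambda>n. real ((2 * n) choose n)"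
  have B: "?B (Suc n) * (real n + 1) = 2 * (2 * real n + 1) * ?B n"
  proof -
    have f: "?B n = fact (2 * n) / (fact n * fact n)" for n by (simp add: binomial_fact mult_2)
    have "fact (2 * Suc n) = (2 * real n + 2) * ((2 * real n + 1) * (fact (2 * n) :: real))"
      by (simp add: algebra_simps)
    then show ?thesis unfolding f by (simp add: divide_simps) (simp add: algebra_simps)
  qed
  have pos: "?B n > 0" "?B (Suc n) > 0" by (auto simp del: binomial_Suc_Suc)
  have k: "(sin (pi * (x - y)))\<^sup>2 * kern n (x - y) = kern n (x - y) - ?B (Suc n) / (4 * ?B n) * kern (Suc n) (x - y)" for y
  proof -
    have "?B (Suc n) / (4 * ?B n) * kern (Suc n) (x - y) = (cos (pi * (x - y)))\<^sup>2 * kern n (x - y)"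
      using pos by (simp add: kern_def power2_eq_square field_simps del: binomial_Suc_Suc)
    moreover have "(sin (pi * (x - y)))\<^sup>2 * kern n (x - y) = kern n (x - y) - (cos (pi * (x - y)))\<^sup>2 * kern n (x - y)"
      unfolding sin_squared_eq by (simp add: left_diff_distrib)
    ultimately show ?thesis by (simp only:)
  qed
  have "(\<integral>y. (sin (pi * (x - y)))\<^sup>2 * kern n (x - y) \<partial>Leb) = 1 - ?B (Suc n) / (4 * ?B n)"
    unfolding k using Leb_continuous_integrable[OF kern_continuous, of _ x] by (simp add: kern_integral del: binomial_Suc_Suc)
  also have "\<dots> = 1 / (2 * real n + 2)"
  proof -
    have "?B (Suc n) = 2 * (2 * real n + 1) * ?B n / (real n + 1)" using B by (simp add: field_simps del: binomial_Suc_Suc)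
    then show ?thesis using pos(1) by (simp add: field_simps del: binomial_Suc_Suc)
  qed
  finally show ?thesis .
qed

text \<open>
  The convolution with \<open>kern n\<close>, written as a trigonometric polynomial.
\<close>

definition smooth_approx :: "nat \<Rightarrow> (real \<Rightarrow> real) \<Rightarrow> real \<Rightarrow> real" where
  "smooth_approx n f x = (\<Sum>k\<le>2 * n. coeff_cp n k * ((\<integral>y. f y * cosf n k y \<partial>Leb) * cosf n k x + (\<integral>y. f y * sinf n k y \<partial>Leb) * sinf n k x))"

lemma integrable_trig:
  assumes "integrable Leb f"
  shows "integrable Leb (\<lambda>y. f y * cosf n k y)" "integrable Leb (\<lambda>y. f y * sinf n k y)"
proof -
  have "f \<in> borel_measurable Leb" using assms by auto
  moreover have "cosf n k \<in> borel_measurable Leb" "sinf n k \<in> borel_measurable Leb"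
    unfolding cosf_def[abs_def] sinf_def[abs_def] by (intro torus_measurable[OF torus_Leb]; simp)+
  moreover have "\<bar>f y * cosf n k y\<bar> \<le> \<bar>f y\<bar> * 1" "\<bar>f y * sinf n k y\<bar> \<le> \<bar>f y\<bar> * 1" for y
    unfolding abs_mult by (intro mult_left_mono; simp add: cosf_def sinf_def)+
  ultimately show "integrable Leb (\<lambda>y. f y * cosf n k y)" "integrable Leb (\<lambda>y. f y * sinf n k y)"
    by (intro Bochner_Integration.integrable_bound[OF assms]; auto)+
qed

lemma smooth_approx_kern:
  assumes f: "integrable Leb f" shows "smooth_approx n f x = (\<integral>y. f y * kern n (x - y) \<partial>Leb)"
proof -
  have "(\<integral>y. f y * kern n (x - y) \<partial>Leb)
     = (\<integral>y. (\<Sum>k\<le>2 * n. coeff_cp n k * ((f y * cosf n k y) * cosf n k x + (f y * sinf n k y) * sinf n k x)) \<partial>Leb)"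
    unfolding kern_expansion sum_distrib_left
    by (intro Bochner_Integration.integral_cong sum.cong refl) (simp add: algebra_simps)
  also have "\<dots> = smooth_approx n f x"
    unfolding smooth_approx_def using integrable_trig[OF f] by simp
  finally show ?thesis by simp
qed

lemma torus_fun_int: "torus_fun f \<Longrightarrow> f (x + of_int k) = f x"
proof (induction k rule: int_induct[where k=0])
  case (step1 i) then show ?case by (metis add.assoc of_int_1 of_int_add torus_fun_def)
next
  case (step2 i) then show ?case by (metis add.assoc add_diff_cancel_right' diff_add_cancel of_int_1 of_int_add torus_fun_def)
qed simp

lemma torus_continuous_bounded:
  assumes "torus_continuous f" obtains C where "\<And>x. \<bar>f x\<bar> \<le> C" "C \<ge> 0"
proof -
  have c: "continuous_on UNIV f" and p: "torus_fun f" using assms by (auto simp: torus_continuous_def)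
  obtain C where C: "\<And>y. y \<in> {0..1} \<Longrightarrow> \<bar>f y\<bar> \<le> C"
    using continuous_bounded_01[OF continuous_on_subset[OF c]] by auto
  have "\<bar>f x\<bar> \<le> C" for x
    using torus_fun_int[OF p, of x "- \<lfloor>x\<rfloor>"] C[of "x - of_int \<lfloor>x\<rfloor>"] floor_correct[of x] by simp
  moreover have "C \<ge> 0" using calculation[of 0] by simp
  ultimately show ?thesis by (rule that)
qed

lemma torus_uniformly_continuous:
  assumes "torus_continuous f" "e > 0"
  obtains d where "d > 0" "\<And>x y. \<bar>x - y\<bar> < d \<Longrightarrow> \<bar>f x - f y\<bar> < e"
proof -
  have c: "continuous_on UNIV f" and p: "torus_fun f" using assms by (auto simp: torus_continuous_def)
  have "uniformly_continuous_on {-1..2} f"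
    by (intro compact_uniformly_continuous continuous_on_subset[OF c]) auto
  then obtain d where d: "d > 0" "\<And>x y. x \<in> {-1..2} \<Longrightarrow> y \<in> {-1..2} \<Longrightarrow> \<bar>x - y\<bar> < d \<Longrightarrow> \<bar>f x - f y\<bar> < e"
    using assms(2) unfolding uniformly_continuous_on_def dist_real_def by metis
  show ?thesis
  proof (rule that[of "min d 1"])
    fix x y :: real assume xy: "\<bar>x - y\<bar> < min d 1"
    have "\<bar>f (x + of_int (- \<lfloor>x\<rfloor>)) - f (y + of_int (- \<lfloor>x\<rfloor>))\<bar> < e"
    proof (rule d)
      have sh: "x + q \<in> {-1..2} \<and> y + q \<in> {-1..2} \<and> \<bar>x + q - (y + q)\<bar> < d"
        if "- q \<le> x" "x < - q + 1" for q using xy that by auto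
      have fl: "- real_of_int (- \<lfloor>x\<rfloor>) \<le> x" "x < - real_of_int (- \<lfloor>x\<rfloor>) + 1" by linarith+
      show "x + of_int (- \<lfloor>x\<rfloor>) \<in> {-1..2}" "y + of_int (- \<lfloor>x\<rfloor>) \<in> {-1..2}"
        "\<bar>x + of_int (- \<lfloor>x\<rfloor>) - (y + of_int (- \<lfloor>x\<rfloor>))\<bar> < d" using sh[OF fl] by blast+
    qed
    then show "\<bar>f x - f y\<bar> < e" by (simp only: torus_fun_int[OF p])
  qed (use d in auto)
qed

text \<open>
  The function \<open>sin\<^sup>2 (\<pi> z)\<close> is the periodic substitute for \<open>z\<^sup>2\<close>: bounded below away from the
  integers, where the boundedness of \<open>f\<close> suffices.
\<close>

lemma torus_modulus:
  assumes f: "torus_continuous f" and e: "e > 0"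
  obtains M where "M \<ge> 0" "\<And>x y. \<bar>f y - f x\<bar> \<le> e + M * (sin (pi * (x - y)))\<^sup>2"
proof -
  have p: "torus_fun f" using f by (simp add: torus_continuous_def)
  obtain d0 where d0: "d0 > 0" "\<And>x y. \<bar>x - y\<bar> < d0 \<Longrightarrow> \<bar>f x - f y\<bar> < e"
    using torus_uniformly_continuous[OF f e] by blast
  obtain C where C: "\<And>x. \<bar>f x\<bar> \<le> C" "C \<ge> 0" using torus_continuous_bounded[OF f] by blast
  define d where "d = min d0 (1/2)"
  have d: "0 < d" "d \<le> 1/2" "d \<le> d0" using d0 by (auto simp: d_def)
  have s: "sin (pi * d) > 0" using d by (intro sin_gt_zero) auto
  define M where "M = 2 * C / (sin (pi * d))\<^sup>2"
  have M: "M \<ge> 0" using C s by (simp add: M_def)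
  show ?thesis
  proof (rule that[OF M])
    fix x y :: real
    define k where "k = round (x - y)"
    define z where "z = x - y - of_int k"
    have z: "\<bar>z\<bar> \<le> 1/2" unfolding z_def k_def by (metis of_int_round_abs_le abs_minus_commute)
    have fy: "f y = f (x - z)" using torus_fun_int[OF p, of y k] by (simp add: z_def algebra_simps)
    have sq: "(sin (pi * (x - y)))\<^sup>2 = (sin (pi * z))\<^sup>2"
    proof -
      have e: "pi * (x - y) = pi * z + of_int k * pi" by (simp add: z_def algebra_simps)
      have s0: "sin (of_int k * pi) = 0" using sin_zero_iff_int2 by blast
      have "sin (pi * (x - y)) = sin (pi * z) * cos (of_int k * pi)"
        unfolding e sin_add s0 by simp
      moreover have "(cos (of_int k * pi))\<^sup>2 = 1"
        using sin_cos_squared_add[of "of_int k * pi"] unfolding s0 by simp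
      ultimately show ?thesis by (simp add: power_mult_distrib)
    qed
    show "\<bar>f y - f x\<bar> \<le> e + M * (sin (pi * (x - y)))\<^sup>2"
    proof (cases "\<bar>z\<bar> < d")
      case True
      then have "\<bar>(x - z) - x\<bar> < d0" using d by simp
      from d0(2)[OF this] have "\<bar>f y - f x\<bar> < e" unfolding fy .
      moreover have "M * (sin (pi * (x - y)))\<^sup>2 \<ge> 0" using M by simp
      ultimately show ?thesis by linarith
    next
      case False
      have "sin (pi * d) \<le> sin (pi * \<bar>z\<bar>)"
      proof (rule sin_monotone_2pi_le)
        show "pi * d \<le> pi * \<bar>z\<bar>" using False by (intro mult_left_mono) auto
        have "pi * \<bar>z\<bar> \<le> pi * (1/2)" using z by (intro mult_left_mono) auto
        then show "pi * \<bar>z\<bar> \<le> pi / 2" by simp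
        have "0 \<le> pi * d" using d by simp
        moreover have "- (pi / 2) \<le> 0" by simp
        ultimately show "- (pi / 2) \<le> pi * d" by linarith
      qed
      then have "(sin (pi * d))\<^sup>2 \<le> (sin (pi * \<bar>z\<bar>))\<^sup>2" using s by (intro power_mono) auto
      also have "\<dots> = (sin (pi * z))\<^sup>2" by (cases "z \<ge> 0") (auto simp: abs_if)
      finally have "M * (sin (pi * d))\<^sup>2 \<le> M * (sin (pi * z))\<^sup>2" using M by (rule mult_left_mono)
      moreover have "M * (sin (pi * d))\<^sup>2 = 2 * C" using s by (simp add: M_def)
      moreover have "\<bar>f y - f x\<bar> \<le> 2 * C" using C(1)[of x] C(1)[of y] by simp
      ultimately show ?thesis using e sq by simp
    qed
  qed
qed

lemma torus_continuous_integrable: "torus_continuous f \<Longrightarrow> integrable Leb f"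
  by (intro Leb_continuous_integrable) (simp add: torus_continuous_def)

text \<open>
  A Chebyshev estimate: integrate the bound of \<open>torus_modulus\<close> against the kernel.
\<close>

lemma smooth_approx_uniform:
  assumes f: "torus_continuous f" and e: "e > 0"
  obtains K where "\<And>n x. n \<ge> K \<Longrightarrow> \<bar>smooth_approx n f x - f x\<bar> \<le> e"
proof -
  obtain M where M: "M \<ge> 0" "\<And>x y. \<bar>f y - f x\<bar> \<le> e/2 + M * (sin (pi * (x - y)))\<^sup>2"
    using torus_modulus[OF f, of "e/2"] e by auto
  have c: "continuous_on UNIV f" using f by (simp add: torus_continuous_def)
  have le: "\<bar>smooth_approx n f x - f x\<bar> \<le> e/2 + M / (2 * real n + 2)" for n x
  proof -
    note ik = Leb_continuous_integrable[OF kern_continuous, of n x]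
    have i1: "integrable Leb (\<lambda>y. f y * kern n (x - y))"
      by (intro Leb_continuous_integrable continuous_intros c kern_continuous)
    have i2: "integrable Leb (\<lambda>y. (sin (pi * (x - y)))\<^sup>2 * kern n (x - y))"
      by (intro Leb_continuous_integrable continuous_intros kern_continuous)
    have i3: "integrable Leb (\<lambda>y. \<bar>(f y - f x) * kern n (x - y)\<bar>)"
      by (intro Leb_continuous_integrable continuous_intros c kern_continuous)
    have "smooth_approx n f x - f x = (\<integral>y. f y * kern n (x - y) - f x * kern n (x - y) \<partial>Leb)"
      using i1 ik by (simp add: smooth_approx_kern[OF torus_continuous_integrable[OF f]] kern_integral)
    also have "\<bar>\<dots>\<bar> \<le> (\<integral>y. \<bar>(f y - f x) * kern n (x - y)\<bar> \<partial>Leb)"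
      unfolding left_diff_distrib[symmetric] by (rule integral_abs_bound)
    also have "\<dots> \<le> (\<integral>y. e/2 * kern n (x - y) + M * ((sin (pi * (x - y)))\<^sup>2 * kern n (x - y)) \<partial>Leb)"
    proof (rule integral_mono[OF i3])
      show "integrable Leb (\<lambda>y. e/2 * kern n (x - y) + M * ((sin (pi * (x - y)))\<^sup>2 * kern n (x - y)))"
        using ik i2 by (intro Bochner_Integration.integrable_add integrable_mult_right)
      fix y
      have "\<bar>f y - f x\<bar> * kern n (x - y) \<le> (e/2 + M * (sin (pi * (x - y)))\<^sup>2) * kern n (x - y)"
        using M(2) kern_nonneg by (rule mult_right_mono)
      then show "\<bar>(f y - f x) * kern n (x - y)\<bar> \<le> e/2 * kern n (x - y) + M * ((sin (pi * (x - y)))\<^sup>2 * kern n (x - y))"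
        using kern_nonneg[of n "x - y"] by (simp add: abs_mult distrib_right mult.assoc)
    qed
    also have "\<dots> = e/2 + M / (2 * real n + 2)"
      using ik i2 by (simp add: kern_integral kern_variance)
    finally show ?thesis .
  qed
  obtain K :: nat where K: "M / e \<le> real K" using real_arch_simple by blast
  show ?thesis
  proof (rule that[of K])
    fix n x assume "K \<le> n"
    then have "M \<le> real n * e" using K e by (smt (verit) of_nat_le_iff pos_divide_le_eq mult_right_mono)
    then have "M / (2 * real n + 2) \<le> e / 2" using e by (simp add: field_simps)
    then show "\<bar>smooth_approx n f x - f x\<bar> \<le> e" using le[of n x] by linarith
  qed
qed

lemma smooth_approx_bound:
  assumes f: "torus_continuous f" and C: "\<And>y. \<bar>f y\<bar> \<le> C" shows "\<bar>smooth_approx n f x\<bar> \<le> C"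
proof -
  have c: "continuous_on UNIV f" using f by (simp add: torus_continuous_def)
  have i1: "integrable Leb (\<lambda>y. \<bar>f y * kern n (x - y)\<bar>)"
    by (intro Leb_continuous_integrable continuous_intros c kern_continuous)
  have "\<bar>smooth_approx n f x\<bar> \<le> (\<integral>y. \<bar>f y * kern n (x - y)\<bar> \<partial>Leb)"
    unfolding smooth_approx_kern[OF torus_continuous_integrable[OF f]] by (rule integral_abs_bound)
  also have "\<dots> \<le> (\<integral>y. C * kern n (x - y) \<partial>Leb)"
    using C kern_nonneg[of n] by (intro integral_mono[OF i1] integrable_mult_right Leb_continuous_integrable kern_continuous)
      (simp add: abs_mult mult_right_mono)
  finally show ?thesis by (simp add: kern_integral)
qed

text \<open>
  Smoothness is defined through iterated \<open>deriv\<close>; a sequence of successive derivatives is easier to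
  produce.
\<close>

lemma torus_smoothI:
  assumes p: "torus_fun f" and D0: "D 0 = f" and D: "\<And>n x. (D n has_real_derivative D (Suc n) x) (at x)"
  shows "torus_smooth f" and "(deriv ^^ n) f = D n"
proof -
  have *: "(deriv ^^ n) f = D n" for n
  proof (induction n)
    case (Suc n)
    have "deriv (D n) = D (Suc n)" using D DERIV_imp_deriv by blast
    then show ?case by (simp add: Suc)
  qed (simp add: D0)
  show "(deriv ^^ n) f = D n" by (rule *)
  show "torus_smooth f" unfolding torus_smooth_def * using p D by (auto simp: field_differentiable_def)
qed

text \<open>
  The \<open>n\<close>-th derivative of \<open>cos (w x)\<close>.
\<close>

definition cos_tower :: "real \<Rightarrow> nat \<Rightarrow> real \<Rightarrow> real" where
  "cos_tower w n x = w ^ n * cos (w * x + real n * (pi / 2))"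
definition sin_tower :: "real \<Rightarrow> nat \<Rightarrow> real \<Rightarrow> real" where
  "sin_tower w n x = w ^ n * sin (w * x + real n * (pi / 2))"

lemma cos_tower_deriv: "(cos_tower w n has_real_derivative cos_tower w (Suc n) x) (at x)"
proof -
  have "cos (w * x + real (Suc n) * (pi / 2)) = cos ((w * x + real n * (pi / 2)) + pi / 2)" by (simp add: algebra_simps add_divide_distrib)
  then have e: "cos (w * x + real (Suc n) * (pi / 2)) = - sin (w * x + real n * (pi / 2))" by (simp only: cos_add) simp
  show ?thesis unfolding cos_tower_def[abs_def] e by (auto intro!: derivative_eq_intros)
qed

lemma sin_tower_deriv: "(sin_tower w n has_real_derivative sin_tower w (Suc n) x) (at x)"
proof -
  have "sin (w * x + real (Suc n) * (pi / 2)) = sin ((w * x + real n * (pi / 2)) + pi / 2)" by (simp add: algebra_simps add_divide_distrib)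
  then have e: "sin (w * x + real (Suc n) * (pi / 2)) = cos (w * x + real n * (pi / 2))" by (simp only: sin_add) simp
  show ?thesis unfolding sin_tower_def[abs_def] e by (auto intro!: derivative_eq_intros)
qed

lemma trig_periodic: "torus_fun (cosf n k)" "torus_fun (sinf n k)"
proof -
  have e: "2 * pi * (real k - real n) * (x + 1) = 2 * pi * (real k - real n) * x + 2 * pi * of_int (int k - int n)" for x
    by (simp add: algebra_simps)
  have c: "cos (a + 2 * pi * of_int j) = cos a" and s: "sin (a + 2 * pi * of_int j) = sin a" for a j
    by (simp_all only: cos_add sin_add cos_integer_2pi sin_integer_2pi) simp_all
  show "torus_fun (cosf n k)" unfolding torus_fun_def cosf_def e by (intro allI c)
  show "torus_fun (sinf n k)" unfolding torus_fun_def sinf_def e by (intro allI s)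
qed

definition approx_tower :: "nat \<Rightarrow> (real \<Rightarrow> real) \<Rightarrow> nat \<Rightarrow> real \<Rightarrow> real" where
  "approx_tower n f j x = (\<Sum>k\<le>2 * n. coeff_cp n k * ((\<integral>y. f y * cosf n k y \<partial>Leb) * cos_tower (2 * pi * (real k - real n)) j x
     + (\<integral>y. f y * sinf n k y \<partial>Leb) * sin_tower (2 * pi * (real k - real n)) j x))"

lemma approx_tower_deriv: "(approx_tower n f j has_real_derivative approx_tower n f (Suc j) x) (at x)"
  unfolding approx_tower_def[abs_def]
  by (intro DERIV_sum DERIV_cmult DERIV_add cos_tower_deriv sin_tower_deriv)

lemma approx_tower_0: "approx_tower n f 0 = smooth_approx n f"
  by (simp add: fun_eq_iff approx_tower_def smooth_approx_def cos_tower_def sin_tower_def cosf_def sinf_def)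

lemma smooth_approx_periodic: "torus_fun (smooth_approx n f)"
  using trig_periodic by (simp add: torus_fun_def smooth_approx_def)

lemma smooth_approx_smooth: "torus_smooth (smooth_approx n f)"
  by (rule torus_smoothI(1)[OF smooth_approx_periodic approx_tower_0 approx_tower_deriv])

section \<open>Uniqueness of the generalized derivative\<close>

text \<open>
  The measures with densities the positive and the negative part of \<open>f\<close> agree on rays, hence
  everywhere.
\<close>

lemma AE_zero_if_interval_integrals_zero:
  fixes f :: "real \<Rightarrow> real"
  assumes f: "integrable lborel f"
    and z: "\<And>a b. a < b \<Longrightarrow> (\<integral>x. indicator {a<..<b} x * f x \<partial>lborel) = 0"
  shows "AE x in lborel. f x = 0"
proof -
  have [measurable]: "f \<in> borel_measurable borel" using f by simp
  have ray: "(\<integral>x. indicator {a<..} x * f x \<partial>lborel) = 0" for a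
  proof -
    have "(\<lambda>n. \<integral>x. indicator {a<..<a + real (Suc n)} x * f x \<partial>lborel) \<longlonglongrightarrow> (\<integral>x. indicator {a<..} x * f x \<partial>lborel)"
    proof (rule integral_dominated_convergence[where w="\<lambda>x. \<bar>f x\<bar>"])
      show "AE x in lborel. (\<lambda>n. indicator {a<..<a + real (Suc n)} x * f x) \<longlonglongrightarrow> indicator {a<..} x * f x"
      proof (intro AE_I2 tendsto_eventually)
        fix x
        obtain K :: nat where "x - a < real K" using reals_Archimedean2 by blast
        then have "\<forall>n\<ge>K. indicator {a<..<a + real (Suc n)} x * f x = indicator {a<..} x * f x"
          by (auto simp: indicator_def)
        then show "\<forall>\<^sub>F n in sequentially. indicator {a<..<a + real (Suc n)} x * f x = indicator {a<..} x * f x"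
          unfolding eventually_sequentially by blast
      qed
    qed (use f in \<open>auto simp: indicator_def\<close>)
    moreover have "(\<lambda>n. \<integral>x. indicator {a<..<a + real (Suc n)} x * f x \<partial>lborel) = (\<lambda>n. 0)"
      using z by (intro ext) simp
    ultimately show ?thesis using LIMSEQ_unique tendsto_const by metis
  qed
  let ?P = "density lborel (\<lambda>x. ennreal (f x))" and ?M = "density lborel (\<lambda>x. ennreal (- f x))"
  have fin: "(\<integral>\<^sup>+x. ennreal (f x) * indicator {a<..} x \<partial>lborel) < \<infinity>" "(\<integral>\<^sup>+x. ennreal (- f x) * indicator {a<..} x \<partial>lborel) < \<infinity>" for a
  proof -
    have "(\<integral>\<^sup>+x. norm (f x) \<partial>lborel) < \<infinity>" using f by (simp add: integrable_iff_bounded)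
    moreover have "(\<integral>\<^sup>+x. ennreal (f x) * indicator {a<..} x \<partial>lborel) \<le> (\<integral>\<^sup>+x. norm (f x) \<partial>lborel)"
      by (intro nn_integral_mono) (auto simp: indicator_def intro!: ennreal_leI)
    moreover have "(\<integral>\<^sup>+x. ennreal (- f x) * indicator {a<..} x \<partial>lborel) \<le> (\<integral>\<^sup>+x. norm (f x) \<partial>lborel)"
      by (intro nn_integral_mono) (auto simp: indicator_def intro!: ennreal_leI)
    ultimately show "(\<integral>\<^sup>+x. ennreal (f x) * indicator {a<..} x \<partial>lborel) < \<infinity>" "(\<integral>\<^sup>+x. ennreal (- f x) * indicator {a<..} x \<partial>lborel) < \<infinity>"
      by (auto intro: order_le_less_trans)
  qed
  have "?P = ?M"
  proof (rule measure_eqI_lessThan)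
    fix a
    show "emeasure ?P {a<..} < \<infinity>" using fin by (simp add: emeasure_density)
    have i: "integrable lborel (\<lambda>x. indicator {a<..} x * f x)"
      using integrable_mult_indicator[OF _ f, of "{a<..}"] by simp
    have "0 = enn2real (\<integral>\<^sup>+x. ennreal (indicator {a<..} x * f x) \<partial>lborel) - enn2real (\<integral>\<^sup>+x. ennreal (- (indicator {a<..} x * f x)) \<partial>lborel)"
      using real_lebesgue_integral_def[OF i] ray by simp
    moreover have "(\<integral>\<^sup>+x. ennreal (indicator {a<..} x * f x) \<partial>lborel) = (\<integral>\<^sup>+x. ennreal (f x) * indicator {a<..} x \<partial>lborel)"
      by (intro nn_integral_cong) (auto simp: indicator_def)
    moreover have "(\<integral>\<^sup>+x. ennreal (- (indicator {a<..} x * f x)) \<partial>lborel) = (\<integral>\<^sup>+x. ennreal (- f x) * indicator {a<..} x \<partial>lborel)"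
      by (intro nn_integral_cong) (auto simp: indicator_def)
    ultimately have "enn2real (emeasure ?P {a<..}) = enn2real (emeasure ?M {a<..})"
      by (simp add: emeasure_density)
    then show "emeasure ?P {a<..} = emeasure ?M {a<..}"
      using fin[of a] by (simp add: emeasure_density) (metis ennreal_enn2real)
  qed auto
  then have "AE x in lborel. ennreal (f x) = ennreal (- f x)"
    by (intro sigma_finite_measure.density_unique[OF sigma_finite_lborel]) auto
  then show ?thesis
  proof eventually_elim
    case (elim x)
    show ?case
    proof (cases "f x \<ge> 0")
      case True
      then have "ennreal (- f x) = 0" by (simp add: ennreal_neg)
      then show ?thesis using elim True by simp
    next
      case False
      then have "ennreal (f x) = 0" by (simp add: ennreal_neg)
      then show ?thesis using elim False by (simp add: ennreal_eq_0_iff)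
    qed
  qed
qed

text \<open>
  Trapezoidal functions approximate the indicator of an interval.
\<close>

lemma AE_zero_if_tested:
  fixes f :: "real \<Rightarrow> real"
  assumes f: "integrable lborel f" and supp: "\<And>x. x \<notin> {c..d} \<Longrightarrow> f x = 0"
    and z: "\<And>\<phi>. continuous_on UNIV \<phi> \<Longrightarrow> (\<And>x. \<bar>\<phi> x\<bar> \<le> 1) \<Longrightarrow> (\<And>x. x \<notin> {c<..<d} \<Longrightarrow> \<phi> x = 0) \<Longrightarrow>
              (\<integral>x. f x * \<phi> x \<partial>lborel) = 0"
  shows "AE x in lborel. f x = 0"
proof (rule AE_zero_if_interval_integrals_zero[OF f])
  have [measurable]: "f \<in> borel_measurable borel" using f by simp
  fix a b :: real assume ab: "a < b"
  define a' b' where "a' = max a c" and "b' = min b d"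
  define \<phi> where "\<phi> n x = min 1 (real n * max 0 (min (x - a') (b' - x)))" for n x
  have c\<phi>: "continuous_on UNIV (\<phi> n)" for n unfolding \<phi>_def by (intro continuous_intros)
  have b\<phi>: "\<bar>\<phi> n x\<bar> \<le> 1" for n x unfolding \<phi>_def by (auto simp: abs_le_iff)
  have s\<phi>: "\<phi> n x = 0" if "x \<notin> {a'<..<b'}" for n x
  proof -
    have "min (x - a') (b' - x) \<le> 0" using that by auto
    then show ?thesis by (simp add: \<phi>_def)
  qed
  have "(\<lambda>n. \<integral>x. f x * \<phi> n x \<partial>lborel) \<longlonglongrightarrow> (\<integral>x. indicator {a'<..<b'} x * f x \<partial>lborel)"
  proof (rule integral_dominated_convergence[where w="\<lambda>x. \<bar>f x\<bar>"])
    show "AE x in lborel. (\<lambda>n. f x * \<phi> n x) \<longlonglongrightarrow> indicator {a'<..<b'} x * f x"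
    proof (intro AE_I2)
      fix x
      show "(\<lambda>n. f x * \<phi> n x) \<longlonglongrightarrow> indicator {a'<..<b'} x * f x"
      proof (cases "x \<in> {a'<..<b'}")
        case True
        define y where "y = min (x - a') (b' - x)"
        have y: "y > 0" using True by (auto simp: y_def)
        obtain K :: nat where K: "1 / y < real K" using reals_Archimedean2 by blast
        have "\<phi> n x = 1" if "n \<ge> K" for n
        proof -
          have "1 / y < real n" using K that by (meson less_le_trans of_nat_le_iff)
          then have "1 \<le> real n * y" using y by (simp add: field_simps)
          then show ?thesis using y by (simp add: \<phi>_def y_def[symmetric])
        qed
        then have "\<forall>\<^sub>F n in sequentially. f x * \<phi> n x = indicator {a'<..<b'} x * f x"
          unfolding eventually_sequentially using True by (intro exI[of _ K]) auto
        then show ?thesis by (rule tendsto_eventually)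
      qed (simp add: s\<phi>)
    qed
    show "AE x in lborel. norm (f x * \<phi> n x) \<le> \<bar>f x\<bar>" for n
      by (simp add: abs_mult mult_left_le b\<phi>)
    show "(\<lambda>x. f x * \<phi> n x) \<in> borel_measurable lborel" for n
      using borel_measurable_continuous_onI[OF c\<phi>] by measurable
  qed (use f in auto)
  moreover have "(\<lambda>n. \<integral>x. f x * \<phi> n x \<partial>lborel) = (\<lambda>n. 0)"
    using z[OF c\<phi> b\<phi>] s\<phi> by (intro ext) (auto simp: a'_def b'_def)
  ultimately have "(\<integral>x. indicator {a'<..<b'} x * f x \<partial>lborel) = 0"
    using LIMSEQ_unique tendsto_const by metis
  moreover have "(\<integral>x. indicator {a'<..<b'} x * f x \<partial>lborel) = (\<integral>x. indicator {a<..<b} x * f x \<partial>lborel)"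
  proof (rule integral_cong_AE)
    show "AE x in lborel. indicat_real {a'<..<b'} x * f x = indicat_real {a<..<b} x * f x"
      using AE_lborel_singleton[of c] AE_lborel_singleton[of d]
    proof eventually_elim
      case (elim x)
      then show ?case
        using supp[of x] by (cases "x \<in> {c..d}") (auto simp: indicator_def a'_def b'_def)
    qed
  qed auto
  ultimately show "(\<integral>x. indicator {a<..<b} x * f x \<partial>lborel) = 0" by simp
qed

lemma integrable_Leb_iff: "f \<in> borel_measurable borel \<Longrightarrow> integrable Leb f \<longleftrightarrow> integrable lborel (\<lambda>x. indicator {0..<1} x * (f x :: real))"
  unfolding Leb_def by (subst integrable_restrict_space) auto

text \<open>
  A test function supported in the open unit interval extends periodically, and the trigonometric
  polynomials \<open>smooth_approx\<close> approximate the extension boundedly.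
\<close>

lemma torus_fundamental_lemma:
  assumes [measurable]: "f \<in> borel_measurable borel" and f: "integrable Leb f"
    and z: "\<And>\<phi>. torus_smooth \<phi> \<Longrightarrow> (\<integral>x. f x * \<phi> x \<partial>Leb) = 0"
  shows "AE x in lborel. x \<in> {0..<1} \<longrightarrow> f x = 0"
proof -
  let ?F = "\<lambda>x. indicator {0..<1} x * f x"
  have "AE x in lborel. ?F x = 0"
  proof (rule AE_zero_if_tested[where c=0 and d=1])
    show "integrable lborel ?F" using f integrable_Leb_iff by auto
    show "?F x = 0" if "x \<notin> {0..1}" for x using that by (auto simp: indicator_def)
    fix \<phi> :: "real \<Rightarrow> real"
    assume c: "continuous_on UNIV \<phi>" and b: "\<And>x. \<bar>\<phi> x\<bar> \<le> 1" and s: "\<And>x. x \<notin> {0<..<1} \<Longrightarrow> \<phi> x = 0"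
    define \<psi> where "\<psi> x = \<phi> (frac x)" for x
    have "continuous_on UNIV \<psi>"
    proof (rule continuous_on_mesh[of 1])
      fix k :: int
      have "continuous_on {of_int k * 1..(of_int k + 1) * 1} (\<lambda>x. \<phi> (x - of_int k))"
        by (intro continuous_on_compose2[OF c] continuous_intros) auto
      then show "continuous_on {of_int k * 1..(of_int k + 1) * 1} \<psi>"
      proof (rule continuous_on_eq)
        fix x :: real assume x: "x \<in> {of_int k * 1..(of_int k + 1) * 1}"
        show "\<phi> (x - of_int k) = \<psi> x"
        proof (cases "x = of_int k + 1")
          case True
          then have "frac x = 0" by simp
          then show ?thesis using True s by (simp add: \<psi>_def)
        next
          case False
          then have "\<lfloor>x\<rfloor> = k" using x by (simp add: floor_unique)
          then show ?thesis by (simp add: \<psi>_def frac_def)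
        qed
      qed
    qed simp
    then have \<psi>: "torus_continuous \<psi>" unfolding torus_continuous_def torus_fun_def \<psi>_def by (simp add: frac_1_eq)
    have b\<psi>: "\<bar>\<psi> x\<bar> \<le> 1" for x unfolding \<psi>_def by (rule b)
    have cs: "continuous_on UNIV (smooth_approx n \<psi>)" for n
      using approx_tower_deriv[of n \<psi> 0] unfolding approx_tower_0
      by (meson DERIV_isCont continuous_at_imp_continuous_on)
    have [measurable]: "smooth_approx n \<psi> \<in> borel_measurable borel" "\<psi> \<in> borel_measurable borel" for n
      using cs \<psi> by (auto simp: torus_continuous_def intro: borel_measurable_continuous_onI)
    have mf: "f \<in> borel_measurable Leb" "\<psi> \<in> borel_measurable Leb" "\<And>n. smooth_approx n \<psi> \<in> borel_measurable Leb"
      by (auto intro!: torus_measurable[OF torus_Leb])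
    have "(\<lambda>n. \<integral>x. f x * smooth_approx n \<psi> x \<partial>Leb) \<longlonglongrightarrow> (\<integral>x. f x * \<psi> x \<partial>Leb)"
    proof (rule integral_dominated_convergence[where w="\<lambda>x. \<bar>f x\<bar>"])
      show "AE x in Leb. (\<lambda>n. f x * smooth_approx n \<psi> x) \<longlonglongrightarrow> f x * \<psi> x"
      proof (intro AE_I2 tendsto_mult tendsto_const)
        fix x
        show "(\<lambda>n. smooth_approx n \<psi> x) \<longlonglongrightarrow> \<psi> x"
        proof (rule LIMSEQ_I)
          fix r :: real assume r: "r > 0"
          obtain K where "\<And>n x. n \<ge> K \<Longrightarrow> \<bar>smooth_approx n \<psi> x - \<psi> x\<bar> \<le> r / 2"
            using smooth_approx_uniform[OF \<psi>, of "r/2"] r by auto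
          note K = this
          have "norm (smooth_approx n \<psi> x - \<psi> x) < r" if "n \<ge> K" for n
            using K[OF that, of x] r by simp
          then show "\<exists>K. \<forall>n\<ge>K. norm (smooth_approx n \<psi> x - \<psi> x) < r" by blast
        qed
      qed
      show "AE x in Leb. norm (f x * smooth_approx n \<psi> x) \<le> \<bar>f x\<bar>" for n
        by (simp add: abs_mult mult_left_le smooth_approx_bound[OF \<psi> b\<psi>])
    qed (use f mf in auto)
    moreover have "(\<lambda>n. \<integral>x. f x * smooth_approx n \<psi> x \<partial>Leb) = (\<lambda>n. 0)"
      by (intro ext) (rule z[OF smooth_approx_smooth])
    ultimately have "(\<integral>x. f x * \<psi> x \<partial>Leb) = 0" using LIMSEQ_unique tendsto_const by metis
    moreover have "(\<integral>x. f x * \<psi> x \<partial>Leb) = (\<integral>x. ?F x * \<phi> x \<partial>lborel)"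
      unfolding integral_Leb by (intro Bochner_Integration.integral_cong) (auto simp: indicator_def \<psi>_def frac_eq)
    ultimately show "(\<integral>x. ?F x * \<phi> x \<partial>lborel) = 0" by simp
  qed
  then show ?thesis by eventually_elim (auto simp: indicator_def)
qed

text \<open>
  Elements of \<open>L2_torus\<close> are Lebesgue measurable only; product measures and Fubini are applied to
  Borel versions.
\<close>

lemma L2_torus_borel_version:
  assumes h: "h \<in> L2_torus"
  obtains k where "k \<in> borel_measurable borel" "integrable Leb (\<lambda>x. (k x)\<^sup>2)"
    "AE x in lborel. x \<in> {0..<1} \<longrightarrow> h x = k x"
    "\<And>\<phi>. \<phi> \<in> borel_measurable borel \<Longrightarrow> inner_L2 h \<phi> = (\<integral>x. k x * \<phi> x \<partial>Leb)"
    "inner_L2 h h = (\<integral>x. (k x)\<^sup>2 \<partial>Leb)"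
proof -
  have m: "(\<lambda>x. indicator {0..<1} x * h x) \<in> borel_measurable lebesgue"
    and i: "integrable lebesgue (\<lambda>x. indicator {0..<1} x * (h x)\<^sup>2)"
    using h by (auto simp: L2_torus_def set_borel_measurable_def set_integrable_def)
  from completion_ex_borel_measurable_real[OF m] obtain k where k: "k \<in> borel_measurable borel"
    and e: "AE x in lborel. indicator {0..<1} x * h x = k x" by auto
  have eL: "AE x in lebesgue. indicator {0..<1} x * h x = k x" using e by (rule AE_completion)
  have ind: "indicator {0..<1::real} x * (a * b) = (indicator {0..<1} x * a) * (b :: real)" for x a b by simp
  have ind2: "indicator {0..<1::real} x * (a)\<^sup>2 = (indicator {0..<1} x * (a :: real))\<^sup>2" for x a by (simp add: indicator_def)
  have conv: "(\<integral>x. indicator {0..<1} x * (k x * \<phi> x) \<partial>lebesgue) = (\<integral>x. k x * \<phi> x \<partial>Leb)" if [measurable]: "\<phi> \<in> borel_measurable borel" for \<phi>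
    unfolding integral_Leb using k by (subst integral_completion) auto
  have kk: "AE x in lebesgue. indicator {0..<1} x * k x = k x"
    using eL by eventually_elim (auto simp: indicator_def of_bool_def split: if_splits)
  have sq: "integrable Leb (\<lambda>x. (k x)\<^sup>2)"
  proof -
    have "integrable lebesgue (\<lambda>x. indicator {0..<1} x * (k x)\<^sup>2)"
    proof (rule Bochner_Integration.integrable_cong_AE_imp[OF i])
      show "(\<lambda>x. indicator {0..<1} x * (k x)\<^sup>2) \<in> borel_measurable lebesgue"
        using k by (intro measurable_completion) auto
      show "AE x in lebesgue. indicator {0..<1} x * (h x)\<^sup>2 = indicator {0..<1} x * (k x)\<^sup>2"
        using eL by eventually_elim (auto simp: indicator_def of_bool_def split: if_splits)
    qed
    then show ?thesis using k by (subst integrable_Leb_iff) (auto simp: integrable_completion)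
  qed
  show ?thesis
  proof (rule that[of k])
    show "AE x in lborel. x \<in> {0..<1} \<longrightarrow> h x = k x" using e by eventually_elim (auto simp: indicator_def)
    fix \<phi> :: "real \<Rightarrow> real" assume \<phi>: "\<phi> \<in> borel_measurable borel"
    have "inner_L2 h \<phi> = (\<integral>x. indicator {0..<1} x * (k x * \<phi> x) \<partial>lebesgue)"
      unfolding inner_L2_def set_lebesgue_integral_def
    proof (rule integral_cong_AE)
      have "(\<lambda>x. (indicator {0..<1} x * h x) * \<phi> x) \<in> borel_measurable lebesgue"
        using \<phi> by (intro borel_measurable_times[OF m] measurable_completion) auto
      then show "(\<lambda>x. indicat_real {0..<1} x *\<^sub>R (h x * \<phi> x)) \<in> borel_measurable lebesgue" by (simp add: mult.assoc)
      show "(\<lambda>x. indicator {0..<1} x * (k x * \<phi> x)) \<in> borel_measurable lebesgue"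
        using k \<phi> by (intro measurable_completion) auto
      show "AE x in lebesgue. indicat_real {0..<1} x *\<^sub>R (h x * \<phi> x) = indicator {0..<1} x * (k x * \<phi> x)"
        using eL by eventually_elim (auto simp: indicator_def of_bool_def split: if_splits)
    qed
    then show "inner_L2 h \<phi> = (\<integral>x. k x * \<phi> x \<partial>Leb)" using conv[OF \<phi>] by simp
  next
    have "inner_L2 h h = (\<integral>x. indicator {0..<1} x * (k x * k x) \<partial>lebesgue)"
      unfolding inner_L2_def set_lebesgue_integral_def
    proof (rule integral_cong_AE)
      show "(\<lambda>x. indicat_real {0..<1} x *\<^sub>R (h x * h x)) \<in> borel_measurable lebesgue"
        using i by (simp add: power2_eq_square)
      show "(\<lambda>x. indicator {0..<1} x * (k x * k x)) \<in> borel_measurable lebesgue"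
        using k by (intro measurable_completion) auto
      show "AE x in lebesgue. indicat_real {0..<1} x *\<^sub>R (h x * h x) = indicator {0..<1} x * (k x * k x)"
        using eL by eventually_elim (auto simp: indicator_def of_bool_def split: if_splits)
    qed
    then show "inner_L2 h h = (\<integral>x. (k x)\<^sup>2 \<partial>Leb)" using conv[OF k] by (simp add: power2_eq_square)
  qed (fact k sq)+
qed

lemma torus_smooth_measurable:
  assumes "torus_smooth \<phi>" shows "\<phi> \<in> borel_measurable borel" "deriv \<phi> \<in> borel_measurable borel" "continuous_on UNIV \<phi>" "continuous_on UNIV (deriv \<phi>)"
proof -
  have d: "(deriv ^^ n) \<phi> field_differentiable (at x)" for n x using assms by (auto simp: torus_smooth_def)
  have c: "continuous_on UNIV ((deriv ^^ n) \<phi>)" for n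
    by (intro continuous_at_imp_continuous_on ballI field_differentiable_imp_continuous_at d)
  show "continuous_on UNIV \<phi>" "continuous_on UNIV (deriv \<phi>)" using c[of 0] c[of 1] by auto
  then show "\<phi> \<in> borel_measurable borel" "deriv \<phi> \<in> borel_measurable borel"
    by (auto intro: borel_measurable_continuous_onI)
qed

text \<open>
  Lets the norm of the representative \<open>weak_dx f\<close>, which is chosen arbitrarily, be computed from any
  explicit generalized derivative.
\<close>

lemma generalized_deriv_unique:
  assumes h: "h1 \<in> L2_torus" "h2 \<in> L2_torus" and g: "generalized_deriv f h1" "generalized_deriv f h2"
  shows "inner_L2 h1 h1 = inner_L2 h2 h2"
proof -
  obtain k1 where k1: "k1 \<in> borel_measurable borel" "integrable Leb (\<lambda>x. (k1 x)\<^sup>2)"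
    "\<And>\<phi>. \<phi> \<in> borel_measurable borel \<Longrightarrow> inner_L2 h1 \<phi> = (\<integral>x. k1 x * \<phi> x \<partial>Leb)"
    "inner_L2 h1 h1 = (\<integral>x. (k1 x)\<^sup>2 \<partial>Leb)" using L2_torus_borel_version[OF h(1)] by metis
  obtain k2 where k2: "k2 \<in> borel_measurable borel" "integrable Leb (\<lambda>x. (k2 x)\<^sup>2)"
    "\<And>\<phi>. \<phi> \<in> borel_measurable borel \<Longrightarrow> inner_L2 h2 \<phi> = (\<integral>x. k2 x * \<phi> x \<partial>Leb)"
    "inner_L2 h2 h2 = (\<integral>x. (k2 x)\<^sup>2 \<partial>Leb)" using L2_torus_borel_version[OF h(2)] by metis
  interpret finite_measure Leb by (rule torus_measureD(1)[OF torus_Leb])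
  note km = torus_measurable[OF torus_Leb k1(1)] torus_measurable[OF torus_Leb k2(1)]
  have i: "integrable Leb k1" "integrable Leb k2"
    by (rule square_integrable_imp_integrable[OF km(1) k1(2)], rule square_integrable_imp_integrable[OF km(2) k2(2)])
  have "AE x in lborel. x \<in> {0..<1} \<longrightarrow> k1 x - k2 x = 0"
  proof (rule torus_fundamental_lemma)
    show "(\<lambda>x. k1 x - k2 x) \<in> borel_measurable borel" using k1(1) k2(1) by simp
    show "integrable Leb (\<lambda>x. k1 x - k2 x)" using i by simp
    fix \<phi> assume \<phi>: "torus_smooth \<phi>"
    note m = torus_smooth_measurable[OF \<phi>]
    obtain C where C: "\<And>y. y \<in> {0..1} \<Longrightarrow> \<bar>\<phi> y\<bar> \<le> C"
      using continuous_bounded_01[OF continuous_on_subset[OF m(3)]] by auto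
    have "integrable Leb (\<lambda>x. (\<phi> x)\<^sup>2)" by (intro Leb_continuous_integrable continuous_intros m)
    then have j: "integrable Leb (\<lambda>x. k1 x * \<phi> x)" "integrable Leb (\<lambda>x. k2 x * \<phi> x)"
      using Cauchy_Schwarz_integral(1)[OF km(1) torus_measurable[OF torus_Leb m(1)] k1(2)]
        Cauchy_Schwarz_integral(1)[OF km(2) torus_measurable[OF torus_Leb m(1)] k2(2)] by auto
    have "inner_L2 h1 \<phi> = inner_L2 h2 \<phi>" using g \<phi> by (simp add: generalized_deriv_def)
    then show "(\<integral>x. (k1 x - k2 x) * \<phi> x \<partial>Leb) = 0"
      using j k1(3)[OF m(1)] k2(3)[OF m(1)] by (simp add: left_diff_distrib)
  qed
  then have "(\<integral>x. (k1 x)\<^sup>2 \<partial>Leb) = (\<integral>x. (k2 x)\<^sup>2 \<partial>Leb)"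
    unfolding integral_Leb using k1(1) k2(1)
    by (intro integral_cong_AE) (auto simp: indicator_def)
  then show ?thesis using k1(4) k2(4) by simp
qed

section \<open>Primitives in time and moments\<close>

lemma lebesgue_measurable_cong_AE:
  assumes g: "g \<in> borel_measurable lebesgue" and eq: "AE x in lebesgue. f x = (g x :: real)"
  shows "f \<in> borel_measurable lebesgue"
proof (rule borel_measurableI)
  fix S :: "real set" assume "open S"
  have ae: "AE x in lborel. f x = g x" using eq by (simp add: AE_completion_iff)
  have "AE x in lborel. \<not> (f x \<noteq> g x)" "AE x in lborel. \<not> (f x \<in> S \<and> f x \<noteq> g x)" using ae by auto
  from this[THEN sets_completion_AE] have p: "{x. f x \<noteq> g x} \<in> sets lebesgue" "{x. f x \<in> S \<and> f x \<noteq> g x} \<in> sets lebesgue"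
    by (auto simp: pred_def)
  have "{x. g x \<in> S} \<in> sets lebesgue" using measurable_sets[OF g, of S] \<open>open S\<close> by (simp add: vimage_def)
  then have "({x. g x \<in> S} - {x. f x \<noteq> g x}) \<union> {x. f x \<in> S \<and> f x \<noteq> g x} \<in> sets lebesgue"
    using p by blast
  moreover have "f -` S \<inter> space lebesgue = ({x. g x \<in> S} - {x. f x \<noteq> g x}) \<union> {x. f x \<in> S \<and> f x \<noteq> g x}" by auto
  ultimately show "f -` S \<inter> space lebesgue \<in> sets lebesgue" by simp
qed

text \<open>
  The integrals over \<open>lebesgue\<close> in the weak formulation involve \<open>weak_dx\<close>, whose dependence on time is
  not controlled; almost everywhere they are Borel integrals.
\<close>

lemma lebesgue_integral_cong_AE:
  assumes g: "g \<in> borel_measurable borel" and eq: "AE x in lborel. f x = (g x :: real)"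
  shows "integral\<^sup>L lebesgue f = integral\<^sup>L lborel g"
proof -
  have g': "g \<in> borel_measurable lebesgue" using g by (intro measurable_completion) auto
  have eq': "AE x in lebesgue. f x = g x" using eq by (rule AE_completion)
  have "integral\<^sup>L lebesgue f = integral\<^sup>L lebesgue g"
    by (rule integral_cong_AE[OF lebesgue_measurable_cong_AE[OF g' eq'] g' eq'])
  also have "\<dots> = integral\<^sup>L lborel g" using g by (intro integral_completion) auto
  finally show ?thesis .
qed

lemma fubini_kernel:
  fixes a b :: "real \<Rightarrow> real" and g :: "real \<Rightarrow> real \<Rightarrow> real"
  assumes a: "integrable lborel a" and b: "integrable lborel b"
    and g: "case_prod g \<in> borel_measurable (borel \<Otimes>\<^sub>M borel)" and g1: "\<And>x y. \<bar>g x y\<bar> \<le> 1"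
  shows "(\<integral>x. (\<integral>y. g x y * (a x * b y) \<partial>lborel) \<partial>lborel) = (\<integral>y. (\<integral>x. g x y * (a x * b y) \<partial>lborel) \<partial>lborel)"
    and "integrable lborel (\<lambda>x. \<integral>y. g x y * (a x * b y) \<partial>lborel)"
proof -
  have [measurable]: "a \<in> borel_measurable borel" "b \<in> borel_measurable borel" using a b by auto
  have g': "case_prod g \<in> borel_measurable (lborel \<Otimes>\<^sub>M lborel)" using g by (simp cong: measurable_cong_sets sets_pair_measure_cong)
  have "integrable (lborel \<Otimes>\<^sub>M lborel) (\<lambda>(x, y). a x * b y)"
  proof (rule lborel_pair.Fubini_integrable)
    show "(\<lambda>(x, y). a x * b y) \<in> borel_measurable (lborel \<Otimes>\<^sub>M lborel)" by measurable
    show "integrable lborel (\<lambda>x. LINT y|lborel. norm (case (x, y) of (x, y) \<Rightarrow> a x * b y))"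
      using a by (simp add: abs_mult)
    show "AE x in lborel. integrable lborel (\<lambda>y. case (x, y) of (x, y) \<Rightarrow> a x * b y)" using b by simp
  qed
  then have i: "integrable (lborel \<Otimes>\<^sub>M lborel) (\<lambda>(x, y). g x y * (a x * b y))"
  proof (rule Bochner_Integration.integrable_bound)
    have "(\<lambda>z. case_prod g z * (a (fst z) * b (snd z))) \<in> borel_measurable (lborel \<Otimes>\<^sub>M lborel)" using g' by measurable
    then show "(\<lambda>(x, y). g x y * (a x * b y)) \<in> borel_measurable (lborel \<Otimes>\<^sub>M lborel)" by (simp add: split_def)
    show "AE z in lborel \<Otimes>\<^sub>M lborel. norm (case z of (x, y) \<Rightarrow> g x y * (a x * b y)) \<le> norm (case z of (x, y) \<Rightarrow> a x * b y)"
    proof (rule AE_I2)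
      fix z :: "real \<times> real"
      obtain x y where "z = (x, y)" by (cases z)
      then show "norm (case z of (x, y) \<Rightarrow> g x y * (a x * b y)) \<le> norm (case z of (x, y) \<Rightarrow> a x * b y)"
        using mult_right_mono[OF g1[of x y] abs_ge_zero[of "a x * b y"]] by (simp add: abs_mult)
    qed
  qed
  show "(\<integral>x. (\<integral>y. g x y * (a x * b y) \<partial>lborel) \<partial>lborel) = (\<integral>y. (\<integral>x. g x y * (a x * b y) \<partial>lborel) \<partial>lborel)"
    using lborel_pair.Fubini_integral[OF i] by simp
  show "integrable lborel (\<lambda>x. \<integral>y. g x y * (a x * b y) \<partial>lborel)"
    using lborel_pair.integrable_fst[OF i] by simp
qed

definition prim :: "(real \<Rightarrow> real) \<Rightarrow> real \<Rightarrow> real" where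
  "prim r t = (\<integral>s. indicator {..t} s * r s \<partial>lborel)"

lemma indicator_pair_measurable:
  "case_prod (\<lambda>(x::real) (y::real). indicator {..x} y :: real) \<in> borel_measurable (borel \<Otimes>\<^sub>M borel)"
  "case_prod (\<lambda>(x::real) (y::real). indicator {..y} x :: real) \<in> borel_measurable (borel \<Otimes>\<^sub>M borel)"
proof -
  have c: "closed {z :: real \<times> real. snd z \<le> fst z}" "closed {z :: real \<times> real. fst z \<le> snd z}"
    by (rule closed_Collect_le; rule continuous_intros; rule continuous_on_id)+
  have e: "case_prod (\<lambda>(x::real) (y::real). indicator {..x} y :: real) = indicator {z. snd z \<le> fst z}"
    "case_prod (\<lambda>(x::real) (y::real). indicator {..y} x :: real) = indicator {z. fst z \<le> snd z}" by (auto simp: indicator_def)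
  show "case_prod (\<lambda>(x::real) (y::real). indicator {..x} y :: real) \<in> borel_measurable (borel \<Otimes>\<^sub>M borel)"
    unfolding e(1) borel_prod by (rule borel_measurable_indicator[OF borel_closed[OF c(1)]])
  show "case_prod (\<lambda>(x::real) (y::real). indicator {..y} x :: real) \<in> borel_measurable (borel \<Otimes>\<^sub>M borel)"
    unfolding e(2) borel_prod by (rule borel_measurable_indicator[OF borel_closed[OF c(2)]])
qed

text \<open>
  The derivative of \<open>R\<^sup>2 / 2\<close> is \<open>r R\<close> for a primitive \<open>R\<close>. As \<open>r\<close> is merely integrable, the proof
  symmetrizes the double integral over the two triangles instead.
\<close>

lemma integral_times_prim:
  assumes "integrable lborel r" shows "(\<integral>t. r t * prim r t \<partial>lborel) = (\<integral>t. r t \<partial>lborel)\<^sup>2 / 2"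
proof -
  let ?I = "\<integral>t. r t * prim r t \<partial>lborel"
  have 1: "?I = (\<integral>t. (\<integral>s. indicator {..t} s * (r t * r s) \<partial>lborel) \<partial>lborel)"
    unfolding prim_def by (intro Bochner_Integration.integral_cong refl) (simp add: mult_ac flip: integral_mult_right_zero)
  have f: "case_prod (\<lambda>(x::real) (y::real). indicator {..x} y :: real) \<in> borel_measurable (borel \<Otimes>\<^sub>M borel)"
    "case_prod (\<lambda>(x::real) (y::real). indicator {..y} x :: real) \<in> borel_measurable (borel \<Otimes>\<^sub>M borel)"
    by (fact indicator_pair_measurable)+
  have 2: "?I = (\<integral>t. (\<integral>s. indicator {..s} t * (r t * r s) \<partial>lborel) \<partial>lborel)"
    unfolding 1 using fubini_kernel(1)[OF assms assms f(1)] by (simp add: indicator_def mult.commute[of "r _" "r _"])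
  have i1: "integrable lborel (\<lambda>t. \<integral>s. indicator {..t} s * (r t * r s) \<partial>lborel)"
    by (rule fubini_kernel(2)[OF assms assms f(1)]) (simp add: indicator_def)
  have i2: "integrable lborel (\<lambda>t. \<integral>s. indicator {..s} t * (r t * r s) \<partial>lborel)"
    by (rule fubini_kernel(2)[OF assms assms f(2)]) (simp add: indicator_def)
  have "?I + ?I = (\<integral>t. (\<integral>s. indicator {..t} s * (r t * r s) \<partial>lborel) + (\<integral>s. indicator {..s} t * (r t * r s) \<partial>lborel) \<partial>lborel)"
    by (subst (1) 1, subst 2) (rule Bochner_Integration.integral_add[OF i1 i2, symmetric])
  also have "\<dots> = (\<integral>t. r t * (\<integral>s. r s \<partial>lborel) \<partial>lborel)"
  proof (intro Bochner_Integration.integral_cong refl)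
    fix t
    have j: "integrable lborel (\<lambda>s. indicator {..t} s * (r t * r s))" "integrable lborel (\<lambda>s. indicator {..s} t * (r t * r s))"
    proof -
      have [measurable]: "r \<in> borel_measurable borel" using assms by simp
      show "integrable lborel (\<lambda>s. indicator {..t} s * (r t * r s))"
        by (rule Bochner_Integration.integrable_bound[OF integrable_mult_right[OF assms, of "r t"]]) (auto simp: indicator_def)
      have "(\<lambda>s. indicator {..s} t :: real) = indicator {t..}" by (auto simp: indicator_def fun_eq_iff)
      then show "integrable lborel (\<lambda>s. indicator {..s} t * (r t * r s))"
        by (intro Bochner_Integration.integrable_bound[OF integrable_mult_right[OF assms, of "r t"]]) (auto simp: indicator_def)
    qed
    have "(\<integral>s. indicator {..t} s * (r t * r s) \<partial>lborel) + (\<integral>s. indicator {..s} t * (r t * r s) \<partial>lborel)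
        = (\<integral>s. indicator {..t} s * (r t * r s) + indicator {..s} t * (r t * r s) \<partial>lborel)"
      using j by simp
    also have "\<dots> = (\<integral>s. r t * r s \<partial>lborel)"
    proof (rule integral_cong_AE)
      show "AE s in lborel. indicator {..t} s * (r t * r s) + indicator {..s} t * (r t * r s) = r t * r s"
        using AE_lborel_singleton[of t] by eventually_elim (auto simp: indicator_def)
    qed (use j assms in auto)
    finally show "(\<integral>s. indicator {..t} s * (r t * r s) \<partial>lborel) + (\<integral>s. indicator {..s} t * (r t * r s) \<partial>lborel) = r t * (\<integral>s. r s \<partial>lborel)"
      by simp
  qed
  also have "\<dots> = (\<integral>t. r t \<partial>lborel)\<^sup>2" by (simp add: power2_eq_square)
  finally show ?thesis by simp
qed

lemma integral_by_parts_prim: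
  assumes r: "integrable lborel r" and q: "integrable lborel q"
  shows "(\<integral>t. r t * (\<integral>s. indicator {..s} t * q s \<partial>lborel) \<partial>lborel) = (\<integral>s. q s * prim r s \<partial>lborel)"
    and "integrable lborel (\<lambda>s. q s * prim r s)"
proof -
  have f: "case_prod (\<lambda>(x::real) (y::real). indicator {..x} y :: real) \<in> borel_measurable (borel \<Otimes>\<^sub>M borel)"
    "case_prod (\<lambda>(x::real) (y::real). indicator {..y} x :: real) \<in> borel_measurable (borel \<Otimes>\<^sub>M borel)"
    by (fact indicator_pair_measurable)+
  have "(\<integral>t. r t * (\<integral>s. indicator {..s} t * q s \<partial>lborel) \<partial>lborel) = (\<integral>t. (\<integral>s. indicator {..s} t * (r t * q s) \<partial>lborel) \<partial>lborel)"
    by (intro Bochner_Integration.integral_cong refl) (simp add: mult_ac flip: integral_mult_right_zero)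
  also have "\<dots> = (\<integral>s. (\<integral>t. indicator {..s} t * (r t * q s) \<partial>lborel) \<partial>lborel)"
    by (rule fubini_kernel(1)[OF r q f(2)]) (simp add: indicator_def)
  also have "\<dots> = (\<integral>s. q s * prim r s \<partial>lborel)"
    unfolding prim_def by (intro Bochner_Integration.integral_cong refl) (simp add: mult_ac flip: integral_mult_right_zero)
  finally show "(\<integral>t. r t * (\<integral>s. indicator {..s} t * q s \<partial>lborel) \<partial>lborel) = (\<integral>s. q s * prim r s \<partial>lborel)" .
  have "integrable lborel (\<lambda>s. (\<integral>t. indicator {..s} t * (q s * r t) \<partial>lborel))"
    by (rule fubini_kernel(2)[OF q r f(1)]) (simp add: indicator_def)
  moreover have "(\<lambda>s. (\<integral>t. indicator {..s} t * (q s * r t) \<partial>lborel)) = (\<lambda>s. q s * prim r s)"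
    unfolding prim_def by (intro ext) (simp add: mult_ac flip: integral_mult_right_zero)
  ultimately show "integrable lborel (\<lambda>s. q s * prim r s)" by simp
qed

text \<open>
  Polynomials are uniformly dense on a compact interval.
\<close>

lemma AE_zero_if_moments_zero:
  fixes f :: "real \<Rightarrow> real"
  assumes f: "integrable lborel f" and supp: "\<And>x. x \<notin> {0..T} \<Longrightarrow> f x = 0"
    and z: "\<And>i. (\<integral>t. f t * t ^ i \<partial>lborel) = 0"
  shows "AE x in lborel. f x = 0"
proof (rule AE_zero_if_tested[OF f supp])
  have [measurable]: "f \<in> borel_measurable borel" using f by simp
  fix \<phi> :: "real \<Rightarrow> real" assume c: "continuous_on UNIV \<phi>"
  have ib: "integrable lborel (\<lambda>t. f t * h t)" if h: "continuous_on UNIV h" for h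
  proof -
    have "bounded (h ` {0..T})" using continuous_on_subset[OF h] by (intro compact_imp_bounded compact_continuous_image) auto
    then obtain B where B: "\<forall>x\<in>h ` {0..T}. norm x \<le> B" unfolding bounded_iff by blast
    have [measurable]: "h \<in> borel_measurable borel" using h by (rule borel_measurable_continuous_onI)
    have le: "\<bar>f t * h t\<bar> \<le> B * \<bar>f t\<bar>" for t
    proof (cases "t \<in> {0..T}")
      case True
      then show ?thesis using B by (auto simp: abs_mult mult.commute[of B] intro!: mult_left_mono)
    qed (simp add: supp)
    have i: "integrable lborel (\<lambda>t. B * \<bar>f t\<bar>)" using f by simp
    have "norm (f t * h t) \<le> norm (B * \<bar>f t\<bar>)" for t
      using le[of t] abs_ge_self[of "B * \<bar>f t\<bar>"] unfolding real_norm_def by (rule order_trans)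
    then show ?thesis by (intro Bochner_Integration.integrable_bound[OF i] AE_I2) simp_all
  qed
  have le: "\<bar>\<integral>x. f x * \<phi> x \<partial>lborel\<bar> \<le> e * (\<integral>x. \<bar>f x\<bar> \<partial>lborel)" if e: "e > 0" for e
  proof -
    have "\<exists>g. real_polynomial_function g \<and> (\<forall>x\<in>{0..T}. \<bar>\<phi> x - g x\<bar> < e)"
    proof (rule Stone_Weierstrass_real_polynomial_function[OF compact_Icc[of 0 T] continuous_on_subset[OF c subset_UNIV] e])
      fix g :: "real \<Rightarrow> real" assume "real_polynomial_function g" "\<And>x. x \<in> {0..T} \<Longrightarrow> \<bar>\<phi> x - g x\<bar> < e"
      then show ?thesis by (intro exI[of _ g]) simp
    qed
    then obtain g where g: "real_polynomial_function g" "\<forall>x\<in>{0..T}. \<bar>\<phi> x - g x\<bar> < e" by (elim exE conjE)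
    obtain a n where gs: "g = (\<lambda>x. \<Sum>i\<le>n. a i * x ^ i)" using g(1) unfolding real_polynomial_function_iff_sum by blast
    have cg: "continuous_on UNIV g" unfolding gs by (intro continuous_intros)
    have im: "integrable lborel (\<lambda>t. f t * t ^ i)" for i by (rule ib) (intro continuous_intros)
    have "(\<integral>x. f x * g x \<partial>lborel) = (\<integral>x. (\<Sum>i\<le>n. a i * (f x * x ^ i)) \<partial>lborel)"
      unfolding gs sum_distrib_left by (intro Bochner_Integration.integral_cong sum.cong refl) simp
    also have "\<dots> = 0" using im z by simp
    finally have g0: "(\<integral>x. f x * g x \<partial>lborel) = 0" .
    have "(\<integral>x. f x * \<phi> x \<partial>lborel) = (\<integral>x. f x * \<phi> x - f x * g x \<partial>lborel)"
      unfolding Bochner_Integration.integral_diff[OF ib[OF c] ib[OF cg]] g0 by (rule diff_0_right[symmetric])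
    also have "\<dots> = (\<integral>x. f x * (\<phi> x - g x) \<partial>lborel)" by (simp only: right_diff_distrib)
    also have "\<bar>\<dots>\<bar> \<le> (\<integral>x. \<bar>f x * (\<phi> x - g x)\<bar> \<partial>lborel)" by (rule integral_abs_bound)
    also have "\<dots> \<le> (\<integral>x. e * \<bar>f x\<bar> \<partial>lborel)"
    proof (rule integral_mono)
      show "integrable lborel (\<lambda>x. \<bar>f x * (\<phi> x - g x)\<bar>)" using ib[OF continuous_on_diff[OF c cg]] by simp
      fix x show "\<bar>f x * (\<phi> x - g x)\<bar> \<le> e * \<bar>f x\<bar>"
      proof (cases "x \<in> {0..T}")
        case True
        then show ?thesis using g(2)[rule_format, OF True] by (simp add: abs_mult mult.commute[of e] mult_left_mono less_imp_le)
      qed (simp add: supp)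
    qed (use f in simp)
    finally show ?thesis by simp
  qed
  have "\<bar>\<integral>x. f x * \<phi> x \<partial>lborel\<bar> \<le> 0 + d" if d: "d > 0" for d
  proof -
    define I where "I = (\<integral>x. \<bar>f x\<bar> \<partial>lborel)"
    have I: "I \<ge> 0" by (simp add: I_def)
    have "d / (I + 1) > 0" using I d by simp
    from le[OF this, folded I_def] have "\<bar>\<integral>x. f x * \<phi> x \<partial>lborel\<bar> \<le> d / (I + 1) * I" .
    also have "\<dots> \<le> d" using I d by (simp add: field_simps)
    finally show ?thesis by simp
  qed
  then have "\<bar>\<integral>x. f x * \<phi> x \<partial>lborel\<bar> \<le> 0" by (rule field_le_epsilon)
  then show "(\<integral>x. f x * \<phi> x \<partial>lborel) = 0" by simp
qed

section \<open>Uniqueness of the weak solution\<close>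

lemma weak_dx_H1:
  assumes "f \<in> H1" shows "weak_dx f \<in> L2_torus \<and> generalized_deriv f (weak_dx f)"
proof -
  obtain g where "g \<in> L2_torus \<and> generalized_deriv f g" using assms by (auto simp: H1_def)
  then show ?thesis unfolding weak_dx_def by (rule someI[where P="\<lambda>g. g \<in> L2_torus \<and> generalized_deriv f g"])
qed

text \<open>
  The weak formulation for the test function \<open>p(t) E(x)\<close>, where \<open>E\<close> is an eigenfunction of the second
  derivative. Moving one derivative from the solution to \<open>E\<close> removes \<open>weak_dx\<close> from the identity.
\<close>

lemma weak_solution_tested:
  assumes W: "torus_measure W" and T: "T > 0" and v: "weak_solution W u0 T v"
    and E: "\<And>j x. (E j has_real_derivative E (Suc j) x) (at x)" and per: "torus_fun (E 0)"
    and E2: "\<And>x. E 2 x = - (w\<^sup>2) * E 0 x" and p: "poly p T = 0"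
    and Rm: "(\<lambda>t. indicator {0..T} t * (poly p t * (\<integral>x. E 0 x * v t x \<partial>Leb))) \<in> borel_measurable borel"
    and Pm: "(\<lambda>t. indicator {0..T} t * (poly (pderiv p) t * (\<integral>x. E 0 x * v t x \<partial>W))) \<in> borel_measurable borel"
  shows "poly p 0 * (\<integral>x. E 0 x * u0 x \<partial>W) + (\<integral>t. indicator {0..T} t * (poly (pderiv p) t * (\<integral>x. E 0 x * v t x \<partial>W)) \<partial>lborel)
       = w\<^sup>2 / 2 * (\<integral>t. indicator {0..T} t * (poly p t * (\<integral>x. E 0 x * v t x \<partial>Leb)) \<partial>lborel)"
proof -
  define G where "G t x = poly p t * E 0 x" for t x
  define D where "D i j t x = poly ((pderiv ^^ i) p) t * E j x" for i j :: nat and t x :: real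
  have Ec: "continuous_on UNIV (E j)" for j by (meson E DERIV_isCont continuous_at_imp_continuous_on)
  have Dt: "((\<lambda>s. D i j s x) has_real_derivative D (Suc i) j t x) (at t within S)" for i j t x S
    unfolding D_def by (auto intro!: derivative_eq_intros poly_DERIV DERIV_subset[OF poly_DERIV])
  have Dx: "(D i j t has_real_derivative D i (Suc j) t x) (at x)" for i j t x
    unfolding D_def[abs_def] by (intro DERIV_cmult E)
  have sm: "smooth_test T G"
    unfolding smooth_test_def
  proof (intro conjI ballI exI[of _ D] allI)
    show "torus_fun (G t)" for t using per by (simp add: torus_fun_def G_def)
    show "D 0 0 = G" by (simp add: fun_eq_iff D_def G_def)
    show "continuous_on ({0..T} \<times> UNIV) (\<lambda>(t, x). D i j t x)" for i j
      unfolding D_def split_def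
      by (intro continuous_intros continuous_on_compose2[OF Ec[of j]]) auto
  qed (use Dt Dx in auto)
  have GT: "G T x = 0" for x using p by (simp add: G_def)
  have eq: "inner_W W (G 0) u0 + (LINT t:{0..T}|lebesgue. inner_W W (dt T G t) (v t))
        = 1/2 * (LINT t:{0..T}|lebesgue. inner_L2 (deriv (G t)) (weak_dx (v t)))"
    using v sm GT unfolding weak_solution_def by blast
  have dG: "dt T G t x = poly (pderiv p) t * E 0 x" if "t \<in> {0..T}" for t x
    unfolding dt_def using Dt[of 0 0 x t "{0..T}"] T that
    by (intro vector_derivative_within_closed_interval) (auto simp: D_def G_def has_real_derivative_iff_has_vector_derivative)
  have 1: "inner_W W (G 0) u0 = poly p 0 * (\<integral>x. E 0 x * u0 x \<partial>W)"
    by (simp add: inner_W_def G_def mult.assoc)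
  have 2: "(LINT t:{0..T}|lebesgue. inner_W W (dt T G t) (v t))
     = (\<integral>t. indicator {0..T} t * (poly (pderiv p) t * (\<integral>x. E 0 x * v t x \<partial>W)) \<partial>lborel)"
    unfolding set_lebesgue_integral_def
    by (rule lebesgue_integral_cong_AE[OF Pm]) (auto simp: inner_W_def dG mult.assoc indicator_def intro!: AE_I2)
  have sE1: "torus_smooth (E 1)" "deriv (E 1) = E 2"
  proof -
    have d0: "deriv (E 0) = E 1" using E[of 0] by (auto intro!: DERIV_imp_deriv)
    have "torus_fun (E 1)" unfolding torus_fun_def
    proof
      fix x
      have "((\<lambda>y. E 0 (y + 1)) has_real_derivative E 1 (x + 1)) (at x)"
        using E[of 0 "x + 1"] by (simp add: DERIV_shift)
      moreover have "(\<lambda>y. E 0 (y + 1)) = E 0" using per by (auto simp: torus_fun_def)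
      ultimately show "E 1 (x + 1) = E 1 x" using E[of 0 x] DERIV_unique by fastforce
    qed
    then show "torus_smooth (E 1)" by (rule torus_smoothI(1)[where D="\<lambda>j. E (Suc j)"]) (use E in auto)
    show "deriv (E 1) = E 2" using E[of 1] by (auto intro!: DERIV_imp_deriv simp: numeral_2_eq_2)
  qed
  have 3: "(LINT t:{0..T}|lebesgue. inner_L2 (deriv (G t)) (weak_dx (v t)))
     = (\<integral>t. w\<^sup>2 * (indicator {0..T} t * (poly p t * (\<integral>x. E 0 x * v t x \<partial>Leb))) \<partial>lborel)"
    unfolding set_lebesgue_integral_def
  proof (rule lebesgue_integral_cong_AE)
    show "(\<lambda>t. w\<^sup>2 * (indicator {0..T} t * (poly p t * (\<integral>x. E 0 x * v t x \<partial>Leb)))) \<in> borel_measurable borel"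
      using Rm by simp
    have "AE t in lborel. t \<in> {0..T} \<longrightarrow> v t \<in> H1 \<and> torus_continuous (v t)"
      using v unfolding weak_solution_def by (simp add: AE_completion_iff)
    then show "AE t in lborel. indicat_real {0..T} t *\<^sub>R inner_L2 (deriv (G t)) (weak_dx (v t))
        = w\<^sup>2 * (indicator {0..T} t * (poly p t * (\<integral>x. E 0 x * v t x \<partial>Leb)))"
    proof eventually_elim
      case (elim t)
      show ?case
      proof (cases "t \<in> {0..T}")
        case True
        with elim have H: "v t \<in> H1" and c: "continuous_on UNIV (v t)" by (auto simp: torus_continuous_def)
        have gd: "generalized_deriv (v t) (weak_dx (v t))" using weak_dx_H1[OF H] by simp
        have "(G t has_real_derivative poly p t * E 1 x) (at x)" for x
          unfolding G_def[abs_def] One_nat_def by (intro DERIV_cmult E)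
        then have "deriv (G t) = (\<lambda>x. poly p t * E 1 x)" by (intro ext DERIV_imp_deriv)
        then have "inner_L2 (deriv (G t)) (weak_dx (v t)) = poly p t * inner_L2 (weak_dx (v t)) (E 1)"
          unfolding inner_L2_def set_lebesgue_integral_def
          by (simp add: mult_ac flip: integral_mult_right_zero)
        also have "inner_L2 (weak_dx (v t)) (E 1) = - inner_L2 (v t) (E 2)"
        proof -
          have "inner_L2 (v t) (deriv (E 1)) = - inner_L2 (weak_dx (v t)) (E 1)"
            using gd sE1(1) unfolding generalized_deriv_def by blast
          then show ?thesis unfolding sE1(2) by linarith
        qed
        also have "inner_L2 (v t) (E 2) = (\<integral>x. v t x * E 2 x \<partial>Leb)"
          unfolding inner_L2_def set_lebesgue_integral_def integral_Leb
          using borel_measurable_continuous_onI[OF c] borel_measurable_continuous_onI[OF Ec[of 2]]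
          by (subst integral_completion) auto
        also have "\<dots> = - (w\<^sup>2) * (\<integral>x. E 0 x * v t x \<partial>Leb)"
          unfolding E2 integral_mult_right_zero[symmetric] by (intro Bochner_Integration.integral_cong refl) (simp add: mult_ac)
        finally show ?thesis using True by simp
      qed simp
    qed
  qed
  show ?thesis using eq unfolding 1 2 3 by simp
qed

text \<open>
  This is where the positivity of \<open>W\<close> on open sets enters: a continuous function is determined by its
  class modulo \<open>W\<close>.
\<close>

lemma torus_continuous_zero:
  assumes W: "torus_measure W" "positive_on_open W" and f: "torus_continuous f" and z: "(\<integral>x. (f x)\<^sup>2 \<partial>W) = 0"
  shows "f x = 0"
proof (rule ccontr)
  assume nz: "f x \<noteq> 0"
  have c: "continuous_on UNIV f" and p: "torus_fun f" using f by (auto simp: torus_continuous_def)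
  obtain C where C: "\<And>x. \<bar>f x\<bar> \<le> C" using torus_continuous_bounded[OF f] by blast
  have i: "integrable W (\<lambda>x. (f x)\<^sup>2)"
  proof (rule torus_integrable[OF W(1), where C="C\<^sup>2"])
    show "(\<lambda>x. (f x)\<^sup>2) \<in> borel_measurable borel" using c by (intro borel_measurable_power borel_measurable_continuous_onI)
    show "\<bar>(f y)\<^sup>2\<bar> \<le> C\<^sup>2" for y using power_mono[OF C[of y] abs_ge_zero, of 2] by simp
  qed
  have ae: "AE x in W. f x = 0" using integral_nonneg_eq_0_iff_AE[OF i] z by auto
  let ?A = "{y. f y \<noteq> 0}"
  have "open (f -` (- {0}))" using c by (intro open_vimage) auto
  then have "torus_open ?A" using p by (auto simp: torus_open_def torus_fun_def vimage_def Compl_eq)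
  then have pos: "emeasure W (?A \<inter> {0..<1}) > 0" using W(2) nz by (auto simp: positive_on_open_def)
  have e: "?A = f -` (- {0})" by auto
  have A: "?A \<in> sets borel" unfolding e by (rule borel_open) fact
  have "{0..<1::real} \<in> sets borel" by (rule atLeastLessThan_borel)
  from torus_sets[OF W(1) sets.Int[OF A this] Int_lower2] have m: "?A \<inter> {0..<1} \<in> sets W" .
  have "AE x in W. x \<notin> ?A \<inter> {0..<1}" using ae by (rule AE_mp) (rule AE_I2, blast)
  then have "?A \<inter> {0..<1} \<in> null_sets W" using AE_iff_null_sets[OF m] by (rule iffD2[rotated])
  then have "emeasure W (?A \<inter> {0..<1}) = 0" by (rule null_setsD1)
  then show False using pos by simp
qed

lemma joint_measurable_extension:
  fixes u :: "real \<Rightarrow> real \<Rightarrow> real"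
  assumes "(\<lambda>(t, x). u t x) \<in> borel_measurable (restrict_space borel ({0..T} \<times> UNIV))"
  shows "(\<lambda>(t, x). if t \<in> {0..T} then u t x else 0) \<in> borel_measurable (borel :: (real \<times> real) measure)"
proof -
  have "{0..T} \<times> (UNIV :: real set) \<in> sets borel" by (intro borel_closed closed_Times) auto
  then have "(\<lambda>z. indicator ({0..T} \<times> UNIV) z *\<^sub>R (case z of (t, x) \<Rightarrow> u t x)) \<in> borel_measurable (borel :: (real \<times> real) measure)"
    using assms by (simp add: borel_measurable_restrict_space_iff)
  moreover have "(\<lambda>z. indicator ({0..T} \<times> UNIV) z *\<^sub>R (case z of (t, x) \<Rightarrow> u t x)) = (\<lambda>(t, x). if t \<in> {0..T} then u t x else 0)"
    by (auto simp: fun_eq_iff indicator_def)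
  ultimately show ?thesis by simp
qed

lemma integral_measurable_param:
  assumes W: "torus_measure W" and V: "(\<lambda>(t, x). V t x) \<in> borel_measurable (borel :: (real \<times> real) measure)"
  shows "(\<lambda>t. \<integral>x. V t x \<partial>W :: real) \<in> borel_measurable borel"
proof -
  interpret finite_measure W by (rule torus_measureD(1)[OF W])
  have "(\<lambda>x. x) \<in> measurable W borel" using torus_measurable[OF W, of "\<lambda>x. x"] by simp
  then have "(\<lambda>z. (fst z, snd z)) \<in> measurable ((borel :: real measure) \<Otimes>\<^sub>M W) (borel \<Otimes>\<^sub>M borel)"
    by (intro measurable_Pair measurable_fst measurable_compose[OF measurable_snd])
  from measurable_compose[OF this[unfolded borel_prod] V]
  have "(\<lambda>z. (case (fst z, snd z) of (t, x) \<Rightarrow> V t x)) \<in> borel_measurable (borel \<Otimes>\<^sub>M W)" .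
  then have "case_prod V \<in> borel_measurable (borel \<Otimes>\<^sub>M W)" by (simp add: split_def)
  then show ?thesis by (rule borel_measurable_lebesgue_integral)
qed

lemma integrable_bounded_supp:
  assumes "f \<in> borel_measurable borel" "\<And>t. t \<in> {0..T} \<Longrightarrow> \<bar>f t\<bar> \<le> B" "\<And>t. t \<notin> {0..T} \<Longrightarrow> f t = 0" and T: "T > 0"
  shows "integrable lborel (f :: real \<Rightarrow> real)"
proof (rule Bochner_Integration.integrable_bound[where f="\<lambda>t. B * indicator {0..T} t"])
  show "AE t in lborel. norm (f t) \<le> norm (B * indicator {0..T} t)"
  proof (rule AE_I2)
    fix t
    show "norm (f t) \<le> norm (B * indicator {0..T} t)"
      using assms(2,3)[of t] abs_ge_self[of B] by (cases "t \<in> {0..T}") auto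
  qed
  have "integrable lborel (indicator {0..T} :: real \<Rightarrow> real)" using T by simp
  then show "integrable lborel (\<lambda>t. B * indicator {0..T} t)" by simp
qed (use assms in auto)

lemma weak_solution_pairing:
  assumes v: "weak_solution W u0 T v" and U: "torus_measure U"
    and e: "e \<in> borel_measurable borel" and e1: "\<And>x. \<bar>e x\<bar> \<le> 1"
  shows "(\<lambda>t. indicator {0..T} t * (\<integral>x. e x * v t x \<partial>U)) \<in> borel_measurable borel"
    and "\<And>t. t \<in> {0..T} \<Longrightarrow> integrable U (\<lambda>x. e x * v t x)"
    and "\<exists>B. \<forall>t\<in>{0..T}. \<bar>\<integral>x. e x * v t x \<partial>U\<bar> \<le> B"
proof -
  interpret finite_measure U by (rule torus_measureD(1)[OF U])
  let ?V = "\<lambda>t x. if t \<in> {0..T} then v t x else 0"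
  have V: "(\<lambda>(t, x). ?V t x) \<in> borel_measurable (borel :: (real \<times> real) measure)"
    using v by (intro joint_measurable_extension) (simp add: weak_solution_def)
  have "(\<lambda>z. e (snd z)) \<in> borel_measurable (borel :: (real \<times> real) measure)"
    using e by (intro measurable_compose[OF _ e]) (simp flip: borel_prod)
  then have m: "(\<lambda>z. e (snd z) * (case z of (t, x) \<Rightarrow> ?V t x)) \<in> borel_measurable (borel :: (real \<times> real) measure)"
    using V by (rule borel_measurable_times)
  have "(\<lambda>t. \<integral>x. e x * ?V t x \<partial>U) \<in> borel_measurable borel"
    using m by (intro integral_measurable_param[OF U]) (simp add: split_def)
  moreover have "(\<lambda>t. indicator {0..T} t * (\<integral>x. e x * v t x \<partial>U)) = (\<lambda>t. \<integral>x. e x * ?V t x \<partial>U)"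
    by (auto simp: fun_eq_iff indicator_def)
  ultimately show "(\<lambda>t. indicator {0..T} t * (\<integral>x. e x * v t x \<partial>U)) \<in> borel_measurable borel" by (simp only:)
  obtain C where C: "\<forall>t\<in>{0..T}. \<forall>x. \<bar>v t x\<bar> \<le> C" using v unfolding weak_solution_def by blast
  have *: "integrable U (\<lambda>x. e x * v t x) \<and> \<bar>\<integral>x. e x * v t x \<partial>U\<bar> \<le> \<bar>C\<bar> * measure U {0..<1}"
    if t: "t \<in> {0..T}" for t
  proof
    have "(\<lambda>x. (t, x)) \<in> measurable borel (borel :: (real \<times> real) measure)" unfolding borel_prod[symmetric] by measurable
    from measurable_compose[OF this V] t have vm: "v t \<in> borel_measurable borel" by simp
    have le: "\<bar>e x * v t x\<bar> \<le> \<bar>C\<bar>" for x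
    proof -
      have "\<bar>v t x\<bar> \<le> \<bar>C\<bar>" using C[rule_format, OF t, of x] abs_ge_self[of C] by linarith
      then show ?thesis using mult_mono[OF e1[of x], of "\<bar>v t x\<bar>" "\<bar>C\<bar>"] by (simp add: abs_mult)
    qed
    have "(\<lambda>x. e x * v t x) \<in> borel_measurable borel" using e vm by (rule borel_measurable_times)
    then show i: "integrable U (\<lambda>x. e x * v t x)"
      using le by (rule torus_integrable[OF U])
    have "\<bar>\<integral>x. e x * v t x \<partial>U\<bar> \<le> (\<integral>x. \<bar>e x * v t x\<bar> \<partial>U)" by (rule integral_abs_bound)
    also have "\<dots> \<le> (\<integral>x. \<bar>C\<bar> \<partial>U)" using i le by (intro integral_mono) auto
    also have "\<dots> = \<bar>C\<bar> * measure U {0..<1}" using torus_measureD(3)[OF U] by (simp add: mult.commute)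
    finally show "\<bar>\<integral>x. e x * v t x \<partial>U\<bar> \<le> \<bar>C\<bar> * measure U {0..<1}" .
  qed
  show "\<exists>B. \<forall>t\<in>{0..T}. \<bar>\<integral>x. e x * v t x \<partial>U\<bar> \<le> B"
    by (rule exI[of _ "\<bar>C\<bar> * measure U {0..<1}"]) (rule ballI, rule conjunct2[OF *])
  show "integrable U (\<lambda>x. e x * v t x)" if "t \<in> {0..T}" for t by (rule conjunct1[OF *[OF that]])
qed

lemma weak_solution_pairing_poly:
  assumes v: "weak_solution W u0 T v" and U: "torus_measure U" and T: "T > 0"
    and e: "e \<in> borel_measurable borel" and e1: "\<And>x. \<bar>e x\<bar> \<le> 1"
  shows "(\<lambda>t. indicator {0..T} t * (poly q t * (\<integral>x. e x * v t x \<partial>U))) \<in> borel_measurable borel" (is "?m")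
    and "integrable lborel (\<lambda>t. indicator {0..T} t * (poly q t * (\<integral>x. e x * v t x \<partial>U)))"
proof -
  have "poly q \<in> borel_measurable borel" by (intro borel_measurable_continuous_onI continuous_intros)
  then have "(\<lambda>t. poly q t * (indicator {0..T} t * (\<integral>x. e x * v t x \<partial>U))) \<in> borel_measurable borel"
    using weak_solution_pairing(1)[OF v U e e1] by (rule borel_measurable_times)
  then show m: ?m by (simp only: mult.left_commute)
  obtain B where B: "\<forall>t\<in>{0..T}. \<bar>\<integral>x. e x * v t x \<partial>U\<bar> \<le> B" using weak_solution_pairing(3)[OF v U e e1] by (elim exE)
  have "bounded (poly q ` {0..T})" by (intro compact_imp_bounded compact_continuous_image continuous_intros) auto
  then obtain Q where Q: "\<forall>y\<in>poly q ` {0..T}. norm y \<le> Q" unfolding bounded_iff by (elim exE)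
  show "integrable lborel (\<lambda>t. indicator {0..T} t * (poly q t * (\<integral>x. e x * v t x \<partial>U)))"
  proof (rule integrable_bounded_supp[OF m _ _ T, where B="Q * B"])
    fix t assume t: "t \<in> {0..T}"
    have q: "\<bar>poly q t\<bar> \<le> Q" using Q t by simp
    have "\<bar>poly q t\<bar> * \<bar>\<integral>x. e x * v t x \<partial>U\<bar> \<le> Q * B"
      using q B[rule_format, OF t] order_trans[OF abs_ge_zero q] by (intro mult_mono) auto
    then show "\<bar>indicator {0..T} t * (poly q t * (\<integral>x. e x * v t x \<partial>U))\<bar> \<le> Q * B"
      using t by (simp add: abs_mult)
  qed simp
qed

text \<open>
  The initial condition enters the weak formulation linearly, so it drops out of the difference.
\<close>

locale solution_difference =
  fixes W :: "real measure" and T :: real and u0 :: "real \<Rightarrow> real" and v1 v2 :: "real \<Rightarrow> real \<Rightarrow> real"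
  assumes W: "torus_measure W" "positive_on_open W" and T: "T > 0"
    and v1: "weak_solution W u0 T v1" and v2: "weak_solution W u0 T v2"
begin

definition d :: "real \<Rightarrow> real \<Rightarrow> real" where "d t x = (if t \<in> {0..T} then v1 t x - v2 t x else 0)"

lemma d_measurable: "(\<lambda>(t, x). d t x) \<in> borel_measurable (borel :: (real \<times> real) measure)"
proof -
  have 1: "(\<lambda>(t, x). if t \<in> {0..T} then v1 t x else 0) \<in> borel_measurable (borel :: (real \<times> real) measure)"
    using v1 by (intro joint_measurable_extension) (simp add: weak_solution_def)
  have 2: "(\<lambda>(t, x). if t \<in> {0..T} then v2 t x else 0) \<in> borel_measurable (borel :: (real \<times> real) measure)"
    using v2 by (intro joint_measurable_extension) (simp add: weak_solution_def)
  have "(\<lambda>(t, x). d t x) = (\<lambda>z. (case z of (t, x) \<Rightarrow> if t \<in> {0..T} then v1 t x else 0) - (case z of (t, x) \<Rightarrow> if t \<in> {0..T} then v2 t x else 0))"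
    by (auto simp: d_def fun_eq_iff)
  then show ?thesis using borel_measurable_diff[OF 1 2] by simp
qed

lemma d_bounded: obtains C where "C \<ge> 0" "\<And>t x. \<bar>d t x\<bar> \<le> C"
proof -
  obtain C1 where C1: "\<forall>t\<in>{0..T}. \<forall>x. \<bar>v1 t x\<bar> \<le> C1" using v1 unfolding weak_solution_def by blast
  obtain C2 where C2: "\<forall>t\<in>{0..T}. \<forall>x. \<bar>v2 t x\<bar> \<le> C2" using v2 unfolding weak_solution_def by blast
  have "\<bar>d t x\<bar> \<le> \<bar>C1\<bar> + \<bar>C2\<bar>" for t x
    using C1[rule_format, of t x] C2[rule_format, of t x] unfolding d_def by (cases "t \<in> {0..T}") auto
  then show ?thesis by (intro that[of "\<bar>C1\<bar> + \<bar>C2\<bar>"]) auto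
qed

lemma AE_d_continuous: "AE t in lborel. torus_continuous (d t)"
proof -
  have "AE t in lborel. t \<in> {0..T} \<longrightarrow> torus_continuous (v1 t)"
    using v1 unfolding weak_solution_def by (auto simp: AE_completion_iff)
  moreover have "AE t in lborel. t \<in> {0..T} \<longrightarrow> torus_continuous (v2 t)"
    using v2 unfolding weak_solution_def by (auto simp: AE_completion_iff)
  ultimately show ?thesis
  proof eventually_elim
    case (elim t)
    show ?case
    proof (cases "t \<in> {0..T}")
      case True
      then have "d t = (\<lambda>x. v1 t x - v2 t x)" by (auto simp: d_def)
      then show ?thesis using elim True by (auto simp: torus_continuous_def torus_fun_def intro!: continuous_intros)
    next
      case False
      then have "d t = (\<lambda>x. 0)" by (auto simp: d_def)
      then show ?thesis by (simp add: torus_continuous_def torus_fun_def)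
    qed
  qed
qed

lemma d_section_measurable: "d t \<in> borel_measurable borel"
proof -
  have "(\<lambda>x. (t, x)) \<in> measurable borel (borel :: (real \<times> real) measure)" unfolding borel_prod[symmetric] by measurable
  from measurable_compose[OF this d_measurable] show ?thesis by simp
qed

definition pairW :: "(real \<Rightarrow> real) \<Rightarrow> real \<Rightarrow> real" where "pairW e t = (\<integral>x. e x * d t x \<partial>W)"
definition pairL :: "(real \<Rightarrow> real) \<Rightarrow> real \<Rightarrow> real" where "pairL e t = (\<integral>x. d t x * e x \<partial>Leb)"

lemma pair_measurable:
  assumes "e \<in> borel_measurable borel"
  shows "pairW e \<in> borel_measurable borel" "pairL e \<in> borel_measurable borel"
proof -
  have "(\<lambda>z. e (snd z)) \<in> borel_measurable (borel :: (real \<times> real) measure)"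
    using assms by (intro measurable_compose[OF _ assms]) (simp flip: borel_prod)
  then have m: "(\<lambda>z. e (snd z) * (case z of (t, x) \<Rightarrow> d t x)) \<in> borel_measurable (borel :: (real \<times> real) measure)"
    using d_measurable by (rule borel_measurable_times)
  then show "pairW e \<in> borel_measurable borel" unfolding pairW_def[abs_def]
    by (intro integral_measurable_param[OF W(1)]) (simp add: split_def)
  show "pairL e \<in> borel_measurable borel" unfolding pairL_def[abs_def]
    using m by (intro integral_measurable_param[OF torus_Leb]) (simp add: split_def mult.commute)
qed

lemma pair_bounded:
  assumes "e \<in> borel_measurable borel" "\<And>x. \<bar>e x\<bar> \<le> 1"
  obtains B where "\<And>t. \<bar>pairW e t\<bar> \<le> B" "\<And>t. \<bar>pairL e t\<bar> \<le> B"
proof -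
  obtain C where C: "C \<ge> 0" "\<And>t x. \<bar>d t x\<bar> \<le> C" using d_bounded by blast
  have b: "\<bar>\<integral>x. e x * d t x \<partial>U\<bar> \<le> C * measure U {0..<1}" if U: "torus_measure U" for U t
  proof -
    interpret finite_measure U by (rule torus_measureD(1)[OF U])
    have le: "\<bar>e x * d t x\<bar> \<le> C" for x
      using mult_mono[OF assms(2)[of x] C(2)[of t x]] by (simp add: abs_mult)
    have i: "integrable U (\<lambda>x. e x * d t x)"
      by (rule torus_integrable[OF U, where C=C]) (use le assms d_section_measurable in auto)
    have "\<bar>\<integral>x. e x * d t x \<partial>U\<bar> \<le> (\<integral>x. \<bar>e x * d t x\<bar> \<partial>U)" by (rule integral_abs_bound)
    also have "\<dots> \<le> (\<integral>x. C \<partial>U)" using i le by (intro integral_mono) auto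
    finally show ?thesis using torus_measureD(3)[OF U] by (simp add: mult.commute)
  qed
  show ?thesis
  proof (rule that)
    show "\<bar>pairW e t\<bar> \<le> max (C * measure W {0..<1}) (C * measure Leb {0..<1})" for t
      using b[OF W(1), of t] by (simp add: pairW_def)
    show "\<bar>pairL e t\<bar> \<le> max (C * measure W {0..<1}) (C * measure Leb {0..<1})" for t
      using b[OF torus_Leb, of t] by (simp add: pairL_def mult.commute)
  qed
qed

lemma pair_zero: "t \<notin> {0..T} \<Longrightarrow> pairW e t = 0" "t \<notin> {0..T} \<Longrightarrow> pairL e t = 0"
  by (auto simp: pairW_def pairL_def d_def)

text \<open>
  A Fourier coefficient of the difference against \<open>W\<close> is the time primitive of the one against
  Lebesgue measure, multiplied by the eigenvalue of half the second derivative. Testing with the polynomials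
  \<open>(t\<^bsup>i+1\<^esup> - T\<^bsup>i+1\<^esup>) / (i+1)\<close>, which vanish at \<open>T\<close> and have derivative \<open>t\<^sup>i\<close>, shows that all moments of the
  two sides agree.
\<close>

lemma pair_relation:
  assumes E: "\<And>j x. (E j has_real_derivative E (Suc j) x) (at x)" and per: "torus_fun (E 0)"
    and E2: "\<And>x. E 2 x = - (w\<^sup>2) * E 0 x" and E1: "\<And>x. \<bar>E 0 x\<bar> \<le> 1"
  shows "AE t in lborel. t \<in> {0..T} \<longrightarrow> pairW (E 0) t = - (w\<^sup>2 / 2) * prim (pairL (E 0)) t"
proof -
  have Em: "E 0 \<in> borel_measurable borel"
    by (intro borel_measurable_continuous_onI) (meson E DERIV_isCont continuous_at_imp_continuous_on)
  note pm[measurable] = pair_measurable[OF Em]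
  obtain B where B: "\<And>t. \<bar>pairW (E 0) t\<bar> \<le> B" "\<And>t. \<bar>pairL (E 0) t\<bar> \<le> B" using pair_bounded[OF Em E1] by blast
  have iW: "integrable lborel (pairW (E 0))" and iL: "integrable lborel (pairL (E 0))"
    by (rule integrable_bounded_supp[OF pm(1) B(1) pair_zero(1) T], assumption, rule integrable_bounded_supp[OF pm(2) B(2) pair_zero(2) T], assumption)
  let ?R = "prim (pairL (E 0))"
  define f where "f t = indicator {0..T} t * (pairW (E 0) t + w\<^sup>2 / 2 * ?R t)" for t
  have iq: "integrable lborel (\<lambda>t. indicator {0..T} t * t ^ i)" for i :: nat
    by (rule integrable_bounded_supp[where B="T ^ i" and T=T]) (use T in \<open>auto simp: indicator_def abs_mult intro!: power_mono\<close>)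
  note parts = integral_by_parts_prim[OF iL iq]
  have iP: "integrable lborel (\<lambda>t. (indicator {0..T} t * t ^ i) * pairW (E 0) t)" for i :: nat
  proof (rule integrable_bounded_supp[where B="T ^ i * B" and T=T])
    fix t assume "t \<in> {0..T}"
    then show "\<bar>(indicator {0..T} t * t ^ i) * pairW (E 0) t\<bar> \<le> T ^ i * B"
      using B(1)[of t] by (auto simp: abs_mult intro!: mult_mono power_mono)
  qed (use T in auto)
  have moment: "(\<integral>t. f t * t ^ i \<partial>lborel) = 0" for i :: nat
  proof -
    define p :: "real poly" where "p = smult (1 / real (Suc i)) (monom 1 (Suc i) - [:T ^ Suc i:])"
    have pp: "pderiv p = monom 1 i" unfolding p_def by (simp add: pderiv_smult pderiv_diff pderiv_monom smult_monom)
    have pt: "poly p t = (t ^ Suc i - T ^ Suc i) / real (Suc i)" for t by (simp add: p_def poly_monom)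
    have pT: "poly p T = 0" by (simp add: pt)
    note S = weak_solution_pairing_poly(1)[OF _ torus_Leb T Em E1, of W u0 _ p] weak_solution_pairing_poly(1)[OF _ W(1) T Em E1, of W u0 _ "pderiv p"]
    note I = weak_solution_pairing_poly(2)[OF _ torus_Leb T Em E1, of W u0 _ p] weak_solution_pairing_poly(2)[OF _ W(1) T Em E1, of W u0 _ "pderiv p"]
    note w = weak_solution_tested[OF W(1) T _ E per E2 pT S]
    have dW: "(\<integral>x. E 0 x * v1 t x \<partial>W) - (\<integral>x. E 0 x * v2 t x \<partial>W) = pairW (E 0) t"
      and dL: "(\<integral>x. E 0 x * v1 t x \<partial>Leb) - (\<integral>x. E 0 x * v2 t x \<partial>Leb) = pairL (E 0) t" if t: "t \<in> {0..T}" for t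
    proof -
      note i = weak_solution_pairing(2)[OF _ _ Em E1 t]
      show "(\<integral>x. E 0 x * v1 t x \<partial>W) - (\<integral>x. E 0 x * v2 t x \<partial>W) = pairW (E 0) t"
        unfolding pairW_def Bochner_Integration.integral_diff[OF i[OF v1 W(1)] i[OF v2 W(1)], symmetric]
        by (intro Bochner_Integration.integral_cong refl) (use t in \<open>simp add: d_def right_diff_distrib\<close>)
      show "(\<integral>x. E 0 x * v1 t x \<partial>Leb) - (\<integral>x. E 0 x * v2 t x \<partial>Leb) = pairL (E 0) t"
        unfolding pairL_def Bochner_Integration.integral_diff[OF i[OF v1 torus_Leb] i[OF v2 torus_Leb], symmetric]
        by (intro Bochner_Integration.integral_cong refl) (use t in \<open>simp add: d_def algebra_simps\<close>)
    qed
    have X: "(\<integral>t. indicator {0..T} t * (poly (pderiv p) t * (\<integral>x. E 0 x * v1 t x \<partial>W)) \<partial>lborel)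
        - (\<integral>t. indicator {0..T} t * (poly (pderiv p) t * (\<integral>x. E 0 x * v2 t x \<partial>W)) \<partial>lborel)
        = (\<integral>t. (indicator {0..T} t * t ^ i) * pairW (E 0) t \<partial>lborel)"
      by (subst Bochner_Integration.integral_diff[OF I(2)[OF v1] I(2)[OF v2], symmetric])
         (intro Bochner_Integration.integral_cong refl, auto simp: indicator_def pp poly_monom dW[symmetric] right_diff_distrib)
    have Y: "(\<integral>t. indicator {0..T} t * (poly p t * (\<integral>x. E 0 x * v1 t x \<partial>Leb)) \<partial>lborel)
        - (\<integral>t. indicator {0..T} t * (poly p t * (\<integral>x. E 0 x * v2 t x \<partial>Leb)) \<partial>lborel)
        = (\<integral>t. pairL (E 0) t * poly p t \<partial>lborel)"
      by (subst Bochner_Integration.integral_diff[OF I(1)[OF v1] I(1)[OF v2], symmetric])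
         (intro Bochner_Integration.integral_cong refl, auto simp: indicator_def dL[symmetric] pair_zero algebra_simps)
    have Z: "(\<integral>t. pairL (E 0) t * poly p t \<partial>lborel) = - (\<integral>t. (indicator {0..T} t * t ^ i) * ?R t \<partial>lborel)"
    proof -
      have "poly p t = - (\<integral>s. indicator {..s} t * (indicator {0..T} s * s ^ i) \<partial>lborel)" if t: "t \<in> {0..T}" for t
      proof -
        have "(\<integral>s. indicator {..s} t * (indicator {0..T} s * s ^ i) \<partial>lborel) = (\<integral>s. s ^ i * indicator {t..T} s \<partial>lborel)"
          using t by (intro Bochner_Integration.integral_cong refl) (auto simp: indicator_def)
        also have "\<dots> = T ^ Suc i / real (Suc i) - t ^ Suc i / real (Suc i)"
          using t by (intro integral_FTC_Icc_real) (auto intro!: derivative_eq_intros simp del: power_Suc of_nat_Suc)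
        finally show ?thesis by (simp add: pt diff_divide_distrib del: power_Suc of_nat_Suc)
      qed
      then have "pairL (E 0) t * poly p t = - (pairL (E 0) t * (\<integral>s. indicator {..s} t * (indicator {0..T} s * s ^ i) \<partial>lborel))" for t
        by (cases "t \<in> {0..T}") (simp_all add: pair_zero(2))
      then show ?thesis using parts(1)[of i] by simp
    qed
    have mi: "(\<integral>t. (indicator {0..T} t * t ^ i) * pairW (E 0) t \<partial>lborel) = - (w\<^sup>2 / 2) * (\<integral>t. (indicator {0..T} t * t ^ i) * ?R t \<partial>lborel)"
    proof -
      have lin: "X = - c * z" if "p0 + a1 = c * b1" "p0 + a2 = c * b2" "a1 - a2 = X" "b1 - b2 = Y" "Y = - z" for p0 a1 a2 b1 b2 c X Y z :: real
      proof -
        have "a1 - a2 = c * (b1 - b2)" using that(1,2) by (simp add: right_diff_distrib)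
        then show ?thesis using that by simp
      qed
      show ?thesis by (rule lin[OF w[OF v1 v1 v1] w[OF v2 v2 v2] X Y Z])
    qed
    have "(\<integral>t. f t * t ^ i \<partial>lborel) = (\<integral>t. (indicator {0..T} t * t ^ i) * pairW (E 0) t + w\<^sup>2 / 2 * ((indicator {0..T} t * t ^ i) * ?R t) \<partial>lborel)"
      by (intro Bochner_Integration.integral_cong refl) (simp add: f_def algebra_simps)
    also have "\<dots> = (\<integral>t. (indicator {0..T} t * t ^ i) * pairW (E 0) t \<partial>lborel) + w\<^sup>2 / 2 * (\<integral>t. (indicator {0..T} t * t ^ i) * ?R t \<partial>lborel)"
      by (subst Bochner_Integration.integral_add[OF iP integrable_mult_right[OF parts(2)]]) (simp only: integral_mult_right_zero)
    finally show ?thesis unfolding mi by linarith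
  qed
  have "AE t in lborel. f t = 0"
  proof (rule AE_zero_if_moments_zero[where T=T])
    have "integrable lborel (\<lambda>t. (indicator {0..T} t * t ^ 0) * pairW (E 0) t + w\<^sup>2 / 2 * ((indicator {0..T} t * t ^ 0) * ?R t))"
      by (intro Bochner_Integration.integrable_add integrable_mult_right iP parts(2))
    then show "integrable lborel f" by (simp add: f_def[abs_def] algebra_simps)
    show "f x = 0" if "x \<notin> {0..T}" for x using that by (simp add: f_def)
  qed (rule moment)
  then show ?thesis by eventually_elim (auto simp: f_def indicator_def of_bool_def)
qed

text \<open>
  The quadratic form \<open>\<integral>\<integral> d\<^sup>2 dW dt\<close> is approached by replacing one factor by its convolution with
  \<open>kern n\<close>. In Fourier modes the result is a combination, with the nonnegative coefficients of the
  kernel, of terms \<open>- w\<^sup>2/2 \<integral> r (\<integral>\<^sub>0\<^sup>t r) dt\<close>, which are not positive by \<open>integral_times_prim\<close>.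
\<close>

lemma AE_d_zero: "AE t in lborel. d t = (\<lambda>x. 0)"
proof -
  interpret finite_measure W by (rule torus_measureD(1)[OF W(1)])
  obtain C where C: "C \<ge> 0" "\<And>t x. \<bar>d t x\<bar> \<le> C" using d_bounded by blast
  define J where "J n t = (\<integral>x. smooth_approx n (d t) x * d t x \<partial>W)" for n t
  define w where "w n k = 2 * pi * (real k - real n)" for n k :: nat
  have cm: "cosf n k \<in> borel_measurable borel" "sinf n k \<in> borel_measurable borel" for n k
    unfolding cosf_def[abs_def] sinf_def[abs_def] by measurable
  have c1: "\<bar>cosf n k x\<bar> \<le> 1" "\<bar>sinf n k x\<bar> \<le> 1" for n k x by (simp_all add: cosf_def sinf_def)
  have di: "integrable U (d t)" if "torus_measure U" for U t
    using C(2) by (intro torus_integrable[OF that d_section_measurable, of _ C]) auto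
  have dei: "integrable U (\<lambda>x. e x * d t x)" if U: "torus_measure U" and e: "e \<in> borel_measurable borel" "\<And>x. \<bar>e x\<bar> \<le> 1" for U e t
  proof (rule torus_integrable[OF U, where C=C])
    show "(\<lambda>x. e x * d t x) \<in> borel_measurable borel" using e(1) d_section_measurable by (rule borel_measurable_times)
    show "\<bar>e x * d t x\<bar> \<le> C" for x using mult_mono[OF e(2)[of x] C(2)[of t x]] by (simp add: abs_mult)
  qed
  have J: "J n t = (\<Sum>k\<le>2 * n. coeff_cp n k * (pairL (cosf n k) t * pairW (cosf n k) t + pairL (sinf n k) t * pairW (sinf n k) t))" for n t
  proof -
    have "J n t = (\<integral>x. (\<Sum>k\<le>2 * n. coeff_cp n k * (pairL (cosf n k) t * (cosf n k x * d t x) + pairL (sinf n k) t * (sinf n k x * d t x))) \<partial>W)"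
      unfolding J_def smooth_approx_def pairL_def sum_distrib_right
      by (intro Bochner_Integration.integral_cong sum.cong refl) (simp add: algebra_simps)
    also have "\<dots> = (\<Sum>k\<le>2 * n. \<integral>x. coeff_cp n k * (pairL (cosf n k) t * (cosf n k x * d t x) + pairL (sinf n k) t * (sinf n k x * d t x)) \<partial>W)"
      by (rule Bochner_Integration.integral_sum)
         (intro integrable_mult_right Bochner_Integration.integrable_add dei[OF W(1)] cm c1)
    also have "\<dots> = (\<Sum>k\<le>2 * n. coeff_cp n k * (pairL (cosf n k) t * pairW (cosf n k) t + pairL (sinf n k) t * pairW (sinf n k) t))"
      unfolding pairW_def using dei[OF W(1)] cm c1
      by (intro sum.cong refl) simp
    finally show ?thesis .
  qed
  have rel: "AE t in lborel. t \<in> {0..T} \<longrightarrow> pairW (cosf n k) t = - ((w n k)\<^sup>2 / 2) * prim (pairL (cosf n k)) t"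
    "AE t in lborel. t \<in> {0..T} \<longrightarrow> pairW (sinf n k) t = - ((w n k)\<^sup>2 / 2) * prim (pairL (sinf n k)) t" for n k
  proof -
    have c0: "cos_tower (w n k) 0 = cosf n k" and s0: "sin_tower (w n k) 0 = sinf n k"
      by (auto simp: cos_tower_def sin_tower_def cosf_def sinf_def w_def)
    have c2: "cos_tower (w n k) 2 x = - ((w n k)\<^sup>2) * cos_tower (w n k) 0 x" for x
      by (simp add: cos_tower_def cos_add)
    have s2: "sin_tower (w n k) 2 x = - ((w n k)\<^sup>2) * sin_tower (w n k) 0 x" for x
      by (simp add: sin_tower_def sin_add)
    show "AE t in lborel. t \<in> {0..T} \<longrightarrow> pairW (cosf n k) t = - ((w n k)\<^sup>2 / 2) * prim (pairL (cosf n k)) t"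
      using pair_relation[where E="cos_tower (w n k)" and w="w n k", OF cos_tower_deriv] trig_periodic(1) c1(1) c2 unfolding c0 by simp
    show "AE t in lborel. t \<in> {0..T} \<longrightarrow> pairW (sinf n k) t = - ((w n k)\<^sup>2 / 2) * prim (pairL (sinf n k)) t"
      using pair_relation[where E="sin_tower (w n k)" and w="w n k", OF sin_tower_deriv] trig_periodic(2) c1(2) s2 unfolding s0 by simp
  qed
  have iL: "integrable lborel (pairL e)" if e: "e \<in> borel_measurable borel" "\<And>x. \<bar>e x\<bar> \<le> 1" for e
  proof -
    obtain B where B: "\<And>t. \<bar>pairW e t\<bar> \<le> B" "\<And>t. \<bar>pairL e t\<bar> \<le> B" using pair_bounded[OF e] by blast
    show ?thesis by (rule integrable_bounded_supp[OF pair_measurable(2)[OF e(1)] B(2) pair_zero(2) T])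
  qed
  have sign: "(\<integral>t. J n t \<partial>lborel) \<le> 0" for n
  proof -
    let ?H = "\<lambda>t. \<Sum>k\<le>2 * n. coeff_cp n k * (- ((w n k)\<^sup>2 / 2)) * (pairL (cosf n k) t * prim (pairL (cosf n k)) t + pairL (sinf n k) t * prim (pairL (sinf n k)) t)"
    note ip = integral_by_parts_prim(2)[OF iL[OF cm(1) c1(1)] iL[OF cm(1) c1(1)]] integral_by_parts_prim(2)[OF iL[OF cm(2) c1(2)] iL[OF cm(2) c1(2)]]
    have "AE t in lborel. \<forall>k\<in>{..2 * n}. t \<in> {0..T} \<longrightarrow> pairW (cosf n k) t = - ((w n k)\<^sup>2 / 2) * prim (pairL (cosf n k)) t
        \<and> pairW (sinf n k) t = - ((w n k)\<^sup>2 / 2) * prim (pairL (sinf n k)) t"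
    proof (rule AE_finite_allI)
      fix k
      show "AE t in lborel. t \<in> {0..T} \<longrightarrow> pairW (cosf n k) t = - ((w n k)\<^sup>2 / 2) * prim (pairL (cosf n k)) t
        \<and> pairW (sinf n k) t = - ((w n k)\<^sup>2 / 2) * prim (pairL (sinf n k)) t"
        using rel(1)[of n k] rel(2)[of n k] by eventually_elim blast
    qed simp
    then have "AE t in lborel. J n t = ?H t"
    proof eventually_elim
      case (elim t)
      show ?case
      proof (cases "t \<in> {0..T}")
        case True
        show ?thesis unfolding J
        proof (intro sum.cong refl)
          fix k assume "k \<in> {..2 * n}"
          with elim True have e: "pairW (cosf n k) t = - ((w n k)\<^sup>2 / 2) * prim (pairL (cosf n k)) t"
             "pairW (sinf n k) t = - ((w n k)\<^sup>2 / 2) * prim (pairL (sinf n k)) t" by auto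
          show "coeff_cp n k * (pairL (cosf n k) t * pairW (cosf n k) t + pairL (sinf n k) t * pairW (sinf n k) t)
             = coeff_cp n k * (- ((w n k)\<^sup>2 / 2)) * (pairL (cosf n k) t * prim (pairL (cosf n k)) t + pairL (sinf n k) t * prim (pairL (sinf n k)) t)"
            unfolding e by (simp add: algebra_simps)
        qed
      next
        case False
        then show ?thesis by (simp add: J pair_zero)
      qed
    qed
    moreover have Jm: "J n \<in> borel_measurable lborel"
      unfolding J[abs_def] using pair_measurable[OF cm(1)] pair_measurable[OF cm(2)] by simp
    moreover have iH: "integrable lborel ?H"
      by (intro Bochner_Integration.integrable_sum integrable_mult_right Bochner_Integration.integrable_add ip)
    ultimately have "(\<integral>t. J n t \<partial>lborel) = (\<integral>t. ?H t \<partial>lborel)"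
      by (intro integral_cong_AE) auto
    also have "\<dots> = (\<Sum>k\<le>2 * n. coeff_cp n k * (- ((w n k)\<^sup>2 / 2)) *
        ((\<integral>t. pairL (cosf n k) t \<partial>lborel)\<^sup>2 / 2 + (\<integral>t. pairL (sinf n k) t \<partial>lborel)\<^sup>2 / 2))"
      unfolding integral_times_prim[OF iL[OF cm(1) c1(1)], symmetric] integral_times_prim[OF iL[OF cm(2) c1(2)], symmetric]
      using ip by (subst Bochner_Integration.integral_sum) auto
    also have "\<dots> \<le> 0"
    proof (rule sum_nonpos)
      fix k
      have "coeff_cp n k * (- ((w n k)\<^sup>2 / 2)) \<le> 0" by (rule mult_nonneg_nonpos[OF coeff_cp_nonneg]) simp
      then show "coeff_cp n k * (- ((w n k)\<^sup>2 / 2)) *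
        ((\<integral>t. pairL (cosf n k) t \<partial>lborel)\<^sup>2 / 2 + (\<integral>t. pairL (sinf n k) t \<partial>lborel)\<^sup>2 / 2) \<le> 0"
        by (rule mult_nonpos_nonneg) simp
    qed
    finally show ?thesis .
  qed
  have SC: "\<bar>smooth_approx n (d t) x * d t x\<bar> \<le> C * C" if "torus_continuous (d t)" for n t x
    unfolding abs_mult by (intro mult_mono smooth_approx_bound[OF that] C abs_ge_zero)
  define S where "S t = (\<integral>x. (d t x)\<^sup>2 \<partial>W)" for t
  have S0: "S t \<ge> 0" for t by (simp add: S_def)
  have lim: "(\<lambda>n. \<integral>t. J n t \<partial>lborel) \<longlonglongrightarrow> (\<integral>t. S t \<partial>lborel)"
    and iS: "integrable lborel S"
  proof -
    have Sm: "S \<in> borel_measurable lborel"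
    proof -
      have "(\<lambda>z. (case z of (t, x) \<Rightarrow> d t x)\<^sup>2) \<in> borel_measurable (borel :: (real \<times> real) measure)"
        using d_measurable by (rule borel_measurable_power)
      then show ?thesis unfolding S_def[abs_def] by (simp add: integral_measurable_param[OF W(1)] split_def)
    qed
    have Jm: "J n \<in> borel_measurable lborel" for n
      unfolding J[abs_def] using pair_measurable[OF cm(1)] pair_measurable[OF cm(2)] by simp
    have conv: "AE t in lborel. (\<lambda>n. J n t) \<longlonglongrightarrow> S t" using AE_d_continuous
    proof eventually_elim
      case (elim t)
      have sm: "smooth_approx n (d t) \<in> borel_measurable borel" for n
        using torus_smooth_measurable(1)[OF smooth_approx_smooth] .
      show ?case unfolding J_def S_def
      proof (rule integral_dominated_convergence[where w="\<lambda>_. C * C"])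
        show "AE x in W. (\<lambda>n. smooth_approx n (d t) x * d t x) \<longlonglongrightarrow> (d t x)\<^sup>2"
        proof (rule AE_I2)
          fix x
          have "(\<lambda>n. smooth_approx n (d t) x) \<longlonglongrightarrow> d t x"
          proof (rule LIMSEQ_I)
            fix r :: real assume r: "r > 0"
            obtain K where K: "\<And>n x. n \<ge> K \<Longrightarrow> \<bar>smooth_approx n (d t) x - d t x\<bar> \<le> r / 2"
              using smooth_approx_uniform[OF elim, of "r/2"] r by auto
            have "norm (smooth_approx n (d t) x - d t x) < r" if "n \<ge> K" for n
              using K[OF that, of x] r by simp
            then show "\<exists>K. \<forall>n\<ge>K. norm (smooth_approx n (d t) x - d t x) < r" by blast
          qed
          then show "(\<lambda>n. smooth_approx n (d t) x * d t x) \<longlonglongrightarrow> (d t x)\<^sup>2"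
            unfolding power2_eq_square by (intro tendsto_mult tendsto_const)
        qed
        show "AE x in W. norm (smooth_approx n (d t) x * d t x) \<le> C * C" for n
        proof (rule AE_I2)
          fix x show "norm (smooth_approx n (d t) x * d t x) \<le> C * C"
            unfolding real_norm_def by (rule SC[OF elim])
        qed
        show "(\<lambda>x. (d t x)\<^sup>2) \<in> borel_measurable W" "(\<lambda>x. smooth_approx n (d t) x * d t x) \<in> borel_measurable W" for n
          by (intro torus_measurable[OF W(1)] borel_measurable_power d_section_measurable)
             (intro torus_measurable[OF W(1)] borel_measurable_times sm d_section_measurable)
      qed simp
    qed
    have bound: "AE t in lborel. norm (J n t) \<le> C * C * measure W {0..<1} * indicator {0..T} t" for n
      using AE_d_continuous
    proof eventually_elim
      case (elim t)
      show ?case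
      proof (cases "t \<in> {0..T}")
        case True
        note le = SC[OF elim]
        have i: "integrable W (\<lambda>x. smooth_approx n (d t) x * d t x)"
        proof (rule torus_integrable[OF W(1) _ le])
          show "(\<lambda>x. smooth_approx n (d t) x * d t x) \<in> borel_measurable borel"
            by (intro borel_measurable_times torus_smooth_measurable(1)[OF smooth_approx_smooth] d_section_measurable)
        qed
        have "\<bar>J n t\<bar> \<le> (\<integral>x. \<bar>smooth_approx n (d t) x * d t x\<bar> \<partial>W)" unfolding J_def by (rule integral_abs_bound)
        also have "\<dots> \<le> (\<integral>x. C * C \<partial>W)" using i le by (intro integral_mono) auto
        finally show ?thesis using True torus_measureD(3)[OF W(1)] by (simp add: mult_ac)
      next
        case False
        then show ?thesis by (simp add: J pair_zero)
      qed
    qed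
    have iB: "integrable lborel (\<lambda>t. C * C * measure W {0..<1} * indicator {0..T} t)"
      using T by (intro integrable_mult_right) simp
    show "(\<lambda>n. \<integral>t. J n t \<partial>lborel) \<longlonglongrightarrow> (\<integral>t. S t \<partial>lborel)"
      by (rule integral_dominated_convergence[OF Sm Jm iB conv bound])
    show "integrable lborel S"
      by (rule integrable_dominated_convergence[OF Sm Jm iB conv bound])
  qed
  have "(\<integral>t. S t \<partial>lborel) \<le> 0"
    using sign by (intro LIMSEQ_le_const2[OF lim]) auto
  then have "(\<integral>t. S t \<partial>lborel) = 0" using S0 by (intro antisym) auto
  then have "AE t in lborel. S t = 0" using integral_nonneg_eq_0_iff_AE[OF iS] S0 by auto
  then show ?thesis using AE_d_continuous
  proof eventually_elim
    case (elim t)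
    show ?case using torus_continuous_zero[OF W elim(2)] elim(1) by (intro ext) (simp add: S_def)
  qed
qed

lemma AE_solutions_equal: "AE t in lebesgue. t \<in> {0..T} \<longrightarrow> v1 t = v2 t"
proof -
  have "AE t in lborel. t \<in> {0..T} \<longrightarrow> v1 t = v2 t"
    using AE_d_zero
  proof eventually_elim
    case (elim t)
    show ?case
    proof (intro impI ext)
      fix x assume t: "t \<in> {0..T}"
      have "d t x = 0" by (rule fun_cong[OF elim])
      then show "v1 t x = v2 t x" using t by (simp add: d_def)
    qed
  qed
  then show ?thesis by (rule AE_completion)
qed

end

section \<open>Uniform convergence of the interpolated flows\<close>

lemma grid_dist:
  assumes "N \<ge> 1" "y \<in> {0..<1}" shows "\<bar>real (idx N y) / real N - y\<bar> \<le> 1 / real N"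
  using idx_bounds[OF assms] by (simp add: add_divide_distrib)

lemma grid_approximation:
  assumes f: "torus_continuous f" and e: "e > 0"
  obtains K where "K \<ge> 1" "\<And>N y. N \<ge> K \<Longrightarrow> y \<in> {0..<1} \<Longrightarrow> \<bar>f (real (idx N y) / real N) - f y\<bar> \<le> e"
    "\<And>N x. N \<ge> K \<Longrightarrow> \<bar>f ((x + 1) / real N) - f (x / real N)\<bar> \<le> e"
proof -
  obtain d where d: "d > 0" "\<And>x y. \<bar>x - y\<bar> < d \<Longrightarrow> \<bar>f x - f y\<bar> < e"
    using torus_uniformly_continuous[OF f e] by blast
  obtain K :: nat where K: "1 / d < real K" using reals_Archimedean2 by blast
  have small: "1 / real N < d" if "N \<ge> max K 1" for N
  proof -
    have "1 / d < real N" using K that by (meson less_le_trans max.boundedE of_nat_le_iff)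
    then show ?thesis using d(1) that by (simp add: field_simps)
  qed
  show ?thesis
  proof (rule that[of "max K 1"])
    fix N y assume N: "N \<ge> max K 1" and y: "y \<in> {0..<1::real}"
    then show "\<bar>f (real (idx N y) / real N) - f y\<bar> \<le> e"
      using grid_dist[of N y] small[OF N] by (intro less_imp_le d(2)) auto
  next
    fix N x assume N: "N \<ge> max K 1"
    have "(x + 1) / real N - x / real N = 1 / real N" by (simp add: add_divide_distrib)
    then show "\<bar>f ((x + 1) / real N) - f (x / real N)\<bar> \<le> e"
      using small[OF N] N by (intro less_imp_le d(2)) simp
  qed simp
qed

text \<open>
  If \<open>\<bar>f y\<bar>\<close> is large then \<open>\<bar>f\<bar>\<close> is at least half as large on a cell around \<open>y\<close> whose width is
  given by the Hoelder bound, and the finitely many cells of that width have positive mass.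
\<close>

lemma sup_from_L2:
  assumes W: "torus_measure W" "positive_on_open W" and A: "A \<ge> 0" and e: "e > 0"
  obtains \<delta> where "\<delta> > 0"
    "\<And>f y. f \<in> borel_measurable borel \<Longrightarrow> (\<And>x. \<bar>f x\<bar> \<le> B) \<Longrightarrow>
       (\<And>x y. x \<in> {0..1} \<Longrightarrow> y \<in> {0..1} \<Longrightarrow> \<bar>f x - f y\<bar> \<le> A * sqrt \<bar>x - y\<bar>) \<Longrightarrow>
       (\<integral>x. (f x)\<^sup>2 \<partial>W) \<le> \<delta> \<Longrightarrow> y \<in> {0..<1} \<Longrightarrow> \<bar>f y\<bar> \<le> e"
proof -
  interpret finite_measure W by (rule torus_measureD(1)[OF W(1)])
  obtain K :: nat where K0: "(2 * A / e)\<^sup>2 < real K" using reals_Archimedean2 by blast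
  have K: "K \<ge> 1" using K0 by (cases K) (auto simp: not_less)
  have AK: "A * sqrt (1 / real K) \<le> e / 2"
  proof -
    have "2 * A / e \<le> sqrt (real K)" using K0 A e by (intro real_le_rsqrt) auto
    then show ?thesis using K e by (simp add: real_sqrt_divide field_simps)
  qed
  \<comment> \<open>Positive because there are finitely many cells.\<close>
  define c where "c = Min (cell W K ` {..<K})"
  have c: "c > 0" "\<And>j. j < K \<Longrightarrow> c \<le> cell W K j"
    unfolding c_def using K cell_pos[OF W] by (auto simp: Min_gr_iff lessThan_empty_iff)
  show ?thesis
  proof (rule that[of "(e / 2)\<^sup>2 * c / 2"])
    show "(e / 2)\<^sup>2 * c / 2 > 0" using e c by simp
    fix f :: "real \<Rightarrow> real" and y :: real
    assume [measurable]: "f \<in> borel_measurable borel" and B: "\<And>x. \<bar>f x\<bar> \<le> B"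
      and h: "\<And>x y. x \<in> {0..1} \<Longrightarrow> y \<in> {0..1} \<Longrightarrow> \<bar>f x - f y\<bar> \<le> A * sqrt \<bar>x - y\<bar>"
      and I: "(\<integral>x. (f x)\<^sup>2 \<partial>W) \<le> (e / 2)\<^sup>2 * c / 2" and y: "y \<in> {0..<1}"
    show "\<bar>f y\<bar> \<le> e"
    proof (rule ccontr)
      assume "\<not> \<bar>f y\<bar> \<le> e"
      then have big: "\<bar>f y\<bar> > e" by simp
      let ?J = "{real (idx K y) / real K ..< (real (idx K y) + 1) / real K}"
      have j: "idx K y < K" by (rule idx_less[OF K y])
      have Js: "?J \<subseteq> {0..<1}" by (rule cell_subset[OF j])
      have Jm: "?J \<in> sets W" by (rule torus_sets[OF W(1) _ Js]) simp
      have low: "(e / 2)\<^sup>2 \<le> (f x)\<^sup>2" if x: "x \<in> ?J" for x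
      proof -
        have "\<bar>y - x\<bar> \<le> 1 / real K" using x idx_bounds[OF K y] by (auto simp: add_divide_distrib)
        then have "A * sqrt \<bar>y - x\<bar> \<le> A * sqrt (1 / real K)" using A by (intro mult_left_mono real_sqrt_le_mono) auto
        moreover have "\<bar>f y - f x\<bar> \<le> A * sqrt \<bar>y - x\<bar>" using y subsetD[OF Js x] by (intro h) auto
        ultimately have "\<bar>f x\<bar> \<ge> e / 2" using big AK by linarith
        then have "(e / 2)\<^sup>2 \<le> \<bar>f x\<bar>\<^sup>2" using e by (intro power_mono) auto
        then show ?thesis by simp
      qed
      have i1: "integrable W (\<lambda>x. (e / 2)\<^sup>2 * indicator ?J x)" using Jm by (intro integrable_mult_right) (simp add: emeasure_eq_measure)
      have "\<bar>(f x)\<^sup>2\<bar> \<le> B\<^sup>2" for x using power_mono[OF B[of x] abs_ge_zero, of 2] by simp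
      then have i2: "integrable W (\<lambda>x. (f x)\<^sup>2)" by (intro torus_integrable[OF W(1)]) auto
      have "(e / 2)\<^sup>2 * cell W K (idx K y) = (\<integral>x. (e / 2)\<^sup>2 * indicator ?J x \<partial>W)"
        using Jm by (simp add: cell_def)
      also have "\<dots> \<le> (\<integral>x. (f x)\<^sup>2 \<partial>W)"
        by (rule integral_mono[OF i1 i2]) (use low in \<open>auto simp: indicator_def\<close>)
      finally have "(e / 2)\<^sup>2 * cell W K (idx K y) \<le> (e / 2)\<^sup>2 * c / 2" using I by linarith
      moreover have "(e / 2)\<^sup>2 * c \<le> (e / 2)\<^sup>2 * cell W K (idx K y)" using c(2)[OF j] by (intro mult_left_mono) auto
      moreover have "(e / 2)\<^sup>2 * c > 0" using e c by simp
      ultimately show False by linarith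
    qed
  qed
qed

locale flows =
  fixes W :: "real measure" and u0 :: "real \<Rightarrow> real" and v :: "nat \<Rightarrow> real \<Rightarrow> nat \<Rightarrow> real" and C m :: real
  assumes W: "torus_measure W" "positive_on_open W"
    and u0: "torus_continuous u0" and u0C: "\<And>y. \<bar>u0 y\<bar> \<le> C"
    and v: "\<And>N. N \<ge> 1 \<Longrightarrow> flow_on W N (v N)"
    and v0: "\<And>N x. N \<ge> 1 \<Longrightarrow> x < N \<Longrightarrow> v N 0 x = u0 (real x / real N)"
    and vC: "\<And>N t x. \<bar>v N t x\<bar> \<le> C"
    and m: "m = measure W {0..<1}"
begin

lemma flow_N: "N \<ge> 1 \<Longrightarrow> flow W N (v N) C m"
  by unfold_locales (use cell_pos[OF W] v vC m sum_cell[OF W(1)] in auto)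

lemma m_nonneg: "m \<ge> 0" by (simp add: m)

lemma C_nonneg: "C \<ge> 0" using u0C[of 0] by simp

definition vt :: "nat \<Rightarrow> real \<Rightarrow> real \<Rightarrow> real" where "vt N t = interp N (v N t)"

lemma two_flows_of_family:
  assumes "N \<ge> 3" "M \<ge> 3"
    "\<And>y. y \<in> {0..<1} \<Longrightarrow> \<bar>u0 (real (idx N y) / real N) - u0 y\<bar> \<le> \<omega>"
    "\<And>y. y \<in> {0..<1} \<Longrightarrow> \<bar>u0 (real (idx M y) / real M) - u0 y\<bar> \<le> \<omega>"
  shows "two_flows W N M (v N) (v M) C m u0 \<omega>"
proof -
  interpret A: flow W N "v N" C m using assms by (intro flow_N) auto
  interpret B: flow W M "v M" C m using assms by (intro flow_N) auto
  have um: "u0 \<in> borel_measurable borel"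
    using u0 by (intro borel_measurable_continuous_onI) (simp add: torus_continuous_def)
  show ?thesis
    by unfold_locales (use assms W um u0C v0[of N] v0[of M] in auto)
qed

text \<open>
  A choice of constants in \<open>F_fixed_time\<close>: first \<open>h\<close> makes the motion between the two times small,
  then a common bound \<open>\<theta>\<close> on \<open>1 / sqrt N\<close>, \<open>1 / sqrt M\<close> and \<open>\<omega>\<close> makes the errors small compared
  with \<open>h\<close>. The second conclusion makes the estimates of \<open>two_flows\<close> available to later lemmas.
\<close>

lemma L2_cauchy:
  assumes s: "s > 0" and e: "e > 0"
  obtains K where "K \<ge> 3" "\<And>N M. N \<ge> K \<Longrightarrow> M \<ge> K \<Longrightarrow> (\<integral>y. (vt N s y - vt M s y)\<^sup>2 \<partial>W) \<le> e"
    "\<And>N M. N \<ge> K \<Longrightarrow> M \<ge> K \<Longrightarrow> \<exists>\<omega>. two_flows W N M (v N) (v M) C m u0 \<omega>"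
proof -
  define k where "k = C\<^sup>2 * m / s"
  have k: "k \<ge> 0" using s m_nonneg by (simp add: k_def)
  define h where "h = e / (18 * (k + 1))"
  have h: "h > 0" using e k by (simp add: h_def)
  define G where "G = 2 * C * m * (12 * sqrt (C\<^sup>2 * m) * sqrt (s + h) + 2 * (s + h))"
  have G: "G \<ge> 0" using C_nonneg m_nonneg s h by (simp add: G_def)
  \<comment> \<open>The first bound gives \<open>Err (s + h) < e / 9 * h\<close>, the second the last term of \<open>F_fixed_time\<close>.\<close>
  define \<theta> where "\<theta> = min (e / 9 * h / (2 * (G + 1))) (e / (144 * (m * k + 1)))"
  have \<theta>: "\<theta> > 0" using e h G m_nonneg k by (auto simp: \<theta>_def add_nonneg_pos)
  obtain K1 where K1: "K1 \<ge> 1" "\<And>N y. N \<ge> K1 \<Longrightarrow> y \<in> {0..<1} \<Longrightarrow> \<bar>u0 (real (idx N y) / real N) - u0 y\<bar> \<le> \<theta>"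
    using grid_approximation[OF u0 \<theta>] by metis
  obtain K2 :: nat where K2: "(1 / \<theta>)\<^sup>2 < real K2" using reals_Archimedean2 by blast
  define K where "K = max 3 (max K1 K2)"
  have sq: "1 / sqrt (real N) \<le> \<theta>" "1 / real N \<le> \<theta>" if N: "N \<ge> K" for N
  proof -
    have "(1 / \<theta>)\<^sup>2 \<le> real N" using K2 N by (simp add: K_def)
    then have "1 / \<theta> \<le> sqrt (real N)" by (rule real_le_rsqrt)
    moreover have "sqrt (real N) > 0" using N by (simp add: K_def)
    ultimately show a: "1 / sqrt (real N) \<le> \<theta>" using \<theta> by (simp add: field_simps)
    have "real N \<ge> 1" using N by (simp add: K_def)
    then have "sqrt (real N) \<le> real N" by (intro real_le_lsqrt) (simp_all add: power2_eq_square)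
    then have "1 / real N \<le> 1 / sqrt (real N)" using \<open>sqrt (real N) > 0\<close> by (intro divide_left_mono) auto
    then show "1 / real N \<le> \<theta>" using a by simp
  qed
  have t: "two_flows W N M (v N) (v M) C m u0 \<theta>" if "N \<ge> K" "M \<ge> K" for N M
    using that K1(2) by (intro two_flows_of_family) (auto simp: K_def)
  show ?thesis
  proof (rule that[of K])
    show "K \<ge> 3" by (simp add: K_def)
    fix N M assume NM: "N \<ge> K" "M \<ge> K"
    show "\<exists>\<omega>. two_flows W N M (v N) (v M) C m u0 \<omega>" using t[OF NM] by blast
    interpret two_flows W N M "v N" "v M" C m u0 \<theta> by (rule t[OF NM])
    have "Err (s + h) \<le> G * \<theta>"
    proof -
      have "6 * sqrt (C\<^sup>2 * m) * sqrt (s + h) * (1 / sqrt N + 1 / sqrt M) \<le> 6 * sqrt (C\<^sup>2 * m) * sqrt (s + h) * (\<theta> + \<theta>)"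
        using sq(1)[OF NM(1)] sq(1)[OF NM(2)] s h m_nonneg by (intro mult_left_mono add_mono) auto
      then have "2 * C * m * (6 * sqrt (C\<^sup>2 * m) * sqrt (s + h) * (1 / sqrt N + 1 / sqrt M) + 2 * \<theta> * (s + h))
         \<le> 2 * C * m * (6 * sqrt (C\<^sup>2 * m) * sqrt (s + h) * (\<theta> + \<theta>) + 2 * \<theta> * (s + h))"
        by (rule mult_left_mono[OF add_right_mono]) (use C_nonneg m_nonneg in simp)
      also have "\<dots> = G * \<theta>" by (simp add: G_def algebra_simps)
      finally show ?thesis by (simp add: Err_def)
    qed
    also have "G * \<theta> \<le> G * (e / 9 * h / (2 * (G + 1)))" using G by (intro mult_left_mono) (auto simp: \<theta>_def)
    also have "\<dots> < e / 9 * h"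
    proof -
      have "G / (2 * (G + 1)) < 1" using G by simp
      then have "e / 9 * h * (G / (2 * (G + 1))) < e / 9 * h * 1" using e h by (intro mult_strict_left_mono) auto
      then show ?thesis by (simp add: mult_ac)
    qed
    finally have "F s \<le> 3 * (e / 9) + 6 * (h * k) + 24 * m * k * (1 / N + 1 / M)"
      using F_fixed_time[OF s h] by (simp only: k_def)
    also have "6 * (h * k) \<le> e / 3"
    proof -
      have "k / (k + 1) \<le> 1" using k by simp
      then have "e / 3 * (k / (k + 1)) \<le> e / 3 * 1" using e by (intro mult_left_mono) auto
      moreover have "6 * (h * k) = e / 3 * (k / (k + 1))" using k by (simp add: h_def divide_simps)
      ultimately show ?thesis by simp
    qed
    also have "24 * m * k * (1 / N + 1 / M) \<le> e / 3"
    proof -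
      have "24 * m * k * (1 / N + 1 / M) \<le> 24 * m * k * (\<theta> + \<theta>)"
        using sq(2)[OF NM(1)] sq(2)[OF NM(2)] m_nonneg k by (intro mult_left_mono add_mono) auto
      also have "\<dots> = 48 * (m * k) * \<theta>" by simp
      also have "\<dots> \<le> 48 * (m * k) * (e / (144 * (m * k + 1)))" using m_nonneg k by (intro mult_left_mono) (auto simp: \<theta>_def)
      also have "\<dots> = e / 3 * (m * k / (m * k + 1))"
      proof -
        have "48 * q * (e / (144 * (q + 1))) = e / 3 * (q / (q + 1))" if "q \<ge> 0" for q :: real
          using that by (simp add: divide_simps)
        then show ?thesis using m_nonneg k by simp
      qed
      also have "\<dots> \<le> e / 3 * 1"
      proof (rule mult_left_mono)
        have Q: "q / (q + 1) \<le> 1" if "q \<ge> 0" for q :: real using that by simp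
        show "m * k / (m * k + 1) \<le> 1" by (rule Q) (rule mult_nonneg_nonneg[OF m_nonneg k])
      qed (use e in simp)
      finally show ?thesis by simp
    qed
    finally show "(\<integral>y. (vt N s y - vt M s y)\<^sup>2 \<partial>W) \<le> e" by (simp add: F_def w_def vt_def)
  qed
qed

lemma vt_bound: "N \<ge> 1 \<Longrightarrow> \<bar>vt N t y\<bar> \<le> C" unfolding vt_def by (erule interp_bound) (rule vC)

lemma vt_periodic: "torus_fun (vt N t)" unfolding vt_def by (rule interp_periodic)

lemma periodic_reduce: "torus_fun f \<Longrightarrow> f x = f (frac x)"
  using torus_fun_int[of f x "- \<lfloor>x\<rfloor>"] by (simp add: frac_def)

lemma uniform_cauchy:
  assumes s: "s > 0" and e: "e > 0"
  obtains K where "K \<ge> 3" "\<And>N M y. N \<ge> K \<Longrightarrow> M \<ge> K \<Longrightarrow> \<bar>vt N s y - vt M s y\<bar> \<le> e"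
    "\<And>N M. N \<ge> K \<Longrightarrow> M \<ge> K \<Longrightarrow> \<exists>\<omega>. two_flows W N M (v N) (v M) C m u0 \<omega>"
proof -
  have A: "2 * sqrt (C\<^sup>2 * m / s) \<ge> 0" using s m_nonneg by simp
  obtain \<delta> where \<delta>: "\<delta> > 0" and sup: "\<And>f y. f \<in> borel_measurable borel \<Longrightarrow> (\<And>x. \<bar>f x\<bar> \<le> 2 * C) \<Longrightarrow>
       (\<And>x y. x \<in> {0..1} \<Longrightarrow> y \<in> {0..1} \<Longrightarrow> \<bar>f x - f y\<bar> \<le> 2 * sqrt (C\<^sup>2 * m / s) * sqrt \<bar>x - y\<bar>) \<Longrightarrow>
       (\<integral>x. (f x)\<^sup>2 \<partial>W) \<le> \<delta> \<Longrightarrow> y \<in> {0..<1} \<Longrightarrow> \<bar>f y\<bar> \<le> e"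
    using sup_from_L2[OF W A e] by metis
  obtain K where K: "K \<ge> 3" "\<And>N M. N \<ge> K \<Longrightarrow> M \<ge> K \<Longrightarrow> (\<integral>y. (vt N s y - vt M s y)\<^sup>2 \<partial>W) \<le> \<delta>"
    "\<And>N M. N \<ge> K \<Longrightarrow> M \<ge> K \<Longrightarrow> \<exists>\<omega>. two_flows W N M (v N) (v M) C m u0 \<omega>"
    using L2_cauchy[OF s \<delta>] by metis
  show ?thesis
  proof (rule that[OF K(1) _ K(3)])
    fix N M y assume NM: "N \<ge> K" "M \<ge> K"
    obtain \<omega> where "two_flows W N M (v N) (v M) C m u0 \<omega>" using K(3)[OF NM] by blast
    then interpret two_flows W N M "v N" "v M" C m u0 \<omega> .
    have "\<bar>w s (frac y)\<bar> \<le> e"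
    proof (rule sup[OF w_measurable w_bound w_holder[OF s]])
      show "(\<integral>x. (w s x)\<^sup>2 \<partial>W) \<le> \<delta>" using K(2)[OF NM] by (simp add: vt_def w_def)
      show "frac y \<in> {0..<1}" by (simp add: frac_lt_1)
    qed auto
    moreover have "vt N s y = vt N s (frac y)" "vt M s y = vt M s (frac y)" by (rule periodic_reduce[OF vt_periodic])+
    ultimately show "\<bar>vt N s y - vt M s y\<bar> \<le> e" by (simp only: vt_def w_def)
  qed
qed

text \<open>
  At time \<open>0\<close> the estimates degenerate, and the limit is the initial function itself.
\<close>

definition u :: "real \<Rightarrow> real \<Rightarrow> real" where "u t y = (if t \<le> 0 then u0 y else lim (\<lambda>N. vt N t y))"

lemma initial_uniform:
  assumes e: "e > 0"
  obtains K where "K \<ge> 1" "\<And>N y. N \<ge> K \<Longrightarrow> \<bar>vt N 0 y - u0 y\<bar> \<le> e"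
proof -
  have e2: "e / 2 > 0" using e by simp
  obtain K where K: "K \<ge> 1" "\<And>N y. N \<ge> K \<Longrightarrow> y \<in> {0..<1} \<Longrightarrow> \<bar>u0 (real (idx N y) / real N) - u0 y\<bar> \<le> e / 2"
    "\<And>N x. N \<ge> K \<Longrightarrow> \<bar>u0 ((x + 1) / real N) - u0 (x / real N)\<bar> \<le> e / 2"
    using grid_approximation[OF u0 e2] by metis
  have p: "torus_fun u0" using u0 by (simp add: torus_continuous_def)
  show ?thesis
  proof (rule that[OF K(1)])
    fix N and y :: real assume N: "N \<ge> K"
    then have N1: "N \<ge> 1" using K(1) by simp
    define z where "z = frac y"
    have z: "z \<in> {0..<1}" by (simp add: z_def frac_lt_1)
    let ?i = "idx N z"
    have i: "?i < N" by (rule idx_less[OF N1 z])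
    have b: "real ?i / real N \<le> z" "z < (real ?i + 1) / real N" by (rule idx_bounds[OF N1 z])+
    define \<theta> where "\<theta> = real N * z - real ?i"
    have \<theta>: "0 \<le> \<theta>" "\<theta> \<le> 1" using b N1 by (auto simp: \<theta>_def field_simps)
    have vs: "v N 0 (site_succ N ?i) = u0 ((real ?i + 1) / real N)"
    proof (cases "?i + 1 = N")
      case True
      then have "site_succ N ?i = 0" "(real ?i + 1) / real N = 0 + 1" using N1 by (auto simp: site_succ_def field_simps)
      then show ?thesis using v0[OF N1, of 0] N1 p unfolding torus_fun_def by (simp only:) simp
    next
      case False
      then have "site_succ N ?i = ?i + 1" using i by (simp add: site_succ_def)
      then show ?thesis using v0[OF N1, of "?i + 1"] i False by (simp add: add.commute)
    qed
    have "vt N 0 z = u0 (real ?i / real N) + \<theta> * (u0 ((real ?i + 1) / real N) - u0 (real ?i / real N))"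
      unfolding vt_def using interp_on_cell_nat[OF N1 i b(1) less_imp_le[OF b(2)], of "v N 0"] v0[OF N1 i] vs by (simp add: \<theta>_def)
    moreover have "\<bar>\<theta> * (u0 ((real ?i + 1) / real N) - u0 (real ?i / real N))\<bar> \<le> 1 * (e / 2)"
      unfolding abs_mult using \<theta> K(3)[OF N, of "real ?i"] by (intro mult_mono) auto
    ultimately have "\<bar>vt N 0 z - u0 z\<bar> \<le> e" using K(2)[OF N z] by linarith
    moreover have "vt N 0 y = vt N 0 z" "u0 y = u0 z" unfolding z_def by (rule periodic_reduce[OF vt_periodic], rule periodic_reduce[OF p])
    ultimately show "\<bar>vt N 0 y - u0 y\<bar> \<le> e" by (simp only:)
  qed
qed

lemma uniform_limit:
  assumes t: "t \<ge> 0" and e: "e > 0"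
  obtains K where "K \<ge> 1" "\<And>N y. N \<ge> K \<Longrightarrow> \<bar>vt N t y - u t y\<bar> \<le> e"
proof (cases "t = 0")
  case True
  then show ?thesis using initial_uniform[OF e] that by (auto simp: u_def)
next
  case False
  then have t: "t > 0" using t by simp
  have conv: "(\<lambda>N. vt N t y) \<longlonglongrightarrow> u t y" for y
  proof -
    have "Cauchy (\<lambda>N. vt N t y)"
    proof (rule CauchyI)
      fix r :: real assume "r > 0"
      then have "r / 2 > 0" by simp
      from uniform_cauchy[OF t this] obtain K where "\<And>N M y. N \<ge> K \<Longrightarrow> M \<ge> K \<Longrightarrow> \<bar>vt N t y - vt M t y\<bar> \<le> r / 2"
        by metis
      note K = this
      have "norm (vt N t y - vt M t y) < r" if "N \<ge> K" "M \<ge> K" for N M using K[OF that, of y] \<open>r > 0\<close> by simp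
      then show "\<exists>K. \<forall>N\<ge>K. \<forall>M\<ge>K. norm (vt N t y - vt M t y) < r" by blast
    qed
    then have "convergent (\<lambda>N. vt N t y)" by (rule Cauchy_convergent)
    then show ?thesis using t by (simp add: u_def convergent_LIMSEQ_iff)
  qed
  from uniform_cauchy[OF t e] obtain K where K: "K \<ge> 3" "\<And>N M y. N \<ge> K \<Longrightarrow> M \<ge> K \<Longrightarrow> \<bar>vt N t y - vt M t y\<bar> \<le> e"
    by metis
  show ?thesis
  proof (rule that[of K])
    fix N y assume N: "N \<ge> K"
    have "(\<lambda>M. \<bar>vt N t y - vt M t y\<bar>) \<longlonglongrightarrow> \<bar>vt N t y - u t y\<bar>"
      by (intro tendsto_rabs tendsto_diff tendsto_const conv)
    then show "\<bar>vt N t y - u t y\<bar> \<le> e"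
      by (rule LIMSEQ_le_const2) (use K(2)[OF N] in blast)
  qed (use K in simp)
qed

lemma pointwise_limit: assumes "t \<ge> 0" shows "(\<lambda>N. vt N t y) \<longlonglongrightarrow> u t y"
proof (rule LIMSEQ_I)
  fix r :: real assume r: "r > 0"
  then have "r / 2 > 0" by simp
  from uniform_limit[OF assms this] obtain K where K: "\<And>N y. N \<ge> K \<Longrightarrow> \<bar>vt N t y - u t y\<bar> \<le> r / 2" by metis
  have "norm (vt N t y - u t y) < r" if "N \<ge> K" for N using K[OF that, of y] r by simp
  then show "\<exists>K. \<forall>N\<ge>K. norm (vt N t y - u t y) < r" by blast
qed

lemma u_bound: assumes "t \<ge> 0" shows "\<bar>u t y\<bar> \<le> C"
proof -
  have "(\<lambda>N. \<bar>vt N t y\<bar>) \<longlonglongrightarrow> \<bar>u t y\<bar>" by (intro tendsto_rabs pointwise_limit assms)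
  then show ?thesis by (rule LIMSEQ_le_const2) (use vt_bound in blast)
qed

text \<open>
  A uniform limit of continuous periodic functions.
\<close>

lemma u_torus_continuous: assumes t: "t \<ge> 0" shows "torus_continuous (u t)"
  unfolding torus_continuous_def
proof
  show "torus_fun (u t)" unfolding torus_fun_def
  proof
    fix y
    have "(\<lambda>N. vt N t (y + 1)) = (\<lambda>N. vt N t y)" using vt_periodic by (auto simp: torus_fun_def)
    then show "u t (y + 1) = u t y" using pointwise_limit[OF t, of "y + 1"] pointwise_limit[OF t, of y] LIMSEQ_unique by metis
  qed
  show "continuous_on UNIV (u t)"
  proof (rule uniform_limit_theorem[where F=sequentially and f="\<lambda>N. vt N t"])
    show "\<forall>\<^sub>F N in sequentially. continuous_on UNIV (vt N t)"
      unfolding vt_def by (intro eventually_sequentiallyI[of 1] interp_continuous)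
    show "Uniform_Limit.uniform_limit UNIV (\<lambda>N. vt N t) (u t) sequentially"
    proof (rule uniform_limitI)
      fix e :: real assume e: "e > 0"
      then have "e / 2 > 0" by simp
      from uniform_limit[OF t this] obtain K where K: "\<And>N y. N \<ge> K \<Longrightarrow> \<bar>vt N t y - u t y\<bar> \<le> e / 2" by metis
      have "dist (vt N t y) (u t y) < e" if "N \<ge> K" for N y using K[OF that, of y] e by (simp add: dist_real_def)
      then show "\<forall>\<^sub>F N in sequentially. \<forall>y\<in>UNIV. dist (vt N t y) (u t y) < e"
        unfolding eventually_sequentially by blast
    qed
  qed simp
qed

lemma u_0: "u 0 = u0" by (simp add: u_def fun_eq_iff)

end

section \<open>Grid sums and continuity in time\<close>

lemma site_succ_periodic:
  assumes p: "torus_fun \<phi>" and x: "x < N"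
  shows "\<phi> (real (site_succ N x) / real N) = \<phi> ((real x + 1) / real N)"
proof (cases "x + 1 = N")
  case True
  then have "site_succ N x = 0" "(real x + 1) / real N = 0 + 1" using x by (auto simp: site_succ_def field_simps)
  then show ?thesis using p unfolding torus_fun_def by (simp only:) simp
next
  case False
  then have "site_succ N x = x + 1" using x by (simp add: site_succ_def)
  then show ?thesis by (simp add: add.commute)
qed

lemma interp_by_parts:
  assumes N: "N \<ge> 1" and \<phi>: "\<And>y. (\<phi> has_real_derivative \<phi>' y) (at y)" and c: "continuous_on UNIV \<phi>'" and p: "torus_fun \<phi>"
  shows "(\<integral>y. interp N a y * \<phi>' y \<partial>Leb) = - (\<integral>y. grad N a y * \<phi> y \<partial>Leb)"
proof -
  obtain B where B: "\<And>y. y \<in> {0..<1} \<Longrightarrow> \<bar>grad N a y\<bar> \<le> B" "B \<ge> 0" using grad_bound[OF N] by blast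
  have c\<phi>: "continuous_on UNIV \<phi>" using \<phi> by (meson DERIV_isCont continuous_at_imp_continuous_on)
  note ci = interp_continuous[OF N, of a]
  obtain B2 where B2: "\<And>y. y \<in> {0..1} \<Longrightarrow> \<bar>\<phi> y\<bar> \<le> B2" using continuous_bounded_01[OF continuous_on_subset[OF c\<phi> subset_UNIV]] by blast
  have B20: "B2 \<ge> 0" using B2[of 0] by simp
  have m: "\<phi> \<in> borel_measurable borel" "\<phi>' \<in> borel_measurable borel" "interp N a \<in> borel_measurable borel"
    using c\<phi> c ci by (auto intro: borel_measurable_continuous_onI)
  have i1: "integrable Leb (\<lambda>y. interp N a y * \<phi>' y)" by (intro Leb_continuous_integrable continuous_intros ci c)
  have i2: "integrable Leb (\<lambda>y. grad N a y * \<phi> y)"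
  proof (rule torus_integrable[OF torus_Leb])
    show "(\<lambda>y. grad N a y * \<phi> y) \<in> borel_measurable borel" using grad_measurable m(1) by (rule borel_measurable_times)
    fix y :: real assume "y \<in> {0..<1}"
    then show "\<bar>grad N a y * \<phi> y\<bar> \<le> B * B2" unfolding abs_mult using B B2[of y] B20 by (intro mult_mono) auto
  qed
  let ?f = "\<lambda>y. indicator {0..<1} y * (interp N a y * \<phi>' y + grad N a y * \<phi> y)"
  have hi: "(?f has_integral interp N a 1 * \<phi> 1 - interp N a 0 * \<phi> 0) {0..1}"
  proof (rule fundamental_theorem_of_calculus_interior_strong[where S="(\<lambda>x. real x / real N) ` {..N}"])
    show "continuous_on {0..1} (\<lambda>y. interp N a y * \<phi> y)"
      by (intro continuous_on_mult continuous_on_subset[OF ci] continuous_on_subset[OF c\<phi>]) auto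
    fix y assume y: "y \<in> {0<..<1} - (\<lambda>x. real x / real N) ` {..N}"
    then have y01: "y \<in> {0..<1}" by auto
    let ?x = "idx N y"
    have x: "?x < N" using idx_less[OF N y01] .
    have "real ?x / real N \<noteq> y" using y x by (metis DiffD2 atMost_iff image_eqI less_imp_le)
    with idx_bounds[OF N y01] have b: "real ?x / real N < y" "y < (real ?x + 1) / real N" by auto
    have "((\<lambda>y. a ?x + (real N * y - real ?x) * (a (site_succ N ?x) - a ?x)) has_real_derivative grad N a y) (at y)"
      by (auto intro!: derivative_eq_intros simp: grad_def)
    then have "(interp N a has_real_derivative grad N a y) (at y)"
      by (rule has_field_derivative_transform_within_open[where S="{real ?x / real N<..<(real ?x + 1) / real N}"])
         (use b interp_on_cell_nat[OF N x, of _ a] in auto)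
    from DERIV_mult[OF this \<phi>] have "((\<lambda>y. interp N a y * \<phi> y) has_real_derivative ?f y) (at y)"
      using y01 by (simp add: mult.commute add.commute)
    then show "((\<lambda>y. interp N a y * \<phi> y) has_vector_derivative ?f y) (at y)"
      by (simp only: has_real_derivative_iff_has_vector_derivative)
  qed auto
  have iL: "integrable lborel ?f"
  proof -
    have "(\<lambda>y. interp N a y * \<phi>' y + grad N a y * \<phi> y) \<in> borel_measurable borel"
      using m grad_measurable[of N a] by (intro borel_measurable_add borel_measurable_times)
    moreover have "integrable Leb (\<lambda>y. interp N a y * \<phi>' y + grad N a y * \<phi> y)" using i1 i2 by simp
    ultimately show ?thesis using integrable_Leb_iff by blast
  qed
  have int: "set_integrable lborel {0..1} ?f"
    unfolding set_integrable_def using integrable_mult_indicator[OF _ iL, of "{0..1}"] by simp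
  have "(\<integral>y. interp N a y * \<phi>' y + grad N a y * \<phi> y \<partial>Leb) = (LINT y:{0..1}|lborel. ?f y)"
    unfolding integral_Leb set_lebesgue_integral_def by (intro Bochner_Integration.integral_cong refl) (auto simp: indicator_def)
  also have "\<dots> = interp N a 1 * \<phi> 1 - interp N a 0 * \<phi> 0"
    using set_borel_integral_eq_integral(2)[OF int] integral_unique[OF hi] by simp
  also have "\<dots> = 0"
    using interp_periodic[of N a] p unfolding torus_fun_def by (metis add_0 diff_self)
  finally show ?thesis using i1 i2 by simp
qed

lemma periodic_derivative:
  assumes d1: "\<And>y. (\<phi> has_real_derivative \<phi>' y) (at y)" and p: "torus_fun \<phi>" shows "torus_fun \<phi>'"
  unfolding torus_fun_def
proof
  fix x
  have "((\<lambda>y. \<phi> (y + 1)) has_real_derivative \<phi>' (x + 1)) (at x)" using d1[of "x + 1"] by (simp add: DERIV_shift)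
  moreover have "(\<lambda>y. \<phi> (y + 1)) = \<phi>" using p by (auto simp: torus_fun_def)
  ultimately show "\<phi>' (x + 1) = \<phi>' x" using d1[of x] DERIV_unique by fastforce
qed

text \<open>
  The grid energy against a smooth function involves no gradient of \<open>a\<close> after integration by parts,
  so its limit follows from the convergence of the interpolations alone.
\<close>

lemma energy_smooth:
  assumes N: "N \<ge> 3" and d1: "\<And>y. (\<phi> has_real_derivative \<phi>' y) (at y)" and d2: "\<And>y. (\<phi>' has_real_derivative \<phi>'' y) (at y)"
    and c: "continuous_on UNIV \<phi>''" and p: "torus_fun \<phi>"
  shows "energy N a (\<lambda>x. \<phi> (real x / real N)) = - (\<integral>y. interp N a y * \<phi>'' y \<partial>Leb)"
proof -
  have c1: "continuous_on UNIV \<phi>'" using d2 by (meson DERIV_isCont continuous_at_imp_continuous_on)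
  have p1: "torus_fun \<phi>'" by (rule periodic_derivative[OF d1 p])
  have "energy N a (\<lambda>x. \<phi> (real x / real N)) = (\<integral>y. grad N a y * \<phi>' y \<partial>Leb)"
  proof (rule energy_integral[OF N Leb_continuous_integrable[OF c1]])
    fix x assume x: "x < N"
    show "\<phi> (real (site_succ N x) / real N) - \<phi> (real x / real N)
        = (\<integral>y. indicator {real x / real N..<(real x + 1) / real N} y * \<phi>' y \<partial>Leb)"
      unfolding site_succ_periodic[OF p x]
      using x by (intro Leb_FTC[OF d1 c1, symmetric]) (auto simp: field_simps)
  qed
  also have "\<dots> = - (\<integral>y. interp N a y * \<phi>'' y \<partial>Leb)"
    using interp_by_parts[OF _ d2 c p1, of N a] N by simp
  finally show ?thesis .
qed

context flows begin

lemma idx_over_N_tendsto: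
  assumes y: "y \<in> {0..<1}" shows "(\<lambda>N. real (idx N y) / real N) \<longlonglongrightarrow> y"
proof -
  have "(\<lambda>N. 1 / real N) \<longlonglongrightarrow> 0" by (rule lim_1_over_n)
  then have "(\<lambda>N. real (idx N y) / real N - y) \<longlonglongrightarrow> 0"
  proof (rule Lim_null_comparison[rotated])
    show "\<forall>\<^sub>F N in sequentially. norm (real (idx N y) / real N - y) \<le> 1 / real N"
      using grid_dist[OF _ y] by (intro eventually_sequentiallyI[of 1]) simp
  qed
  then show ?thesis by (simp add: LIM_zero_iff)
qed

lemma v_idx_tendsto:
  assumes t: "t \<ge> 0" and y: "y \<in> {0..<1}" shows "(\<lambda>N. v N t (idx N y)) \<longlonglongrightarrow> u t y"
proof -
  let ?z = "\<lambda>N. real (idx N y) / real N"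
  have "isCont (u t) y" using u_torus_continuous[OF t] by (simp add: torus_continuous_def continuous_on_eq_continuous_at)
  then have 1: "(\<lambda>N. u t (?z N)) \<longlonglongrightarrow> u t y" using idx_over_N_tendsto[OF y] by (rule isCont_tendsto_compose)
  have 2: "(\<lambda>N. vt N t (?z N) - u t (?z N)) \<longlonglongrightarrow> 0"
  proof (rule LIMSEQ_I)
    fix r :: real assume r: "r > 0"
    then have "r / 2 > 0" by simp
    from uniform_limit[OF t this] obtain K where K: "\<And>N y. N \<ge> K \<Longrightarrow> \<bar>vt N t y - u t y\<bar> \<le> r / 2" by metis
    have "norm (vt N t (?z N) - u t (?z N) - 0) < r" if "N \<ge> K" for N using K[OF that, of "?z N"] r by simp
    then show "\<exists>K. \<forall>N\<ge>K. norm (vt N t (?z N) - u t (?z N) - 0) < r" by blast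
  qed
  have "(\<lambda>N. vt N t (?z N)) \<longlonglongrightarrow> u t y" using tendsto_add[OF 2 1] by simp
  then show ?thesis
  proof (rule Lim_transform_eventually)
    show "\<forall>\<^sub>F N in sequentially. vt N t (?z N) = v N t (idx N y)"
      using idx_less[OF _ y] by (intro eventually_sequentiallyI[of 1]) (simp add: vt_def interp_grid)
  qed
qed

text \<open>
  The grid sum is the integral of a function that is constant on cells; it converges boundedly because
  the flows converge uniformly and the limit is continuous.
\<close>

lemma grid_sum_tendsto:
  assumes t: "t \<ge> 0" and f: "torus_continuous f"
  shows "(\<lambda>N. \<Sum>x<N. cell W N x * (f (real x / real N) * v N t x)) \<longlonglongrightarrow> (\<integral>y. f y * u t y \<partial>W)"
proof -
  interpret finite_measure W by (rule torus_measureD(1)[OF W(1)])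
  obtain B where B: "\<And>x. \<bar>f x\<bar> \<le> B" "B \<ge> 0" using torus_continuous_bounded[OF f] by blast
  have fm: "f \<in> borel_measurable borel" "u t \<in> borel_measurable borel"
    using f u_torus_continuous[OF t] by (auto simp: torus_continuous_def intro: borel_measurable_continuous_onI)
  have "(\<lambda>N. \<integral>y. f (real (idx N y) / real N) * v N t (idx N y) \<partial>W) \<longlonglongrightarrow> (\<integral>y. f y * u t y \<partial>W)"
  proof (rule integral_dominated_convergence[where w="\<lambda>_. B * C"])
    show "(\<lambda>y. f y * u t y) \<in> borel_measurable W"
      by (intro torus_measurable[OF W(1)] borel_measurable_times fm)
    show "(\<lambda>y. f (real (idx N y) / real N) * v N t (idx N y)) \<in> borel_measurable W" for N
      by (intro torus_measurable[OF W(1)] idx_measurable[of "\<lambda>x. f (real x / real N) * v N t x" N])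
    show "AE y in W. (\<lambda>N. f (real (idx N y) / real N) * v N t (idx N y)) \<longlonglongrightarrow> f y * u t y"
    proof (rule AE_I2)
      fix y assume "y \<in> space W"
      then have y: "y \<in> {0..<1}" by (simp add: torus_measureD[OF W(1)])
      have "isCont f y" using f by (simp add: torus_continuous_def continuous_on_eq_continuous_at)
      from isCont_tendsto_compose[OF this idx_over_N_tendsto[OF y]]
      show "(\<lambda>N. f (real (idx N y) / real N) * v N t (idx N y)) \<longlonglongrightarrow> f y * u t y"
        by (intro tendsto_mult v_idx_tendsto t y)
    qed
    show "AE y in W. norm (f (real (idx N y) / real N) * v N t (idx N y)) \<le> B * C" for N
      unfolding real_norm_def abs_mult by (intro AE_I2 mult_mono B vC abs_ge_zero)
  qed simp
  then show ?thesis
  proof (rule Lim_transform_eventually)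
    show "\<forall>\<^sub>F N in sequentially. (\<integral>y. f (real (idx N y) / real N) * v N t (idx N y) \<partial>W) = (\<Sum>x<N. cell W N x * (f (real x / real N) * v N t x))"
      by (intro eventually_sequentiallyI[of 1] integral_idx[OF W(1), of _ "\<lambda>x. f (real x / real _) * v _ t x"])
  qed
qed

lemma grid_sum_bound:
  assumes N: "N \<ge> 1" and B: "\<And>x. x < N \<Longrightarrow> \<bar>g x\<bar> \<le> B" and B0: "B \<ge> 0"
  shows "\<bar>\<Sum>x<N. cell W N x * (g x * v N t x)\<bar> \<le> B * C * m"
proof -
  have "\<bar>\<Sum>x<N. cell W N x * (g x * v N t x)\<bar> \<le> (\<Sum>x<N. cell W N x * (B * C))"
  proof (intro order_trans[OF sum_abs] sum_mono)
    fix x assume x: "x \<in> {..<N}"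
    have "\<bar>g x * v N t x\<bar> \<le> B * C" unfolding abs_mult using B[of x] x B0 vC by (intro mult_mono) auto
    then show "\<bar>cell W N x * (g x * v N t x)\<bar> \<le> cell W N x * (B * C)"
      unfolding abs_mult[of "cell W N x"] using cell_pos[OF W, of x N] x by (simp add: mult_left_mono)
  qed
  also have "\<dots> = B * C * m" unfolding sum_distrib_right[symmetric] sum_cell[OF W(1) N] m by (rule mult.commute)
  finally show ?thesis .
qed

lemma Leb_integral_tendsto:
  assumes t: "t \<ge> 0" and f: "continuous_on UNIV f"
  shows "(\<lambda>N. \<integral>y. vt N t y * f y \<partial>Leb) \<longlonglongrightarrow> (\<integral>y. u t y * f y \<partial>Leb)"
proof -
  interpret finite_measure Leb by (rule torus_measureD(1)[OF torus_Leb])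
  have fm: "f \<in> borel_measurable borel" "u t \<in> borel_measurable borel"
    using f u_torus_continuous[OF t] by (auto simp: torus_continuous_def intro: borel_measurable_continuous_onI)
  obtain B where B: "\<And>y. y \<in> {0..1} \<Longrightarrow> \<bar>f y\<bar> \<le> B" using continuous_bounded_01[OF continuous_on_subset[OF f subset_UNIV]] by blast
  have "(\<lambda>N. \<integral>y. vt (N + 1) t y * f y \<partial>Leb) \<longlonglongrightarrow> (\<integral>y. u t y * f y \<partial>Leb)"
  proof (rule integral_dominated_convergence[where w="\<lambda>_. C * B"])
    show "(\<lambda>y. u t y * f y) \<in> borel_measurable Leb" by (intro torus_measurable[OF torus_Leb] borel_measurable_times fm)
    show "(\<lambda>y. vt (N + 1) t y * f y) \<in> borel_measurable Leb" for N unfolding vt_def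
      by (intro torus_measurable[OF torus_Leb] borel_measurable_times fm interp_measurable) simp
    show "AE y in Leb. (\<lambda>N. vt (N + 1) t y * f y) \<longlonglongrightarrow> u t y * f y"
      by (intro AE_I2 tendsto_mult tendsto_const LIMSEQ_ignore_initial_segment pointwise_limit t)
    show "AE y in Leb. norm (vt (N + 1) t y * f y) \<le> C * B" for N
    proof (rule AE_I2)
      fix y assume "y \<in> space Leb"
      then have "y \<in> {0..1}" by (simp add: torus_measureD[OF torus_Leb])
      then show "norm (vt (N + 1) t y * f y) \<le> C * B"
        unfolding real_norm_def abs_mult using vt_bound[of "N+1"] B C_nonneg by (intro mult_mono) auto
    qed
  qed simp
  then show ?thesis by (rule LIMSEQ_offset)
qed

lemma Leb_integral_bound:
  assumes N: "N \<ge> 1" and f: "continuous_on UNIV f" and B: "\<And>y. y \<in> {0..1} \<Longrightarrow> \<bar>f y\<bar> \<le> B"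
  shows "\<bar>\<integral>y. vt N t y * f y \<partial>Leb\<bar> \<le> C * B"
proof -
  interpret finite_measure Leb by (rule torus_measureD(1)[OF torus_Leb])
  have i: "integrable Leb (\<lambda>y. \<bar>vt N t y * f y\<bar>)" unfolding vt_def
    by (intro Leb_continuous_integrable continuous_intros interp_continuous N f)
  have "\<bar>\<integral>y. vt N t y * f y \<partial>Leb\<bar> \<le> (\<integral>y. \<bar>vt N t y * f y\<bar> \<partial>Leb)" by (rule integral_abs_bound)
  also have "\<dots> \<le> (\<integral>y. C * B \<partial>Leb)"
  proof (rule integral_mono[OF i])
    fix y assume "y \<in> space Leb"
    then have "y \<in> {0..1}" by (simp add: torus_measureD[OF torus_Leb])
    then show "\<bar>vt N t y * f y\<bar> \<le> C * B"
      unfolding abs_mult using vt_bound[OF N] B C_nonneg by (intro mult_mono) auto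
  qed simp
  also have "\<dots> = C * B"
    using sum_cell[OF torus_Leb, of 1] cell_Leb[of 0 1] by (simp add: torus_measureD[OF torus_Leb])
  finally show ?thesis .
qed

text \<open>
  The time derivative of the grid sum is an integral against \<open>\<phi>''\<close>, bounded for every grid.
\<close>

lemma smooth_pairing_lipschitz:
  assumes st: "0 \<le> s" "0 \<le> t" and B: "\<And>y. y \<in> {0..1} \<Longrightarrow> \<bar>\<phi>'' y\<bar> \<le> B"
    and d1: "\<And>y. (\<phi> has_real_derivative \<phi>' y) (at y)" and d2: "\<And>y. (\<phi>' has_real_derivative \<phi>'' y) (at y)"
    and c: "continuous_on UNIV \<phi>''" and p: "torus_fun \<phi>"
  shows "\<bar>(\<integral>y. \<phi> y * u t y \<partial>W) - (\<integral>y. \<phi> y * u s y \<partial>W)\<bar> \<le> C * B * \<bar>t - s\<bar>"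
proof -
  define P where "P N t = (\<Sum>x<N. cell W N x * (\<phi> (real x / real N) * v N t x))" for N t
  have tc: "torus_continuous \<phi>" unfolding torus_continuous_def
    using p d1 by (auto intro!: continuous_at_imp_continuous_on DERIV_isCont)
  have lim: "(\<lambda>N. P N t) \<longlonglongrightarrow> (\<integral>y. \<phi> y * u t y \<partial>W)" if "t \<ge> 0" for t
    unfolding P_def by (rule grid_sum_tendsto[OF that tc])
  have le: "\<bar>P N t - P N s\<bar> \<le> C * B * \<bar>t - s\<bar>" if N: "N \<ge> 3" for N
  proof -
    interpret flow W N "v N" C m using N by (intro flow_N) simp
    have d: "(P N has_real_derivative (\<integral>y. vt N r y * \<phi>'' y \<partial>Leb) / 2) (at r within {0..})" if r: "r \<in> {0..}" for r
    proof -
      have "(P N has_real_derivative (\<Sum>x<N. cell W N x * (\<phi> (real x / real N) * lap W N (v N r) x))) (at r within {0..})"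
        unfolding P_def[abs_def] by (intro DERIV_sum DERIV_cmult) (use deriv r in auto)
      moreover have "(\<Sum>x<N. cell W N x * (\<phi> (real x / real N) * lap W N (v N r) x)) = (\<integral>y. vt N r y * \<phi>'' y \<partial>Leb) / 2"
        using lap_energy[OF cell, of "\<lambda>x. \<phi> (real x / real N)" "v N r"] energy_smooth[OF N d1 d2 c p, of "v N r"]
        by (simp add: energy_commute[of N "\<lambda>x. \<phi> (real x / real N)"] vt_def)
      ultimately show ?thesis by simp
    qed
    have "norm (P N t - P N s) \<le> C * B * norm (t - s)"
    proof (rule field_differentiable_bound[OF convex_real_interval(1) d])
      fix r :: real
      have "0 \<le> C * B" using C_nonneg B[of 0] by simp
      then show "norm ((\<integral>y. vt N r y * \<phi>'' y \<partial>Leb) / 2) \<le> C * B"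
        using Leb_integral_bound[OF _ c B, of N r] N by simp
    qed (use st in auto)
    then show ?thesis by simp
  qed
  have "(\<lambda>N. \<bar>P N t - P N s\<bar>) \<longlonglongrightarrow> \<bar>(\<integral>y. \<phi> y * u t y \<partial>W) - (\<integral>y. \<phi> y * u s y \<partial>W)\<bar>"
    by (intro tendsto_rabs tendsto_diff lim st)
  then show ?thesis by (rule LIMSEQ_le_const2) (use le in blast)
qed

text \<open>
  For smooth \<open>H\<close> the pairing is Lipschitz in time; continuous functions are uniform limits of
  trigonometric polynomials.
\<close>

lemma weakly_continuous: "weakly_continuous_version W T u"
  unfolding weakly_continuous_version_def
proof (intro allI impI)
  fix H :: "real \<Rightarrow> real" assume H: "torus_continuous H"
  interpret finite_measure W by (rule torus_measureD(1)[OF W(1)])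
  have um: "u t \<in> borel_measurable borel" if "t \<ge> 0" for t
    using u_torus_continuous[OF that] by (auto simp: torus_continuous_def intro: borel_measurable_continuous_onI)
  have intb: "integrable W (\<lambda>y. f y * u t y)" if f: "torus_continuous f" and t: "t \<ge> 0" for f t
  proof -
    obtain B where B: "\<And>x. \<bar>f x\<bar> \<le> B" "B \<ge> 0" using torus_continuous_bounded[OF f] by blast
    have fm: "f \<in> borel_measurable borel" using f by (auto simp: torus_continuous_def intro: borel_measurable_continuous_onI)
    show ?thesis
      by (rule torus_integrable[OF W(1) borel_measurable_times[OF fm um[OF t]], where C="B * C"])
         (unfold abs_mult, intro mult_mono B u_bound t abs_ge_zero)
  qed
  show "continuous_on {0..T} (\<lambda>t. \<integral>x. H x * u t x \<partial>W)"
    unfolding continuous_on_iff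
  proof (intro ballI allI impI)
    fix t e :: real assume t: "t \<in> {0..T}" and e: "e > 0"
    define \<epsilon> where "\<epsilon> = e / (4 * (C * m + 1))"
    have Cm: "C * m \<ge> 0" using C_nonneg m_nonneg by simp
    have \<epsilon>: "\<epsilon> > 0" using e Cm by (simp add: \<epsilon>_def)
    obtain n where K: "\<And>k x. k \<ge> n \<Longrightarrow> \<bar>smooth_approx k H x - H x\<bar> \<le> \<epsilon>" using smooth_approx_uniform[OF H \<epsilon>] by metis
    note n = K[OF order_refl]
    let ?\<phi> = "smooth_approx n H"
    let ?D = "approx_tower n H"
    have d1: "(?\<phi> has_real_derivative ?D 1 y) (at y)" for y
      using approx_tower_deriv[of n H 0 y] unfolding approx_tower_0 One_nat_def .
    have d2: "(?D 1 has_real_derivative ?D 2 y) (at y)" for y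
      using approx_tower_deriv[of n H 1 y] unfolding numeral_2_eq_2 One_nat_def .
    have c: "continuous_on UNIV (?D 2)"
      by (intro continuous_at_imp_continuous_on ballI DERIV_isCont[OF approx_tower_deriv])
    obtain B where B: "\<And>y. y \<in> {0..1} \<Longrightarrow> \<bar>?D 2 y\<bar> \<le> B" using continuous_bounded_01[OF continuous_on_subset[OF c subset_UNIV]] by blast
    have B0: "C * B \<ge> 0" using C_nonneg B[of 0] by simp
    have tc: "torus_continuous ?\<phi>" unfolding torus_continuous_def
      by (intro conjI smooth_approx_periodic continuous_at_imp_continuous_on ballI DERIV_isCont[OF d1])
    have close: "\<bar>(\<integral>x. ?\<phi> x * u s x \<partial>W) - (\<integral>x. H x * u s x \<partial>W)\<bar> \<le> e / 4" if s: "s \<ge> 0" for s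
    proof -
      have "\<bar>(\<integral>x. ?\<phi> x * u s x \<partial>W) - (\<integral>x. H x * u s x \<partial>W)\<bar> = \<bar>\<integral>x. (?\<phi> x - H x) * u s x \<partial>W\<bar>"
        using intb[OF tc s] intb[OF H s] by (simp add: left_diff_distrib)
      also have "\<dots> \<le> (\<integral>x. \<bar>(?\<phi> x - H x) * u s x\<bar> \<partial>W)" by (rule integral_abs_bound)
      also have "\<dots> \<le> (\<integral>x. \<epsilon> * C \<partial>W)"
      proof (rule integral_mono)
        show "integrable W (\<lambda>x. \<bar>(?\<phi> x - H x) * u s x\<bar>)"
          using intb[OF tc s] intb[OF H s] by (simp add: left_diff_distrib)
        show "\<bar>(?\<phi> x - H x) * u s x\<bar> \<le> \<epsilon> * C" for x
          unfolding abs_mult using \<epsilon> by (intro mult_mono n u_bound s) auto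
      qed simp
      also have "\<dots> = \<epsilon> * (C * m)" by (simp add: torus_measureD[OF W(1)] m)
      also have "\<dots> \<le> e / 4"
      proof -
        have Q: "e / (4 * (q + 1)) * q \<le> e / 4" if "q \<ge> 0" for q :: real using that e by (simp add: field_simps)
        show ?thesis unfolding \<epsilon>_def by (rule Q[OF Cm])
      qed
      finally show ?thesis .
    qed
    define dd where "dd = e / (4 * (C * B + 1))"
    have dd: "dd > 0" using e B0 by (simp add: dd_def)
    show "\<exists>d>0. \<forall>t'\<in>{0..T}. dist t' t < d \<longrightarrow> dist (\<integral>x. H x * u t' x \<partial>W) (\<integral>x. H x * u t x \<partial>W) < e"
    proof (intro exI[of _ dd] conjI ballI impI)
      fix t' assume t': "t' \<in> {0..T}" and dist: "dist t' t < dd"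
      have "\<bar>(\<integral>x. ?\<phi> x * u t' x \<partial>W) - (\<integral>x. ?\<phi> x * u t x \<partial>W)\<bar> \<le> C * B * \<bar>t' - t\<bar>"
        by (rule smooth_pairing_lipschitz[OF _ _ B d1 d2 c smooth_approx_periodic]) (use t t' in auto)
      also have "\<dots> \<le> C * B * dd" using dist B0 by (intro mult_left_mono) (auto simp: dist_real_def)
      also have "\<dots> \<le> e / 4"
      proof -
        have Q: "q * (e / (4 * (q + 1))) \<le> e / 4" if "q \<ge> 0" for q :: real using that e by (simp add: field_simps)
        show ?thesis unfolding dd_def by (rule Q[OF B0])
      qed
      finally have mid: "\<bar>(\<integral>x. ?\<phi> x * u t' x \<partial>W) - (\<integral>x. ?\<phi> x * u t x \<partial>W)\<bar> \<le> e / 4" .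
      show "dist (\<integral>x. H x * u t' x \<partial>W) (\<integral>x. H x * u t x \<partial>W) < e"
      proof -
        have "0 \<le> t" "0 \<le> t'" using t t' by auto
        then show ?thesis using close[of t] close[of t'] mid e unfolding dist_real_def by linarith
      qed
    qed (fact dd)
  qed
qed

end

section \<open>The weak formulation\<close>

text \<open>
  Dominated convergence on a bounded time interval. The measurability of the limit is
  inherited from the approximations.
\<close>

lemma time_integral_limit:
  fixes f :: "nat \<Rightarrow> real \<Rightarrow> real"
  assumes T: "T > 0" and c: "\<And>N. N \<ge> K \<Longrightarrow> continuous_on {0..T} (f N)"
    and b: "\<And>N t. N \<ge> K \<Longrightarrow> t \<in> {0..T} \<Longrightarrow> \<bar>f N t\<bar> \<le> B"
    and l: "\<And>t. t \<in> {0..T} \<Longrightarrow> (\<lambda>N. f N t) \<longlonglongrightarrow> g t"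
  shows "(\<lambda>t. indicator {0..T} t * g t) \<in> borel_measurable borel"
    and "integrable lborel (\<lambda>t. indicator {0..T} t * g t)"
    and "(\<lambda>N. \<integral>t. indicator {0..T} t * f N t \<partial>lborel) \<longlonglongrightarrow> (\<integral>t. indicator {0..T} t * g t \<partial>lborel)"
proof -
  let ?F = "\<lambda>N t. indicator {0..T} t * f (N + K) t"
  let ?g = "\<lambda>t. indicator {0..T} t * g t"
  have fm: "?F N \<in> borel_measurable borel" for N
  proof -
    have "continuous_on {0..T} (f (N + K))" by (rule c) simp
    from borel_measurable_continuous_on_indicator[OF _ this] show ?thesis by simp
  qed
  have lim: "(\<lambda>N. ?F N t) \<longlonglongrightarrow> ?g t" for t
  proof (cases "t \<in> {0..T}")
    case True
    from LIMSEQ_ignore_initial_segment[OF l[OF True], of K] show ?thesis using True by simp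
  qed simp
  show gm: "?g \<in> borel_measurable borel" by (rule borel_measurable_LIMSEQ_real[OF lim fm])
  have iB: "integrable lborel (\<lambda>t. B * indicator {0..T} t)" using T by (intro integrable_mult_right) simp
  have bd: "AE t in lborel. norm (?F N t) \<le> B * indicator {0..T} t" for N
  proof (rule AE_I2)
    fix t show "norm (?F N t) \<le> B * indicator {0..T} t" using b[of "N + K" t] by (cases "t \<in> {0..T}") auto
  qed
  have gm': "?g \<in> borel_measurable lborel" "\<And>N. ?F N \<in> borel_measurable lborel" using gm fm by auto
  show "integrable lborel ?g"
    by (rule integrable_dominated_convergence[OF gm' iB AE_I2[OF lim] bd])
  have "(\<lambda>N. \<integral>t. ?F N t \<partial>lborel) \<longlonglongrightarrow> (\<integral>t. ?g t \<partial>lborel)"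
    by (rule integral_dominated_convergence[OF gm' iB AE_I2[OF lim] bd])
  then show "(\<lambda>N. \<integral>t. indicator {0..T} t * f N t \<partial>lborel) \<longlonglongrightarrow> (\<integral>t. ?g t \<partial>lborel)"
    by (rule LIMSEQ_offset)
qed

context flows begin

text \<open>
  Differentiate the grid sum of \<open>G v\<^sub>N\<close> in time, integrate over \<open>[0,T]\<close>, and let \<open>N\<close> tend to infinity.
  The energy term is first written with the second space derivative of \<open>G\<close>, and in the limit one
  derivative is moved back to \<open>u\<close>.
\<close>

lemma weak_identity:
  assumes T: "T > 0" and G: "smooth_test T G" and GT: "\<And>x. G T x = 0" and H: "\<And>t. t > 0 \<Longrightarrow> u t \<in> H1"
  shows "inner_W W (G 0) u0 + (LINT t:{0..T}|lebesgue. inner_W W (dt T G t) (u t))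
        = 1/2 * (LINT t:{0..T}|lebesgue. inner_L2 (deriv (G t)) (weak_dx (u t)))"
proof -
  obtain D where D0: "D 0 0 = G" and Dc: "\<And>i j. continuous_on ({0..T} \<times> UNIV) (\<lambda>(t, x). D i j t x)"
    and Dt: "\<And>i j t x. t \<in> {0..T} \<Longrightarrow> ((\<lambda>s. D i j s x) has_real_derivative D (Suc i) j t x) (at t within {0..T})"
    and Dx: "\<And>i j t x. t \<in> {0..T} \<Longrightarrow> (D i j t has_real_derivative D i (Suc j) t x) (at x)"
    and p: "\<And>t. t \<in> {0..T} \<Longrightarrow> torus_fun (G t)"
    using G unfolding smooth_test_def by blast
  have cx: "continuous_on UNIV (D i j t)" if "t \<in> {0..T}" for i j t
    by (intro continuous_at_imp_continuous_on ballI DERIV_isCont[OF Dx[OF that]])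
  have ct: "continuous_on {0..T} (\<lambda>t. D i j t x)" for i j x
    by (rule DERIV_continuous_on[OF Dt])
  have per: "torus_fun (D 0 j t)" if t: "t \<in> {0..T}" for j t
  proof (induction j)
    case 0 show ?case using p[OF t] D0 by simp
  next
    case (Suc j) show ?case by (rule periodic_derivative[OF Dx[OF t] Suc])
  qed
  have per1: "torus_fun (D 1 0 t)" if t: "t \<in> {0..T}" for t
    unfolding torus_fun_def
  proof
    fix x
    have "((\<lambda>s. D 0 0 s (x + 1)) has_real_derivative D 1 0 t x) (at t within {0..T})"
    proof (rule has_field_derivative_transform_within[of _ _ _ _ 1])
      show "((\<lambda>s. D 0 0 s x) has_real_derivative D 1 0 t x) (at t within {0..T})" using Dt[OF t, of 0 0 x] by simp
      show "D 0 0 s x = D 0 0 s (x + 1)" if "s \<in> {0..T}" for s using per[OF that, of 0] by (simp add: torus_fun_def)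
    qed (use t in auto)
    moreover have "((\<lambda>s. D 0 0 s (x + 1)) has_real_derivative D 1 0 t (x + 1)) (at t within {0..T})"
      using Dt[OF t, of 0 0 "x + 1"] by simp
    ultimately have "((\<lambda>s. D 0 0 s (x + 1)) has_vector_derivative D 1 0 t x) (at t within {0..T})"
      "((\<lambda>s. D 0 0 s (x + 1)) has_vector_derivative D 1 0 t (x + 1)) (at t within {0..T})"
      by (simp_all add: has_real_derivative_iff_has_vector_derivative)
    from vector_derivative_within_closed_interval[OF T t this(1)] vector_derivative_within_closed_interval[OF T t this(2)]
    show "D 1 0 t (x + 1) = D 1 0 t x" by simp
  qed
  have bd: "\<exists>B. \<forall>t\<in>{0..T}. \<forall>x\<in>{0..1}. \<bar>D i j t x\<bar> \<le> B" for i j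
  proof -
    have "compact ((\<lambda>(t, x). D i j t x) ` ({0..T} \<times> {0..1}))"
      by (intro compact_continuous_image continuous_on_subset[OF Dc] compact_Times) auto
    then have "bounded ((\<lambda>(t, x). D i j t x) ` ({0..T} \<times> {0..1}))" by (rule compact_imp_bounded)
    then obtain B where B: "\<forall>z\<in>(\<lambda>(t, x). D i j t x) ` ({0..T} \<times> {0..1}). norm z \<le> B" unfolding bounded_iff by (elim exE)
    have "\<bar>D i j t x\<bar> \<le> B" if "t \<in> {0..T}" "x \<in> {0..1}" for t x
      using bspec[OF B, of "D i j t x"] that by (force simp: image_iff)
    then show ?thesis by (intro exI[of _ B] ballI)
  qed
  obtain B1 where B1: "\<forall>t\<in>{0..T}. \<forall>x\<in>{0..1}. \<bar>D 1 0 t x\<bar> \<le> B1" using bd[of 1 0] by (elim exE)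
  obtain B2 where B2: "\<forall>t\<in>{0..T}. \<forall>x\<in>{0..1}. \<bar>D 0 2 t x\<bar> \<le> B2" using bd[of 0 2] by (elim exE)
  have T0: "(0::real) \<in> {0..T}" "T \<in> {0..T}" using T by auto
  have B10: "B1 \<ge> 0" using bspec[OF bspec[OF B1 T0(1)], of 0] by simp
  define A where "A N t = (\<Sum>x<N. cell W N x * (D 1 0 t (real x / real N) * v N t x))" for N t
  define E where "E N t = (\<integral>y. vt N t y * D 0 2 t y \<partial>Leb)" for N t
  define S where "S N t = (\<Sum>x<N. cell W N x * (D 0 0 t (real x / real N) * v N t x))" for N t
  have e: "E N t = - energy N (v N t) (\<lambda>x. D 0 0 t (real x / real N))" if "N \<ge> 3" "t \<in> {0..T}" for N t
    using energy_smooth[OF that(1), of "D 0 0 t" "D 0 1 t" "D 0 2 t" "v N t"]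
      Dx[OF that(2), of 0 0] Dx[OF that(2), of 0 1] cx[OF that(2), of 0 2] per[OF that(2), of 0]
    by (simp add: E_def vt_def numeral_2_eq_2)
  have vc: "continuous_on {0..T} (\<lambda>t. v N t x)" if "N \<ge> 1" "x < N" for N x
  proof -
    interpret flow W N "v N" C m using that by (intro flow_N)
    show ?thesis by (rule continuous_on_subset[OF cont[OF that(2)]]) auto
  qed
  have cA: "continuous_on {0..T} (A N)" if "N \<ge> 3" for N
    unfolding A_def[abs_def] using that by (intro continuous_on_sum continuous_on_mult continuous_on_const ct vc) auto
  have cE: "continuous_on {0..T} (E N)" if N: "N \<ge> 3" for N
  proof (rule continuous_on_eq)
    show "continuous_on {0..T} (\<lambda>t. - energy N (v N t) (\<lambda>x. D 0 0 t (real x / real N)))"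
      unfolding energy_def
      by (intro continuous_on_minus continuous_on_sum continuous_on_mult continuous_on_diff continuous_on_const ct vc)
         (use N in \<open>auto dest: nbrs_less\<close>)
  qed (use e N in auto)
  have bA: "\<bar>A N t\<bar> \<le> B1 * C * m" if "N \<ge> 3" "t \<in> {0..T}" for N t
    unfolding A_def
  proof (rule grid_sum_bound[OF _ _ B10])
    fix x assume "x < N"
    then show "\<bar>D 1 0 t (real x / real N)\<bar> \<le> B1" using B1 that by (auto simp: field_simps)
  qed (use that in simp)
  have bE: "\<bar>E N t\<bar> \<le> C * B2" if "N \<ge> 3" "t \<in> {0..T}" for N t
    unfolding E_def by (rule Leb_integral_bound[OF _ cx[OF that(2)]]) (use that B2 in auto)
  have lA: "(\<lambda>N. A N t) \<longlonglongrightarrow> (\<integral>y. D 1 0 t y * u t y \<partial>W)" if t: "t \<in> {0..T}" for t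
    unfolding A_def by (rule grid_sum_tendsto) (use t cx[OF t] per1[OF t] in \<open>auto simp: torus_continuous_def\<close>)
  have lE: "(\<lambda>N. E N t) \<longlonglongrightarrow> (\<integral>y. u t y * D 0 2 t y \<partial>Leb)" if t: "t \<in> {0..T}" for t
    unfolding E_def by (rule Leb_integral_tendsto[OF _ cx[OF t]]) (use t in auto)
  note tA = time_integral_limit[OF T cA bA lA] and tE = time_integral_limit[OF T cE bE lE]
  have id: "(\<integral>t. indicator {0..T} t * A N t \<partial>lborel) + (\<integral>t. indicator {0..T} t * E N t \<partial>lborel) / 2 = - S N 0" if N: "N \<ge> 3" for N
  proof -
    interpret flow W N "v N" C m using N by (intro flow_N) simp
    have d: "(S N has_vector_derivative (A N t + E N t / 2)) (at t within {0..T})" if t: "0 \<le> t" "t \<le> T" for t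
    proof -
      have tT: "t \<in> {0..T}" using t by simp
      have "(S N has_real_derivative (\<Sum>x<N. cell W N x * (D 0 0 t (real x / real N) * lap W N (v N t) x + D (Suc 0) 0 t (real x / real N) * v N t x))) (at t within {0..T})"
        unfolding S_def[abs_def]
        by (intro DERIV_sum DERIV_cmult DERIV_mult' Dt[OF tT] DERIV_subset[OF deriv]) (use t in auto)
      moreover have "(\<Sum>x<N. cell W N x * (D 0 0 t (real x / real N) * lap W N (v N t) x + D (Suc 0) 0 t (real x / real N) * v N t x)) = A N t + E N t / 2"
        unfolding distrib_left sum.distrib e[OF N tT] using lap_energy[OF cell, of "\<lambda>x. D 0 0 t (real x / real N)" "v N t"]
        by (simp add: A_def energy_commute[of N "\<lambda>x. D 0 0 t (real x / real N)"])
      ultimately show ?thesis by (simp add: has_real_derivative_iff_has_vector_derivative)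
    qed
    have "(\<integral>t. indicator {0..T} t *\<^sub>R (A N t + E N t / 2) \<partial>lborel) = S N T - S N 0"
      using T by (intro integral_FTC_Icc d continuous_on_add continuous_on_divide cA cE N continuous_on_const) auto
    also have "S N T = 0" using GT by (simp add: S_def D0)
    finally have "(\<integral>t. indicator {0..T} t * A N t + (indicator {0..T} t * E N t) / 2 \<partial>lborel) = - S N 0"
      by (simp add: distrib_left)
    moreover have "integrable lborel (\<lambda>t. indicator {0..T} t * A N t)" "integrable lborel (\<lambda>t. indicator {0..T} t * E N t)"
      using borel_integrable_compact[OF compact_Icc cA[OF N]] borel_integrable_compact[OF compact_Icc cE[OF N]] by simp_all
    ultimately show ?thesis by simp
  qed
  have "(\<lambda>N. S N 0) \<longlonglongrightarrow> (\<integral>y. D 0 0 0 y * u 0 y \<partial>W)"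
    unfolding S_def by (rule grid_sum_tendsto) (use cx[OF T0(1)] per[OF T0(1)] in \<open>auto simp: torus_continuous_def\<close>)
  then have l1: "(\<lambda>N. - S N 0) \<longlonglongrightarrow> - (\<integral>y. D 0 0 0 y * u 0 y \<partial>W)" by (rule tendsto_minus)
  have "(\<lambda>N. (\<integral>t. indicator {0..T} t * A N t \<partial>lborel) + (\<integral>t. indicator {0..T} t * E N t \<partial>lborel) / 2)
    \<longlonglongrightarrow> (\<integral>t. indicator {0..T} t * (\<integral>y. D 1 0 t y * u t y \<partial>W) \<partial>lborel) + (\<integral>t. indicator {0..T} t * (\<integral>y. u t y * D 0 2 t y \<partial>Leb) \<partial>lborel) / 2"
    by (intro tendsto_add tendsto_divide tendsto_const tA(3) tE(3)) simp_all
  then have "(\<lambda>N. - S N 0) \<longlonglongrightarrow> (\<integral>t. indicator {0..T} t * (\<integral>y. D 1 0 t y * u t y \<partial>W) \<partial>lborel) + (\<integral>t. indicator {0..T} t * (\<integral>y. u t y * D 0 2 t y \<partial>Leb) \<partial>lborel) / 2"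
    by (rule Lim_transform_eventually) (use id in \<open>auto intro: eventually_sequentiallyI[of 3]\<close>)
  from LIMSEQ_unique[OF l1 this]
  have main: "(\<integral>y. D 0 0 0 y * u 0 y \<partial>W) + (\<integral>t. indicator {0..T} t * (\<integral>y. D 1 0 t y * u t y \<partial>W) \<partial>lborel)
     = - (\<integral>t. indicator {0..T} t * (\<integral>y. u t y * D 0 2 t y \<partial>Leb) \<partial>lborel) / 2" by simp
  have r1: "(LINT t:{0..T}|lebesgue. inner_W W (dt T G t) (u t)) = (\<integral>t. indicator {0..T} t * (\<integral>y. D 1 0 t y * u t y \<partial>W) \<partial>lborel)"
    unfolding set_lebesgue_integral_def
  proof (rule lebesgue_integral_cong_AE[OF tA(1) AE_I2])
    fix t
    show "indicator {0..T} t *\<^sub>R inner_W W (dt T G t) (u t) = indicator {0..T} t * (\<integral>y. D 1 0 t y * u t y \<partial>W)"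
    proof (cases "t \<in> {0..T}")
      case True
      have "dt T G t = D 1 0 t"
      proof
        fix x show "dt T G t x = D 1 0 t x"
          unfolding dt_def using Dt[OF True, of 0 0 x]
          by (intro vector_derivative_within_closed_interval[OF T True]) (simp add: D0 has_real_derivative_iff_has_vector_derivative)
      qed
      then show ?thesis by (simp add: inner_W_def)
    qed simp
  qed
  have r2: "(LINT t:{0..T}|lebesgue. inner_L2 (deriv (G t)) (weak_dx (u t))) = (\<integral>t. - (indicator {0..T} t * (\<integral>y. u t y * D 0 2 t y \<partial>Leb)) \<partial>lborel)"
    unfolding set_lebesgue_integral_def
  proof (rule lebesgue_integral_cong_AE)
    show "(\<lambda>t. - (indicator {0..T} t * (\<integral>y. u t y * D 0 2 t y \<partial>Leb))) \<in> borel_measurable borel"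
      using tE(1) by (rule borel_measurable_uminus)
    show "AE t in lborel. indicator {0..T} t *\<^sub>R inner_L2 (deriv (G t)) (weak_dx (u t)) = - (indicator {0..T} t * (\<integral>y. u t y * D 0 2 t y \<partial>Leb))"
      using AE_lborel_singleton[of 0]
    proof eventually_elim
      case (elim t)
      show ?case
      proof (cases "t \<in> {0..T}")
        case True
        then have t0: "t > 0" using elim by auto
        have gd: "generalized_deriv (u t) (weak_dx (u t))" using weak_dx_H1[OF H[OF t0]] by simp
        have dG: "deriv (G t) = D 0 1 t" using Dx[OF True, of 0 0] by (auto simp: D0 intro!: DERIV_imp_deriv)
        have dd: "deriv (D 0 1 t) = D 0 2 t" using Dx[OF True, of 0 1] by (auto simp: numeral_2_eq_2 intro!: DERIV_imp_deriv)
        have sm: "torus_smooth (D 0 1 t)"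
          by (rule torus_smoothI(1)[where D="\<lambda>n. D 0 (Suc n) t"]) (use per[OF True] Dx[OF True] in auto)
        have um: "u t \<in> borel_measurable borel"
          using u_torus_continuous[of t] t0 by (intro borel_measurable_continuous_onI) (simp add: torus_continuous_def)
        have "inner_L2 (deriv (G t)) (weak_dx (u t)) = inner_L2 (weak_dx (u t)) (D 0 1 t)"
          unfolding dG inner_L2_def by (simp add: mult.commute)
        also have "\<dots> = - inner_L2 (u t) (deriv (D 0 1 t))"
        proof -
          have "inner_L2 (u t) (deriv (D 0 1 t)) = - inner_L2 (weak_dx (u t)) (D 0 1 t)"
            using gd sm unfolding generalized_deriv_def by blast
          then show ?thesis by linarith
        qed
        also have "inner_L2 (u t) (deriv (D 0 1 t)) = (\<integral>y. u t y * D 0 2 t y \<partial>Leb)"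
          unfolding dd inner_L2_def set_lebesgue_integral_def integral_Leb
          using um borel_measurable_continuous_onI[OF cx[OF True, of 0 2]]
          by (subst integral_completion) auto
        finally show ?thesis using True by simp
      qed simp
    qed
  qed
  show ?thesis unfolding r1 r2 using main by (simp add: inner_W_def D0 u_0)
qed

end

section \<open>The gradient of the limit\<close>

text \<open>
  The Riesz-Fischer argument: a subsequence with summable increments converges almost everywhere, and
  Fatou's lemma bounds the distance to its limit.
\<close>

lemma L2_complete:
  fixes h :: "nat \<Rightarrow> 'a \<Rightarrow> real"
  assumes M: "finite_measure M" and hm: "\<And>k. h k \<in> borel_measurable M" and hi: "\<And>k. integrable M (\<lambda>x. (h k x)\<^sup>2)"
    and cauchy: "\<And>e. e > 0 \<Longrightarrow> \<exists>K. \<forall>i\<ge>K. \<forall>j\<ge>K. (\<integral>x. (h i x - h j x)\<^sup>2 \<partial>M) \<le> e"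
  shows "\<exists>g. g \<in> borel_measurable M \<and> integrable M (\<lambda>x. (g x)\<^sup>2) \<and> (\<forall>k. integrable M (\<lambda>x. (h k x - g x)\<^sup>2)) \<and>
    (\<lambda>k. \<integral>x. (h k x - g x)\<^sup>2 \<partial>M) \<longlonglongrightarrow> 0"
proof -
  interpret finite_measure M by (rule M)
  have sq2: "integrable M (\<lambda>x. (f x - g x)\<^sup>2)"
    if f: "f \<in> borel_measurable M" "integrable M (\<lambda>x. (f x)\<^sup>2)" and g: "g \<in> borel_measurable M" "integrable M (\<lambda>x. (g x)\<^sup>2)" for f g :: "'a \<Rightarrow> real"
  proof (rule Bochner_Integration.integrable_bound[where f="\<lambda>x. 2 * (f x)\<^sup>2 + 2 * (g x)\<^sup>2"])
    show "integrable M (\<lambda>x. 2 * (f x)\<^sup>2 + 2 * (g x)\<^sup>2)" using f g by simp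
    show "(\<lambda>x. (f x - g x)\<^sup>2) \<in> borel_measurable M" using f g by simp
    have "(a - b)\<^sup>2 \<le> 2 * a\<^sup>2 + 2 * b\<^sup>2" for a b :: real using zero_le_power2[of "a + b"] by (simp add: power2_sum power2_diff)
    then show "AE x in M. norm ((f x - g x)\<^sup>2) \<le> norm (2 * (f x)\<^sup>2 + 2 * (g x)\<^sup>2)" by (intro AE_I2) simp
  qed
  have "\<forall>k. \<exists>K. \<forall>i\<ge>K. \<forall>j\<ge>K. (\<integral>x. (h i x - h j x)\<^sup>2 \<partial>M) \<le> (1/4) ^ k" using cauchy by simp
  then obtain K where K: "\<And>k i j. i \<ge> K k \<Longrightarrow> j \<ge> K k \<Longrightarrow> (\<integral>x. (h i x - h j x)\<^sup>2 \<partial>M) \<le> (1/4) ^ k" by metis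
  \<comment> \<open>Beyond \<open>K k\<close> and \<open>K (k - 1)\<close> at the same time, and unbounded.\<close>
  define r where "r k = (\<Sum>l\<le>k. K l) + k" for k
  have rK: "r k \<ge> K k" "r (Suc k) \<ge> K k" "r k \<ge> k" for k
  proof -
    have "K k \<le> (\<Sum>l\<le>k. K l)" by (rule member_le_sum) auto
    then show "r k \<ge> K k" "r (Suc k) \<ge> K k" "r k \<ge> k" by (auto simp: r_def)
  qed
  define d where "d k x = \<bar>h (r (Suc k)) x - h (r k) x\<bar>" for k x
  have dm: "d k \<in> borel_measurable M" for k unfolding d_def[abs_def] using hm by simp
  have d2: "integrable M (\<lambda>x. (d k x)\<^sup>2)" for k unfolding d_def power2_abs by (intro sq2 hm hi)
  have dd: "(\<integral>\<^sup>+x. ennreal (d k x) \<partial>M) \<le> ennreal (sqrt (measure M (space M)) * (1/2) ^ k)" for k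
  proof -
    have o: "integrable M (\<lambda>x. 1\<^sup>2 :: real)" by simp
    note CS = Cauchy_Schwarz_integral[OF dm borel_measurable_const d2 o, of k]
    have i: "integrable M (d k)" using CS(1) by simp
    have "(\<integral>x. (d k x)\<^sup>2 \<partial>M) \<le> (1/4) ^ k" unfolding d_def power2_abs by (intro K rK)
    then have "sqrt (\<integral>x. (d k x)\<^sup>2 \<partial>M) \<le> sqrt ((1/4) ^ k)" by (rule real_sqrt_le_mono)
    also have "\<dots> = (1/2) ^ k" by (simp add: real_sqrt_power real_sqrt_divide)
    finally have "sqrt (\<integral>x. (d k x)\<^sup>2 \<partial>M) * sqrt (measure M (space M)) \<le> (1/2) ^ k * sqrt (measure M (space M))"
      by (rule mult_right_mono) simp
    then have "(\<integral>x. d k x \<partial>M) \<le> sqrt (measure M (space M)) * (1/2) ^ k" using CS(2) by (simp add: mult.commute)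
    moreover have "(\<integral>\<^sup>+x. ennreal (d k x) \<partial>M) = ennreal (\<integral>x. d k x \<partial>M)"
      by (rule nn_integral_eq_integral[OF i]) (simp add: d_def)
    ultimately show ?thesis by (simp add: ennreal_leI)
  qed
  have "(\<integral>\<^sup>+x. (\<Sum>k. ennreal (d k x)) \<partial>M) = (\<Sum>k. \<integral>\<^sup>+x. ennreal (d k x) \<partial>M)"
    using dm by (intro nn_integral_suminf) simp
  also have "\<dots> \<le> (\<Sum>k. ennreal (sqrt (measure M (space M)) * (1/2) ^ k))" by (intro suminf_le dd) auto
  also have "\<dots> = ennreal (\<Sum>k. sqrt (measure M (space M)) * (1/2) ^ k)" by (intro suminf_ennreal2 summable_mult summable_geometric) auto
  finally have "(\<integral>\<^sup>+x. (\<Sum>k. ennreal (d k x)) \<partial>M) \<noteq> \<infinity>" by (auto simp: top_unique)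
  then have "AE x in M. (\<Sum>k. ennreal (d k x)) \<noteq> \<infinity>"
    using dm by (intro nn_integral_PInf_AE) auto
  then have conv: "AE x in M. convergent (\<lambda>k. h (r k) x)"
  proof eventually_elim
    case (elim x)
    have "summable (\<lambda>k. d k x)" using elim by (intro summable_suminf_not_top) (auto simp: d_def)
    then have "summable (\<lambda>k. h (r (Suc k)) x - h (r k) x)" unfolding d_def by (rule summable_rabs_cancel)
    then have "convergent (\<lambda>n. \<Sum>k<n. h (r (Suc k)) x - h (r k) x)" by (simp add: summable_iff_convergent)
    then have "convergent (\<lambda>n. h (r n) x - h (r 0) x)" by (simp only: sum_lessThan_telescope[of "\<lambda>k. h (r k) x"])
    then show ?case by (simp add: convergent_diff_const_right_iff)
  qed
  define g where "g x = lim (\<lambda>k. h (r k) x)" for x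
  have gm: "g \<in> borel_measurable M" unfolding g_def[abs_def] by (rule borel_measurable_lim_metric) (rule hm)
  have lim: "AE x in M. (\<lambda>k. h (r k) x) \<longlonglongrightarrow> g x"
    using conv by eventually_elim (simp add: g_def convergent_LIMSEQ_iff)
  have fatou: "(\<integral>\<^sup>+x. ennreal ((h i x - g x)\<^sup>2) \<partial>M) \<le> ennreal e"
    if i: "\<And>j. j \<ge> L \<Longrightarrow> (\<integral>x. (h i x - h j x)\<^sup>2 \<partial>M) \<le> e" for i e L
  proof -
    have "(\<integral>\<^sup>+x. ennreal ((h i x - g x)\<^sup>2) \<partial>M) = (\<integral>\<^sup>+x. liminf (\<lambda>k. ennreal ((h i x - h (r k) x)\<^sup>2)) \<partial>M)"
    proof (rule nn_integral_cong_AE)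
      show "AE x in M. ennreal ((h i x - g x)\<^sup>2) = liminf (\<lambda>k. ennreal ((h i x - h (r k) x)\<^sup>2))"
        using lim
      proof eventually_elim
        case (elim x)
        have "(\<lambda>k. ennreal ((h i x - h (r k) x)\<^sup>2)) \<longlonglongrightarrow> ennreal ((h i x - g x)\<^sup>2)"
          by (intro tendsto_ennrealI tendsto_power tendsto_diff tendsto_const elim)
        from lim_imp_Liminf[OF _ this] show ?case by simp
      qed
    qed
    also have "\<dots> \<le> liminf (\<lambda>k. \<integral>\<^sup>+x. ennreal ((h i x - h (r k) x)\<^sup>2) \<partial>M)"
      using hm by (intro nn_integral_liminf) simp
    also have "\<dots> \<le> ennreal e"
    proof (rule Liminf_le)
      show "\<forall>\<^sub>F k in sequentially. (\<integral>\<^sup>+x. ennreal ((h i x - h (r k) x)\<^sup>2) \<partial>M) \<le> ennreal e"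
      proof (rule eventually_sequentiallyI[of L])
        fix k assume "L \<le> k"
        then have "L \<le> r k" using rK(3)[of k] by simp
        from i[OF this] show "(\<integral>\<^sup>+x. ennreal ((h i x - h (r k) x)\<^sup>2) \<partial>M) \<le> ennreal e"
          by (subst nn_integral_eq_integral[OF sq2[OF hm hi hm hi]]) (auto intro: ennreal_leI)
      qed
    qed simp
    finally show ?thesis .
  qed
  have int1: "integrable M (\<lambda>x. (h i x - g x)\<^sup>2)"
    if i: "\<And>j. j \<ge> L \<Longrightarrow> (\<integral>x. (h i x - h j x)\<^sup>2 \<partial>M) \<le> e" for i e L
  proof (rule integrableI_bounded)
    show "(\<lambda>x. (h i x - g x)\<^sup>2) \<in> borel_measurable M" using hm gm by simp
    have "(\<integral>\<^sup>+x. ennreal ((h i x - g x)\<^sup>2) \<partial>M) \<le> ennreal e" by (rule fatou[OF i])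
    then show "(\<integral>\<^sup>+x. ennreal (norm ((h i x - g x)\<^sup>2)) \<partial>M) < \<infinity>" by (simp add: le_less_trans ennreal_less_top)
  qed
  obtain L where L: "\<And>i j. i \<ge> L \<Longrightarrow> j \<ge> L \<Longrightarrow> (\<integral>x. (h i x - h j x)\<^sup>2 \<partial>M) \<le> 1" using cauchy[of 1] by auto
  have hg: "integrable M (\<lambda>x. (h L x - g x)\<^sup>2)" by (rule int1[OF L]) auto
  have "integrable M (\<lambda>x. (h L x - (h L x - g x))\<^sup>2)" by (rule sq2[OF hm hi borel_measurable_diff[OF hm gm] hg])
  then have gi: "integrable M (\<lambda>x. (g x)\<^sup>2)" by simp
  show ?thesis
  proof (intro exI[of _ g] conjI allI gm gi sq2[OF hm hi gm gi])
    show "(\<lambda>k. \<integral>x. (h k x - g x)\<^sup>2 \<partial>M) \<longlonglongrightarrow> 0"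
    proof (rule LIMSEQ_I)
      fix e :: real assume e: "e > 0"
      then obtain L where L: "\<And>i j. i \<ge> L \<Longrightarrow> j \<ge> L \<Longrightarrow> (\<integral>x. (h i x - h j x)\<^sup>2 \<partial>M) \<le> e / 2" using cauchy[of "e / 2"] by auto
      have "norm ((\<integral>x. (h k x - g x)\<^sup>2 \<partial>M) - 0) < e" if k: "k \<ge> L" for k
      proof -
        have "(\<integral>x. (h k x - g x)\<^sup>2 \<partial>M) \<le> e / 2" by (rule integral_real_bounded[OF _ fatou[OF L[OF k]]]) (use e in auto)
        moreover have "(\<integral>x. (h k x - g x)\<^sup>2 \<partial>M) \<ge> 0" by simp
        ultimately show ?thesis using e by simp
      qed
      then show "\<exists>L. \<forall>k\<ge>L. norm ((\<integral>x. (h k x - g x)\<^sup>2 \<partial>M) - 0) < e" by blast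
    qed
  qed
qed

context flows begin

text \<open>
  The gradients of the interpolations are Cauchy in \<open>L\<^sup>2\<close> by \<open>grad_dist\<close>, and their limit is a
  generalized derivative of \<open>u t\<close>. Strong convergence also identifies the limit of the energies.
\<close>

lemma u_H1:
  assumes t: "t > 0"
  shows "u t \<in> H1" and "(\<lambda>N. energy N (v N t) (v N t)) \<longlonglongrightarrow> inner_L2 (weak_dx (u t)) (weak_dx (u t))"
proof -
  interpret L: finite_measure Leb by (rule torus_measureD(1)[OF torus_Leb])
  let ?h = "\<lambda>k. grad (k + 3) (v (k + 3) t)"
  have hb: "?h k \<in> borel_measurable borel" for k by simp
  note hm = torus_measurable[OF torus_Leb hb]
  have hi: "integrable Leb (\<lambda>x. (?h k x)\<^sup>2)" for k
    unfolding power2_eq_square by (rule grad_prod_integrable) auto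
  have cauchy: "\<exists>K. \<forall>i\<ge>K. \<forall>j\<ge>K. (\<integral>x. (?h i x - ?h j x)\<^sup>2 \<partial>Leb) \<le> e" if e: "e > 0" for e
  proof -
    define k where "k = m + C\<^sup>2 * m / t\<^sup>2"
    have k: "k \<ge> 0" using m_nonneg by (simp add: k_def)
    have e': "e / (4 * (k + 1)) > 0" using e k by simp
    obtain K where K: "\<And>N M y. N \<ge> K \<Longrightarrow> M \<ge> K \<Longrightarrow> \<bar>vt N t y - vt M t y\<bar> \<le> e / (4 * (k + 1))"
      "\<And>N M. N \<ge> K \<Longrightarrow> M \<ge> K \<Longrightarrow> \<exists>\<omega>. two_flows W N M (v N) (v M) C m u0 \<omega>"
      using uniform_cauchy[OF t e'] by metis
    have "(\<integral>x. (?h i x - ?h j x)\<^sup>2 \<partial>Leb) \<le> e" if ij: "i \<ge> K" "j \<ge> K" for i j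
    proof -
      have ij': "i + 3 \<ge> K" "j + 3 \<ge> K" using ij by auto
      obtain \<omega> where "two_flows W (i + 3) (j + 3) (v (i + 3)) (v (j + 3)) C m u0 \<omega>" using K(2)[OF ij'] by (elim exE)
      then interpret two_flows W "i + 3" "j + 3" "v (i + 3)" "v (j + 3)" C m u0 \<omega> .
      have "(\<integral>x. (?h i x - ?h j x)\<^sup>2 \<partial>Leb) \<le> 4 * (e / (4 * (k + 1))) * k"
      proof (rule grad_dist[OF t, folded k_def])
        show "\<bar>w t y\<bar> \<le> e / (4 * (k + 1))" for y using K(1)[OF ij', of y] by (simp only: w_def vt_def)
      qed
      also have "\<dots> = e * (k / (k + 1))" using k by (simp add: field_simps)
      also have "\<dots> \<le> e * 1" using k e by (intro mult_left_mono) auto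
      finally show ?thesis by simp
    qed
    then show ?thesis by (intro exI[of _ K] allI impI)
  qed
  have "\<exists>g. g \<in> borel_measurable Leb \<and> integrable Leb (\<lambda>x. (g x)\<^sup>2) \<and> (\<forall>k. integrable Leb (\<lambda>x. (?h k x - g x)\<^sup>2)) \<and>
      (\<lambda>k. \<integral>x. (?h k x - g x)\<^sup>2 \<partial>Leb) \<longlonglongrightarrow> 0"
    by (rule L2_complete[OF L.finite_measure_axioms hm hi]) (rule cauchy)
  then obtain g where g: "g \<in> borel_measurable Leb" "integrable Leb (\<lambda>x. (g x)\<^sup>2)" and g3: "\<forall>k. integrable Leb (\<lambda>x. (?h k x - g x)\<^sup>2)"
      and gl: "(\<lambda>k. \<integral>x. (?h k x - g x)\<^sup>2 \<partial>Leb) \<longlonglongrightarrow> 0"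
    by (elim exE conjE)
  note g = g g3[rule_format]
  \<comment> \<open>Elements of \<open>L2_torus\<close> have to be periodic on the whole line.\<close>
  define G where "G y = g (frac y)" for y
  have Gg: "G y = g y" if "y \<in> {0..<1}" for y using that by (simp add: G_def frac_eq)
  have gl2: "(\<lambda>x. indicator {0..<1} x * g x) \<in> borel_measurable lborel"
    using g(1) by (simp add: Leb_def borel_measurable_restrict_space_iff)
  have iG: "(\<lambda>x. indicator {0..<1} x * G x) = (\<lambda>x. indicator {0..<1} x * g x)"
    using Gg by (auto simp: indicator_def)
  have ig: "integrable lborel (\<lambda>x. indicator {0..<1} x * (g x)\<^sup>2)"
    using g(2) by (simp add: Leb_def integrable_restrict_space)
  have iG2: "(\<lambda>x. indicator {0..<1} x * (G x)\<^sup>2) = (\<lambda>x. indicator {0..<1} x * (g x)\<^sup>2)"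
    using Gg by (auto simp: indicator_def)
  have GL2: "G \<in> L2_torus"
    unfolding L2_torus_def set_borel_measurable_def set_integrable_def real_scaleR_def iG iG2 mem_Collect_eq
    using ig gl2
    by (auto simp: torus_fun_def G_def frac_1_eq integrable_completion intro!: measurable_completion)
  have G_pair: "inner_L2 G \<phi> = (\<integral>x. g x * \<phi> x \<partial>Leb)" if "\<phi> \<in> borel_measurable borel" for \<phi>
  proof -
    have "(\<lambda>x. indicator {0..<1} x * (G x * \<phi> x)) = (\<lambda>x. (indicator {0..<1} x * g x) * \<phi> x)"
      using Gg by (auto simp: indicator_def)
    moreover have "(\<lambda>x. (indicator {0..<1} x * g x) * \<phi> x) \<in> borel_measurable lborel" using gl2 that by simp
    ultimately show ?thesis
      unfolding inner_L2_def set_lebesgue_integral_def integral_Leb real_scaleR_def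
      by (simp add: integral_completion mult.assoc)
  qed
  have GG: "inner_L2 G G = (\<integral>x. (g x)\<^sup>2 \<partial>Leb)"
    unfolding inner_L2_def set_lebesgue_integral_def integral_Leb real_scaleR_def power2_eq_square[symmetric] iG2
    using ig by (simp add: integral_completion)
  have pair: "(\<lambda>k. \<integral>x. ?h k x * f x \<partial>Leb) \<longlonglongrightarrow> (\<integral>x. g x * f x \<partial>Leb)"
    if f: "f \<in> borel_measurable Leb" "integrable Leb (\<lambda>x. (f x)\<^sup>2)" for f
  proof (rule LIM_zero_cancel, rule Lim_null_comparison)
    have "(\<lambda>k. sqrt (\<integral>x. (?h k x - g x)\<^sup>2 \<partial>Leb) * sqrt (\<integral>x. (f x)\<^sup>2 \<partial>Leb)) \<longlonglongrightarrow> sqrt 0 * sqrt (\<integral>x. (f x)\<^sup>2 \<partial>Leb)"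
      by (intro tendsto_mult tendsto_const tendsto_real_sqrt gl)
    then show "(\<lambda>k. sqrt (\<integral>x. (?h k x - g x)\<^sup>2 \<partial>Leb) * sqrt (\<integral>x. (f x)\<^sup>2 \<partial>Leb)) \<longlonglongrightarrow> 0" by simp
    show "\<forall>\<^sub>F k in sequentially. norm ((\<integral>x. ?h k x * f x \<partial>Leb) - (\<integral>x. g x * f x \<partial>Leb))
        \<le> sqrt (\<integral>x. (?h k x - g x)\<^sup>2 \<partial>Leb) * sqrt (\<integral>x. (f x)\<^sup>2 \<partial>Leb)"
    proof (rule always_eventually, rule allI)
      fix k
      have "(\<integral>x. ?h k x * f x \<partial>Leb) - (\<integral>x. g x * f x \<partial>Leb) = (\<integral>x. (?h k x - g x) * f x \<partial>Leb)"
        unfolding left_diff_distrib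
        by (rule Bochner_Integration.integral_diff[symmetric]) (rule Cauchy_Schwarz_integral(1)[OF hm f(1) hi f(2)] Cauchy_Schwarz_integral(1)[OF g(1) f(1) g(2) f(2)])+
      then show "norm ((\<integral>x. ?h k x * f x \<partial>Leb) - (\<integral>x. g x * f x \<partial>Leb))
        \<le> sqrt (\<integral>x. (?h k x - g x)\<^sup>2 \<partial>Leb) * sqrt (\<integral>x. (f x)\<^sup>2 \<partial>Leb)"
        using Cauchy_Schwarz_integral(2)[OF borel_measurable_diff[OF hm g(1)] f(1) g(3) f(2), of k] by simp
    qed
  qed
  have uc: "continuous_on UNIV (u t)" and up: "torus_fun (u t)"
    using u_torus_continuous[of t] t by (auto simp: torus_continuous_def)
  have um: "u t \<in> borel_measurable borel" using uc by (rule borel_measurable_continuous_onI)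
  have u_pair: "inner_L2 (u t) \<phi> = (\<integral>x. u t x * \<phi> x \<partial>Leb)" if "\<phi> \<in> borel_measurable borel" for \<phi>
    unfolding inner_L2_def set_lebesgue_integral_def integral_Leb real_scaleR_def
    using um that by (subst integral_completion) auto
  have gd: "generalized_deriv (u t) G"
    unfolding generalized_deriv_def
  proof (intro allI impI)
    fix \<phi> assume \<phi>: "torus_smooth \<phi>"
    note pm = torus_smooth_measurable[OF \<phi>]
    have d: "(\<phi> has_real_derivative deriv \<phi> y) (at y)" for y
    proof -
      have "(deriv ^^ 0) \<phi> field_differentiable (at y)" using \<phi> unfolding torus_smooth_def by (elim conjE allE)
      then show ?thesis by (simp add: DERIV_deriv_iff_field_differentiable)
    qed
    have p: "torus_fun \<phi>" using \<phi> by (simp add: torus_smooth_def)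
    have "(\<lambda>k. \<integral>y. vt (k + 3) t y * deriv \<phi> y \<partial>Leb) \<longlonglongrightarrow> (\<integral>y. u t y * deriv \<phi> y \<partial>Leb)"
      by (rule LIMSEQ_ignore_initial_segment[OF Leb_integral_tendsto[OF _ pm(4)]]) (use t in simp)
    moreover have "(\<integral>y. vt (k + 3) t y * deriv \<phi> y \<partial>Leb) = - (\<integral>y. ?h k y * \<phi> y \<partial>Leb)" for k
      unfolding vt_def by (rule interp_by_parts[OF _ d pm(4) p]) simp
    ultimately have a: "(\<lambda>k. - (\<integral>y. ?h k y * \<phi> y \<partial>Leb)) \<longlonglongrightarrow> (\<integral>y. u t y * deriv \<phi> y \<partial>Leb)" by (simp only:)
    have "integrable Leb (\<lambda>x. (\<phi> x)\<^sup>2)" by (intro Leb_continuous_integrable continuous_on_power pm(3))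
    from pair[OF torus_measurable[OF torus_Leb pm(1)] this]
    have "(\<lambda>k. - (\<integral>y. ?h k y * \<phi> y \<partial>Leb)) \<longlonglongrightarrow> - (\<integral>x. g x * \<phi> x \<partial>Leb)" by (rule tendsto_minus)
    from LIMSEQ_unique[OF a this] show "inner_L2 (u t) (deriv \<phi>) = - inner_L2 G \<phi>"
      by (simp only: u_pair[OF pm(2)] G_pair[OF pm(1)])
  qed
  have uL2: "u t \<in> L2_torus"
  proof -
    have "integrable Leb (\<lambda>x. (u t x)\<^sup>2)" by (intro Leb_continuous_integrable continuous_on_power uc)
    then have "integrable lborel (\<lambda>x. indicator {0..<1} x * (u t x)\<^sup>2)" using um by (simp add: integrable_Leb_iff)
    then have "integrable lebesgue (\<lambda>x. indicator {0..<1} x * (u t x)\<^sup>2)" using um by (subst integrable_completion) auto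
    moreover have "(\<lambda>x. indicator {0..<1} x * u t x) \<in> borel_measurable lebesgue" using um by (intro measurable_completion) auto
    ultimately show ?thesis using up by (simp add: L2_torus_def set_borel_measurable_def set_integrable_def)
  qed
  show H1: "u t \<in> H1" unfolding H1_def using uL2 GL2 gd by (intro CollectI conjI bexI[of _ G])
  have wG: "inner_L2 (weak_dx (u t)) (weak_dx (u t)) = (\<integral>x. (g x)\<^sup>2 \<partial>Leb)"
    using weak_dx_H1[OF H1] generalized_deriv_unique[OF _ GL2 _ gd, of "weak_dx (u t)"] by (simp add: GG)
  have sq: "(\<integral>x. (?h k x)\<^sup>2 \<partial>Leb) = (\<integral>x. (?h k x - g x)\<^sup>2 \<partial>Leb) + 2 * (\<integral>x. ?h k x * g x \<partial>Leb) - (\<integral>x. (g x)\<^sup>2 \<partial>Leb)" for k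
  proof -
    have hg: "integrable Leb (\<lambda>x. ?h k x * g x)" by (rule Cauchy_Schwarz_integral(1)[OF hm g(1) hi g(2)])
    have "(\<integral>x. (?h k x)\<^sup>2 \<partial>Leb) = (\<integral>x. (?h k x - g x)\<^sup>2 + 2 * (?h k x * g x) - (g x)\<^sup>2 \<partial>Leb)"
      by (rule Bochner_Integration.integral_cong) (auto simp: power2_diff)
    also have "\<dots> = (\<integral>x. (?h k x - g x)\<^sup>2 \<partial>Leb) + (\<integral>x. 2 * (?h k x * g x) \<partial>Leb) - (\<integral>x. (g x)\<^sup>2 \<partial>Leb)"
      using g(2,3) hg by simp
    finally show ?thesis by simp
  qed
  have "(\<lambda>k. \<integral>x. (?h k x)\<^sup>2 \<partial>Leb) \<longlonglongrightarrow> 0 + 2 * (\<integral>x. g x * g x \<partial>Leb) - (\<integral>x. (g x)\<^sup>2 \<partial>Leb)"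
    unfolding sq by (intro tendsto_add tendsto_diff tendsto_mult tendsto_const gl pair g(1,2))
  then have "(\<lambda>k. energy (k + 3) (v (k + 3) t) (v (k + 3) t)) \<longlonglongrightarrow> inner_L2 (weak_dx (u t)) (weak_dx (u t))"
    by (simp add: wG energy_grad power2_eq_square)
  then show "(\<lambda>N. energy N (v N t) (v N t)) \<longlonglongrightarrow> inner_L2 (weak_dx (u t)) (weak_dx (u t))"
    by (rule LIMSEQ_offset)
qed

end

context flows begin

section \<open>The limit is a weak solution\<close>

lemma inner_L2_square_le: assumes t: "t \<ge> 0" shows "inner_L2 (u t) (u t) \<le> C\<^sup>2"
proof -
  have uc: "continuous_on UNIV (u t)" using u_torus_continuous[OF t] by (simp add: torus_continuous_def)
  have um: "u t \<in> borel_measurable borel" using uc by (rule borel_measurable_continuous_onI)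
  interpret L: finite_measure Leb by (rule torus_measureD(1)[OF torus_Leb])
  have "inner_L2 (u t) (u t) = (\<integral>x. u t x * u t x \<partial>Leb)"
    unfolding inner_L2_def set_lebesgue_integral_def integral_Leb real_scaleR_def
    using um by (subst integral_completion) auto
  also have "\<dots> \<le> (\<integral>x. C\<^sup>2 \<partial>Leb)"
  proof (rule integral_mono)
    show "integrable Leb (\<lambda>x. u t x * u t x)" by (intro Leb_continuous_integrable continuous_on_mult uc)
    fix x
    have "\<bar>u t x\<bar> * \<bar>u t x\<bar> \<le> C * C" using u_bound[OF t, of x] C_nonneg by (intro mult_mono) auto
    then show "u t x * u t x \<le> C\<^sup>2" by (simp add: power2_eq_square)
  qed simp
  also have "\<dots> = C\<^sup>2" using sum_cell[OF torus_Leb, of 1] cell_Leb[of 0 1] by (simp add: torus_measureD[OF torus_Leb])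
  finally show ?thesis .
qed

text \<open>
  The integral of the dissipation is the decay of \<open>\<Sum> W\<^sup>N\<^sub>x v\<^sup>2\<close>.
\<close>

lemma diss_integral:
  assumes N: "N \<ge> 1" and T: "T > 0"
  shows "(\<integral>\<^sup>+t. ennreal (indicator {0..T} t * energy N (v N t) (v N t)) \<partial>lborel) \<le> ennreal (C\<^sup>2 * m)"
    and "(\<lambda>t. indicator {0..T} t * energy N (v N t) (v N t)) \<in> borel_measurable borel"
proof -
  interpret f: flow W N "v N" C m by (rule flow_N[OF N])
  have c: "continuous_on {0..T} (\<lambda>t. energy N (v N t) (v N t))"
  proof -
    have "continuous_on {0..} f.diss" by (rule DERIV_continuous_on[OF f.deriv_diss]) simp
    then show ?thesis unfolding f.diss_def[abs_def] by (rule continuous_on_subset) auto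
  qed
  show "(\<lambda>t. indicator {0..T} t * energy N (v N t) (v N t)) \<in> borel_measurable borel"
    using borel_measurable_continuous_on_indicator[OF _ c] by simp
  let ?V = "\<lambda>s. - (\<Sum>x<N. cell W N x * (v N s x)\<^sup>2)"
  have i: "integrable lborel (\<lambda>t. indicator {0..T} t * energy N (v N t) (v N t))"
    using borel_integrable_compact[OF compact_Icc c] by simp
  have d: "(?V has_vector_derivative energy N (v N t) (v N t)) (at t within {0..T})" if "0 \<le> t" "t \<le> T" for t
  proof -
    have "(?V has_real_derivative - (- f.diss t)) (at t within {0..})" by (rule DERIV_minus[OF f.deriv_mass2]) (use that in simp)
    then have "(?V has_real_derivative energy N (v N t) (v N t)) (at t within {0..T})"
      unfolding f.diss_def by (intro DERIV_subset[of _ _ _ "{0..}" "{0..T}"]) auto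
    then show ?thesis by (simp add: has_real_derivative_iff_has_vector_derivative)
  qed
  have "(\<integral>t. indicator {0..T} t *\<^sub>R energy N (v N t) (v N t) \<partial>lborel) = ?V T - ?V 0"
    using T by (intro integral_FTC_Icc d c) auto
  also have "\<dots> \<le> C\<^sup>2 * m"
  proof -
    have "(\<Sum>x<N. cell W N x * (v N T x)\<^sup>2) \<ge> 0" by (intro sum_nonneg mult_nonneg_nonneg) (auto simp: cell_def)
    then show ?thesis using f.initial_mass2[of 0] by simp
  qed
  finally have "(\<integral>t. indicator {0..T} t * energy N (v N t) (v N t) \<partial>lborel) \<le> C\<^sup>2 * m" by simp
  then show "(\<integral>\<^sup>+t. ennreal (indicator {0..T} t * energy N (v N t) (v N t)) \<partial>lborel) \<le> ennreal (C\<^sup>2 * m)"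
    by (subst nn_integral_eq_integral[OF i]) (auto simp: energy_nonneg intro: ennreal_leI)
qed

text \<open>
  Fatou's lemma for the energies of the flows.
\<close>

lemma H1_norm_integrable:
  assumes T: "T > 0"
  shows "(\<integral>\<^sup>+t\<in>{0..T}. ennreal (inner_H1 (u t) (u t)) \<partial>lebesgue) < \<infinity>"
proof -
  let ?e = "\<lambda>N t. ennreal (indicator {0..T} t * energy N (v N t) (v N t))"
  let ?L = "\<lambda>t. liminf (\<lambda>N. ?e (N + 1) t)"
  have em: "?e (N + 1) \<in> borel_measurable lborel" for N using diss_integral(2)[of "N + 1" T] T by simp
  have "(\<integral>\<^sup>+t\<in>{0..T}. ennreal (inner_H1 (u t) (u t)) \<partial>lebesgue) = (\<integral>\<^sup>+t\<in>{0..T}. ennreal (inner_H1 (u t) (u t)) \<partial>lborel)"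
    by (rule nn_integral_completion)
  also have "\<dots> \<le> (\<integral>\<^sup>+t. ennreal (C\<^sup>2) * indicator {0..T} t + ?L t \<partial>lborel)"
  proof (rule nn_integral_mono_AE)
    show "AE t in lborel. ennreal (inner_H1 (u t) (u t)) * indicator {0..T} t \<le> ennreal (C\<^sup>2) * indicator {0..T} t + ?L t"
      using AE_lborel_singleton[of 0]
    proof eventually_elim
      case (elim t)
      show ?case
      proof (cases "t \<in> {0..T}")
        case True
        then have t: "t > 0" using elim by auto
        have "(\<lambda>N. ?e (N + 1) t) \<longlonglongrightarrow> ennreal (inner_L2 (weak_dx (u t)) (weak_dx (u t)))"
          using True LIMSEQ_ignore_initial_segment[OF u_H1(2)[OF t], of 1] by (intro tendsto_ennrealI) simp
        from lim_imp_Liminf[OF _ this]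
        have "?L t = ennreal (inner_L2 (weak_dx (u t)) (weak_dx (u t)))" by simp
        moreover have "ennreal (inner_H1 (u t) (u t)) \<le> ennreal (C\<^sup>2) + ennreal (inner_L2 (weak_dx (u t)) (weak_dx (u t)))"
        proof -
          have "inner_L2 (weak_dx (u t)) (weak_dx (u t)) \<ge> 0"
            by (rule LIMSEQ_le_const[OF u_H1(2)[OF t]]) (use energy_nonneg in blast)
          moreover have "ennreal (inner_H1 (u t) (u t)) \<le> ennreal (C\<^sup>2 + inner_L2 (weak_dx (u t)) (weak_dx (u t)))"
            using inner_L2_square_le[of t] t by (intro ennreal_leI) (simp add: inner_H1_def)
          ultimately show ?thesis by (simp add: ennreal_plus)
        qed
        ultimately show ?thesis using True by simp
      qed simp
    qed
  qed
  also have "\<dots> = (\<integral>\<^sup>+t. ennreal (C\<^sup>2) * indicator {0..T} t \<partial>lborel) + (\<integral>\<^sup>+t. ?L t \<partial>lborel)"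
    using em by (intro nn_integral_add borel_measurable_liminf) auto
  finally have le: "(\<integral>\<^sup>+t\<in>{0..T}. ennreal (inner_H1 (u t) (u t)) \<partial>lebesgue)
    \<le> (\<integral>\<^sup>+t. ennreal (C\<^sup>2) * indicator {0..T} t \<partial>lborel) + (\<integral>\<^sup>+t. ?L t \<partial>lborel)" .
  have "(\<integral>\<^sup>+t. ?L t \<partial>lborel) \<le> liminf (\<lambda>N. \<integral>\<^sup>+t. ?e (N + 1) t \<partial>lborel)" by (rule nn_integral_liminf[OF em])
  also have "\<dots> \<le> ennreal (C\<^sup>2 * m)"
    by (rule Liminf_le) (auto intro!: always_eventually diss_integral(1)[OF _ T])
  finally have "(\<integral>\<^sup>+t. ?L t \<partial>lborel) < \<infinity>" by (rule le_less_trans) simp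
  moreover have "(\<integral>\<^sup>+t. ennreal (C\<^sup>2) * indicator {0..T} t \<partial>lborel) < \<infinity>"
    using T by (subst nn_integral_cmult_indicator) (auto simp: ennreal_mult_less_top)
  ultimately show ?thesis using le by (auto intro: le_less_trans)
qed

text \<open>
  The interpolations depend on space through finitely many cells and are continuous in time on each
  of them; the limit is pointwise.
\<close>

lemma u_measurable: "(\<lambda>(t, x). u t x) \<in> borel_measurable (restrict_space borel ({0..T} \<times> UNIV))"
proof -
  \<comment> \<open>The flows are differentiable for nonnegative times only, hence the truncation.\<close>
  have vm: "(\<lambda>z. v N (max 0 (fst z)) j) \<in> borel_measurable (borel :: (real \<times> real) measure)" if N: "N \<ge> 1" and j: "j < N" for N j
  proof (rule borel_measurable_continuous_onI)
    interpret f: flow W N "v N" C m by (rule flow_N[OF N])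
    show "continuous_on UNIV (\<lambda>z :: real \<times> real. v N (max 0 (fst z)) j)"
      by (rule continuous_on_compose2[OF f.cont[OF j]]) (auto intro!: continuous_intros)
  qed
  have m1: "(\<lambda>z. vt (N + 1) (max 0 (fst z)) (snd z)) \<in> borel_measurable (borel :: (real \<times> real) measure)" for N
  proof -
    let ?N = "N + 1"
    let ?v = "\<lambda>(k :: int) (z :: real \<times> real). v ?N (max 0 (fst z)) (nat (k mod int ?N))"
    have nm: "nat (k mod int ?N) < ?N" for k
      using pos_mod_bound[of "int ?N" k] pos_mod_sign[of "int ?N" k] by (subst nat_less_iff) auto
    have fm: "?v k \<in> borel_measurable borel" for k by (rule vm[OF _ nm]) simp
    define F where "F k z = ?v k z + (real ?N * snd z - of_int k) * (?v (k + 1) z - ?v k z)" for k z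
    have sm: "(\<lambda>z :: real \<times> real. real ?N * snd z - c) \<in> borel_measurable borel" for c
      by (intro borel_measurable_continuous_onI continuous_intros)
    have Fm: "F k \<in> borel_measurable borel" for k
      unfolding F_def[abs_def] by (intro borel_measurable_add borel_measurable_times borel_measurable_diff fm sm)
    have fl: "(\<lambda>z. \<lfloor>real ?N * snd z\<rfloor>) \<in> (borel :: (real \<times> real) measure) \<rightarrow>\<^sub>M count_space UNIV"
      by (rule measurable_compose[OF _ measurable_real_floor]) (intro borel_measurable_continuous_onI continuous_intros)
    have "(\<lambda>z. F \<lfloor>real ?N * snd z\<rfloor> z) \<in> borel_measurable (borel :: (real \<times> real) measure)"
      by (rule measurable_compose_countable[OF Fm fl])
    then show ?thesis unfolding vt_def interp_def Let_def F_def .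
  qed
  have "(\<lambda>z. u (max 0 (fst z)) (snd z)) \<in> borel_measurable (borel :: (real \<times> real) measure)"
    by (rule borel_measurable_LIMSEQ_real[OF LIMSEQ_ignore_initial_segment[OF pointwise_limit] m1]) simp
  then have "(\<lambda>z. u (max 0 (fst z)) (snd z)) \<in> borel_measurable (restrict_space borel ({0..T} \<times> UNIV))"
    by (rule measurable_restrict_space1)
  then show ?thesis
    by (rule measurable_cong[THEN iffD1, rotated]) (auto simp: space_restrict_space)
qed

theorem weak_solution: assumes T: "T > 0" shows "weak_solution W u0 T u"
  unfolding weak_solution_def
proof (intro conjI)
  show "\<forall>t\<in>{0..T}. torus_fun (u t)" using u_torus_continuous by (simp add: torus_continuous_def)
  show "(\<lambda>(t, x). u t x) \<in> borel_measurable (restrict_space borel ({0..T} \<times> UNIV))" by (rule u_measurable)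
  show "\<exists>C. \<forall>t\<in>{0..T}. \<forall>x. \<bar>u t x\<bar> \<le> C" using u_bound by (intro exI[of _ C]) simp
  have "AE t in lebesgue. t \<noteq> 0" by (rule AE_completion[OF AE_lborel_singleton])
  then show "AE t in lebesgue. t \<in> {0..T} \<longrightarrow> u t \<in> H1 \<and> torus_continuous (u t)"
    by eventually_elim (use u_H1(1) u_torus_continuous in auto)
  show "(\<integral>\<^sup>+t\<in>{0..T}. ennreal (inner_H1 (u t) (u t)) \<partial>lebesgue) < \<infinity>" by (rule H1_norm_integrable[OF T])
  show "\<forall>G. smooth_test T G \<and> (\<forall>x. G T x = 0) \<longrightarrow>
        inner_W W (G 0) u0 + (LINT t:{0..T}|lebesgue. inner_W W (dt T G t) (u t))
        = 1/2 * (LINT t:{0..T}|lebesgue. inner_L2 (deriv (G t)) (weak_dx (u t)))"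
    using weak_identity[OF T] u_H1(1) by simp
qed

end

section \<open>Convergence in probability\<close>

text \<open>
  From \<open>exp (- z) \<le> 1 / (1 + z) \<le> 1 - z + z\<^sup>2\<close>.
\<close>

lemma exp_minus_bounds:
  fixes z :: real
  assumes z: "z \<ge> 0" shows "0 \<le> z - (1 - exp (- z))" "z - (1 - exp (- z)) \<le> z\<^sup>2"
proof -
  show "0 \<le> z - (1 - exp (- z))" using exp_ge_add_one_self[of "- z"] by simp
  have "exp (- z) \<le> 1 / (1 + z)"
    using exp_ge_add_one_self[of z] z by (simp add: exp_minus divide_simps)
  also have "\<dots> \<le> 1 - z + z\<^sup>2"
  proof -
    have "(1 - z + z\<^sup>2) * (1 + z) = 1 + z ^ 3" by (simp add: algebra_simps power2_eq_square power3_eq_cube)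
    moreover have "z ^ 3 \<ge> 0" using z by simp
    ultimately have "1 \<le> (1 - z + z\<^sup>2) * (1 + z)" by linarith
    then show ?thesis using z by (subst pos_divide_le_eq) auto
  qed
  finally show "z - (1 - exp (- z)) \<le> z\<^sup>2" by simp
qed

text \<open>
  The second moment of \<open>exp (- Y) - exp (- \<mu>)\<close> is a combination of the two Laplace transforms and tends
  to \<open>0\<close>; a deviation of \<open>Y\<close> from \<open>\<mu>\<close> forces a deviation of the exponentials.
\<close>

lemma convergence_in_probability_by_Laplace:
  fixes Y :: "nat \<Rightarrow> 'a \<Rightarrow> real"
  assumes P: "\<And>n. n \<ge> 1 \<Longrightarrow> prob_space (M n)" and m: "\<And>n. n \<ge> 1 \<Longrightarrow> Y n \<in> borel_measurable (M n)"
    and nn: "\<And>n \<omega>. Y n \<omega> \<ge> 0"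
    and l1: "(\<lambda>n. \<integral>\<omega>. exp (- Y n \<omega>) \<partial>M n) \<longlonglongrightarrow> exp (- \<mu>)"
    and l2: "(\<lambda>n. \<integral>\<omega>. exp (- (2 * Y n \<omega>)) \<partial>M n) \<longlonglongrightarrow> exp (- (2 * \<mu>))" and \<delta>: "\<delta> > 0"
  shows "(\<lambda>n. measure (M n) {\<omega> \<in> space (M n). \<bar>Y n \<omega> - \<mu>\<bar> > \<delta>}) \<longlonglongrightarrow> 0"
proof (rule Lim_null_comparison)
  \<comment> \<open>The smaller of the two deviations of \<open>exp (- Y)\<close> that correspond to \<open>Y = \<mu> + \<delta>\<close> and \<open>Y = \<mu> - \<delta>\<close>.\<close>
  define \<kappa> where "\<kappa> = exp (- \<mu>) * (1 - exp (- \<delta>))"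
  have \<kappa>: "\<kappa> > 0" using \<delta> by (simp add: \<kappa>_def)
  let ?Z = "\<lambda>n \<omega>. exp (- (2 * Y n \<omega>)) - 2 * exp (- \<mu>) * exp (- Y n \<omega>) + exp (- (2 * \<mu>))"
  have sq: "?Z n \<omega> = (exp (- Y n \<omega>) - exp (- \<mu>))\<^sup>2" for n \<omega>
  proof -
    have "exp (- (2 * y)) = (exp (- y))\<^sup>2" for y :: real by (simp add: power2_eq_square exp_add[symmetric])
    then show ?thesis by (simp add: power2_diff)
  qed
  let ?e = "\<lambda>n. (\<integral>\<omega>. exp (- (2 * Y n \<omega>)) \<partial>M n) - 2 * exp (- \<mu>) * (\<integral>\<omega>. exp (- Y n \<omega>) \<partial>M n) + exp (- (2 * \<mu>))"
  have "(\<lambda>n. ?e n / \<kappa>\<^sup>2) \<longlonglongrightarrow> (exp (- (2 * \<mu>)) - 2 * exp (- \<mu>) * exp (- \<mu>) + exp (- (2 * \<mu>))) / \<kappa>\<^sup>2"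
    using \<kappa> by (intro tendsto_divide tendsto_add tendsto_diff tendsto_mult tendsto_const l1 l2) auto
  moreover have "exp (- (2 * \<mu>)) - 2 * exp (- \<mu>) * exp (- \<mu>) + exp (- (2 * \<mu>)) = 0"
    by (simp add: exp_add[symmetric])
  ultimately show "(\<lambda>n. ?e n / \<kappa>\<^sup>2) \<longlonglongrightarrow> 0" by simp
  show "\<forall>\<^sub>F n in sequentially. norm (measure (M n) {\<omega> \<in> space (M n). \<bar>Y n \<omega> - \<mu>\<bar> > \<delta>}) \<le> ?e n / \<kappa>\<^sup>2"
  proof (rule eventually_sequentiallyI[of 1])
    fix n :: nat assume n: "1 \<le> n"
    interpret prob_space "M n" by (rule P[OF n])
    note [measurable] = m[OF n]
    have b: "integrable (M n) (\<lambda>\<omega>. exp (- (c * Y n \<omega>)))" if "c \<ge> 0" for c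
      by (rule integrable_const_bound[where B=1]) (use nn[of n] that in auto)
    have i1: "integrable (M n) (\<lambda>\<omega>. exp (- Y n \<omega>))" and i2: "integrable (M n) (\<lambda>\<omega>. exp (- (2 * Y n \<omega>)))"
      using b[of 1] b[of 2] by simp_all
    let ?A = "{\<omega> \<in> space (M n). \<bar>Y n \<omega> - \<mu>\<bar> > \<delta>}"
    have A: "?A \<in> sets (M n)" by measurable
    have "\<kappa>\<^sup>2 * measure (M n) ?A = (\<integral>\<omega>. \<kappa>\<^sup>2 * indicator ?A \<omega> \<partial>M n)" using A by simp
    also have "\<dots> \<le> (\<integral>\<omega>. ?Z n \<omega> \<partial>M n)"
    proof (rule integral_mono)
      show "integrable (M n) (\<lambda>\<omega>. \<kappa>\<^sup>2 * indicator ?A \<omega>)" using A by (intro integrable_mult_right integrable_real_indicator) (auto simp: emeasure_eq_measure)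
      show "integrable (M n) (?Z n)" using i1 i2 by simp
      fix \<omega>
      show "\<kappa>\<^sup>2 * indicator ?A \<omega> \<le> ?Z n \<omega>"
      proof (cases "\<omega> \<in> ?A")
        case True
        have "\<kappa> \<le> \<bar>exp (- Y n \<omega>) - exp (- \<mu>)\<bar>"
        proof (cases "Y n \<omega> > \<mu>")
          case True
          then have "- Y n \<omega> \<le> - \<mu> + - \<delta>" using \<open>\<omega> \<in> ?A\<close> by auto
          then have "exp (- Y n \<omega>) \<le> exp (- \<mu> + - \<delta>)" by (simp only: exp_le_cancel_iff)
          also have "\<dots> = exp (- \<mu>) * exp (- \<delta>)" by (rule exp_add)
          finally have "exp (- Y n \<omega>) \<le> exp (- \<mu>) * exp (- \<delta>)" .
          then show ?thesis by (simp add: \<kappa>_def algebra_simps)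
        next
          case False
          then have "- \<mu> + \<delta> \<le> - Y n \<omega>" using \<open>\<omega> \<in> ?A\<close> by auto
          then have "exp (- \<mu> + \<delta>) \<le> exp (- Y n \<omega>)" by (simp only: exp_le_cancel_iff)
          then have a: "exp (- \<mu>) * exp \<delta> \<le> exp (- Y n \<omega>)" by (simp only: exp_add)
          have "1 + \<delta> \<le> exp \<delta>" "1 + - \<delta> \<le> exp (- \<delta>)" by (rule exp_ge_add_one_self)+
          then have "2 - exp (- \<delta>) \<le> exp \<delta>" by linarith
          then have "exp (- \<mu>) * (1 - exp (- \<delta>)) \<le> exp (- \<mu>) * (exp \<delta> - 1)" by (intro mult_left_mono) auto
          with a show ?thesis by (simp add: \<kappa>_def algebra_simps)
        qed
        then have "\<kappa>\<^sup>2 \<le> \<bar>exp (- Y n \<omega>) - exp (- \<mu>)\<bar>\<^sup>2" using \<kappa> by (intro power_mono) auto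
        then show ?thesis unfolding sq using True by simp
      next
        case False then show ?thesis unfolding sq by simp
      qed
    qed
    also have "\<dots> = ?e n" using i1 i2 by (simp add: prob_space)
    finally show "norm (measure (M n) ?A) \<le> ?e n / \<kappa>\<^sup>2" using \<kappa> by (simp add: pos_le_divide_eq mult.commute)
  qed
qed

context flows begin

text \<open>
  With \<open>z = l N\<^sup>-\<^sup>\<gamma> H\<close> the bracket \<open>1 - exp (- z)\<close> is \<open>z\<close> up to \<open>z\<^sup>2\<close>, and \<open>N\<^sup>\<gamma> z\<^sup>2\<close> is of order \<open>N\<^sup>-\<^sup>\<gamma>\<close>.
\<close>

lemma exponent_tendsto:
  assumes t: "t \<ge> 0" and H: "torus_continuous H" "\<And>x. H x \<ge> 0" and \<gamma>: "\<gamma> > 0" and l: "l \<ge> 0"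
  shows "(\<lambda>N. real N powr \<gamma> * (\<Sum>x<N. cell W N x * (v N t x * (1 - exp (- (l * (real N powr - \<gamma> * H (real x / real N))))))))
    \<longlonglongrightarrow> l * (\<integral>y. H y * u t y \<partial>W)"
proof -
  obtain B where B: "\<And>x. \<bar>H x\<bar> \<le> B" using torus_continuous_bounded[OF H(1)] by blast
  let ?S = "\<lambda>N. \<Sum>x<N. cell W N x * (H (real x / real N) * v N t x)"
  let ?z = "\<lambda>N x. l * (real N powr - \<gamma> * H (real x / real N))"
  let ?E = "\<lambda>N. real N powr \<gamma> * (\<Sum>x<N. cell W N x * (v N t x * (1 - exp (- ?z N x))))"
  have p0: "(\<lambda>N. real N powr - \<gamma>) \<longlonglongrightarrow> 0"
    using \<gamma> by (intro tendsto_neg_powr filterlim_real_sequentially) simp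
  have "(\<lambda>N. l * ?S N - ?E N) \<longlonglongrightarrow> 0"
  proof (rule Lim_null_comparison)
    have "(\<lambda>N. m * (C * (l * B)\<^sup>2) * real N powr - \<gamma>) \<longlonglongrightarrow> m * (C * (l * B)\<^sup>2) * 0" by (intro tendsto_mult tendsto_const p0)
    then show "(\<lambda>N. m * (C * (l * B)\<^sup>2) * real N powr - \<gamma>) \<longlonglongrightarrow> 0" by simp
    show "\<forall>\<^sub>F N in sequentially. norm (l * ?S N - ?E N) \<le> m * (C * (l * B)\<^sup>2) * real N powr - \<gamma>"
    proof (rule eventually_sequentiallyI[of 1])
      fix N :: nat assume N: "1 \<le> N"
      then have pp: "real N powr \<gamma> * real N powr - \<gamma> = 1" by (simp add: powr_minus)
      have id: "l * ?S N - ?E N = (\<Sum>x<N. cell W N x * (v N t x * (real N powr \<gamma> * (?z N x - (1 - exp (- ?z N x))))))"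
      proof -
        have h: "l * h = real N powr \<gamma> * (l * (real N powr - \<gamma> * h))" for h
          using pp by (metis mult.assoc mult.commute mult.left_neutral)
        have "l * ?S N = (\<Sum>x<N. cell W N x * (v N t x * (l * H (real x / real N))))"
          unfolding sum_distrib_left by (intro sum.cong refl) (simp add: algebra_simps)
        also have "\<dots> = (\<Sum>x<N. cell W N x * (v N t x * (real N powr \<gamma> * ?z N x)))"
          by (intro sum.cong refl arg_cong2[of _ _ _ _ "(*)"] h)
        finally have e: "l * ?S N = (\<Sum>x<N. cell W N x * (v N t x * (real N powr \<gamma> * ?z N x)))" .
        show ?thesis unfolding e unfolding sum_distrib_left sum_subtractf[symmetric]
          by (intro sum.cong refl) (simp add: algebra_simps)
      qed
      have "norm (l * ?S N - ?E N) \<le> (\<Sum>x<N. \<bar>cell W N x * (v N t x * (real N powr \<gamma> * (?z N x - (1 - exp (- ?z N x)))))\<bar>)"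
        unfolding id real_norm_def by (rule sum_abs)
      also have "\<dots> \<le> (\<Sum>x<N. cell W N x * (C * ((l * B)\<^sup>2 * real N powr - \<gamma>)))"
      proof (rule sum_mono)
        fix x assume "x \<in> {..<N}"
        have z: "?z N x \<ge> 0" using l H(2) by simp
        note eb = exp_minus_bounds[OF z]
        have "\<bar>real N powr \<gamma> * (?z N x - (1 - exp (- ?z N x)))\<bar> = real N powr \<gamma> * (?z N x - (1 - exp (- ?z N x)))"
          using eb(1) by (simp add: abs_mult)
        also have "\<dots> \<le> real N powr \<gamma> * (?z N x)\<^sup>2" by (intro mult_left_mono eb(2)) simp
        also have "\<dots> = (real N powr \<gamma> * real N powr - \<gamma>) * ((l * H (real x / real N))\<^sup>2 * real N powr - \<gamma>)"
          by (simp add: power2_eq_square algebra_simps)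
        also have "\<dots> = (l * H (real x / real N))\<^sup>2 * real N powr - \<gamma>" by (simp only: pp mult_1)
        also have "\<dots> \<le> (l * B)\<^sup>2 * real N powr - \<gamma>"
          using l H(2) B[of "real x / real N"] by (intro mult_right_mono power_mono mult_left_mono) auto
        finally have "\<bar>real N powr \<gamma> * (?z N x - (1 - exp (- ?z N x)))\<bar> \<le> (l * B)\<^sup>2 * real N powr - \<gamma>" .
        moreover have "cell W N x \<ge> 0" by (simp add: cell_def)
        ultimately show "\<bar>cell W N x * (v N t x * (real N powr \<gamma> * (?z N x - (1 - exp (- ?z N x)))))\<bar> \<le> cell W N x * (C * ((l * B)\<^sup>2 * real N powr - \<gamma>))"
          unfolding abs_mult[of "cell W N x"] abs_mult[of "v N t x"] using vC[of N t x] C_nonneg by (intro mult_mono) auto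
      qed
      also have "\<dots> = m * (C * (l * B)\<^sup>2) * real N powr - \<gamma>"
        unfolding sum_distrib_right[symmetric] m sum_cell[OF W(1) N] by (simp add: mult.assoc)
      finally show "norm (l * ?S N - ?E N) \<le> m * (C * (l * B)\<^sup>2) * real N powr - \<gamma>" .
    qed
  qed
  moreover have "(\<lambda>N. l * ?S N) \<longlonglongrightarrow> l * (\<integral>y. H y * u t y \<partial>W)" by (intro tendsto_mult tendsto_const grid_sum_tendsto t H)
  ultimately have "(\<lambda>N. l * ?S N - (l * ?S N - ?E N)) \<longlonglongrightarrow> l * (\<integral>y. H y * u t y \<partial>W) - 0" by (rule tendsto_diff[rotated])
  then show ?thesis by simp
qed

lemma empirical_nonneg_tendsto:
  fixes M :: "nat \<Rightarrow> 'a measure"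
  assumes P: "\<And>N. N \<ge> 1 \<Longrightarrow> prob_space (M N)" and X: "\<And>N. N \<ge> 1 \<Longrightarrow> X N \<in> measurable (M N) (count_space UNIV)"
    and lap: "\<And>N a. N \<ge> 1 \<Longrightarrow> (\<And>x. 0 \<le> a x \<and> a x \<le> 1) \<Longrightarrow>
       (\<integral>\<omega>. (\<Prod>x<N. a x ^ X N \<omega> x) \<partial>M N) = exp (- (real N powr \<gamma> * (\<Sum>x<N. cell W N x * (v N t x * (1 - a x)))))"
    and \<gamma>: "\<gamma> > 0" and t: "t \<ge> 0" and H: "torus_continuous H" "\<And>x. H x \<ge> 0" and \<delta>: "\<delta> > 0"
  shows "(\<lambda>N. measure (M N) {\<omega> \<in> space (M N). \<bar>empirical_pairing N \<gamma> (X N \<omega>) H - (\<integral>x. H x * u t x \<partial>W)\<bar> > \<delta>}) \<longlonglongrightarrow> 0"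
proof (rule convergence_in_probability_by_Laplace[OF P _ _ _ _ \<delta>])
  let ?Y = "\<lambda>N \<omega>. empirical_pairing N \<gamma> (X N \<omega>) H"
  show "?Y N \<in> borel_measurable (M N)" if "N \<ge> 1" for N
    by (rule measurable_compose[OF X[OF that]]) simp
  show "?Y N \<omega> \<ge> 0" for N \<omega> unfolding empirical_pairing_def using H(2) by (intro mult_nonneg_nonneg sum_nonneg) auto
  have L: "(\<lambda>N. \<integral>\<omega>. exp (- (l * ?Y N \<omega>)) \<partial>M N) \<longlonglongrightarrow> exp (- (l * (\<integral>x. H x * u t x \<partial>W)))" if l: "l \<ge> 0" for l
  proof (rule Lim_transform_eventually[OF tendsto_exp[OF tendsto_minus[OF exponent_tendsto[OF t H \<gamma> l]]]])
    show "\<forall>\<^sub>F N in sequentially. exp (- (real N powr \<gamma> * (\<Sum>x<N. cell W N x * (v N t x * (1 - exp (- (l * (real N powr - \<gamma> * H (real x / real N)))))))))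
       = (\<integral>\<omega>. exp (- (l * ?Y N \<omega>)) \<partial>M N)"
    proof (rule eventually_sequentiallyI[of 1])
      fix N :: nat assume N: "1 \<le> N"
      let ?a = "\<lambda>x. exp (- (l * (real N powr - \<gamma> * H (real x / real N))))"
      have "exp (- (l * ?Y N \<omega>)) = (\<Prod>x<N. ?a x ^ X N \<omega> x)" for \<omega>
        unfolding empirical_pairing_def exp_of_nat_mult[symmetric]
        by (simp add: exp_sum[symmetric] sum_distrib_left sum_negf[symmetric] mult_ac)
      moreover have "0 \<le> ?a x \<and> ?a x \<le> 1" for x using l H(2) by simp
      ultimately show "exp (- (real N powr \<gamma> * (\<Sum>x<N. cell W N x * (v N t x * (1 - ?a x))))) = (\<integral>\<omega>. exp (- (l * ?Y N \<omega>)) \<partial>M N)"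
        using lap[OF N, of ?a] by simp
    qed
  qed
  show "(\<lambda>N. \<integral>\<omega>. exp (- ?Y N \<omega>) \<partial>M N) \<longlonglongrightarrow> exp (- (\<integral>x. H x * u t x \<partial>W))" using L[of 1] by simp
  show "(\<lambda>N. \<integral>\<omega>. exp (- (2 * ?Y N \<omega>)) \<partial>M N) \<longlonglongrightarrow> exp (- (2 * (\<integral>x. H x * u t x \<partial>W)))" using L[of 2] by simp
qed

text \<open>
  A general \<open>H\<close> is the difference of the nonnegative functions \<open>H + B\<close> and \<open>B\<close>.
\<close>

lemma empirical_tendsto:
  fixes M :: "nat \<Rightarrow> 'a measure"
  assumes P: "\<And>N. N \<ge> 1 \<Longrightarrow> prob_space (M N)" and X: "\<And>N. N \<ge> 1 \<Longrightarrow> X N \<in> measurable (M N) (count_space UNIV)"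
    and lap: "\<And>N a. N \<ge> 1 \<Longrightarrow> (\<And>x. 0 \<le> a x \<and> a x \<le> 1) \<Longrightarrow>
       (\<integral>\<omega>. (\<Prod>x<N. a x ^ X N \<omega> x) \<partial>M N) = exp (- (real N powr \<gamma> * (\<Sum>x<N. cell W N x * (v N t x * (1 - a x)))))"
    and \<gamma>: "\<gamma> > 0" and t: "t \<ge> 0" and H: "torus_continuous H" and \<delta>: "\<delta> > 0"
  shows "(\<lambda>N. measure (M N) {\<omega> \<in> space (M N). \<bar>empirical_pairing N \<gamma> (X N \<omega>) H - (\<integral>x. H x * u t x \<partial>W)\<bar> > \<delta>}) \<longlonglongrightarrow> 0"
proof -
  obtain B where B: "\<And>x. \<bar>H x\<bar> \<le> B" using torus_continuous_bounded[OF H] by blast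
  have B0: "B \<ge> 0" using B[of 0] by simp
  define H1 H2 where "H1 x = H x + B" and "H2 x = B" for x :: real
  have H1: "torus_continuous H1" "\<And>x. H1 x \<ge> 0"
  proof -
    show "torus_continuous H1" using H unfolding H1_def by (auto simp: torus_continuous_def torus_fun_def intro!: continuous_intros)
    show "H1 x \<ge> 0" for x using B[of x] by (simp add: H1_def abs_le_iff)
  qed
  have H2: "torus_continuous H2" "\<And>x. H2 x \<ge> 0" using B0 by (auto simp: H2_def torus_continuous_def torus_fun_def)
  let ?D = "\<lambda>N G \<omega>. empirical_pairing N \<gamma> (X N \<omega>) G - (\<integral>x. G x * u t x \<partial>W)"
  let ?p = "\<lambda>N G d. measure (M N) {\<omega> \<in> space (M N). \<bar>?D N G \<omega>\<bar> > d}"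
  have c: "(\<lambda>N. ?p N G (\<delta> / 2)) \<longlonglongrightarrow> 0" if "torus_continuous G" "\<And>x. G x \<ge> 0" for G
    by (rule empirical_nonneg_tendsto[OF P X lap \<gamma> t that]) (use \<delta> in auto)
  have um: "u t \<in> borel_measurable borel" using u_torus_continuous[OF t] by (auto simp: torus_continuous_def intro: borel_measurable_continuous_onI)
  have iG: "integrable W (\<lambda>x. G x * u t x)" if G: "torus_continuous G" for G
  proof -
    obtain B' where B': "\<And>x. \<bar>G x\<bar> \<le> B'" using torus_continuous_bounded[OF G] by blast
    show ?thesis
    proof (rule torus_integrable[OF W(1), where C="B' * C"])
      show "(\<lambda>x. G x * u t x) \<in> borel_measurable borel"
        using G by (intro borel_measurable_times um borel_measurable_continuous_onI) (simp add: torus_continuous_def)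
      show "\<bar>G x * u t x\<bar> \<le> B' * C" for x
        unfolding abs_mult using B'[of x] u_bound[OF t, of x] by (intro mult_mono) auto
    qed
  qed
  have D: "?D N H \<omega> = ?D N H1 \<omega> - ?D N H2 \<omega>" for N \<omega>
  proof -
    have "(\<integral>x. H x * u t x \<partial>W) = (\<integral>x. H1 x * u t x - H2 x * u t x \<partial>W)" by (simp add: H1_def H2_def algebra_simps)
    also have "\<dots> = (\<integral>x. H1 x * u t x \<partial>W) - (\<integral>x. H2 x * u t x \<partial>W)" by (intro Bochner_Integration.integral_diff iG H1 H2)
    finally show ?thesis
      by (simp add: empirical_pairing_def H1_def H2_def distrib_right sum.distrib distrib_left)
  qed
  show ?thesis
  proof (rule Lim_null_comparison)
    show "(\<lambda>N. ?p N H1 (\<delta> / 2) + ?p N H2 (\<delta> / 2)) \<longlonglongrightarrow> 0" using tendsto_add[OF c[OF H1] c[OF H2]] by simp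
    show "\<forall>\<^sub>F N in sequentially. norm (?p N H \<delta>) \<le> ?p N H1 (\<delta> / 2) + ?p N H2 (\<delta> / 2)"
    proof (rule eventually_sequentiallyI[of 1])
      fix N :: nat assume N: "1 \<le> N"
      interpret prob_space "M N" by (rule P[OF N])
      have [measurable]: "(\<lambda>\<omega>. empirical_pairing N \<gamma> (X N \<omega>) G) \<in> borel_measurable (M N)" for G
        by (rule measurable_compose[OF X[OF N]]) simp
      have s: "{\<omega> \<in> space (M N). \<bar>?D N G \<omega>\<bar> > d} \<in> sets (M N)" for G d by measurable
      have "{\<omega> \<in> space (M N). \<bar>?D N H \<omega>\<bar> > \<delta>} \<subseteq> {\<omega> \<in> space (M N). \<bar>?D N H1 \<omega>\<bar> > \<delta> / 2} \<union> {\<omega> \<in> space (M N). \<bar>?D N H2 \<omega>\<bar> > \<delta> / 2}"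
        unfolding D by (auto simp: abs_if split: if_splits)
      then have "?p N H \<delta> \<le> measure (M N) ({\<omega> \<in> space (M N). \<bar>?D N H1 \<omega>\<bar> > \<delta> / 2} \<union> {\<omega> \<in> space (M N). \<bar>?D N H2 \<omega>\<bar> > \<delta> / 2})"
        by (intro finite_measure_mono sets.Un s)
      also have "\<dots> \<le> ?p N H1 (\<delta> / 2) + ?p N H2 (\<delta> / 2)" by (intro measure_Un_le s)
      finally show "norm (?p N H \<delta>) \<le> ?p N H1 (\<delta> / 2) + ?p N H2 (\<delta> / 2)" by simp
    qed
  qed
qed

end

theorem theorem2p2:
  fixes W :: "real measure"
    and \<gamma>0 \<gamma> :: real
    and u0 :: "real \<Rightarrow> real"
    and M :: "nat \<Rightarrow> 'a measure"
    and \<eta> :: "nat \<Rightarrow> real \<Rightarrow> 'a \<Rightarrow> (nat \<Rightarrow> nat)"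
  assumes W: "torus_measure W" "positive_on_open W"
    and \<gamma>0: "\<gamma>0 > 0"
      "(\<lambda>N. 1 / real N powr (2 + \<gamma>0) * (\<Sum>x<N. 1 / cell W N x)) \<longlonglongrightarrow> 0"
    and \<gamma>: "\<gamma> \<ge> \<gamma>0"
    and u0: "torus_continuous u0" "\<And>x. u0 x \<ge> 0"
    and process: "\<And>N. N \<ge> 1 \<Longrightarrow>
      markov_process_with_generator (M N) (\<eta> N) (Omega N)
        (\<lambda>f \<xi>. (real N)\<^sup>2 * L W N f \<xi>) (initial_measure W \<gamma> u0 N)"
  shows "\<forall>T>0. \<exists>u.
      weak_solution W u0 T u \<and> weakly_continuous_version W T u \<and>
      (\<forall>v. weak_solution W u0 T v \<longrightarrow> (AE t in lebesgue. t \<in> {0..T} \<longrightarrow> v t = u t)) \<and>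
      (\<forall>t H \<delta>. 0 \<le> t \<and> t < T \<and> torus_continuous H \<and> \<delta> > 0 \<longrightarrow>
        (\<lambda>N. measure (M N) {\<omega> \<in> space (M N).
            \<bar>empirical_pairing N \<gamma> (\<eta> N t \<omega>) H - (\<integral>x. H x * u t x \<partial>W)\<bar> > \<delta>})
        \<longlonglongrightarrow> 0)"
proof -
  obtain C where C: "\<And>x. \<bar>u0 x\<bar> \<le> C" using torus_continuous_bounded[OF u0(1)] by blast
  let ?Q = "\<lambda>N w. (\<forall>t x. \<bar>w t x\<bar> \<le> C) \<and> (N \<ge> 1 \<longrightarrow> flow_on W N w \<and> (\<forall>x<N. w 0 x = u0 (real x / real N)) \<and>
     (\<forall>t a. t \<ge> 0 \<longrightarrow> (\<forall>x. 0 \<le> a x \<and> a x \<le> 1) \<longrightarrow> (\<integral>\<omega>. (\<Prod>x<N. a x ^ \<eta> N t \<omega> x) \<partial>M N)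
       = exp (- (real N powr \<gamma> * (\<Sum>x<N. cell W N x * (w t x * (1 - a x)))))))"
  have "\<exists>w. ?Q N w" for N
  proof (cases "N \<ge> 1")
    case True
    show ?thesis
    proof (rule laplace_functional[OF True _ u0(2) _ process[OF True]])
      show "cell W N x > 0" if "x < N" for x by (rule cell_pos[OF W that])
      show "u0 x \<le> C" for x using C[of x] by simp
      fix w
      assume "flow_on W N w" "\<And>x. x < N \<Longrightarrow> w 0 x = u0 (real x / real N)" "\<And>t x. \<bar>w t x\<bar> \<le> C"
        "\<And>t a. t \<ge> 0 \<Longrightarrow> (\<And>x. 0 \<le> a x \<and> a x \<le> 1) \<Longrightarrow> (\<integral>\<omega>. (\<Prod>x<N. a x ^ \<eta> N t \<omega> x) \<partial>M N)
          = exp (- (real N powr \<gamma> * (\<Sum>x<N. cell W N x * (w t x * (1 - a x)))))"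
      then show ?thesis by (intro exI[of _ w] conjI impI allI) simp_all
    qed
  next
    case False
    \<comment> \<open>The bound by \<open>C\<close> is demanded for the empty grid too.\<close>
    then show ?thesis using C[of 0] by (intro exI[of _ "\<lambda>_ _. 0"]) auto
  qed
  then have "\<exists>v. \<forall>N. ?Q N (v N)" by (intro choice allI)
  then obtain v where Q: "\<forall>N. ?Q N (v N)" by (elim exE)
  then have vC: "\<And>N t x. \<bar>v N t x\<bar> \<le> C" and v: "\<And>N. N \<ge> 1 \<Longrightarrow> flow_on W N (v N)"
    and v0: "\<And>N x. N \<ge> 1 \<Longrightarrow> x < N \<Longrightarrow> v N 0 x = u0 (real x / real N)"
    and lap: "\<And>N t a. N \<ge> 1 \<Longrightarrow> t \<ge> 0 \<Longrightarrow> (\<And>x. 0 \<le> a x \<and> a x \<le> 1) \<Longrightarrow> (\<integral>\<omega>. (\<Prod>x<N. a x ^ \<eta> N t \<omega> x) \<partial>M N)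
     = exp (- (real N powr \<gamma> * (\<Sum>x<N. cell W N x * (v N t x * (1 - a x)))))"
    by simp_all
  interpret flows W u0 v C "measure W {0..<1}"
    by unfold_locales (fact W u0(1) C v v0 vC refl)+
  show ?thesis
  proof (intro allI impI exI[of _ u] conjI)
    fix T :: real assume T: "T > 0"
    show "weak_solution W u0 T u" by (rule weak_solution[OF T])
    show "weakly_continuous_version W T u" by (rule weakly_continuous)
    show "AE t in lebesgue. t \<in> {0..T} \<longrightarrow> w t = u t" if "weak_solution W u0 T w" for w
    proof -
      interpret solution_difference W T u0 w u
        by unfold_locales (fact W T that weak_solution[OF T])+
      show ?thesis by (rule AE_solutions_equal)
    qed
    fix t H and \<delta> :: real assume a: "0 \<le> t \<and> t < T \<and> torus_continuous H \<and> \<delta> > 0"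
    have P: "prob_space (M N)" "\<eta> N t \<in> measurable (M N) (count_space UNIV)" if "N \<ge> 1" for N
      using process[OF that] a unfolding markov_process_with_generator_def by auto
    have g: "\<gamma> > 0" using \<gamma> \<gamma>0(1) by simp
    show "(\<lambda>N. measure (M N) {\<omega> \<in> space (M N). \<bar>empirical_pairing N \<gamma> (\<eta> N t \<omega>) H - (\<integral>x. H x * u t x \<partial>W)\<bar> > \<delta>}) \<longlonglongrightarrow> 0"
      by (rule empirical_tendsto[OF P lap g]) (use a in auto)
  qed
qed

end
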